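(* For every $\alpha\in(\frac{\pi}{6},\frac{\pi}{3})$, the Morse index of the $Y$-noid $Y_\alpha$ is two, and its nullity is five.
   Context: **The $Y$-noids $Y_\alpha$.** Let $\alpha\in(0,\pi/3)$ and put $\alpha_1=\alpha$, $\alpha_2=\alpha+\frac{2\pi}{3}$, $\alpha_3=\alpha-\frac{2\pi}{3}$. Let $\Gamma$ be a circle of radius $c>0$ centered at the origin in $\{x_3=0\}$. $Y_\alpha=(\Sigma_1,\Sigma_2,\Sigma_3;\Gamma)$ is the minimal triple junction surface in $\mathbb{R}^3$ whose faces $\Sigma_i$ are rotationally symmetric pieces of catenoids with boundary $\Gamma$ and outward unit conormal along $\Gamma$ equal to $\eta_i=\cos\alpha_i\,e_r+\sin\alpha_i\,e_3$, where $e_r$ is the outward radial unit vector of the plane and $e_3=(0,0,1)$ (so $\eta_1+\eta_2+\eta_3=0$). Explicitly, $\Sigma_i$ is parametrized by $$X_i(t,\theta)=c_i\big(\cosh(t+T_i)\cos\theta,\ \cosh(t+T_i)\sin\theta,\ \epsilon_i t\big),\quad t\in[0,\infty),\ \theta\in[0,2\pi),$$ where $\tanh T_i=-\cos\alpha_i$, $c_i\cosh T_i=c$, and $\epsilon_1=\epsilon_2=-1$, $\epsilon_3=+1$. The surface is determined up to homothety (choice of $c$); index and nullity do not depend on this choice. **Index form.** Unit normals on the faces are chosen compatibly, so that they sum to $0$ along $\Gamma$; accordingly, an admissible (normal) variation is a triple $\phi=(\phi_1,\phi_2,\phi_3)$ of functions $\phi_i$ on $\Sigma_i$ with $\phi_1+\phi_2+\phi_3=0$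 on $\Gamma$ (in the sense of traces). Let $A_i$ be the second fundamental form of $\Sigma_i$ and $\mathbf{H}_\Gamma$ the curvature vector of the curve $\Gamma$ in $\mathbb{R}^3$. The index form (second variation of area) is $$Q(\phi)=\sum_{i=1}^3\Big(\int_{\Sigma_i}|\nabla\phi_i|^2-|A_i|^2\phi_i^2-\int_\Gamma (\mathbf{H}_\Gamma\cdot\eta_i)\,\phi_i^2\Big),$$ with associated symmetric bilinear form $Q(\cdot,\cdot)$. **Morse index.** The maximal dimension of a subspace of compactly supported admissible $W^{1,2}$ triples (supports may meet $\Gamma$) on which $Q$ is negative definite. **Nullity.** Let $L^2_*$ be the completion of compactly supported smooth functions in the norm $\|f\|_{L^2_*}^2=\int f^2(1+|x|^2)^{-1}(\log(2+|x|))^{-2}$, where $|x|$ is the Euclidean norm of the position. Let $\mathcal D$ be the space of admissible triples $\phi$ with each $\phi_i\in L^2_*(\Sigma_i)$ and $|\nabla\phi_i|\in L^2(\Sigma_i)$. The nullity is the dimension of the null space $\{\phi\in\mathcal D: Q(\phi,\psi)=0\ \text{for all }\psi\in\mathcal D\}$. *)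

theory Defs
  imports "HOL-Analysis.Analysis"
begin

section \<open>Geometry of parametrized surfaces and curves\<close>

text \<open>First partial derivatives of a map on the plane, with respect to
  \<open>t = fst x\<close> (index 1) and \<open>\<theta> = snd x\<close> (index 2).\<close>

definition pd :: "2 \<Rightarrow> (real \<times> real \<Rightarrow> 'a::real_normed_vector) \<Rightarrow> real \<times> real \<Rightarrow> 'a" where
  "pd j f x = frechet_derivative f (at x) (if j = 1 then (1, 0) else (0, 1))"

definition first_ff :: "(real \<times> real \<Rightarrow> real^3) \<Rightarrow> real \<times> real \<Rightarrow> real^2^2" where
  "first_ff X x = (\<chi> i j. pd i X x \<bullet> pd j X x)"

definition area_density :: "(real \<times> real \<Rightarrow> real^3) \<Rightarrow> real \<times> real \<Rightarrow> real" where
  "area_density X x = sqrt (det (first_ff X x))"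

definition unit_normal :: "(real \<times> real \<Rightarrow> real^3) \<Rightarrow> real \<times> real \<Rightarrow> real^3" where
  "unit_normal X x = sgn (cross3 (pd 1 X x) (pd 2 X x))"

definition second_ff :: "(real \<times> real \<Rightarrow> real^3) \<Rightarrow> real \<times> real \<Rightarrow> real^2^2" where
  "second_ff X x = (\<chi> i j. pd i (pd j X) x \<bullet> unit_normal X x)"

text \<open>\<open>|A|\<^sup>2 = tr ((g\<^sup>-\<^sup>1 h)\<^sup>2)\<close>, the squared norm of the second fundamental form \<open>h\<close> with respect
  to the metric \<open>g\<close>; it does not depend on the choice of the unit normal.\<close>

definition normA_sq :: "(real \<times> real \<Rightarrow> real^3) \<Rightarrow> real \<times> real \<Rightarrow> real" where
  "normA_sq X x = (let S = matrix_inv (first_ff X x) ** second_ff X x in trace (S ** S))"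

text \<open>The metric on covectors: \<open>\<langle>\<nabla>u, \<nabla>v\<rangle> = g\<^sup>i\<^sup>j \<partial>\<^sub>iu \<partial>\<^sub>jv\<close> is \<open>cometric X x (du x) (dv x)\<close>.\<close>

definition cometric :: "(real \<times> real \<Rightarrow> real^3) \<Rightarrow> real \<times> real \<Rightarrow> real^2 \<Rightarrow> real^2 \<Rightarrow> real" where
  "cometric X x p q = p \<bullet> (matrix_inv (first_ff X x) *v q)"

definition speed :: "(real \<Rightarrow> real^3) \<Rightarrow> real \<Rightarrow> real" where
  "speed \<gamma> s = norm (vector_derivative \<gamma> (at s))"

definition curvature_vector :: "(real \<Rightarrow> real^3) \<Rightarrow> real \<Rightarrow> real^3" where
  "curvature_vector \<gamma> s =
     (1 / speed \<gamma> s) *\<^sub>R vector_derivative (\<lambda>r. sgn (vector_derivative \<gamma> (at r))) (at s)"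


section \<open>The Y-noids\<close>

text \<open>The three faces are indexed by the three-element type \<open>3 = {1, 2, 3}\<close>.\<close>

definition ang :: "real \<Rightarrow> 3 \<Rightarrow> real" where
  "ang \<alpha> i = (if i = 1 then \<alpha> else if i = 2 then \<alpha> + 2 * pi / 3 else \<alpha> - 2 * pi / 3)"

definition eps :: "3 \<Rightarrow> real" where
  "eps i = (if i = 3 then 1 else -1)"

definition T_par :: "real \<Rightarrow> 3 \<Rightarrow> real" where
  "T_par \<alpha> i = artanh (- cos (ang \<alpha> i))"

definition c_par :: "real \<Rightarrow> real \<Rightarrow> 3 \<Rightarrow> real" where
  "c_par \<alpha> c i = c / cosh (T_par \<alpha> i)"

definition e_r :: "real \<Rightarrow> real^3" where
  "e_r \<theta> = cos \<theta> *\<^sub>R axis 1 1 + sin \<theta> *\<^sub>R axis 2 1"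

definition e_3 :: "real^3" where
  "e_3 = axis 3 1"

definition face :: "real \<Rightarrow> real \<Rightarrow> 3 \<Rightarrow> real \<times> real \<Rightarrow> real^3" where
  "face \<alpha> c i = (\<lambda>(t, \<theta>). c_par \<alpha> c i *\<^sub>R
     (cosh (t + T_par \<alpha> i) *\<^sub>R e_r \<theta> + (eps i * t) *\<^sub>R e_3))"

definition Gam :: "real \<Rightarrow> real \<Rightarrow> real^3" where
  "Gam c \<theta> = c *\<^sub>R e_r \<theta>"

definition conormal :: "real \<Rightarrow> 3 \<Rightarrow> real \<Rightarrow> real^3" where
  "conormal \<alpha> i \<theta> = cos (ang \<alpha> i) *\<^sub>R e_r \<theta> + sin (ang \<alpha> i) *\<^sub>R e_3"


section \<open>Weakly differentiable functions and traces\<close>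

text \<open>A function on a face is represented by its pull-back \<open>u (t, \<theta>)\<close>, \<open>t \<ge> 0\<close>, which is
  \<open>2\<pi>\<close>-periodic in \<open>\<theta>\<close>; its values for \<open>t < 0\<close> are irrelevant. Integrals over a face are taken over
  the fundamental domain \<open>strip\<close>, whereas weak derivatives are taken on the universal cover \<open>halfplane\<close>
  of the interior of the face.\<close>

definition strip :: "(real \<times> real) set" where
  "strip = {0..} \<times> {0..<2*pi}"

definition halfplane :: "(real \<times> real) set" where
  "halfplane = {0<..} \<times> UNIV"

definition collar :: "(real \<times> real) set" where
  "collar = {0..1} \<times> {0..<2*pi}"

definition periodic :: "(real \<times> real \<Rightarrow> real) \<Rightarrow> bool" where
  "periodic u \<longleftrightarrow> (\<forall>t\<ge>0. \<forall>\<theta>. u (t, \<theta> + 2 * pi) = u (t, \<theta>))"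

definition C1_function :: "(real \<times> real \<Rightarrow> real) \<Rightarrow> bool" where
  "C1_function f \<longleftrightarrow> (\<forall>x. f differentiable (at x)) \<and> (\<forall>j. continuous_on UNIV (pd j f))"

definition C1_test :: "(real \<times> real \<Rightarrow> real) \<Rightarrow> bool" where
  "C1_test f \<longleftrightarrow> C1_function f \<and>
     (\<exists>K. compact K \<and> K \<subseteq> halfplane \<and> (\<forall>x. x \<notin> K \<longrightarrow> f x = 0))"

definition loc_integrable :: "(real \<times> real \<Rightarrow> real) \<Rightarrow> bool" where
  "loc_integrable u \<longleftrightarrow> u \<in> borel_measurable borel \<and>
     (\<forall>K. compact K \<longrightarrow> K \<subseteq> halfplane \<longrightarrow> set_integrable lborel K u)"

definition has_weak_gradient ::
    "(real \<times> real \<Rightarrow> real) \<Rightarrow> (real \<times> real \<Rightarrow> real^2) \<Rightarrow> bool" where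
  "has_weak_gradient u p \<longleftrightarrow> loc_integrable u \<and>
     (\<forall>j. loc_integrable (\<lambda>x. p x $ j) \<and>
       (\<forall>f. C1_test f \<longrightarrow>
         (LINT x:halfplane|lborel. u x * pd j f x) = - (LINT x:halfplane|lborel. p x $ j * f x)))"

text \<open>The weak differential (its components are the weak partial derivatives), unique up to null sets.\<close>

definition weak_gradient :: "(real \<times> real \<Rightarrow> real) \<Rightarrow> real \<times> real \<Rightarrow> real^2" where
  "weak_gradient u = (SOME p. has_weak_gradient u p)"

text \<open>The trace on \<open>\<Gamma> = {t = 0}\<close> is the continuous extension of the restriction operator from functions that are
  \<open>C\<^sup>1\<close> up to the boundary to \<open>W\<^sup>1\<^sup>,\<^sup>2\<close> of a collar of \<open>\<Gamma>\<close>. The metric of a face is comparable to the flat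
  metric on the collar.\<close>

definition has_trace :: "(real \<times> real \<Rightarrow> real) \<Rightarrow> (real \<Rightarrow> real) \<Rightarrow> bool" where
  "has_trace u \<tau> \<longleftrightarrow> \<tau> \<in> borel_measurable borel \<and>
     (\<exists>v. (\<forall>n::nat. C1_function (v n) \<and> periodic (v n)) \<and>
       (\<lambda>n. \<integral>\<^sup>+x\<in>collar. ennreal ((v n x - u x)\<^sup>2) \<partial>lborel) \<longlonglongrightarrow> 0 \<and>
       (\<forall>j. (\<lambda>n. \<integral>\<^sup>+x\<in>collar. ennreal ((pd j (v n) x - weak_gradient u x $ j)\<^sup>2) \<partial>lborel) \<longlonglongrightarrow> 0) \<and>
       (\<lambda>n. \<integral>\<^sup>+\<theta>\<in>{0..<2*pi}. ennreal ((v n (0, \<theta>) - \<tau> \<theta>)\<^sup>2) \<partial>lborel) \<longlonglongrightarrow> 0)"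

definition bdry_trace :: "(real \<times> real \<Rightarrow> real) \<Rightarrow> real \<Rightarrow> real" where
  "bdry_trace u = (SOME \<tau>. has_trace u \<tau>)"


section \<open>Admissible variations and the index form\<close>

type_synonym triple = "3 \<Rightarrow> real \<times> real \<Rightarrow> real"

definition admissible :: "triple \<Rightarrow> bool" where
  "admissible \<phi> \<longleftrightarrow>
     (\<forall>i. \<phi> i \<in> borel_measurable borel \<and> periodic (\<phi> i) \<and>
       (\<exists>p. has_weak_gradient (\<phi> i) p) \<and> (\<exists>\<tau>. has_trace (\<phi> i) \<tau>)) \<and>
     (AE \<theta> in lborel. \<theta> \<in> {0..<2*pi} \<longrightarrow> (\<Sum>i\<in>UNIV. bdry_trace (\<phi> i) \<theta>) = 0)"

definition index_form :: "real \<Rightarrow> real \<Rightarrow> triple \<Rightarrow> triple \<Rightarrow> real" where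
  "index_form \<alpha> c \<phi> \<psi> = (\<Sum>i\<in>UNIV.
     (LINT x:strip|lborel.
        (cometric (face \<alpha> c i) x (weak_gradient (\<phi> i) x) (weak_gradient (\<psi> i) x)
          - normA_sq (face \<alpha> c i) x * \<phi> i x * \<psi> i x) * area_density (face \<alpha> c i) x)
     - (LINT \<theta>:{0..<2*pi}|lborel.
        (curvature_vector (Gam c) \<theta> \<bullet> conormal \<alpha> i \<theta>)
          * bdry_trace (\<phi> i) \<theta> * bdry_trace (\<psi> i) \<theta> * speed (Gam c) \<theta>))"

definition in_L2 :: "real \<Rightarrow> real \<Rightarrow> 3 \<Rightarrow> (real \<times> real \<Rightarrow> real) \<Rightarrow> bool" where
  "in_L2 \<alpha> c i u \<longleftrightarrow> u \<in> borel_measurable borel \<and>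
     set_integrable lborel strip (\<lambda>x. (u x)\<^sup>2 * area_density (face \<alpha> c i) x)"

definition gradient_in_L2 :: "real \<Rightarrow> real \<Rightarrow> 3 \<Rightarrow> (real \<times> real \<Rightarrow> real) \<Rightarrow> bool" where
  "gradient_in_L2 \<alpha> c i u \<longleftrightarrow>
     set_integrable lborel strip (\<lambda>x.
       cometric (face \<alpha> c i) x (weak_gradient u x) (weak_gradient u x)
         * area_density (face \<alpha> c i) x)"

text \<open>The completion of the compactly supported smooth functions in the \<open>L\<^sup>2\<^sub>*\<close> norm is
  realized as the weighted \<open>L\<^sup>2\<close> space of all measurable functions of finite norm.\<close>

definition in_L2_star :: "real \<Rightarrow> real \<Rightarrow> 3 \<Rightarrow> (real \<times> real \<Rightarrow> real) \<Rightarrow> bool" where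
  "in_L2_star \<alpha> c i u \<longleftrightarrow> u \<in> borel_measurable borel \<and>
     set_integrable lborel strip (\<lambda>x. (u x)\<^sup>2
       * (1 / (1 + (norm (face \<alpha> c i x))\<^sup>2)) * (1 / (ln (2 + norm (face \<alpha> c i x)))\<^sup>2)
       * area_density (face \<alpha> c i) x)"


section \<open>Morse index and nullity\<close>

text \<open>Triples are identified when they agree almost everywhere, so all dimensions are
  dimensions modulo the space of null triples.\<close>

definition null_triple :: "triple \<Rightarrow> bool" where
  "null_triple \<phi> \<longleftrightarrow> (\<forall>i. AE x in lborel. x \<in> strip \<longrightarrow> \<phi> i x = 0)"

definition triple_subspace :: "triple set \<Rightarrow> bool" where
  "triple_subspace V \<longleftrightarrow> (\<lambda>i x. 0) \<in> V \<and>
     (\<forall>\<phi>\<in>V. \<forall>\<psi>\<in>V. \<forall>a b :: real. (\<lambda>i x. a * \<phi> i x + b * \<psi> i x) \<in> V)"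

definition independent_family :: "nat \<Rightarrow> (nat \<Rightarrow> triple) \<Rightarrow> bool" where
  "independent_family n b \<longleftrightarrow>
     (\<forall>a :: nat \<Rightarrow> real. null_triple (\<lambda>i x. \<Sum>k<n. a k * b k i x) \<longrightarrow> (\<forall>k<n. a k = 0))"

definition dimension :: "triple set \<Rightarrow> enat" where
  "dimension V = (SUP n \<in> {n. \<exists>b. (\<forall>k<n. b k \<in> V) \<and> independent_family n b}. enat n)"

definition compact_W12_triples :: "real \<Rightarrow> real \<Rightarrow> triple set" where
  "compact_W12_triples \<alpha> c = {\<phi>. admissible \<phi> \<and>
     (\<forall>i. in_L2 \<alpha> c i (\<phi> i) \<and> gradient_in_L2 \<alpha> c i (\<phi> i) \<and>
       (\<exists>R. AE x in lborel. x \<in> strip \<and> fst x > R \<longrightarrow> \<phi> i x = 0))}"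

definition negative_definite_on :: "real \<Rightarrow> real \<Rightarrow> triple set \<Rightarrow> bool" where
  "negative_definite_on \<alpha> c V \<longleftrightarrow> (\<forall>\<phi>\<in>V. \<not> null_triple \<phi> \<longrightarrow> index_form \<alpha> c \<phi> \<phi> < 0)"

definition morse_index :: "real \<Rightarrow> real \<Rightarrow> enat" where
  "morse_index \<alpha> c = (SUP V \<in> {V. triple_subspace V \<and> V \<subseteq> compact_W12_triples \<alpha> c \<and>
     negative_definite_on \<alpha> c V}. dimension V)"

definition energy_space :: "real \<Rightarrow> real \<Rightarrow> triple set" where
  "energy_space \<alpha> c = {\<phi>. admissible \<phi> \<and>
     (\<forall>i. in_L2_star \<alpha> c i (\<phi> i) \<and> gradient_in_L2 \<alpha> c i (\<phi> i))}"

definition null_space :: "real \<Rightarrow> real \<Rightarrow> triple set" where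
  "null_space \<alpha> c =
     {\<phi> \<in> energy_space \<alpha> c. \<forall>\<psi> \<in> energy_space \<alpha> c. index_form \<alpha> c \<phi> \<psi> = 0}"

definition nullity :: "real \<Rightarrow> real \<Rightarrow> enat" where
  "nullity \<alpha> c = dimension (null_space \<alpha> c)"

end

(* Proof idea. In the coordinates (t, theta) all three faces are conformal to the flat half cylinder, and the index form becomes
   sum_i int (u_t^2 + u_theta^2 - 2 sech^2(t + T_i) u^2) - tanh T_i int_Gamma u^2.
   Split each u into its mean over theta and the rest V. By Wirtinger's inequality and the Riccati identity for q = -tanh, the form is
   int (V_t + tanh V)^2 + int (V_theta^2 - V^2) >= 0 on V. On the means m_i, a Hardy inequality with vertex at the neck of the catenoid
   gives the lower bound sum_i m_i(0)^2 / cos alpha_i as soon as m_1 and m_3 vanish at the necks of the two faces that contain one;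
   this is nonnegative because sum_i m_i(0) = 0. So the index is at most two, and cut-off constants (beta_1, beta_2, beta_3) with
   sum_i beta_i = 0 span a negative plane. For the nullity, radial test functions force m_i = K tanh(t + T_i); then the form vanishes on
   each V, and the equality cases give V_i = (A_i cos theta + B_i sin theta) cosh T_i / cosh(t + T_i) with sum_i A_i = sum_i B_i = 0. *)
theory Submission
  imports Defs
begin

text \<open>The bound \<open>pi / 6 < \<alpha>\<close> makes cos \<alpha>_3 positive, so that faces
  1 and 3 contain the neck of their catenoid while face 2 does not; hence two constraints. The
  auxiliary functions come from translations: on a catenoid the vertical component of the unit
  normal is tanh and the horizontal ones have profile 1/cosh. The Hardy weight is the logarithmic
  derivative of tanh, which vanishes at the neck; q is that of 1/cosh. The obstacle is that
  variations are known only through weak gradients and traces, both given by choice operators. Much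
  of the work therefore shows that such a function is, on almost every line, the integral of its
  partial derivative starting from its trace; the rest is calculus on lines and circles combined by
  Fubini. The null space is found without regularity theory: the means solve a weak ordinary
  differential equation, treated by Wronskians, and testing a null field with itself leaves
  nonnegative terms that sum to zero, because the radial contributions are proportional to tanh T_i
  and these add up to zero.\<close>

abbreviation L1_on where "L1_on \<equiv> set_integrable lborel"
abbreviation Bor where "Bor \<equiv> borel_measurable borel"

section \<open>Absolutely continuous functions of one variable\<close>

text \<open>The derivative is an explicit argument, fixed only up to null sets, so that a weak
  partial derivative can be inserted directly. For \<open>b < a\<close> the condition is void, which
  lets later statements quantify over all end points.\<close>

definition ac :: "real \<Rightarrow> real \<Rightarrow> (real \<Rightarrow> real) \<Rightarrow> (real \<Rightarrow> real) \<Rightarrow> bool" where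
  "ac a b f d \<longleftrightarrow> L1_on {a..b} d \<and>
     (\<forall>x y. a \<le> x \<longrightarrow> x \<le> y \<longrightarrow> y \<le> b \<longrightarrow> f y - f x = (LBINT s:{x..y}. d s))"

lemma acD:
  assumes "ac a b f d" "a \<le> x" "x \<le> y" "y \<le> b"
  shows "f y - f x = (LBINT s:{x..y}. d s)"
  using assms by (auto simp: ac_def)

lemma ac_integrable: "ac a b f d \<Longrightarrow> L1_on {a..b} d"
  by (simp add: ac_def)

lemma ac_subinterval:
  assumes "ac a b f d" "a \<le> a'" "b' \<le> b"
  shows "ac a' b' f d"
proof -
  have "L1_on {a'..b'} d"
    by (rule set_integrable_subset[OF ac_integrable[OF assms(1)]]) (use assms in auto)
  then show ?thesis using assms by (auto simp: ac_def)
qed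

lemma ac_continuous:
  assumes "ac a b f d"
  shows "continuous_on {a..b} f"
proof -
  have i: "d integrable_on {a..b}"
    using set_borel_integral_eq_integral(1)[OF ac_integrable[OF assms]] .
  have eq: "f a + integral {a..x} d = f x" if "x \<in> {a..b}" for x
  proof -
    have "L1_on {a..x} d"
      by (rule set_integrable_subset[OF ac_integrable[OF assms]]) (use that in auto)
    from set_borel_integral_eq_integral(2)[OF this] acD[OF assms, of a x] that show ?thesis by auto
  qed
  have "continuous_on {a..b} (\<lambda>x. f a + integral {a..x} d)"
    by (intro continuous_intros indefinite_integral_continuous_1 i)
  then show ?thesis by (rule continuous_on_eq) (rule eq)
qed

lemma LBINT_split:
  fixes d :: "real \<Rightarrow> real"
  assumes "L1_on {a..b} d" "a \<le> x" "x \<le> b"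
  shows "(LBINT s:{a..b}. d s) = (LBINT s:{a..x}. d s) + (LBINT s:{x..b}. d s)"
proof -
  have 1: "L1_on {a..x} d" "L1_on {x..b} d"
    by (rule set_integrable_subset[OF assms(1)]; use assms in auto)+
  have "integral {a..x} d + integral {x..b} d = integral {a..b} d"
    by (rule Henstock_Kurzweil_Integration.integral_combine)
       (use assms set_borel_integral_eq_integral(1)[OF assms(1)] in auto)
  then show ?thesis
    using set_borel_integral_eq_integral(2)[OF assms(1)] set_borel_integral_eq_integral(2)[OF 1(1)]
      set_borel_integral_eq_integral(2)[OF 1(2)] by simp
qed

lemma acI:
  assumes "L1_on {a..b} d"
    and "\<And>x. a \<le> x \<Longrightarrow> x \<le> b \<Longrightarrow> f x = f a + (LBINT s:{a..x}. d s)"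
  shows "ac a b f d"
  unfolding ac_def
proof (intro conjI allI impI assms(1))
  fix x y assume "a \<le> x" "x \<le> y" "y \<le> b"
  then have "L1_on {a..y} d"
    by (intro set_integrable_subset[OF assms(1)]) auto
  from LBINT_split[OF this, of x] assms(2)[of x] assms(2)[of y] \<open>a \<le> x\<close> \<open>x \<le> y\<close> \<open>y \<le> b\<close>
  show "f y - f x = (LBINT s:{x..y}. d s)" by auto
qed

lemma ac_cong:
  assumes "ac a b f d" "\<And>x. a \<le> x \<Longrightarrow> x \<le> b \<Longrightarrow> f x = g x"
  shows "ac a b g d"
  using assms by (auto simp: ac_def)

lemma ac_C1:
  assumes "\<And>x. a \<le> x \<Longrightarrow> x \<le> b \<Longrightarrow> (f has_real_derivative d x) (at x within {a..b})"
    and "continuous_on {a..b} d"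
  shows "ac a b f d"
  unfolding ac_def
proof (intro conjI allI impI)
  show i: "L1_on {a..b} d"
    by (rule borel_integrable_atLeastAtMost'[OF assms(2)])
  fix x y assume xy: "a \<le> x" "x \<le> y" "y \<le> b"
  have "(d has_integral (f y - f x)) {x..y}"
  proof (rule fundamental_theorem_of_calculus)
    fix z assume "z \<in> {x..y}"
    then show "(f has_vector_derivative d z) (at z within {x..y})"
      using assms(1)[of z] xy DERIV_subset[of f "d z" z "{a..b}" "{x..y}"]
      by (auto simp: has_real_derivative_iff_has_vector_derivative)
  qed (use xy in auto)
  moreover have "L1_on {x..y} d"
    by (rule set_integrable_subset[OF i]) (use xy in auto)
  ultimately show "f y - f x = (LBINT s:{x..y}. d s)"
    by (simp add: set_borel_integral_eq_integral(2) integral_unique)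
qed

lemma ac_lin:
  assumes "ac a b f d" "ac a b g e"
  shows "ac a b (\<lambda>x. k * f x + l * g x) (\<lambda>x. k * d x + l * e x)"
  unfolding ac_def
proof (intro conjI allI impI)
  show "L1_on {a..b} (\<lambda>x. k * d x + l * e x)"
    using ac_integrable[OF assms(1)] ac_integrable[OF assms(2)]
    by (intro set_integral_add(1) set_integrable_mult_right) auto
  fix x y assume xy: "a \<le> x" "x \<le> y" "y \<le> b"
  have "L1_on {x..y} d" "L1_on {x..y} e"
    using ac_integrable[OF assms(1)] ac_integrable[OF assms(2)] xy
    by (auto intro: set_integrable_subset)
  then have "(LBINT s:{x..y}. k * d s + l * e s) = k * (LBINT s:{x..y}. d s) + l * (LBINT s:{x..y}. e s)"
    by (subst set_integral_add(2)) (auto intro: set_integrable_mult_right)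
  then show "k * f y + l * g y - (k * f x + l * g x) = (LBINT s:{x..y}. k * d s + l * e s)"
    using acD[OF assms(1) xy] acD[OF assms(2) xy] by (simp add: algebra_simps)
qed

lemma ac_diff_const: "ac a b f d \<Longrightarrow> ac a b (\<lambda>x. f x - k) d"
  by (simp add: ac_def)

lemma ac_shift:
  assumes "ac a b f d"
  shows "ac (a - k) (b - k) (\<lambda>x. f (x + k)) (\<lambda>x. d (x + k))"
  unfolding ac_def
proof (intro conjI allI impI)
  have ind: "indicator {x..y} (s::real) = (indicator {x+k..y+k} (k + 1 * s) :: real)" for x y s
    by (auto simp: indicator_def)
  show "L1_on {a - k..b - k} (\<lambda>x. d (x + k))"
    using ac_integrable[OF assms] lborel_integrable_real_affine[where c=1 and t=k and f="\<lambda>x. indicator {a..b} x *\<^sub>R d x"]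
    unfolding set_integrable_def ind[of "a - k" "b - k"] by (simp add: add.commute)
  fix x y assume xy: "a - k \<le> x" "x \<le> y" "y \<le> b - k"
  have "(LBINT s:{x..y}. d (s + k)) = (LBINT s:{x+k..y+k}. d s)"
    unfolding set_lebesgue_integral_def ind[of x y]
    by (subst lborel_integral_real_affine[where c=1 and t=k and f="\<lambda>s. indicator {x+k..y+k} s *\<^sub>R d s"])
       (auto simp: add.commute)
  then show "f (y + k) - f (x + k) = (LBINT s:{x..y}. d (s + k))"
    using acD[OF assms, of "x + k" "y + k"] xy by auto
qed

lemma ac_reflect:
  assumes "ac a b f d"
  shows "ac (-b) (-a) (\<lambda>x. f (-x)) (\<lambda>x. - d (-x))"
  unfolding ac_def
proof (intro conjI allI impI)
  have ind: "indicator {x..y} (s::real) = (indicator {-y..-x} (0 + (-1) * s) :: real)" for x y s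
    by (auto simp: indicator_def)
  show "L1_on {-b..-a} (\<lambda>x. - d (- x))"
    using ac_integrable[OF assms] lborel_integrable_real_affine[where c="-1" and t=0 and f="\<lambda>x. indicator {a..b} x *\<^sub>R d x"]
    unfolding set_integrable_def ind[of "-b" "-a"] by simp
  fix x y assume xy: "-b \<le> x" "x \<le> y" "y \<le> -a"
  have "(LBINT s:{x..y}. d (- s)) = (LBINT s:{-y..-x}. d s)"
    unfolding set_lebesgue_integral_def ind[of x y]
    by (subst lborel_integral_real_affine[where c="-1" and t=0 and f="\<lambda>s. indicator {-y..-x} s *\<^sub>R d s"])
       auto
  then show "f (-y) - f (-x) = (LBINT s:{x..y}. - d (-s))"
    using acD[OF assms, of "-y" "-x"] xy by (auto simp: set_lebesgue_integral_def)
qed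

lemma ac_zero_const:
  assumes "ac a b f d" "AE x in lborel. a < x \<longrightarrow> x < b \<longrightarrow> d x = 0" "a \<le> x" "x \<le> b"
  shows "f x = f a"
proof -
  have "AE s in lborel. s \<noteq> a \<and> s \<noteq> x" by (simp add: AE_lborel_singleton)
  then have "AE s in lborel. indicator {a..x} s *\<^sub>R d s = 0"
    using assms(2) by eventually_elim (use assms in \<open>auto simp: indicator_def\<close>)
  then have "(LBINT s:{a..x}. d s) = 0"
    unfolding set_lebesgue_integral_def by (rule integral_eq_zero_AE)
  with acD[OF assms(1), of a x] assms show ?thesis by auto
qed

lemma L1_mult_bounded:
  fixes f g :: "'a \<Rightarrow> real"
  assumes "set_integrable M A f" "set_borel_measurable M A g" "\<And>x. x \<in> A \<Longrightarrow> \<bar>g x\<bar> \<le> B"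
  shows "set_integrable M A (\<lambda>x. f x * g x)" "set_integrable M A (\<lambda>x. g x * f x)"
proof -
  have "set_integrable M A (\<lambda>x. B * f x)" using assms by (intro set_integrable_mult_right)
  then have i: "integrable M (\<lambda>x. indicator A x *\<^sub>R (B * f x))" by (simp add: set_integrable_def)
  have m: "(\<lambda>x. (indicator A x *\<^sub>R f x) * (indicator A x *\<^sub>R g x)) \<in> borel_measurable M"
    using assms unfolding set_integrable_def set_borel_measurable_def
    by (intro borel_measurable_times) auto
  have eq: "(\<lambda>x. (indicator A x *\<^sub>R f x) * (indicator A x *\<^sub>R g x)) = (\<lambda>x. indicator A x *\<^sub>R (f x * g x))"
    by (auto simp: indicator_def fun_eq_iff)
  show "set_integrable M A (\<lambda>x. f x * g x)"
    unfolding set_integrable_def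
  proof (rule Bochner_Integration.integrable_bound[OF i])
    show "AE x in M. norm (indicator A x *\<^sub>R (f x * g x)) \<le> norm (indicator A x *\<^sub>R (B * f x))"
    proof (intro always_eventually allI)
      fix x
      show "norm (indicator A x *\<^sub>R (f x * g x)) \<le> norm (indicator A x *\<^sub>R (B * f x))"
      proof (cases "x \<in> A")
        case True
        have "\<bar>f x\<bar> * \<bar>g x\<bar> \<le> \<bar>f x\<bar> * \<bar>B\<bar>" using assms(3)[OF True] by (intro mult_left_mono) auto
        then show ?thesis using True by (simp add: abs_mult mult.commute)
      qed auto
    qed
  qed (use m eq in auto)
  then show "set_integrable M A (\<lambda>x. g x * f x)" by (simp add: mult.commute)
qed

lemma integrable_prod:
  fixes D E :: "real \<Rightarrow> real"
  assumes "integrable lborel D" "integrable lborel E"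
  shows "integrable (lborel \<Otimes>\<^sub>M lborel) (\<lambda>(x, y). D x * E y)"
proof (rule lborel_pair.Fubini_integrable)
  show "(\<lambda>(x, y). D x * E y) \<in> borel_measurable (lborel \<Otimes>\<^sub>M lborel)"
    using assms by (auto simp: case_prod_beta' intro!: borel_measurable_times)
  show "integrable lborel (\<lambda>x. LINT y|lborel. norm (case (x, y) of (x, y) \<Rightarrow> D x * E y))"
    using assms by (simp add: abs_mult)
  show "AE x in lborel. integrable lborel (\<lambda>y. case (x, y) of (x, y) \<Rightarrow> D x * E y)"
    using assms by simp
qed

lemma ac_bounded:
  assumes "ac a b f d"
  obtains B where "\<And>x. x \<in> {a..b} \<Longrightarrow> \<bar>f x\<bar> \<le> B"
proof -
  have "compact (f ` {a..b})" using ac_continuous[OF assms] compact_continuous_image by blast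
  then obtain B where "\<forall>y\<in>f ` {a..b}. norm y \<le> B" using compact_imp_bounded bounded_iff by metis
  then show ?thesis using that by (metis imageI real_norm_def)
qed

lemma continuous_set_borel:
  fixes f :: "real \<Rightarrow> real"
  assumes "continuous_on {a..b} f"
  shows "set_borel_measurable lborel {a..b} f"
  unfolding set_borel_measurable_def
  using borel_measurable_continuous_on_indicator[OF _ assms] by simp

lemma ac_integrable_mult:
  assumes "ac a b f d" "L1_on {a..b} e"
  shows "L1_on {a..b} (\<lambda>x. f x * e x)" "L1_on {a..b} (\<lambda>x. e x * f x)"
proof -
  obtain B where "\<And>x. x \<in> {a..b} \<Longrightarrow> \<bar>f x\<bar> \<le> B" using ac_bounded[OF assms(1)] by blast
  from L1_mult_bounded[OF assms(2) continuous_set_borel[OF ac_continuous[OF assms(1)]] this]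
  show "L1_on {a..b} (\<lambda>x. f x * e x)" "L1_on {a..b} (\<lambda>x. e x * f x)" by auto
qed

text \<open>The product of the two increments is the integral of \<open>d s * e r\<close> over a
  square. Splitting the square along its diagonal and applying Fubini in opposite orders to the two
  triangles yields the two terms of integration by parts; no pointwise derivative is
  involved.\<close>

lemma ac_mult:
  assumes f: "ac a b f d" and g: "ac a b g e"
  shows "ac a b (\<lambda>x. f x * g x) (\<lambda>x. d x * g x + f x * e x)"
  unfolding ac_def
proof (intro conjI allI impI)
  note dg = ac_integrable_mult(2)[OF g ac_integrable[OF f]]
  note fe = ac_integrable_mult(1)[OF f ac_integrable[OF g]]
  show "L1_on {a..b} (\<lambda>x. d x * g x + f x * e x)"
    by (intro set_integral_add(1) dg fe)
  fix x y assume xy: "a \<le> x" "x \<le> y" "y \<le> b"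
  have sub: "L1_on {x..y} h" if "L1_on {a..b} h" for h :: "real \<Rightarrow> real"
    by (rule set_integrable_subset[OF that]) (use xy in auto)
  define D where "D s = indicator {x..y} s *\<^sub>R d s" for s
  define E where "E s = indicator {x..y} s *\<^sub>R e s" for s
  have D: "integrable lborel D" and E: "integrable lborel E"
    using sub[OF ac_integrable[OF f]] sub[OF ac_integrable[OF g]]
    by (auto simp: D_def[abs_def] E_def[abs_def] set_integrable_def)
  have iD: "(LINT s|lborel. D s) = f y - f x" and iE: "(LINT s|lborel. E s) = g y - g x"
    using acD[OF f xy] acD[OF g xy] by (auto simp: D_def[abs_def] E_def[abs_def] set_lebesgue_integral_def)
  let ?H = "\<lambda>(s, r). D s * E r"
  have H: "integrable (lborel \<Otimes>\<^sub>M lborel) ?H" by (rule integrable_prod[OF D E])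
  have mT: "{z. snd z \<le> (fst z::real)} \<in> sets (lborel \<Otimes>\<^sub>M lborel)"
    unfolding lborel_prod by (intro borel_closed[THEN subsetD[OF sets_lborel[THEN equalityD2]]] closed_Collect_le continuous_intros)
  have mT': "{z. snd z > (fst z::real)} \<in> sets (lborel \<Otimes>\<^sub>M lborel)"
    unfolding lborel_prod by (intro borel_open[THEN subsetD[OF sets_lborel[THEN equalityD2]]] open_Collect_less continuous_intros)
  define H1 where "H1 z = indicator {z. snd z \<le> fst z} z *\<^sub>R ?H z" for z
  define H2 where "H2 z = indicator {z. snd z > fst z} z *\<^sub>R ?H z" for z
  have H1: "integrable (lborel \<Otimes>\<^sub>M lborel) H1" and H2: "integrable (lborel \<Otimes>\<^sub>M lborel) H2"
    unfolding H1_def H2_def using integrable_mult_indicator[OF mT H] integrable_mult_indicator[OF mT' H] by auto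
  have "(LINT z|(lborel \<Otimes>\<^sub>M lborel). ?H z) = (LINT z|(lborel \<Otimes>\<^sub>M lborel). H1 z + H2 z)"
    by (intro Bochner_Integration.integral_cong) (auto simp: H1_def H2_def indicator_def)
  also have "\<dots> = (LINT z|(lborel \<Otimes>\<^sub>M lborel). H1 z) + (LINT z|(lborel \<Otimes>\<^sub>M lborel). H2 z)"
    by (rule Bochner_Integration.integral_add[OF H1 H2])
  also have "(LINT z|(lborel \<Otimes>\<^sub>M lborel). H1 z) = (LINT s|lborel. LINT r|lborel. H1 (s, r))"
    using lborel_pair.integral_fst'[OF H1] by simp
  also have "(\<lambda>s. LINT r|lborel. H1 (s, r)) = (\<lambda>s. indicator {x..y} s *\<^sub>R (d s * (g s - g x)))"
  proof
    fix s
    show "(LINT r|lborel. H1 (s, r)) = indicator {x..y} s *\<^sub>R (d s * (g s - g x))"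
    proof (cases "s \<in> {x..y}")
      case True
      then have "(LINT r|lborel. H1 (s, r)) = (LINT r|lborel. d s * (indicator {x..s} r *\<^sub>R e r))"
        by (intro Bochner_Integration.integral_cong) (auto simp: H1_def D_def E_def indicator_def)
      also have "\<dots> = d s * (g s - g x)"
        using acD[OF g, of x s] xy True by (simp add: set_lebesgue_integral_def)
      finally show ?thesis using True by simp
    qed (simp add: H1_def D_def)
  qed
  also have "(LINT z|(lborel \<Otimes>\<^sub>M lborel). H2 z) = (LINT r|lborel. LINT s|lborel. H2 (s, r))"
    using lborel_pair.integral_snd[of "\<lambda>s r. H2 (s, r)"] H2 by (simp add: case_prod_beta')
  also have "(\<lambda>r. LINT s|lborel. H2 (s, r)) = (\<lambda>r. indicator {x..y} r *\<^sub>R ((f r - f x) * e r))"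
  proof
    fix r
    show "(LINT s|lborel. H2 (s, r)) = indicator {x..y} r *\<^sub>R ((f r - f x) * e r)"
    proof (cases "r \<in> {x..y}")
      case True
      \<comment> \<open>The triangle of \<open>H2\<close> excludes the diagonal, so its slice
        differs from the closed interval \<open>{x..r}\<close> in the single point
        \<open>s = r\<close>.\<close>
      have "AE s in lborel. s \<noteq> r" by (simp add: AE_lborel_singleton)
      then have *: "AE s in lborel. H2 (s, r) = (indicator {x..r} s *\<^sub>R d s) * e r"
        by eventually_elim (use True in \<open>auto simp: H2_def D_def E_def indicator_def\<close>)
      have i: "L1_on {x..r} d"
        by (rule set_integrable_subset[OF ac_integrable[OF f]]) (use xy True in auto)
      have m: "(\<lambda>s. (indicator {x..r} s *\<^sub>R d s) * e r) \<in> borel_measurable lborel"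
        using i unfolding set_integrable_def by auto
      have "(\<lambda>s. H2 (s, r)) \<in> borel_measurable lborel"
        using borel_measurable_integrable[OF H2] by (rule measurable_compose[rotated]) auto
      then have "(LINT s|lborel. H2 (s, r)) = (LINT s|lborel. (indicator {x..r} s *\<^sub>R d s) * e r)"
        by (rule integral_cong_AE[OF _ m *])
      also have "\<dots> = (f r - f x) * e r"
        using acD[OF f, of x r] xy True by (simp add: set_lebesgue_integral_def)
      finally show ?thesis using True by simp
    qed (simp add: H2_def E_def)
  qed
  finally have *: "(LINT z|(lborel \<Otimes>\<^sub>M lborel). ?H z) =
      (LBINT s:{x..y}. d s * (g s - g x)) + (LBINT s:{x..y}. (f s - f x) * e s)"
    by (simp add: set_lebesgue_integral_def)
  have "(LINT z|(lborel \<Otimes>\<^sub>M lborel). ?H z) = (f y - f x) * (g y - g x)"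
    using lborel_pair.integral_fst'[OF H] by (simp add: iD iE)
  moreover have "(LBINT s:{x..y}. d s * (g s - g x)) = (LBINT s:{x..y}. d s * g s) - (f y - f x) * g x"
    using acD[OF f xy] sub[OF dg] sub[OF ac_integrable[OF f]]
    by (simp add: right_diff_distrib set_integral_diff(2) set_integrable_mult_left)
  moreover have "(LBINT s:{x..y}. (f s - f x) * e s) = (LBINT s:{x..y}. f s * e s) - f x * (g y - g x)"
    using acD[OF g xy] sub[OF fe] sub[OF ac_integrable[OF g]]
    by (simp add: left_diff_distrib set_integral_diff(2) set_integrable_mult_right)
  moreover have "(LBINT s:{x..y}. d s * g s + f s * e s) = (LBINT s:{x..y}. d s * g s) + (LBINT s:{x..y}. f s * e s)"
    by (rule set_integral_add(2)[OF sub[OF dg] sub[OF fe]])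
  ultimately show "f y * g y - f x * g x = (LBINT s:{x..y}. d s * g s + f s * e s)"
    using * by (simp add: algebra_simps)
qed

section \<open>Hardy and Wirtinger inequalities\<close>

lemma LBINT_mono_set:
  fixes f :: "real \<Rightarrow> real"
  assumes "L1_on B f" "A \<subseteq> B" "A \<in> sets borel" "\<And>x. x \<in> B \<Longrightarrow> 0 \<le> f x"
  shows "(LBINT x:A. f x) \<le> (LBINT x:B. f x)"
proof -
  have "L1_on A f" by (rule set_integrable_subset[OF assms(1)]) (use assms in auto)
  then show ?thesis
    using assms unfolding set_lebesgue_integral_def set_integrable_def
    by (intro integral_mono) (auto simp: indicator_def)
qed

text \<open>Cauchy-Schwarz, read off from the nonnegative integral of
  \<open>(d x - K)\<^sup>2\<close>, where \<open>K\<close> is the mean slope.\<close>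

lemma ac_increment_sq:
  assumes "ac a b f d" "a \<le> b" "L1_on {a..b} (\<lambda>x. (d x)\<^sup>2)"
  shows "(f b - f a)\<^sup>2 \<le> (b - a) * (LBINT x:{a..b}. (d x)\<^sup>2)"
proof (cases "a = b")
  case False
  then have ab: "a < b" using assms by simp
  define K where "K = (f b - f a) / (b - a)"
  have K: "K * (b - a) = f b - f a" using ab by (simp add: K_def)
  have d: "(LBINT x:{a..b}. d x) = f b - f a" using acD[OF assms(1), of a b] ab by simp
  have c: "L1_on {a..b} (\<lambda>x. K\<^sup>2)" by (intro borel_integrable_atLeastAtMost') auto
  have c': "(LBINT x:{a..b}. K\<^sup>2) = K\<^sup>2 * (b - a)" using ab by (simp add: set_lebesgue_integral_def)
  have i: "L1_on {a..b} (\<lambda>x. (2 * K) * d x)"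
    using ac_integrable[OF assms(1)] by (rule set_integrable_mult_right)
  have "0 \<le> (LBINT x:{a..b}. (d x - K)\<^sup>2)" unfolding set_lebesgue_integral_def by (intro Bochner_Integration.integral_nonneg) auto
  also have "(LBINT x:{a..b}. (d x - K)\<^sup>2) = (LBINT x:{a..b}. ((d x)\<^sup>2 - (2 * K) * d x) + K\<^sup>2)"
    by (simp add: power2_eq_square algebra_simps)
  also have "\<dots> = (LBINT x:{a..b}. (d x)\<^sup>2) - (2 * K) * (f b - f a) + K\<^sup>2 * (b - a)"
    by (subst set_integral_add(2), intro set_integral_diff(1) assms(3) i, rule c,
        subst set_integral_diff(2)[OF assms(3) i]) (simp add: d c')
  finally have "(2 * K) * (f b - f a) - K\<^sup>2 * (b - a) \<le> (LBINT x:{a..b}. (d x)\<^sup>2)" by simp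
  then have "(b - a) * ((2 * K) * (f b - f a) - K\<^sup>2 * (b - a)) \<le> (b - a) * (LBINT x:{a..b}. (d x)\<^sup>2)"
    using ab by (intro mult_left_mono) auto
  moreover have "(b - a) * ((2 * K) * (f b - f a) - K\<^sup>2 * (b - a)) = (f b - f a)\<^sup>2"
    unfolding K[symmetric] by (simp add: power2_eq_square algebra_simps)
  ultimately show ?thesis by simp
qed simp

text \<open>Completing the square: by the Riccati equation for \<open>q\<close>, the difference
  between d^2 - V f^2 and (d - q f)^2 is exactly the derivative of q f^2. The Hardy, Wirtinger and
  catenoid estimates all rest on this identity with different \<open>q\<close>.\<close>

lemma riccati_identity:
  assumes f: "ac a b f d" and "a \<le> b" and d2: "L1_on {a..b} (\<lambda>x. (d x)\<^sup>2)"
    and q: "\<And>x. a \<le> x \<Longrightarrow> x \<le> b \<Longrightarrow> (q has_real_derivative (- V x - (q x)\<^sup>2)) (at x)"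
    and V: "continuous_on {a..b} V"
  shows "L1_on {a..b} (\<lambda>x. (d x - q x * f x)\<^sup>2)"
    and "(LBINT x:{a..b}. (d x)\<^sup>2) - (LBINT x:{a..b}. V x * (f x)\<^sup>2)
       = (LBINT x:{a..b}. (d x - q x * f x)\<^sup>2) + q b * (f b)\<^sup>2 - q a * (f a)\<^sup>2"
    and "L1_on {a..b} (\<lambda>x. V x * (f x)\<^sup>2)"
proof -
  have cq: "continuous_on {a..b} q"
    by (intro DERIV_atLeastAtMost_imp_continuous_on) (use q in blast)
  have "ac a b q (\<lambda>x. - V x - (q x)\<^sup>2)"
    by (rule ac_C1) (auto intro!: q[THEN DERIV_subset] continuous_intros V cq)
  from ac_mult[OF this ac_mult[OF f f]]
  have e: "ac a b (\<lambda>x. q x * (f x * f x)) (\<lambda>x. (- V x - (q x)\<^sup>2) * (f x * f x) + q x * (d x * f x + f x * d x))"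
    (is "ac a b _ ?e") .
  show V2: "L1_on {a..b} (\<lambda>x. V x * (f x)\<^sup>2)"
    by (intro borel_integrable_atLeastAtMost' continuous_intros V ac_continuous[OF f])
  have eq: "(d x - q x * f x)\<^sup>2 = ((d x)\<^sup>2 - V x * (f x)\<^sup>2) - ?e x" for x
    by (simp add: power2_eq_square algebra_simps)
  show "L1_on {a..b} (\<lambda>x. (d x - q x * f x)\<^sup>2)"
    unfolding eq by (intro set_integral_diff(1) d2 V2 ac_integrable[OF e])
  show "(LBINT x:{a..b}. (d x)\<^sup>2) - (LBINT x:{a..b}. V x * (f x)\<^sup>2)
       = (LBINT x:{a..b}. (d x - q x * f x)\<^sup>2) + q b * (f b)\<^sup>2 - q a * (f a)\<^sup>2"
    unfolding eq using acD[OF e, of a b] \<open>a \<le> b\<close>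
    by (subst set_integral_diff(2)[OF set_integral_diff(1)[OF d2 V2] ac_integrable[OF e]],
        subst set_integral_diff(2)[OF d2 V2]) (simp add: power2_eq_square)
qed

text \<open>The weight \<open>q\<close> is the logarithmic derivative of a positive solution of \<open>w'' + V w = 0\<close>
  with \<open>w 0 = 0\<close>, hence singular like \<open>1 / x\<close> at the origin.\<close>

lemma hardy_aux:
  assumes f: "ac 0 b f d" and "0 < b" and d2: "L1_on {0..b} (\<lambda>x. (d x)\<^sup>2)" and f0: "f 0 = 0"
    and q: "\<And>x. 0 < x \<Longrightarrow> x \<le> b \<Longrightarrow> (q has_real_derivative (- V x - (q x)\<^sup>2)) (at x)"
    and V: "continuous_on {0..b} V" and V0: "\<And>x. 0 \<le> x \<Longrightarrow> x \<le> b \<Longrightarrow> 0 \<le> V x"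
    and qx: "\<And>x. 0 < x \<Longrightarrow> x \<le> b \<Longrightarrow> q x \<le> 1 / x"
  obtains M where "\<And>x. 0 < x \<Longrightarrow> x \<le> b \<Longrightarrow> L1_on {x..b} (\<lambda>x. (d x - q x * f x)\<^sup>2) \<and>
    (LBINT x:{x..b}. (d x - q x * f x)\<^sup>2) + q b * (f b)\<^sup>2 + (LBINT x:{0..b}. V x * (f x)\<^sup>2)
      \<le> (LBINT x:{0..b}. (d x)\<^sup>2) + M * x"
proof -
  have cont: "continuous_on {0..b} (\<lambda>x. V x * (f x)\<^sup>2)"
    by (intro continuous_intros V ac_continuous[OF f])
  have Vi: "L1_on {0..b} (\<lambda>x. V x * (f x)\<^sup>2)"
    by (rule borel_integrable_atLeastAtMost'[OF cont])
  have "compact ((\<lambda>x. V x * (f x)\<^sup>2) ` {0..b})" using cont compact_continuous_image by blast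
  then obtain M where M: "\<forall>y\<in>(\<lambda>x. V x * (f x)\<^sup>2) ` {0..b}. norm y \<le> M"
    using compact_imp_bounded bounded_iff by metis
  have "L1_on {x..b} (\<lambda>x. (d x - q x * f x)\<^sup>2) \<and>
    (LBINT x:{x..b}. (d x - q x * f x)\<^sup>2) + q b * (f b)\<^sup>2 + (LBINT x:{0..b}. V x * (f x)\<^sup>2)
      \<le> (LBINT x:{0..b}. (d x)\<^sup>2) + M * x" if x: "0 < x" "x \<le> b" for x
  proof -
    have fx: "ac x b f d" by (rule ac_subinterval[OF f]) (use x in auto)
    have d2x: "L1_on {x..b} (\<lambda>x. (d x)\<^sup>2)" "L1_on {0..x} (\<lambda>x. (d x)\<^sup>2)"
      using d2 x by (auto intro: set_integrable_subset)
    have "L1_on {0..x} (\<lambda>x. V x * (f x)\<^sup>2)"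
      using Vi x by (auto intro: set_integrable_subset)
    then have "(LBINT x:{0..x}. V x * (f x)\<^sup>2) \<le> (LBINT x:{0..x}. M)"
      using M x by (intro set_integral_mono borel_integrable_atLeastAtMost'[of 0 x "\<lambda>_. M"]) (auto simp: abs_le_iff)
    then have Mx: "(LBINT x:{0..x}. V x * (f x)\<^sup>2) \<le> M * x"
      using x by (simp add: set_lebesgue_integral_def mult.commute)
    \<comment> \<open>\<open>q\<close> may blow up like 1/x at the origin, but
      \<open>f 0 = 0\<close> bounds \<open>(f x)\<^sup>2 / x\<close> by the energy on
      \<open>{0..x}\<close>. The boundary term at \<open>x\<close> is thus absorbed by the part of
      the energy that \<open>{x..b}\<close> leaves out.\<close>
    have "(f x - f 0)\<^sup>2 \<le> (x - 0) * (LBINT x:{0..x}. (d x)\<^sup>2)"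
      using x d2x by (intro ac_increment_sq ac_subinterval[OF f]) auto
    then have "(f x)\<^sup>2 / x \<le> (LBINT x:{0..x}. (d x)\<^sup>2)"
      using x f0 by (simp add: field_simps)
    moreover have "q x * (f x)\<^sup>2 \<le> (1 / x) * (f x)\<^sup>2"
      using qx[OF x] by (intro mult_right_mono) auto
    ultimately have qf: "q x * (f x)\<^sup>2 \<le> (LBINT x:{0..x}. (d x)\<^sup>2)" by simp
    have Vx: "continuous_on {x..b} V" using V by (rule continuous_on_subset) (use x in auto)
    note R = riccati_identity[OF fx \<open>x \<le> b\<close> d2x(1) q Vx]
    have "(LBINT x:{x..b}. (d x - q x * f x)\<^sup>2) + q b * (f b)\<^sup>2 + (LBINT x:{0..b}. V x * (f x)\<^sup>2)
      \<le> (LBINT x:{0..b}. (d x)\<^sup>2) + M * x"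
      using R(2) x qf Mx LBINT_split[OF Vi, of x] LBINT_split[OF d2, of x] by force
    with R(1) x show ?thesis by auto
  qed
  with that show ?thesis by blast
qed

text \<open>The error term \<open>M * x\<close> of \<open>hardy_aux\<close> disappears as
  \<open>x\<close> tends to 0. In the equality case the same limit kills the integral of the square
  over every \<open>{e..b}\<close>.\<close>

lemma hardy:
  assumes f: "ac 0 b f d" and b: "0 < b" and d2: "L1_on {0..b} (\<lambda>x. (d x)\<^sup>2)" and f0: "f 0 = 0"
    and q: "\<And>x. 0 < x \<Longrightarrow> x \<le> b \<Longrightarrow> (q has_real_derivative (- V x - (q x)\<^sup>2)) (at x)"
    and V: "continuous_on {0..b} V" and V0: "\<And>x. 0 \<le> x \<Longrightarrow> x \<le> b \<Longrightarrow> 0 \<le> V x"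
    and qx: "\<And>x. 0 < x \<Longrightarrow> x \<le> b \<Longrightarrow> q x \<le> 1 / x"
  shows "q b * (f b)\<^sup>2 + (LBINT x:{0..b}. V x * (f x)\<^sup>2) \<le> (LBINT x:{0..b}. (d x)\<^sup>2)"
    and "(LBINT x:{0..b}. (d x)\<^sup>2) \<le> q b * (f b)\<^sup>2 + (LBINT x:{0..b}. V x * (f x)\<^sup>2) \<Longrightarrow>
      AE x in lborel. 0 < x \<longrightarrow> x < b \<longrightarrow> d x = q x * f x"
proof -
  obtain M where M: "\<And>x. 0 < x \<Longrightarrow> x \<le> b \<Longrightarrow> L1_on {x..b} (\<lambda>x. (d x - q x * f x)\<^sup>2) \<and>
    (LBINT x:{x..b}. (d x - q x * f x)\<^sup>2) + q b * (f b)\<^sup>2 + (LBINT x:{0..b}. V x * (f x)\<^sup>2)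
      \<le> (LBINT x:{0..b}. (d x)\<^sup>2) + M * x"
    using hardy_aux[OF f b d2 f0 q V V0 qx] by blast
  have pos: "0 \<le> (LBINT x:{x..b}. (d x - q x * f x)\<^sup>2)" for x
    unfolding set_lebesgue_integral_def by (intro Bochner_Integration.integral_nonneg) auto
  have lim: "((\<lambda>x. M * x) \<longlongrightarrow> 0) (at_right 0)"
    by (auto intro!: tendsto_eq_intros)
  have small: "eventually (\<lambda>x. 0 < x \<and> x < e) (at_right (0::real))" if "0 < e" for e
    using eventually_at_right_real[OF that] by (simp add: greaterThanLessThan_iff)
  let ?A = "q b * (f b)\<^sup>2 + (LBINT x:{0..b}. V x * (f x)\<^sup>2)"
  let ?B = "LBINT x:{0..b}. (d x)\<^sup>2"
  have "?A - ?B \<le> 0"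
  proof (rule tendsto_lowerbound[OF lim])
    show "\<forall>\<^sub>F x in at_right 0. ?A - ?B \<le> M * x"
      using small[OF b] by eventually_elim (use M pos in smt)
  qed simp
  then show "?A \<le> ?B" by simp
  assume eq: "?B \<le> ?A"
  have z: "(LBINT x:{e..b}. (d x - q x * f x)\<^sup>2) = 0" if e: "0 < e" "e \<le> b" for e
  proof -
    have "(LBINT x:{e..b}. (d x - q x * f x)\<^sup>2) \<le> 0"
    proof (rule tendsto_lowerbound[OF lim])
      show "\<forall>\<^sub>F x in at_right 0. (LBINT x:{e..b}. (d x - q x * f x)\<^sup>2) \<le> M * x"
        using small[OF e(1)]
      proof eventually_elim
        case (elim x)
        have "(LBINT x:{e..b}. (d x - q x * f x)\<^sup>2) \<le> (LBINT x:{x..b}. (d x - q x * f x)\<^sup>2)"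
          by (rule LBINT_mono_set) (use M[of x] elim e in auto)
        with M[of x] elim e eq show ?case by auto
      qed
    qed simp
    with pos[of e] show ?thesis by simp
  qed
  have ae: "AE x in lborel. e \<le> x \<longrightarrow> x \<le> b \<longrightarrow> d x = q x * f x" if e: "0 < e" "e \<le> b" for e
  proof -
    have "integrable lborel (\<lambda>x. indicator {e..b} x *\<^sub>R (d x - q x * f x)\<^sup>2)"
      using M[OF e] by (simp add: set_integrable_def)
    then have "AE x in lborel. indicator {e..b} x *\<^sub>R (d x - q x * f x)\<^sup>2 = 0"
      using z[OF e] unfolding set_lebesgue_integral_def
      by (subst (asm) integral_nonneg_eq_0_iff_AE) auto
    then show ?thesis by eventually_elim (auto simp: indicator_def)
  qed
  \<comment> \<open>Equality is known on each \<open>{e..b}\<close> separately; the sequence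
    \<open>b / Suc n\<close> exhausts the open interval with a single null set.\<close>
  have "AE x in lborel. \<forall>n. b / real (Suc n) \<le> x \<longrightarrow> x \<le> b \<longrightarrow> d x = q x * f x"
    unfolding AE_all_countable using b by (intro allI ae) (auto simp: field_simps)
  then show "AE x in lborel. 0 < x \<longrightarrow> x < b \<longrightarrow> d x = q x * f x"
  proof eventually_elim
    case (elim x)
    show ?case
    proof (intro impI)
      assume x: "0 < x" "x < b"
      obtain n where "b / x < real (Suc n)" by (meson less_Suc_eq reals_Archimedean2 of_nat_less_iff order_less_trans)
      then have "b / real (Suc n) \<le> x" using x by (simp add: field_simps)
      with elim x show "d x = q x * f x" by auto
    qed
  qed
qed

section \<open>Wirtinger's inequality for periodic functions of mean zero\<close>

lemma cot_ode:
  assumes f: "ac 0 b f d" and b: "0 < b" "b < pi"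
    and d: "AE x in lborel. 0 < x \<longrightarrow> x < b \<longrightarrow> d x = cos x / sin x * f x" and f0: "f 0 = 0"
    and x: "0 \<le> x" "x \<le> b"
  shows "f x = f b / sin b * sin x"
proof (cases "x = 0")
  case False
  then have x: "0 < x" "x \<le> b" using x by auto
  have s: "sin y > 0" if "x \<le> y" "y \<le> b" for y using that x b by (intro sin_gt_zero) auto
  \<comment> \<open>The equation says that f / sin has derivative zero. The interval starts at a
    positive \<open>x\<close> because 1 / sin is singular at the origin.\<close>
  have "ac x b (\<lambda>y. 1 / sin y) (\<lambda>y. - cos y / (sin y)\<^sup>2)"
    using s by (intro ac_C1) (auto intro!: derivative_eq_intros continuous_intros simp: power2_eq_square, (metis less_irrefl)+)
  from ac_mult[OF ac_subinterval[OF f, of x b] this]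
  have h: "ac x b (\<lambda>y. f y * (1 / sin y)) (\<lambda>y. d y * (1 / sin y) + f y * (- cos y / (sin y)\<^sup>2))" using x by simp
  have "f b * (1 / sin b) = f x * (1 / sin x)"
  proof (rule ac_zero_const[OF h])
    show "AE y in lborel. x < y \<longrightarrow> y < b \<longrightarrow> d y * (1 / sin y) + f y * (- cos y / (sin y)\<^sup>2) = 0"
      using d by eventually_elim (use x s in \<open>auto simp: field_simps power2_eq_square\<close>)
  qed (use x in auto)
  with s[of x] s[of b] x show ?thesis by (simp add: field_simps)
qed (use f0 in auto)

text \<open>For positive \<open>x\<close> below pi this is cot x \<le> 1/x, the bound that
  \<open>hardy\<close> asks of its weight.\<close>

lemma x_cos_le_sin:
  assumes "0 \<le> x" "x \<le> pi"
  shows "x * cos x \<le> sin (x::real)"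
proof -
  have "sin 0 - 0 * cos 0 \<le> sin x - x * cos x"
  proof (rule DERIV_nonneg_imp_nondecreasing[OF assms(1)])
    fix y assume y: "0 \<le> y" "y \<le> x"
    show "\<exists>z. ((\<lambda>x. sin x - x * cos x) has_real_derivative z) (at y) \<and> 0 \<le> z"
      by (rule exI[of _ "y * sin y"]) (use y assms in \<open>auto intro!: derivative_eq_intros mult_nonneg_nonneg sin_ge_zero\<close>)
  qed
  then show ?thesis by simp
qed

lemma LBINT_reflect:
  fixes F :: "real \<Rightarrow> real"
  shows "(LBINT x:{a..b}. F (k - x)) = (LBINT x:{k-b..k-a}. F x)"
    and "L1_on {k-b..k-a} F \<Longrightarrow> L1_on {a..b} (\<lambda>x. F (k - x))"
proof -
  have ind: "indicator {a..b} (s::real) = (indicator {k-b..k-a} (k + (-1) * s) :: real)" for s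
    by (auto simp: indicator_def)
  show "(LBINT x:{a..b}. F (k - x)) = (LBINT x:{k-b..k-a}. F x)"
    unfolding set_lebesgue_integral_def ind
    by (subst lborel_integral_real_affine[where c="-1" and t=k and f="\<lambda>s. indicator {k-b..k-a} s *\<^sub>R F s"]) auto
  assume "L1_on {k-b..k-a} F"
  then show "L1_on {a..b} (\<lambda>x. F (k - x))"
    using lborel_integrable_real_affine[where c="-1" and t=k and f="\<lambda>x. indicator {k-b..k-a} x *\<^sub>R F x"]
    unfolding set_integrable_def ind by simp
qed

lemma LBINT_shift:
  fixes F :: "real \<Rightarrow> real"
  shows "(LBINT x:{a..b}. F (x + k)) = (LBINT x:{a+k..b+k}. F x)"
    and "L1_on {a+k..b+k} F \<Longrightarrow> L1_on {a..b} (\<lambda>x. F (x + k))"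
proof -
  have ind: "indicator {a..b} (s::real) = (indicator {a+k..b+k} (k + 1 * s) :: real)" for s
    by (auto simp: indicator_def)
  show "(LBINT x:{a..b}. F (x + k)) = (LBINT x:{a+k..b+k}. F x)"
    unfolding set_lebesgue_integral_def ind
    by (subst lborel_integral_real_affine[where c=1 and t=k and f="\<lambda>s. indicator {a+k..b+k} s *\<^sub>R F s"])
       (auto simp: add.commute)
  assume "L1_on {a+k..b+k} F"
  then show "L1_on {a..b} (\<lambda>x. F (x + k))"
    using lborel_integrable_real_affine[where c=1 and t=k and f="\<lambda>x. indicator {a+k..b+k} x *\<^sub>R F x"]
    unfolding set_integrable_def ind by (simp add: add.commute)
qed

text \<open>\<open>hardy\<close> with V = 1 and q = cot, the logarithmic derivative of sin. A
  quarter period is the right length: cot (pi/2) = 0 removes the boundary term, so \<open>f\<close>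
  is free at the right end.\<close>

lemma wirtinger_quarter:
  assumes f: "ac 0 (pi/2) f d" and d2: "L1_on {0..pi/2} (\<lambda>x. (d x)\<^sup>2)" and f0: "f 0 = 0"
  shows "(LBINT x:{0..pi/2}. (f x)\<^sup>2) \<le> (LBINT x:{0..pi/2}. (d x)\<^sup>2)"
    and "(LBINT x:{0..pi/2}. (d x)\<^sup>2) \<le> (LBINT x:{0..pi/2}. (f x)\<^sup>2) \<Longrightarrow> x \<in> {0..pi/2} \<Longrightarrow> f x = f (pi/2) * sin x"
proof -
  have s: "sin x > 0" if "0 < x" "x \<le> pi/2" for x :: real using that by (intro sin_gt_zero) auto
  have q: "((\<lambda>x. cos x / sin x) has_real_derivative - 1 - (cos x / sin x)\<^sup>2) (at x)" if "0 < x" "x \<le> pi/2" for x :: real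
    using s[OF that] by (auto intro!: derivative_eq_intros simp: field_simps power2_eq_square)
  have qx: "cos x / sin x \<le> 1 / x" if "0 < x" "x \<le> pi/2" for x :: real
    using s[OF that] that x_cos_le_sin[of x] by (simp add: field_simps)
  note H = hardy[where V="\<lambda>_. 1" and q="\<lambda>x. cos x / sin x", OF f _ d2 f0 q continuous_on_const _ qx]
  show "(LBINT x:{0..pi/2}. (f x)\<^sup>2) \<le> (LBINT x:{0..pi/2}. (d x)\<^sup>2)"
    using H(1) by simp
  assume "(LBINT x:{0..pi/2}. (d x)\<^sup>2) \<le> (LBINT x:{0..pi/2}. (f x)\<^sup>2)" and x: "x \<in> {0..pi/2}"
  then have "AE x in lborel. 0 < x \<longrightarrow> x < pi/2 \<longrightarrow> d x = cos x / sin x * f x"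
    using H(2) by simp
  from cot_ode[OF f _ _ this f0, of x] x pi_gt_zero show "f x = f (pi/2) * sin x" by simp
qed

text \<open>Both halves vanish at their outer end and are free at the midpoint, so the quarter
  estimate applies to each, on the right after reflection. In the equality case both amplitudes
  equal the value at the midpoint, so the two pieces form one sine.\<close>

lemma wirtinger_half:
  assumes f: "ac u (u + pi) f d" and d2: "L1_on {u..u+pi} (\<lambda>x. (d x)\<^sup>2)"
    and f0: "f u = 0" "f (u + pi) = 0"
  shows "(LBINT x:{u..u+pi}. (f x)\<^sup>2) \<le> (LBINT x:{u..u+pi}. (d x)\<^sup>2)"
    and "(LBINT x:{u..u+pi}. (d x)\<^sup>2) \<le> (LBINT x:{u..u+pi}. (f x)\<^sup>2) \<Longrightarrow>
      \<exists>C. \<forall>x\<in>{u..u+pi}. f x = C * sin (x - u)"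
proof -
  let ?m = "u + pi/2"
  have a1: "ac 0 (pi/2) (\<lambda>x. f (x + u)) (\<lambda>x. d (x + u))"
    using ac_subinterval[OF ac_shift[OF f, of u], of 0 "pi/2"] by simp
  have b1: "L1_on {0..pi/2} (\<lambda>x. (d (x + u))\<^sup>2)"
    by (rule LBINT_shift(2)[where F="\<lambda>x. (d x)\<^sup>2"]) (rule set_integrable_subset[OF d2], auto)
  note W1 = wirtinger_quarter[OF a1 b1]
  have "ac 0 (pi/2) (\<lambda>x. f (- (x + -(u+pi)))) (\<lambda>x. - d (- (x + -(u+pi))))"
    using ac_subinterval[OF ac_shift[OF ac_reflect[OF f], of "-(u+pi)"], of 0 "pi/2"] by simp
  then have a2: "ac 0 (pi/2) (\<lambda>x. f ((u + pi) - x)) (\<lambda>x. - d ((u+pi) - x))" by (simp add: add.commute)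
  have b2: "L1_on {0..pi/2} (\<lambda>x. (- d ((u+pi) - x))\<^sup>2)"
    using LBINT_reflect(2)[where F="\<lambda>x. (d x)\<^sup>2" and k="u+pi" and a=0 and b="pi/2", OF set_integrable_subset[OF d2]] by auto
  note W2 = wirtinger_quarter[OF a2 b2]
  have f2: "L1_on {u..u+pi} (\<lambda>x. (f x)\<^sup>2)"
    by (intro borel_integrable_atLeastAtMost' continuous_intros ac_continuous[OF f])
  have e: "pi/2 + u = ?m" "u + pi - pi/2 = ?m" by simp_all
  have sh: "(LBINT x:{0..pi/2}. F (x + u)) = (LBINT x:{u..?m}. F x)" for F :: "real \<Rightarrow> real"
    using LBINT_shift(1)[of 0 "pi/2" F u] by (simp add: add.commute)
  have re: "(LBINT x:{0..pi/2}. F (u + pi - x)) = (LBINT x:{?m..u+pi}. F x)" for F :: "real \<Rightarrow> real"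
    using LBINT_reflect(1)[of 0 "pi/2" F "u+pi"] by (simp add: e)
  have s1: "(LBINT x:{u..u+pi}. (f x)\<^sup>2) = (LBINT x:{0..pi/2}. (f (x+u))\<^sup>2) + (LBINT x:{0..pi/2}. (f (u+pi-x))\<^sup>2)"
    using LBINT_split[OF f2, of ?m] sh[of "\<lambda>x. (f x)\<^sup>2"] re[of "\<lambda>x. (f x)\<^sup>2"] by simp
  have s2: "(LBINT x:{u..u+pi}. (d x)\<^sup>2) = (LBINT x:{0..pi/2}. (d (x+u))\<^sup>2) + (LBINT x:{0..pi/2}. (- d (u+pi-x))\<^sup>2)"
    using LBINT_split[OF d2, of ?m] sh[of "\<lambda>x. (d x)\<^sup>2"] re[of "\<lambda>x. (d x)\<^sup>2"] by simp
  show "(LBINT x:{u..u+pi}. (f x)\<^sup>2) \<le> (LBINT x:{u..u+pi}. (d x)\<^sup>2)"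
    unfolding s1 s2 using W1(1) W2(1) f0 by simp
  assume "(LBINT x:{u..u+pi}. (d x)\<^sup>2) \<le> (LBINT x:{u..u+pi}. (f x)\<^sup>2)"
  then have 1: "f (x + u) = f ?m * sin x" and 2: "f (u + pi - x) = f ?m * sin x" if "x \<in> {0..pi/2}" for x
    unfolding s1 s2 using W1(1) W2(1) W1(2)[OF _ _ that] W2(2)[OF _ _ that] f0 by (simp_all add: e)
  have "f x = f ?m * sin (x - u)" if "x \<in> {u..u+pi}" for x
  proof (cases "x \<le> ?m")
    case True
    with 1[of "x - u"] that show ?thesis by simp
  next
    case False
    with 2[of "u + pi - x"] that have "f x = f ?m * sin (pi - (x - u))" by (simp add: algebra_simps)
    then show ?thesis by simp
  qed
  then show "\<exists>C. \<forall>x\<in>{u..u+pi}. f x = C * sin (x - u)" by blast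
qed
lemma ac_cong_AE:
  assumes f: "ac a b f d" and ae: "AE x in lborel. a < x \<longrightarrow> x < b \<longrightarrow> d x = e x"
    and m: "e \<in> Bor"
  shows "ac a b f e"
  unfolding ac_def
proof (intro conjI allI impI)
  have ae': "AE s in lborel. indicator {x..y} s *\<^sub>R d s = indicator {x..y} s *\<^sub>R e s" if "a \<le> x" "y \<le> b" for x y
  proof -
    have "AE s in lborel. s \<noteq> a \<and> s \<noteq> b" by (simp add: AE_lborel_singleton)
    with ae show ?thesis by eventually_elim (use that in \<open>auto simp: indicator_def\<close>)
  qed
  have m': "(\<lambda>s. indicator {x..y} s *\<^sub>R e s) \<in> borel_measurable lborel" for x y using m by simp
  show "L1_on {a..b} e"
    using ac_integrable[OF f] unfolding set_integrable_def
    by (rule integrable_cong_AE_imp[OF _ m']) (use ae'[of a b] in simp)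
  fix x y assume xy: "a \<le> x" "x \<le> y" "y \<le> b"
  have "L1_on {x..y} d"
    by (rule set_integrable_subset[OF ac_integrable[OF f]]) (use xy in auto)
  then have "(LBINT s:{x..y}. d s) = (LBINT s:{x..y}. e s)"
    unfolding set_lebesgue_integral_def set_integrable_def
    by (intro integral_cong_AE m' ae') (use xy in auto)
  with acD[OF f xy] show "f y - f x = (LBINT s:{x..y}. e s)" by simp
qed

lemma ac_join:
  assumes "ac a b f d" "ac b c f d" "a \<le> b" "b \<le> c"
  shows "ac a c f d"
proof (rule acI)
  have "L1_on ({a..b} \<union> {b..c}) d"
    using ac_integrable[OF assms(1)] ac_integrable[OF assms(2)] by (intro set_integrable_Un) auto
  then show i: "L1_on {a..c} d"
    using ivl_disj_un_two_touch(4)[OF assms(3,4)] by simp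
  fix x assume x: "a \<le> x" "x \<le> c"
  show "f x = f a + (LBINT s:{a..x}. d s)"
  proof (cases "x \<le> b")
    case True
    then show ?thesis using acD[OF assms(1), of a x] x by auto
  next
    case False
    have "L1_on {a..x} d" by (rule set_integrable_subset[OF i]) (use x in auto)
    from LBINT_split[OF this, of b] show ?thesis
      using False acD[OF assms(1), of a b] acD[OF assms(2), of b x] assms x by auto
  qed
qed

lemma LBINT_period:
  fixes F :: "real \<Rightarrow> real"
  assumes i: "L1_on {0..2*p} F" and per: "\<And>x. p < x \<Longrightarrow> x \<le> 2*p \<Longrightarrow> F x = F (x - p)"
    and a: "0 \<le> a" "a \<le> p"
  shows "(LBINT x:{a..a+p}. F x) = (LBINT x:{0..p}. F x)"
proof -
  have sub: "L1_on {x..y} F" if "0 \<le> x" "y \<le> 2*p" for x y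
    by (rule set_integrable_subset[OF i]) (use that in auto)
  \<comment> \<open>The relation \<open>F x = F (x - p)\<close> is available for
    \<open>p < x\<close> only, so the end point 0 of the shifted interval is removed.\<close>
  have ae: "AE x in lborel. x \<noteq> 0" by (simp add: AE_lborel_singleton)
  have sh: "L1_on {0..a} (\<lambda>x. F (x + p))"
    by (rule LBINT_shift(2)) (use sub[of p "a+p"] a in simp)
  have "(LBINT x:{p..a+p}. F x) = (LBINT x:{0..a}. F (x + p))"
    using LBINT_shift(1)[of 0 a F p] by simp
  also have "\<dots> = (LBINT x:{0..a}. F x)"
    unfolding set_lebesgue_integral_def
  proof (rule integral_cong_AE)
    show "AE x in lborel. indicator {0..a} x *\<^sub>R F (x + p) = indicator {0..a} x *\<^sub>R F x"
      using ae by eventually_elim (use per a in \<open>auto simp: indicator_def\<close>)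
  qed (use sub[of 0 a] sh a in \<open>auto simp: set_integrable_def\<close>)
  finally show ?thesis
    using LBINT_split[OF sub[of a "a+p"], of p] LBINT_split[OF sub[of 0 p], of a] a by simp
qed

text \<open>Fourier series are avoided. After periodic extension there are points \<open>a\<close>
  and \<open>a + pi\<close> with a common value \<open>k\<close>; the function minus
  \<open>k\<close> vanishes at both ends of two consecutive half periods, where the half-period
  inequality holds. Mean zero shows that subtracting \<open>k\<close> can only raise the left-hand
  side.\<close>

lemma wirtinger:
  assumes g: "ac 0 (2*pi) g d" and d2: "L1_on {0..2*pi} (\<lambda>x. (d x)\<^sup>2)"
    and md: "d \<in> Bor"
    and per: "g (2*pi) = g 0" and mean: "(LBINT x:{0..2*pi}. g x) = 0"
  shows "(LBINT x:{0..2*pi}. (g x)\<^sup>2) \<le> (LBINT x:{0..2*pi}. (d x)\<^sup>2)"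
    and "(LBINT x:{0..2*pi}. (d x)\<^sup>2) \<le> (LBINT x:{0..2*pi}. (g x)\<^sup>2) \<Longrightarrow>
      \<exists>A B. \<forall>x\<in>{0..2*pi}. g x = A * cos x + B * sin x"
proof -
  define G where "G x = (if x \<le> 2*pi then g x else g (x - 2*pi))" for x
  define D where "D x = (if x \<le> 2*pi then d x else d (x - 2*pi))" for x
  have mD: "D \<in> Bor" unfolding D_def[abs_def] using md by measurable
  have G1: "ac 0 (2*pi) G D"
    by (rule ac_cong_AE[OF ac_cong[OF g] _ mD]) (auto simp: G_def D_def)
  have "ac (2*pi) (4*pi) (\<lambda>x. g (x - 2*pi)) (\<lambda>x. d (x - 2*pi))"
    using ac_shift[OF g, of "-(2*pi)"] by simp
  then have "ac (2*pi) (4*pi) G (\<lambda>x. d (x - 2*pi))"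
  proof (rule ac_cong)
    fix x assume "2*pi \<le> x" "x \<le> 4*pi"
    then show "g (x - 2*pi) = G x" using per by (cases "x = 2*pi") (auto simp: G_def)
  qed
  then have G2: "ac (2*pi) (4*pi) G D"
    by (rule ac_cong_AE[OF _ _ mD]) (auto simp: D_def)
  have G: "ac 0 (4*pi) G D" by (rule ac_join[OF G1 G2]) auto
  have GD: "continuous_on {0..4*pi} G" by (rule ac_continuous[OF G])
  have Gp: "G (x + 2*pi) = G x" if "0 \<le> x" "x \<le> 2*pi" for x
    using that per by (cases "x = 0") (auto simp: G_def)
  have D2: "L1_on {0..4*pi} (\<lambda>x. (D x)\<^sup>2)"
  proof -
    have "L1_on {2*pi..4*pi} (\<lambda>x. (d (x - 2*pi))\<^sup>2)"
      using LBINT_shift(2)[of "2*pi" "-(2*pi)" "4*pi" "\<lambda>x. (d x)\<^sup>2"] d2 by simp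
    then have "L1_on {2*pi<..4*pi} (\<lambda>x. (d (x - 2*pi))\<^sup>2)"
      by (rule set_integrable_subset) auto
    then have "L1_on {2*pi<..4*pi} (\<lambda>x. (D x)\<^sup>2)"
      by (rule set_integrable_cong[THEN iffD1, rotated 3]) (auto simp: D_def)
    moreover have "L1_on {0..2*pi} (\<lambda>x. (D x)\<^sup>2)"
      using d2 by (rule set_integrable_cong[THEN iffD1, rotated 3]) (auto simp: D_def)
    ultimately have "L1_on ({0..2*pi} \<union> {2*pi<..4*pi}) (\<lambda>x. (D x)\<^sup>2)"
      by (intro set_integrable_Un) auto
    moreover have "{0..2*pi} \<union> {2*pi<..4*pi} = {0..4*pi}" by auto
    ultimately show ?thesis by simp
  qed
  \<comment> \<open>\<open>?h\<close> takes opposite values at 0 and pi because \<open>G\<close> has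
    period 2 pi, so it has a zero in between.\<close>
  obtain a where a: "0 \<le> a" "a \<le> pi" "G a = G (a + pi)"
  proof -
    let ?h = "\<lambda>x. G x - G (x + pi)"
    have c: "continuous_on {0..pi} ?h"
      by (intro continuous_intros continuous_on_compose2[OF GD] continuous_on_subset[OF GD]) auto
    have "?h pi = - ?h 0" using Gp[of 0] by simp
    then have "?h 0 \<le> 0 \<and> 0 \<le> ?h pi \<or> ?h pi \<le> 0 \<and> 0 \<le> ?h 0" by auto
    then have "\<exists>x\<ge>0. x \<le> pi \<and> ?h x = 0"
      using IVT'[of ?h 0 0 pi, OF _ _ _ c] IVT2'[of ?h pi 0 0, OF _ _ _ c] by auto
    then show ?thesis using that by auto
  qed
  define k where "k = G a"
  define H where "H x = G x - k" for x
  have H: "ac 0 (4*pi) H D" unfolding H_def by (rule ac_diff_const[OF G])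
  have Hc: "continuous_on {0..4*pi} H" by (rule ac_continuous[OF H])
  have Hp: "H (x + 2*pi) = H x" if "0 \<le> x" "x \<le> 2*pi" for x using Gp[OF that] by (simp add: H_def)
  have ci: "L1_on {x..y} (\<lambda>x. (H x)\<^sup>2)" "L1_on {x..y} H"
      "L1_on {x..y} G" "L1_on {x..y} (\<lambda>x. (G x)\<^sup>2)" if "0 \<le> x" "y \<le> 4*pi" for x y
    using that by (auto intro!: borel_integrable_atLeastAtMost' continuous_intros continuous_on_subset[OF Hc] continuous_on_subset[OF GD])
  have D2': "L1_on {x..y} (\<lambda>x. (D x)\<^sup>2)" if "0 \<le> x" "y \<le> 4*pi" for x y
    by (rule set_integrable_subset[OF D2]) (use that in auto)
  have [simp]: "H a = 0" "H (a + pi) = 0" using a by (auto simp: H_def k_def)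
  have [simp]: "H (a + 2*pi) = 0" using Hp[of a] a pi_gt_zero by auto
  have e2: "a + pi + pi = a + 2*pi" by simp
  have "ac a (a + pi) H D" by (rule ac_subinterval[OF H]) (use a in auto)
  note W1 = wirtinger_half[OF this D2']
  have "ac (a+pi) (a + pi + pi) H D" by (rule ac_subinterval[OF H]) (use a in auto)
  note W2 = wirtinger_half[OF this D2', unfolded e2]
  have sp: "(LBINT x:{a..a+2*pi}. F x) = (LBINT x:{a..a+pi}. F x) + (LBINT x:{a+pi..a+2*pi}. F x)"
    if "L1_on {a..a+2*pi} F" for F :: "real \<Rightarrow> real"
    by (rule LBINT_split[OF that]) auto
  have le4: "a + 2*pi \<le> 4*pi" "a + pi \<le> 4*pi" using a pi_gt_zero by auto
  have pD: "(LBINT x:{a..a+2*pi}. (D x)\<^sup>2) = (LBINT x:{0..2*pi}. (d x)\<^sup>2)"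
  proof -
    have "(LBINT x:{a..a+2*pi}. (D x)\<^sup>2) = (LBINT x:{0..2*pi}. (D x)\<^sup>2)"
      by (rule LBINT_period) (use D2 a in \<open>auto simp: D_def\<close>)
    also have "\<dots> = (LBINT x:{0..2*pi}. (d x)\<^sup>2)"
      by (rule set_lebesgue_integral_cong) (auto simp: D_def)
    finally show ?thesis .
  qed
  have pH2: "(LBINT x:{a..a+2*pi}. (H x)\<^sup>2) = (LBINT x:{0..2*pi}. (H x)\<^sup>2)"
    by (rule LBINT_period) (use ci[of 0 "4*pi"] a Hp[of "_ - 2*pi"] in auto)
  have pH: "(LBINT x:{a..a+2*pi}. H x) = (LBINT x:{0..2*pi}. H x)"
    by (rule LBINT_period) (use ci[of 0 "4*pi"] a Hp[of "_ - 2*pi"] in auto)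
  have cst: "L1_on {0..2*pi} (\<lambda>x. c)" for c :: real
    by (intro borel_integrable_atLeastAtMost' continuous_intros)
  have "(LBINT x:{0..2*pi}. G x) = (LBINT x:{0..2*pi}. g x)"
    by (rule set_lebesgue_integral_cong) (auto simp: G_def)
  with mean have gG: "(LBINT x:{0..2*pi}. G x) = 0" by simp
  have gG2: "(LBINT x:{0..2*pi}. (G x)\<^sup>2) = (LBINT x:{0..2*pi}. (g x)\<^sup>2)"
    by (rule set_lebesgue_integral_cong) (auto simp: G_def)
  have iH: "(LBINT x:{0..2*pi}. H x) = - (2 * pi * k)"
    unfolding H_def using ci[of 0 "2*pi"] gG by (simp add: set_integral_diff(2) cst) (simp add: set_lebesgue_integral_def)
  \<comment> \<open>The cross term vanishes since \<open>g\<close> has mean zero: subtracting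
    \<open>k\<close> adds exactly 2 pi k^2. In the equality case this surplus forces
    \<open>k = 0\<close>.\<close>
  have iH2: "(LBINT x:{0..2*pi}. (H x)\<^sup>2) = (LBINT x:{0..2*pi}. (g x)\<^sup>2) + 2 * pi * k\<^sup>2"
  proof -
    have "(LBINT x:{0..2*pi}. (H x)\<^sup>2) = (LBINT x:{0..2*pi}. ((G x)\<^sup>2 - (2 * k) * G x) + k\<^sup>2)"
      by (simp add: H_def power2_eq_square algebra_simps)
    also have "\<dots> = (LBINT x:{0..2*pi}. (G x)\<^sup>2) - (2 * k) * (LBINT x:{0..2*pi}. G x) + (LBINT x:{0..2*pi}. k\<^sup>2)"
      using ci[of 0 "2*pi"]
      by (subst set_integral_add(2), intro set_integral_diff(1) set_integrable_mult_right)
         (auto simp: cst set_integral_diff(2) set_integrable_mult_right)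
    finally show ?thesis using gG gG2 by (simp add: set_lebesgue_integral_def)
  qed
  have nn: "0 \<le> 2 * pi * k\<^sup>2" by simp
  note S = sp[OF ci(1), OF a(1) le4(1)] sp[OF D2', OF a(1) le4(1)]
  have w: "(LBINT x:{a..a+pi}. (H x)\<^sup>2) \<le> (LBINT x:{a..a+pi}. (D x)\<^sup>2)"
     "(LBINT x:{a+pi..a+2*pi}. (H x)\<^sup>2) \<le> (LBINT x:{a+pi..a+2*pi}. (D x)\<^sup>2)"
    using W1(1) W2(1) a le4 by auto
  show "(LBINT x:{0..2*pi}. (g x)\<^sup>2) \<le> (LBINT x:{0..2*pi}. (d x)\<^sup>2)"
    using w S pD pH2 iH2 nn by linarith
  assume eq: "(LBINT x:{0..2*pi}. (d x)\<^sup>2) \<le> (LBINT x:{0..2*pi}. (g x)\<^sup>2)"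
  have "2 * pi * k\<^sup>2 \<le> 0" using w S pD pH2 iH2 eq by linarith
  then have k0: "k = 0" using pi_gt_zero by (auto simp: mult_le_0_iff simp del: pi_gt_zero)
  have "\<exists>C. \<forall>x\<in>{a..a+pi}. H x = C * sin (x - a)"
    using W1(2) w S pD pH2 iH2 eq nn a le4 by force
  then obtain C where C: "\<And>x. x\<in>{a..a+pi} \<Longrightarrow> H x = C * sin (x - a)" by blast
  have "\<exists>C. \<forall>x\<in>{a+pi..a+2*pi}. H x = C * sin (x - (a + pi))"
    using W2(2) w S pD pH2 iH2 eq nn a le4 by force
  then obtain C' where C': "\<And>x. x\<in>{a+pi..a+2*pi} \<Longrightarrow> H x = C' * sin (x - (a + pi))" by blast
  have sint: "(LBINT x:{u..u+pi}. c * sin (x - u)) = 2 * c" for u c :: real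
  proof -
    have "ac u (u+pi) (\<lambda>x. - c * cos (x - u)) (\<lambda>x. c * sin (x - u))"
      by (rule ac_C1) (auto intro!: derivative_eq_intros continuous_intros)
    from acD[OF this, of u "u+pi"] show ?thesis by simp
  qed
  have "(LBINT x:{a..a+pi}. H x) = 2 * C"
    by (subst sint[symmetric, of C a], rule set_lebesgue_integral_cong) (auto simp: C)
  moreover have "(LBINT x:{a+pi..a+2*pi}. H x) = 2 * C'"
    by (subst sint[symmetric, of C' "a+pi"], unfold e2, rule set_lebesgue_integral_cong) (auto simp: C')
  \<comment> \<open>With \<open>k = 0\<close> the function \<open>H\<close> has mean zero, so the
    two half waves have opposite amplitudes and join to one sine of period 2 pi.\<close>
  ultimately have CC: "C' = - C"
    using sp[OF ci(2), OF a(1) le4(1)] pH iH k0 by simp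
  have all: "G x = C * sin (x - a)" if x: "x \<in> {a..a+2*pi}" for x
  proof (cases "x \<le> a + pi")
    case True
    then show ?thesis using C[of x] x k0 by (simp add: H_def)
  next
    case False
    then have "H x = - C * sin ((x - a) - pi)" using C'[of x] x CC by (simp add: algebra_simps)
    also have "\<dots> = C * sin (x - a)" by (simp add: sin_diff algebra_simps)
    finally show ?thesis using k0 by (simp add: H_def)
  qed
  have "g x = (- C * sin a) * cos x + (C * cos a) * sin x" if x: "x \<in> {0..2*pi}" for x
  proof -
    have "g x = C * sin (x - a)"
    proof (cases "x < a")
      case True
      then have "G (x + 2*pi) = C * sin (x + 2*pi - a)" using x a by (intro all) auto
      moreover have "sin (x + 2*pi - a) = sin (x - a)" using sin_periodic[of "x - a"] by (simp add: algebra_simps)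
      ultimately have "G x = C * sin (x - a)" using Gp[of x] x by simp
      then show ?thesis using x by (simp add: G_def)
    qed (use all[of x] a x in \<open>auto simp: G_def\<close>)
    then show ?thesis by (simp add: sin_diff algebra_simps)
  qed
  then show "\<exists>A B. \<forall>x\<in>{0..2*pi}. g x = A * cos x + B * sin x" by blast
qed

section \<open>Integrals over product sets\<close>

lemma AE_product:
  assumes "AE z in lborel. Q z"
  shows "AE x in lborel. AE y in lborel. Q (x::real, y::real)"
    and "AE y in lborel. AE x in lborel. Q (x::real, y::real)"
proof -
  have Q: "AE z in lborel \<Otimes>\<^sub>M lborel. Q z" using assms unfolding lborel_prod .
  then show "AE x in lborel. AE y in lborel. Q (x::real, y::real)" by (rule lborel_pair.AE_pair)
  \<comment> \<open>\<open>Q\<close> carries no measurability, so the order of the quantifiers is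
    exchanged for a measurable null set \<open>N\<close> that contains the exceptional set.\<close>
  obtain N where N0: "N \<in> null_sets (lborel \<Otimes>\<^sub>M lborel)"
      and "{z \<in> space (lborel \<Otimes>\<^sub>M lborel). \<not> Q z} \<subseteq> N"
    using Q unfolding eventually_ae_filter by blast
  then have N3: "\<And>z. \<not> Q z \<Longrightarrow> z \<in> N" by (auto simp: space_pair_measure)
  have "AE z in lborel \<Otimes>\<^sub>M lborel. z \<notin> N" using N0 by (rule AE_not_in)
  then have "AE x in lborel. AE y in lborel. (x, y) \<notin> N" by (rule lborel_pair.AE_pair)
  moreover have "{z \<in> space (lborel \<Otimes>\<^sub>M lborel). (fst z, snd z) \<notin> N} \<in> sets (lborel \<Otimes>\<^sub>M lborel)"
  proof -
    have "{z \<in> space (lborel \<Otimes>\<^sub>M lborel). (fst z, snd z) \<notin> N} = space (lborel \<Otimes>\<^sub>M lborel) - N" by auto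
    then show ?thesis using sets.compl_sets[OF null_setsD2[OF N0]] by metis
  qed
  ultimately have "AE y in lborel. AE x in lborel. (x, y) \<notin> N"
    using lborel_pair.AE_commute[of "\<lambda>x y. (x, y) \<notin> N"] by simp
  then show "AE y in lborel. AE x in lborel. Q (x::real, y::real)"
    by eventually_elim (use N3 in \<open>auto elim!: eventually_mono\<close>)
qed

lemma AE_productI:
  assumes "AE x in lborel. AE y in lborel. Q (x::real, y::real)" "{z. Q z} \<in> sets borel"
  shows "AE z in lborel. Q z"
proof -
  have "AE z in lborel \<Otimes>\<^sub>M lborel. Q z"
    by (rule lborel_pair.AE_pair_measure) (use assms in \<open>auto simp: borel_prod[symmetric] space_pair_measure\<close>)
  then show ?thesis unfolding lborel_prod .
qed

lemma indicator_Times_scaleR: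
  "indicator (A \<times> B) (x, y) *\<^sub>R (f::real) = indicator A x *\<^sub>R (indicator B y *\<^sub>R f)"
  by (auto simp: indicator_def)

lemma set_Fubini:
  fixes f :: "real \<times> real \<Rightarrow> real"
  assumes f: "L1_on (A \<times> B) f"
  shows "AE x in lborel. x \<in> A \<longrightarrow> L1_on B (\<lambda>y. f (x, y))"
    and "AE y in lborel. y \<in> B \<longrightarrow> L1_on A (\<lambda>x. f (x, y))"
    and "(LBINT z:A\<times>B. f z) = (LBINT x:A. LBINT y:B. f (x, y))"
    and "(LBINT z:A\<times>B. f z) = (LBINT y:B. LBINT x:A. f (x, y))"
    and "L1_on A (\<lambda>x. LBINT y:B. f (x, y))"
    and "L1_on B (\<lambda>y. LBINT x:A. f (x, y))"
proof -
  let ?g = "\<lambda>z. indicator (A \<times> B) z *\<^sub>R f z"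
  have i: "integrable (lborel \<Otimes>\<^sub>M lborel) ?g"
    using f by (simp add: set_integrable_def lborel_prod)
  have i': "integrable (lborel \<Otimes>\<^sub>M lborel) (\<lambda>(x, y). indicator A x *\<^sub>R (indicator B y *\<^sub>R f (x, y)))"
    using i by (rule back_subst[of "integrable _"]) (auto simp: fun_eq_iff indicator_def)
  have eq: "(\<lambda>y. indicator A x *\<^sub>R (indicator B y *\<^sub>R f (x, y))) = (\<lambda>y. indicator B y *\<^sub>R f (x, y))" if "x \<in> A" for x
    using that by simp
  show "AE x in lborel. x \<in> A \<longrightarrow> L1_on B (\<lambda>y. f (x, y))"
    using lborel_pair.AE_integrable_fst'[OF i']
    by eventually_elim (auto simp: set_integrable_def eq)
  have i2: "integrable (lborel \<Otimes>\<^sub>M lborel) (\<lambda>(y, x). indicator A x *\<^sub>R (indicator B y *\<^sub>R f (x, y)))"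
    using lborel_pair.integrable_product_swap[OF i'] by (simp add: case_prod_beta')
  show "AE y in lborel. y \<in> B \<longrightarrow> L1_on A (\<lambda>x. f (x, y))"
    using lborel_pair.AE_integrable_fst'[OF i2]
    by eventually_elim (auto simp: set_integrable_def)
  have "(LBINT z:A\<times>B. f z) = (LINT z|(lborel \<Otimes>\<^sub>M lborel). (case z of (x, y) \<Rightarrow> indicator A x *\<^sub>R (indicator B y *\<^sub>R f (x, y))))"
    unfolding set_lebesgue_integral_def lborel_prod
    by (intro Bochner_Integration.integral_cong) (auto simp: indicator_def)
  note e1 = this
  show "(LBINT z:A\<times>B. f z) = (LBINT x:A. LBINT y:B. f (x, y))"
    unfolding e1 lborel_pair.integral_fst'[OF i', symmetric] by (simp add: set_lebesgue_integral_def)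
  have sw: "(LBINT x. indicator A x *\<^sub>R (indicator B y *\<^sub>R f (x, y))) = indicator B y *\<^sub>R (LBINT x. indicator A x *\<^sub>R f (x, y))" for y
    by (cases "y \<in> B") simp_all
  show "(LBINT z:A\<times>B. f z) = (LBINT y:B. LBINT x:A. f (x, y))"
    unfolding e1 lborel_pair.integral_snd[OF i', symmetric] sw by (simp add: set_lebesgue_integral_def)
  show "L1_on A (\<lambda>x. LBINT y:B. f (x, y))"
    using lborel_pair.integrable_fst'[OF i'] by (simp add: set_lebesgue_integral_def set_integrable_def)
  show "L1_on B (\<lambda>y. LBINT x:A. f (x, y))"
    using lborel_pair.integrable_fst'[OF i2] unfolding prod.case sw
    by (simp add: set_lebesgue_integral_def set_integrable_def)
qed

lemma set_Tonelli:
  fixes f :: "real \<times> real \<Rightarrow> real"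
  assumes f: "f \<in> Bor" and A: "A \<in> sets borel" and B: "B \<in> sets borel"
    and 1: "AE x in lborel. x \<in> A \<longrightarrow> L1_on B (\<lambda>y. f (x, y))"
    and 2: "L1_on A (\<lambda>x. LBINT y:B. \<bar>f (x, y)\<bar>)"
  shows "L1_on (A \<times> B) f"
proof -
  have AB: "A \<times> B \<in> sets borel" using A B by (auto simp: borel_prod[symmetric])
  have "integrable (lborel \<Otimes>\<^sub>M lborel) (\<lambda>z. indicator (A \<times> B) z *\<^sub>R f z)"
  proof (rule lborel_pair.Fubini_integrable)
    show "(\<lambda>z. indicator (A \<times> B) z *\<^sub>R f z) \<in> borel_measurable (lborel \<Otimes>\<^sub>M lborel)"
      using f AB by (simp add: lborel_prod)
    show "integrable lborel (\<lambda>x. LINT y|lborel. norm (indicator (A \<times> B) (x, y) *\<^sub>R f (x, y)))"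
      using 2 unfolding set_integrable_def set_lebesgue_integral_def indicator_Times_scaleR
      by (simp add: abs_mult)
    show "AE x in lborel. integrable lborel (\<lambda>y. indicator (A \<times> B) (x, y) *\<^sub>R f (x, y))"
      using 1 unfolding set_integrable_def indicator_Times_scaleR
      by eventually_elim (auto simp: indicator_def)
  qed
  then show ?thesis by (simp add: set_integrable_def lborel_prod)
qed

lemma L1_tensor:
  fixes a b :: "real \<Rightarrow> real"
  assumes "L1_on A a" "L1_on B b"
  shows "L1_on (A \<times> B) (\<lambda>z. a (fst z) * b (snd z))"
proof -
  have "integrable (lborel \<Otimes>\<^sub>M lborel) (\<lambda>(x, y). (indicator A x *\<^sub>R a x) * (indicator B y *\<^sub>R b y))"
    using assms by (intro integrable_prod) (auto simp: set_integrable_def)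
  moreover have "(\<lambda>(x, y). (indicator A x *\<^sub>R a x) * (indicator B y *\<^sub>R b y)) =
      (\<lambda>z. indicator (A \<times> B) z *\<^sub>R (a (fst z) * b (snd z)))"
    by (auto simp: indicator_def fun_eq_iff)
  ultimately show ?thesis by (simp add: set_integrable_def lborel_prod)
qed

lemma L1_bound:
  fixes f g :: "'a \<Rightarrow> real"
  assumes "set_integrable M A f" "set_borel_measurable M A g" "AE x in M. x \<in> A \<longrightarrow> \<bar>g x\<bar> \<le> f x"
  shows "set_integrable M A g"
  using assms(1,2) unfolding set_integrable_def set_borel_measurable_def
  by (rule Bochner_Integration.integrable_bound)
     (use assms(3) in \<open>auto elim!: eventually_mono simp: indicator_def\<close>)

lemma Bor_set:
  fixes f :: "'a::euclidean_space \<Rightarrow> real"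
  assumes "f \<in> Bor" "A \<in> sets borel"
  shows "set_borel_measurable lborel A f"
  using assms unfolding set_borel_measurable_def by simp

lemma L2_mult_integrable:
  fixes f g :: "'a::euclidean_space \<Rightarrow> real"
  assumes "f \<in> Bor" "g \<in> Bor" "A \<in> sets borel"
    and "L1_on A (\<lambda>x. (f x)\<^sup>2)" "L1_on A (\<lambda>x. (g x)\<^sup>2)"
  shows "L1_on A (\<lambda>x. f x * g x)"
proof (rule L1_bound[OF set_integral_add(1)[OF assms(4,5)]])
  show "set_borel_measurable lborel A (\<lambda>x. f x * g x)"
    using assms by (intro Bor_set) auto
  have "\<bar>f x * g x\<bar> \<le> (f x)\<^sup>2 + (g x)\<^sup>2" for x
  proof -
    have "2 * (\<bar>f x\<bar> * \<bar>g x\<bar>) \<le> (f x)\<^sup>2 + (g x)\<^sup>2"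
      using sum_squares_bound[of "\<bar>f x\<bar>" "\<bar>g x\<bar>"] by (simp add: mult.assoc)
    moreover have "0 \<le> \<bar>f x\<bar> * \<bar>g x\<bar>" by simp
    ultimately show ?thesis unfolding abs_mult by linarith
  qed
  then show "AE x in lborel. x \<in> A \<longrightarrow> \<bar>f x * g x\<bar> \<le> (f x)\<^sup>2 + (g x)\<^sup>2" by simp
qed

lemma L2_add_integrable:
  fixes f g :: "'a::euclidean_space \<Rightarrow> real"
  assumes "f \<in> Bor" "g \<in> Bor" "A \<in> sets borel"
    and "L1_on A (\<lambda>x. (f x)\<^sup>2)" "L1_on A (\<lambda>x. (g x)\<^sup>2)"
  shows "L1_on A (\<lambda>x. (k * f x + l * g x)\<^sup>2)"
proof -
  have "L1_on A (\<lambda>x. k\<^sup>2 * (f x)\<^sup>2 + ((2 * k * l) * (f x * g x) + l\<^sup>2 * (g x)\<^sup>2))"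
    by (intro set_integral_add(1) set_integrable_mult_right impI assms L2_mult_integrable)
  then show ?thesis by (simp add: power2_eq_square algebra_simps)
qed

section \<open>Weak derivatives and absolute continuity on lines\<close>

definition c1 :: "(real \<Rightarrow> real) \<Rightarrow> (real \<Rightarrow> real) \<Rightarrow> bool" where
  "c1 f f' \<longleftrightarrow> (\<forall>x. (f has_real_derivative f' x) (at x)) \<and> continuous_on UNIV f'"

lemma c1_continuous: "c1 f f' \<Longrightarrow> continuous_on UNIV f"
  by (auto simp: c1_def intro!: DERIV_continuous_on)

lemma c1D: "c1 f f' \<Longrightarrow> (f has_real_derivative f' x) (at x)"
  by (simp add: c1_def)

lemma c1D': "c1 f f' \<Longrightarrow> continuous_on UNIV f'"
  by (simp add: c1_def)

lemma c1_ac: "c1 f f' \<Longrightarrow> ac a b f f'"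
  by (rule ac_C1) (auto simp: c1_def has_field_derivative_at_within intro: continuous_on_subset)

text \<open>Truncated squares stay C^1 across the junction at 0, which truncated linear functions do
  not; all cut-offs and bumps are built from them.\<close>

lemma c1_pos_part_sq: "c1 (\<lambda>x. (max 0 x)\<^sup>2) (\<lambda>x. 2 * max 0 x)"
  unfolding c1_def
proof (intro conjI allI)
  show "continuous_on UNIV (\<lambda>x::real. 2 * max 0 x)" by (intro continuous_intros)
  fix x :: real
  consider "x < 0" | "x = 0" | "x > 0" by linarith
  then show "((\<lambda>x. (max 0 x)\<^sup>2) has_real_derivative 2 * max 0 x) (at x)"
  proof cases
    case 1
    have "((\<lambda>x. 0) has_real_derivative 0) (at x)" by simp
    then have "((\<lambda>x. (max 0 x)\<^sup>2) has_real_derivative 0) (at x)"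
      by (rule has_field_derivative_transform_within_open[of _ _ _ "{..<0}"]) (use 1 in auto)
    with 1 show ?thesis by simp
  next
    case 3
    have "((\<lambda>x. x\<^sup>2) has_real_derivative 2 * x) (at x)" by (auto intro!: derivative_eq_intros)
    then have "((\<lambda>x. (max 0 x)\<^sup>2) has_real_derivative 2 * x) (at x)"
      by (rule has_field_derivative_transform_within_open[of _ _ _ "{0<..}"]) (use 3 in auto)
    with 3 show ?thesis by simp
  next
    case 2
    have "((\<lambda>h::real. max 0 h) \<longlongrightarrow> max 0 0) (at 0)"
      by (intro tendsto_intros)
    moreover have "eventually (\<lambda>h. max 0 h = ((max 0 (0 + h))\<^sup>2 - (max 0 0)\<^sup>2) / h) (at (0::real))"
      by (auto simp: eventually_at_filter power2_eq_square max_def)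
    ultimately have "((\<lambda>h::real. ((max 0 (0 + h))\<^sup>2 - (max 0 0)\<^sup>2) / h) \<longlongrightarrow> max 0 0) (at 0)"
      by (rule Lim_transform_eventually)
    with 2 show ?thesis by (simp add: DERIV_def)
  qed
qed

lemma c1_compose_affine: "c1 f f' \<Longrightarrow> c1 (\<lambda>x. f (k * x + l)) (\<lambda>x. k * f' (k * x + l))"
  unfolding c1_def
proof (intro conjI allI)
  assume f: "(\<forall>x. (f has_real_derivative f' x) (at x)) \<and> continuous_on UNIV f'"
  fix x
  have "((\<lambda>x. k * x + l) has_real_derivative k) (at x)" by (auto intro!: derivative_eq_intros)
  from DERIV_chain2[OF f[THEN conjunct1, rule_format] this]
  show "((\<lambda>x. f (k * x + l)) has_real_derivative k * f' (k * x + l)) (at x)" by (simp add: mult.commute)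
  show "continuous_on UNIV (\<lambda>x. k * f' (k * x + l))"
    by (intro continuous_intros continuous_on_compose2[OF f[THEN conjunct2]]) auto
qed

lemma c1_mult: "c1 f f' \<Longrightarrow> c1 g g' \<Longrightarrow> c1 (\<lambda>x. f x * g x) (\<lambda>x. f' x * g x + f x * g' x)"
  using c1_continuous[of f f'] c1_continuous[of g g'] unfolding c1_def
  by (auto intro!: derivative_eq_intros continuous_intros)

lemma c1_lin: "c1 f f' \<Longrightarrow> c1 g g' \<Longrightarrow> c1 (\<lambda>x. k * f x + l * g x) (\<lambda>x. k * f' x + l * g' x)"
  unfolding c1_def by (auto intro!: derivative_eq_intros continuous_intros)

section \<open>Spline bumps and functions orthogonal to all of them\<close>

text \<open>A quadratic spline that increases from \<open>0\<close> on \<open>{..0}\<close> to \<open>1\<close> on \<open>{1..}\<close>.\<close>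

definition smoothstep :: "real \<Rightarrow> real" where
  "smoothstep x = 2 * (max 0 x)\<^sup>2 - 4 * (max 0 (x - 1/2))\<^sup>2 + 2 * (max 0 (x - 1))\<^sup>2"

definition smoothstep' :: "real \<Rightarrow> real" where
  "smoothstep' x = 4 * max 0 x - 8 * max 0 (x - 1/2) + 4 * max 0 (x - 1)"

lemma c1_smoothstep: "c1 smoothstep smoothstep'"
proof -
  note P = c1_compose_affine[OF c1_pos_part_sq, of 1]
  have "c1 (\<lambda>x. 1 * (2 * (max 0 (1*x+0))\<^sup>2 + (-4) * (max 0 (1*x+(-1/2)))\<^sup>2) + 2 * (max 0 (1*x+(-1)))\<^sup>2)
     (\<lambda>x. 1 * (2 * (1 * (2 * max 0 (1*x+0))) + (-4) * (1 * (2 * max 0 (1*x+(-1/2))))) + 2 * (1 * (2 * max 0 (1*x+(-1)))))"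
    by (intro c1_lin P)
  then show ?thesis by (simp add: smoothstep_def[abs_def] smoothstep'_def[abs_def] algebra_simps)
qed

lemma smoothstep_eq_0 [simp]: "x \<le> 0 \<Longrightarrow> smoothstep x = 0"
  by (simp add: smoothstep_def)

lemma smoothstep_eq_1 [simp]: "1 \<le> x \<Longrightarrow> smoothstep x = 1"
  by (simp add: smoothstep_def power2_eq_square algebra_simps)

lemma smoothstep_bounds: "0 \<le> smoothstep x" "smoothstep x \<le> 1"
proof -
  consider "x \<le> 0" | "0 \<le> x" "x \<le> 1/2" | "1/2 \<le> x" "x \<le> 1" | "1 \<le> x" by linarith
  then have "0 \<le> smoothstep x \<and> smoothstep x \<le> 1"
  proof cases
    case 2
    then have "smoothstep x = 2 * x\<^sup>2" "x\<^sup>2 \<le> (1/2)\<^sup>2" by (auto simp: smoothstep_def intro: power_mono)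
    then show ?thesis by (auto simp: power2_eq_square)
  next
    case 3
    then have "smoothstep x = 1 - 2 * (1 - x)\<^sup>2" by (simp add: smoothstep_def power2_eq_square algebra_simps)
    moreover have "(1 - x)\<^sup>2 \<le> (1/2)\<^sup>2" using 3 by (intro power_mono) auto
    ultimately show ?thesis by (auto simp: power2_eq_square)
  qed auto
  then show "0 \<le> smoothstep x" "smoothstep x \<le> 1" by auto
qed

lemma smoothstep'_bounds: "0 \<le> smoothstep' x" "smoothstep' x \<le> 2"
  by (auto simp: smoothstep'_def max_def)

text \<open>A C^1 approximation from below of the indicator of the open interval, with transition
  zones of width 1/n inside it. For small \<open>n\<close> the two zones may overlap.\<close>

definition bump :: "nat \<Rightarrow> real \<Rightarrow> real \<Rightarrow> real \<Rightarrow> real" where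
  "bump n r s x = smoothstep (real n * (x - r)) * smoothstep (real n * (s - x))"

lemma c1_bump: "\<exists>f'. c1 (bump n r s) f'"
proof -
  have "c1 (\<lambda>x. smoothstep (real n * x + (- real n * r)) * smoothstep ((- real n) * x + real n * s))
    (\<lambda>x. (real n * smoothstep' (real n * x + (- real n * r))) * smoothstep ((- real n) * x + real n * s) +
        smoothstep (real n * x + (- real n * r)) * ((- real n) * smoothstep' ((- real n) * x + real n * s)))"
    by (intro c1_mult c1_compose_affine c1_smoothstep)
  moreover have "bump n r s = (\<lambda>x. smoothstep (real n * x + (- real n * r)) * smoothstep ((- real n) * x + real n * s))"
    by (simp add: bump_def fun_eq_iff algebra_simps)
  ultimately show ?thesis by auto
qed

lemma bump_continuous: "continuous_on UNIV (bump n r s)"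
  using c1_bump c1_continuous by blast

lemma bump_bounds: "0 \<le> bump n r s x" "bump n r s x \<le> 1"
  using smoothstep_bounds by (auto simp: bump_def intro: mult_le_one)

lemma bump_eq_0: "x \<notin> {r<..<s} \<Longrightarrow> bump n r s x = 0"
  by (auto simp: bump_def not_less mult_nonneg_nonpos)

lemma bump_le_indicator: "bump n r s x \<le> indicator {r..s} x"
  using bump_bounds[of n r s x] bump_eq_0[of x r s n] by (auto simp: indicator_def)

lemma bump_tendsto: "(\<lambda>n. bump n r s x) \<longlonglongrightarrow> indicator {r<..<s} x"
proof (cases "x \<in> {r<..<s}")
  case True
  define m where "m = min (x - r) (s - x)"
  have m: "m > 0" using True by (simp add: m_def)
  obtain N :: nat where N: "1 / m < real N" using reals_Archimedean2 by blast
  have "bump n r s x = 1" if "n \<ge> N" for n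
  proof -
    have "1 \<le> real N * m" using N m by (simp add: field_simps)
    also have "\<dots> \<le> real n * m" using that m by (intro mult_right_mono) auto
    finally have "1 \<le> real n * m" .
    moreover have "real n * m \<le> real n * (x - r)" "real n * m \<le> real n * (s - x)"
      by (intro mult_left_mono; simp add: m_def)+
    ultimately show ?thesis by (simp add: bump_def)
  qed
  then have "eventually (\<lambda>n. bump n r s x = indicator {r<..<s} x) sequentially"
    using True by (auto simp: eventually_sequentially)
  then show ?thesis by (rule tendsto_eventually)
qed (simp add: bump_eq_0)

text \<open>Open boxes form an intersection-stable generator of the Borel sets, and the sets over
  which \<open>g\<close> integrates to zero form a Dynkin system; the hypothesis \<open>all\<close>
  handles complements. Integrating over the sets where \<open>g\<close> has a fixed sign then gives
  \<open>g = 0\<close>.\<close>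

lemma AE_zero_box_integrals:
  fixes g :: "real \<times> real \<Rightarrow> real"
  assumes g: "integrable lborel g" and all: "(LINT z|lborel. g z) = 0"
    and box: "\<And>a b c d. (LINT z:{a<..<b}\<times>{c<..<d}|lborel. g z) = 0"
  shows "AE z in lborel. g z = 0"
proof -
  let ?G = "range (\<lambda>(a, b). box a b :: (real \<times> real) set)"
  have si: "L1_on A g" if "A \<in> sets borel" for A
    using integrable_mult_indicator[OF _ g, of A] that by (simp add: set_integrable_def)
  have P: "(LBINT z:A. g z) = 0" if A: "A \<in> sets borel" for A
  proof -
    have sig: "A \<in> sigma_sets UNIV ?G" using A unfolding borel_eq_box by (simp add: sets_measure_of)
    have "Int_stable ?G" by (auto simp: Int_stable_def box_Int_box)
    from this subset_UNIV[of ?G, folded Pow_UNIV] sig show ?thesis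
    proof (induction rule: sigma_sets_induct_disjoint)
      case (basic A)
      then obtain p q :: "real \<times> real" where A: "A = box p q" by auto
      have "box p q = {fst p<..<fst q} \<times> {snd p<..<snd q}"
        by (cases p; cases q) (auto simp: mem_box Basis_prod_def)
      with A box show ?case by simp
    next
      case (compl A)
      then have A: "A \<in> sets borel" unfolding borel_eq_box by (simp add: sets_measure_of)
      have "(LINT z:A \<union> (UNIV - A)|lborel. g z) = (LBINT z:A. g z) + (LBINT z:UNIV - A. g z)"
        by (rule set_integral_Un) (use A si in auto)
      then show ?case using compl all by (simp add: set_lebesgue_integral_def)
    next
      case (union A)
      then have A: "A i \<in> sets lborel" for i unfolding sets_lborel borel_eq_box by (auto simp: sets_measure_of)
      have "(LINT z:(\<Union>i. A i)|lborel. g z) = (\<Sum>i. LBINT z:A i. g z)"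
        by (rule lebesgue_integral_countable_add)
           (use A union(1) si in \<open>auto simp: disjoint_family_on_def\<close>)
      with union show ?case by simp
    qed (auto simp: set_lebesgue_integral_def)
  qed
  have m: "{z. 0 \<le> g z} \<in> sets borel" "{z. g z \<le> 0} \<in> sets borel"
    using borel_measurable_integrable[OF g] by auto
  have "AE z in lborel. indicator {z. 0 \<le> g z} z *\<^sub>R g z = 0"
    using P[OF m(1)] si[OF m(1)] unfolding set_lebesgue_integral_def set_integrable_def
    by (subst (asm) integral_nonneg_eq_0_iff_AE) (auto simp: indicator_def)
  moreover have "AE z in lborel. - (indicator {z. g z \<le> 0} z *\<^sub>R g z) = 0"
    using P[OF m(2)] si[OF m(2)] unfolding set_lebesgue_integral_def set_integrable_def
    by (subst integral_nonneg_eq_0_iff_AE[symmetric]) (auto simp: indicator_def simp del: neg_equal_0_iff_equal)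
  ultimately show ?thesis by eventually_elim (auto simp: indicator_def split: if_splits)
qed

lemma borel_Times:
  fixes A B :: "real set"
  assumes "A \<in> sets borel" "B \<in> sets borel"
  shows "A \<times> B \<in> sets borel"
  using pair_measureI[OF assms] unfolding borel_prod .

lemma borel_fst_snd:
  fixes h :: "real \<Rightarrow> real"
  assumes "h \<in> Bor"
  shows "(\<lambda>z::real\<times>real. h (fst z)) \<in> Bor"
    and "(\<lambda>z::real\<times>real. h (snd z)) \<in> Bor"
  by (rule measurable_compose[OF _ assms], intro borel_measurable_continuous_onI continuous_intros)+

text \<open>Integrability is asked only on compact boxes inside \<open>I \<times> J\<close>, so
  nothing is claimed up to the boundary of the half plane.\<close>

definition locint :: "real set \<Rightarrow> real set \<Rightarrow> (real \<times> real \<Rightarrow> real) \<Rightarrow> bool" where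
  "locint I J F \<longleftrightarrow> F \<in> Bor \<and>
     (\<forall>a b c d. {a..b} \<subseteq> I \<longrightarrow> {c..d} \<subseteq> J \<longrightarrow> L1_on ({a..b}\<times>{c..d}) F)"

lemma locint_integrable_mult:
  assumes F: "locint I J F" and ab: "{a..b} \<subseteq> I" "{c..d} \<subseteq> J"
    and h: "continuous_on UNIV h" "\<And>x. x \<notin> {a..b} \<Longrightarrow> h x = 0"
    and k: "continuous_on UNIV k" "\<And>y. y \<notin> {c..d} \<Longrightarrow> k y = 0"
  shows "integrable lborel (\<lambda>z. F z * (h (fst z) * k (snd z)))"
    and "(LINT z|lborel. F z * (h (fst z) * k (snd z))) = (LINT z:{a..b}\<times>{c..d}|lborel. F z * (h (fst z) * k (snd z)))"
proof -
  have eq: "(\<lambda>z. indicator ({a..b}\<times>{c..d}) z *\<^sub>R (F z * (h (fst z) * k (snd z)))) = (\<lambda>z. F z * (h (fst z) * k (snd z)))"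
    using h(2) k(2) by (auto simp: indicator_def fun_eq_iff)
  have c: "continuous_on UNIV (\<lambda>z::real\<times>real. h (fst z) * k (snd z))"
    by (intro continuous_intros continuous_on_compose2[OF h(1)] continuous_on_compose2[OF k(1)]) auto
  then have "compact ((\<lambda>z::real\<times>real. h (fst z) * k (snd z)) ` ({a..b}\<times>{c..d}))"
    by (intro compact_continuous_image compact_Times) (auto intro: continuous_on_subset)
  then obtain B where B: "\<forall>v\<in>(\<lambda>z::real\<times>real. h (fst z) * k (snd z)) ` ({a..b}\<times>{c..d}). norm v \<le> B"
    using compact_imp_bounded bounded_iff by metis
  have "L1_on ({a..b}\<times>{c..d}) (\<lambda>z. F z * (h (fst z) * k (snd z)))"
  proof (rule L1_mult_bounded(1))
    show "L1_on ({a..b}\<times>{c..d}) F" using F ab by (auto simp: locint_def)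
    show "set_borel_measurable lborel ({a..b} \<times> {c..d}) (\<lambda>z. h (fst z) * k (snd z))"
      by (intro Bor_set borel_measurable_continuous_onI c borel_Times) auto
    show "\<bar>h (fst x) * k (snd x)\<bar> \<le> B" if "x \<in> {a..b} \<times> {c..d}" for x
      using bspec[OF B imageI[OF that]] by simp
  qed
  then show "integrable lborel (\<lambda>z. F z * (h (fst z) * k (snd z)))"
    unfolding set_integrable_def eq .
  show "(LINT z|lborel. F z * (h (fst z) * k (snd z))) = (LINT z:{a..b}\<times>{c..d}|lborel. F z * (h (fst z) * k (snd z)))"
    unfolding set_lebesgue_integral_def eq ..
qed

lemma rational_enlarge:
  fixes I :: "real set"
  assumes "open I" "{a..b} \<subseteq> I" "a \<le> b"
  obtains p q where "p \<in> \<rat>" "q \<in> \<rat>" "p < a" "b < q" "{p..q} \<subseteq> I"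
proof -
  have "a \<in> I" "b \<in> I" using assms by auto
  then obtain e1 e2 where e12: "e1 > 0" "ball a e1 \<subseteq> I" "e2 > 0" "ball b e2 \<subseteq> I"
    using assms(1) unfolding open_contains_ball by blast
  define e where "e = min e1 e2"
  have e: "e > 0" "ball a e \<subseteq> I" "ball b e \<subseteq> I" using e12 by (auto simp: e_def)
  obtain p where p: "p \<in> \<rat>" "a - e < p" "p < a" using Rats_dense_in_real[of "a - e" a] e by auto
  obtain q where q: "q \<in> \<rat>" "b < q" "q < b + e" using Rats_dense_in_real[of b "b + e"] e by auto
  have "{p..q} \<subseteq> I"
  proof
    fix x assume x: "x \<in> {p..q}"
    then have "x \<in> ball a e \<or> x \<in> ball b e \<or> x \<in> {a..b}" using p q by (auto simp: dist_real_def)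
    then show "x \<in> I" using e assms by auto
  qed
  with p q that show ?thesis by blast
qed

text \<open>Dominated convergence replaces the bumps by indicators of boxes compactly contained in
  the domain. On each such box the previous lemma applies to the restricted function.\<close>

lemma AE_zero_bump_integrals:
  assumes "open I" "open J" and F: "locint I J F"
    and z: "\<And>n r s r' s'. {r..s} \<subseteq> I \<Longrightarrow> {r'..s'} \<subseteq> J \<Longrightarrow> r < s \<Longrightarrow> r' < s' \<Longrightarrow>
      (LINT z|lborel. F z * (bump n r s (fst z) * bump n r' s' (snd z))) = 0"
  shows "AE z in lborel. z \<in> I \<times> J \<longrightarrow> F z = 0"
proof -
  have box: "(LINT z:{r<..<s}\<times>{r'<..<s'}|lborel. F z) = 0"
    if sub: "{r..s} \<subseteq> I" "{r'..s'} \<subseteq> J" and "r < s" "r' < s'" for r s r' s'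
  proof -
    let ?w = "\<lambda>z. indicator ({r..s}\<times>{r'..s'}) z *\<^sub>R \<bar>F z\<bar>"
    have FI: "L1_on ({r..s}\<times>{r'..s'}) F" using F sub by (auto simp: locint_def)
    have mF: "F \<in> Bor" using F by (simp add: locint_def)
    have "(\<lambda>n. LINT z|lborel. F z * (bump n r s (fst z) * bump n r' s' (snd z)))
        \<longlonglongrightarrow> (LINT z|lborel. F z * (indicator {r<..<s} (fst z) * indicator {r'<..<s'} (snd z)))"
    proof (rule integral_dominated_convergence[where w="?w"])
      show "(\<lambda>z. F z * (indicator {r<..<s} (fst z) * indicator {r'<..<s'} (snd z))) \<in> borel_measurable lborel"
        using mF by (auto intro!: borel_measurable_times borel_fst_snd)
      show "(\<lambda>z. F z * (bump n r s (fst z) * bump n r' s' (snd z))) \<in> borel_measurable lborel" for n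
        using mF borel_measurable_continuous_onI[OF bump_continuous]
        by (auto intro!: borel_measurable_times borel_fst_snd)
      show "integrable lborel ?w"
        using set_integrable_abs[OF FI] by (simp add: set_integrable_def)
      show "AE z in lborel. (\<lambda>n. F z * (bump n r s (fst z) * bump n r' s' (snd z)))
         \<longlonglongrightarrow> F z * (indicator {r<..<s} (fst z) * indicator {r'<..<s'} (snd z))"
        by (intro AE_I2 tendsto_intros bump_tendsto)
      show "AE z in lborel. norm (F z * (bump n r s (fst z) * bump n r' s' (snd z))) \<le> ?w z" for n
      proof (rule AE_I2)
        fix z :: "real \<times> real"
        have "bump n r s (fst z) * bump n r' s' (snd z) \<le> indicator {r..s} (fst z) * indicator {r'..s'} (snd z)"
          by (intro mult_mono bump_le_indicator bump_bounds) auto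
        also have "\<dots> = indicator ({r..s}\<times>{r'..s'}) z" by (cases z) (auto simp: indicator_def)
        finally have "\<bar>F z\<bar> * (bump n r s (fst z) * bump n r' s' (snd z)) \<le> \<bar>F z\<bar> * indicator ({r..s}\<times>{r'..s'}) z"
          by (rule mult_left_mono) auto
        then show "norm (F z * (bump n r s (fst z) * bump n r' s' (snd z))) \<le> ?w z"
          by (simp add: abs_mult bump_bounds mult.commute)
      qed
    qed
    with z[OF that] have "(LINT z|lborel. F z * (indicator {r<..<s} (fst z) * indicator {r'<..<s'} (snd z))) = 0"
      by (simp add: LIMSEQ_const_iff)
    moreover have "F z * (indicator {r<..<s} (fst z) * indicator {r'<..<s'} (snd z)) =
       indicator ({r<..<s}\<times>{r'<..<s'}) z *\<^sub>R F z" for z by (cases z) (auto simp: indicator_def)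
    ultimately show ?thesis by (simp add: set_lebesgue_integral_def)
  qed
  have loc: "AE z in lborel. z \<in> {r<..<s}\<times>{r'<..<s'} \<longrightarrow> F z = 0"
    if sub: "{r..s} \<subseteq> I" "{r'..s'} \<subseteq> J" for r s r' s'
  proof (cases "r < s \<and> r' < s'")
    case True
    let ?K = "{r<..<s}\<times>{r'<..<s'}"
    have "L1_on ({r..s}\<times>{r'..s'}) F" using F sub by (auto simp: locint_def)
    then have "L1_on ?K F" by (rule set_integrable_subset) (auto intro!: borel_Times)
    then have "integrable lborel (\<lambda>z. indicator ?K z *\<^sub>R F z)" by (simp add: set_integrable_def)
    moreover have "(LINT z|lborel. indicator ?K z *\<^sub>R F z) = 0"
      using box[OF sub] True by (simp add: set_lebesgue_integral_def)
    moreover have "(LINT z:{a<..<b}\<times>{c<..<d}|lborel. indicator ?K z *\<^sub>R F z) = 0" for a b c d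
    proof -
      let ?a = "max a r" and ?b = "min b s" and ?c = "max c r'" and ?d = "min d s'"
      have "(LINT z:{a<..<b}\<times>{c<..<d}|lborel. indicator ?K z *\<^sub>R F z) = (LINT z:{?a<..<?b}\<times>{?c<..<?d}|lborel. F z)"
        unfolding set_lebesgue_integral_def
        by (intro Bochner_Integration.integral_cong) (auto simp: indicator_def)
      also have "\<dots> = 0"
      proof (cases "?a < ?b \<and> ?c < ?d")
        case True
        have "{?a..?b} \<subseteq> {r..s}" "{?c..?d} \<subseteq> {r'..s'}" by auto
        with sub True show ?thesis by (intro box) auto
      next
        case False
        then have "{?a<..<?b}\<times>{?c<..<?d} = {}" by auto
        then show ?thesis by (simp only: set_lebesgue_integral_def) simp
      qed
      finally show ?thesis .
    qed
    ultimately have "AE z in lborel. indicator ?K z *\<^sub>R F z = 0"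
      by (rule AE_zero_box_integrals)
    then show ?thesis by eventually_elim (auto simp: indicator_def split: if_splits)
  qed auto
  \<comment> \<open>Countably many rational boxes cover the open set, so the exceptional sets unite
    to a null set.\<close>
  let ?R = "{(p, q, p', q'). p \<in> \<rat> \<and> q \<in> \<rat> \<and> p' \<in> \<rat> \<and> q' \<in> \<rat> \<and> {p..q} \<subseteq> I \<and> {p'..q'} \<subseteq> J}"
  have "countable (\<rat> \<times> \<rat> \<times> \<rat> \<times> (\<rat>::real set))" by (intro countable_SIGMA countable_rat)
  then have "countable ?R" by (rule countable_subset[rotated]) auto
  then have "AE z in lborel. \<forall>(p, q, p', q')\<in>?R. z \<in> {p<..<q}\<times>{p'<..<q'} \<longrightarrow> F z = 0"
    by (subst AE_ball_countable) (auto intro: loc)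
  then show ?thesis
  proof eventually_elim
    case (elim z)
    show ?case
    proof
      assume zIJ: "z \<in> I \<times> J"
      then obtain x y where z: "z = (x, y)" "x \<in> I" "y \<in> J" by auto
      obtain p q where "p \<in> \<rat>" "q \<in> \<rat>" "p < x" "x < q" "{p..q} \<subseteq> I"
        using rational_enlarge[OF \<open>open I\<close>, of x x] z by auto
      moreover obtain p' q' where "p' \<in> \<rat>" "q' \<in> \<rat>" "p' < y" "y < q'" "{p'..q'} \<subseteq> J"
        using rational_enlarge[OF \<open>open J\<close>, of y y] z by auto
      ultimately show "F z = 0" using bspec[OF elim, of "(p, q, p', q')"] z(1) by simp
    qed
  qed
qed

lemma c1_zero_outside:
  assumes "c1 a a'" "\<And>x. x \<notin> {r..s} \<Longrightarrow> a x = 0" "x \<notin> {r..s}"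
  shows "a' x = 0"
proof -
  have "((\<lambda>_. 0) has_real_derivative 0) (at x)" by simp
  then have "(a has_real_derivative 0) (at x)"
    by (rule has_field_derivative_transform_within_open[of _ _ _ "- {r..s}"]) (use assms in auto)
  then show ?thesis using c1D[OF assms(1)] DERIV_unique by blast
qed

text \<open>The vanishing integral is what brings the antiderivative back to zero on the right, so
  that \<open>h\<close> becomes the derivative of a test function.\<close>

lemma antiderivative_compact_support:
  assumes h: "continuous_on UNIV h" and z: "\<And>x. x \<notin> {m<..<M} \<Longrightarrow> h x = 0" and "m \<le> M"
    and int: "(LBINT x. h x) = (0::real)"
  obtains a where "c1 a h" "\<And>x. x \<notin> {m<..<M} \<Longrightarrow> a x = 0"
proof -
  define a where "a x = integral {m - 1..x} h" for x
  have low: "a x = 0" if "x \<le> m" for x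
  proof -
    have "integral {m - 1..x} h = integral {m - 1..x} (\<lambda>_. 0)"
      by (rule Henstock_Kurzweil_Integration.integral_cong) (use that z in auto)
    then show ?thesis by (simp add: a_def)
  qed
  have "(a has_real_derivative h x) (at x)" for x
  proof (cases "x < m")
    case True
    have "((\<lambda>_. 0) has_real_derivative 0) (at x)" by simp
    then have "(a has_real_derivative 0) (at x)"
      by (rule has_field_derivative_transform_within_open[of _ _ _ "{..<m}"]) (use True low in auto)
    with True z[of x] show ?thesis by simp
  next
    case False
    have "(a has_real_derivative h x) (at x within {m - 1..x + 1})"
      unfolding a_def[abs_def]
      by (rule integral_has_real_derivative) (use False h in \<open>auto intro: continuous_on_subset\<close>)
    then show ?thesis using False by (subst (asm) at_within_interior) auto
  qed
  then have c: "c1 a h" using h by (simp add: c1_def)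
  have "a x = 0" if "M \<le> x" for x
  proof -
    have eq: "(\<lambda>t. indicator {m - 1..x} t *\<^sub>R h t) = h"
    proof
      fix t show "indicator {m - 1..x} t *\<^sub>R h t = h t"
        using z[of t] that \<open>m \<le> M\<close> by (cases "t \<in> {m<..<M}") auto
    qed
    have "L1_on {m-1..x} h"
      by (rule borel_integrable_atLeastAtMost') (use h in \<open>auto intro: continuous_on_subset\<close>)
    then have "a x = (LBINT t:{m-1..x}. h t)" by (simp add: a_def set_borel_integral_eq_integral(2))
    also have "\<dots> = 0" using int by (simp only: set_lebesgue_integral_def eq)
    finally show ?thesis .
  qed
  with low c that show ?thesis by (metis greaterThanLessThan_iff not_le)
qed

section \<open>Integration along lines and the representation of weakly differentiable
  functions\<close>

lemma AE_lborel_snd: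
  assumes "AE y in lborel. Q (y::real)"
  shows "AE z in lborel. Q (snd (z::real\<times>real))"
proof -
  obtain N where N: "N \<in> null_sets lborel" "{y. \<not> Q y} \<subseteq> N"
    using assms unfolding eventually_ae_filter by auto
  have "{z::real\<times>real. snd z \<notin> N} = UNIV \<times> (- N)" by auto
  then have m: "{z::real\<times>real. snd z \<notin> N} \<in> sets borel"
    using N borel_Times[of UNIV "- N"] by auto
  have "AE y in lborel. y \<notin> N" by (rule AE_not_in[OF N(1)])
  then have "AE z in lborel. snd (z::real\<times>real) \<notin> N"
    by (intro AE_productI m) auto
  then show ?thesis by eventually_elim (use N in auto)
qed

text \<open>The oriented integral of \<open>D\<close> along the first coordinate from
  \<open>x0\<close> to \<open>fst z\<close>. The difference of indicators encodes the sign and keeps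
  the domain of integration fixed, so that measurability in \<open>z\<close> is that of a parameter
  integral.\<close>

definition lint :: "(real \<times> real \<Rightarrow> real) \<Rightarrow> real \<Rightarrow> real \<times> real \<Rightarrow> real" where
  "lint D x0 z = (LINT s|lborel. (indicator {x0..fst z} s - indicator {fst z..x0} s) * D (s, snd z))"

lemma lint_measurable:
  assumes "D \<in> Bor"
  shows "lint D x0 \<in> Bor"
proof -
  have f: "(\<lambda>w. fst (fst w)) \<in> borel_measurable ((borel :: (real\<times>real) measure) \<Otimes>\<^sub>M (lborel :: real measure))"
    "(\<lambda>w. snd (fst w)) \<in> borel_measurable ((borel :: (real\<times>real) measure) \<Otimes>\<^sub>M (lborel :: real measure))"
    by (rule measurable_compose[OF measurable_fst], intro borel_measurable_continuous_onI continuous_intros)+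
  have [measurable]: "(\<lambda>w. D (snd w, snd (fst w))) \<in> borel_measurable ((borel :: (real\<times>real) measure) \<Otimes>\<^sub>M (lborel :: real measure))"
    by (rule measurable_compose[OF _ assms], intro borel_measurable_Pair f) simp
  have [measurable]: "{w. x0 \<le> snd w \<and> snd w \<le> fst (fst w)} \<in> sets ((borel :: (real\<times>real) measure) \<Otimes>\<^sub>M (lborel :: real measure))"
    "{w. fst (fst w) \<le> snd w \<and> snd w \<le> x0} \<in> sets ((borel :: (real\<times>real) measure) \<Otimes>\<^sub>M (lborel :: real measure))"
  proof -
    have s: "(\<lambda>w. snd w) \<in> borel_measurable ((borel :: (real\<times>real) measure) \<Otimes>\<^sub>M (lborel :: real measure))" by simp
    have sp: "space ((borel :: (real\<times>real) measure) \<Otimes>\<^sub>M (lborel :: real measure)) = UNIV"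
      by (auto simp: space_pair_measure)
    note le = borel_measurable_le[OF s f(1)] borel_measurable_le[OF f(1) s]
      borel_measurable_le[OF borel_measurable_const s] borel_measurable_le[OF s borel_measurable_const]
    show "{w. x0 \<le> snd w \<and> snd w \<le> fst (fst w)} \<in> sets ((borel :: (real\<times>real) measure) \<Otimes>\<^sub>M (lborel :: real measure))"
      using sets.Int[OF le(3)[of x0] le(1)] unfolding sp by (simp add: Collect_conj_eq)
    show "{w. fst (fst w) \<le> snd w \<and> snd w \<le> x0} \<in> sets ((borel :: (real\<times>real) measure) \<Otimes>\<^sub>M (lborel :: real measure))"
      using sets.Int[OF le(2) le(4)[of x0]] unfolding sp by (simp add: Collect_conj_eq)
  qed
  have "(\<lambda>z. LINT s|lborel. (indicator {w. x0 \<le> snd w \<and> snd w \<le> fst (fst w)} (z, s)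
      - indicator {w. fst (fst w) \<le> snd w \<and> snd w \<le> x0} (z, s)) * D (s, snd z)) \<in> Bor"
    by (rule sigma_finite_measure.borel_measurable_lebesgue_integral[OF sigma_finite_lborel])
       (simp add: case_prod_beta', measurable)
  moreover have "(\<lambda>z. LINT s|lborel. (indicator {w. x0 \<le> snd w \<and> snd w \<le> fst (fst w)} (z, s)
      - indicator {w. fst (fst w) \<le> snd w \<and> snd w \<le> x0} (z, s)) * D (s, snd z)) = lint D x0"
    unfolding lint_def by (intro ext Bochner_Integration.integral_cong) (auto simp: indicator_def)
  ultimately show ?thesis by simp
qed

lemma lint_ac:
  assumes i: "L1_on {a..b} (\<lambda>s. D (s, y))" and x0: "x0 \<in> {a..b}"
  shows "ac a b (\<lambda>x. lint D x0 (x, y)) (\<lambda>x. D (x, y))"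
proof -
  define H where "H x = (LBINT s:{a..x}. D (s, y))" for x
  have sub: "L1_on {p..q} (\<lambda>s. D (s, y))" if "a \<le> p" "q \<le> b" for p q
    by (rule set_integrable_subset[OF i]) (use that in auto)
  have eq: "lint D x0 (x, y) = H x - H x0" if x: "x \<in> {a..b}" for x
  proof -
    consider "x = x0" | "x0 < x" | "x < x0" by linarith
    then show ?thesis
    proof cases
      case 2
      then have "lint D x0 (x, y) = (LBINT s:{x0..x}. D (s, y))"
        by (simp add: lint_def set_lebesgue_integral_def)
      with LBINT_split[OF sub[of a x], of x0] x x0 2 show ?thesis by (auto simp: H_def)
    next
      case 3
      then have "lint D x0 (x, y) = - (LBINT s:{x..x0}. D (s, y))"
        by (simp add: lint_def set_lebesgue_integral_def)
      with LBINT_split[OF sub[of a x0], of x] x x0 3 show ?thesis by (auto simp: H_def)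
    qed (simp add: lint_def)
  qed
  have "AE s in lborel. s \<noteq> a" by (simp add: AE_lborel_singleton)
  then have "AE s in lborel. indicator {a..a} s *\<^sub>R D (s, y) = 0" by eventually_elim (auto simp: indicator_def)
  then have "H a = 0" unfolding H_def set_lebesgue_integral_def by (rule integral_eq_zero_AE)
  then show ?thesis
    by (intro acI i) (use eq x0 in \<open>auto simp: H_def\<close>)
qed

text \<open>\<open>I\<close> is the open interval along the lines, with base point
  \<open>x0\<close>, and \<open>J\<close> parametrizes the lines. Both directions of the half plane
  are instances: \<open>I = UNIV\<close> for circles and \<open>I = {0<..}\<close> for rays.\<close>

locale line_domain =
  fixes I J :: "real set" and x0 :: real
  assumes openI: "open I" and openJ: "open J" and x0: "x0 \<in> I"
    and conv: "\<And>a b. a \<in> I \<Longrightarrow> b \<in> I \<Longrightarrow> {a..b} \<subseteq> I"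
begin

text \<open>The exceptional set of \<open>y\<close> must not depend on the interval. Fubini is
  therefore applied on countably many rational boxes, and a general interval is enlarged to a
  rational one.\<close>

lemma locint_slices:
  assumes D: "locint I J D"
  shows "AE y in lborel. y \<in> J \<longrightarrow> (\<forall>a b. {a..b} \<subseteq> I \<longrightarrow> L1_on {a..b} (\<lambda>x. D (x, y)))"
proof -
  let ?R = "{(p, q, p', q'). p \<in> \<rat> \<and> q \<in> \<rat> \<and> p' \<in> \<rat> \<and> q' \<in> \<rat> \<and> {p..q} \<subseteq> I \<and> {p'..q'} \<subseteq> J}"
  have "countable (\<rat> \<times> \<rat> \<times> \<rat> \<times> (\<rat>::real set))" by (intro countable_SIGMA countable_rat)
  then have "countable ?R" by (rule countable_subset[rotated]) auto
  then have "AE y in lborel. \<forall>(p, q, p', q')\<in>?R. y \<in> {p'..q'} \<longrightarrow> L1_on {p..q} (\<lambda>x. D (x, y))"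
  proof (subst AE_ball_countable, safe)
    fix p q p' q' assume "{p..q} \<subseteq> I" "{p'..q'} \<subseteq> J"
    then have "L1_on ({p..q}\<times>{p'..q'}) D" using D by (auto simp: locint_def)
    from set_Fubini(2)[OF this]
    show "AE y in lborel. y \<in> {p'..q'} \<longrightarrow> L1_on {p..q} (\<lambda>x. D (x, y))" .
  qed
  then show ?thesis
  proof eventually_elim
    case (elim y)
    show ?case
    proof (intro impI allI)
      fix a b assume y: "y \<in> J" and ab: "{a..b} \<subseteq> I"
      obtain p' q' where pq': "p' \<in> \<rat>" "q' \<in> \<rat>" "p' < y" "y < q'" "{p'..q'} \<subseteq> J"
        using rational_enlarge[OF openJ, of y y] y by auto
      show "L1_on {a..b} (\<lambda>x. D (x, y))"
      proof (cases "a \<le> b")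
        case True
        obtain p q where pq: "p \<in> \<rat>" "q \<in> \<rat>" "p < a" "b < q" "{p..q} \<subseteq> I"
          using rational_enlarge[OF openI ab True] by auto
        have "L1_on {p..q} (\<lambda>x. D (x, y))"
          using bspec[OF elim, of "(p, q, p', q')"] pq pq' by simp
        then show ?thesis by (rule set_integrable_subset) (use pq in auto)
      qed (simp add: set_integrable_def)
    qed
  qed
qed

lemma enlarge_x0:
  assumes "{a..b} \<subseteq> I" "a \<le> b"
  shows "{min a x0..max b x0} \<subseteq> I"
proof -
  have "a \<in> I" "b \<in> I" using assms by auto
  then have "min a x0 \<in> I" "max b x0 \<in> I" using x0 by (auto simp: min_def max_def)
  then show ?thesis by (rule conv)
qed

lemma lint_ac_slices:
  assumes D: "locint I J D"
  shows "AE y in lborel. y \<in> J \<longrightarrow> (\<forall>a b. {a..b} \<subseteq> I \<longrightarrow> ac a b (\<lambda>x. lint D x0 (x, y)) (\<lambda>x. D (x, y)))"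
  using locint_slices[OF D]
proof eventually_elim
  case (elim y)
  show ?case
  proof (intro impI allI)
    fix a b assume y: "y \<in> J" and ab: "{a..b} \<subseteq> I"
    show "ac a b (\<lambda>x. lint D x0 (x, y)) (\<lambda>x. D (x, y))"
    proof (cases "a \<le> b")
      case True
      have "L1_on {min a x0..max b x0} (\<lambda>x. D (x, y))"
        using elim y enlarge_x0[OF ab True] by blast
      from lint_ac[OF this, of x0] show ?thesis
        by (rule ac_subinterval[rotated 0]) auto
    qed (auto simp: ac_def set_integrable_def)
  qed
qed

lemma locint_lint:
  assumes D: "locint I J D"
  shows "locint I J (lint D x0)"
  unfolding locint_def
proof (intro conjI allI impI)
  show m: "lint D x0 \<in> Bor" using D by (intro lint_measurable) (simp add: locint_def)
  fix a b c d assume ab: "{a..b} \<subseteq> I" and cd: "{c..d} \<subseteq> J"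
  show "L1_on ({a..b} \<times> {c..d}) (lint D x0)"
  proof (cases "a \<le> b")
    case True
    let ?a = "min a x0" and ?b = "max b x0"
    have "L1_on ({?a..?b}\<times>{c..d}) D" using D enlarge_x0[OF ab True] cd by (auto simp: locint_def)
    then have "L1_on ({?a..?b}\<times>{c..d}) (\<lambda>z. \<bar>D z\<bar>)" by (rule set_integrable_abs)
    from set_Fubini(6)[OF this]
    have "L1_on ({a..b}\<times>{c..d}) (\<lambda>z. 1 * (LBINT s:{?a..?b}. \<bar>D (s, snd z)\<bar>))"
      by (intro L1_tensor[of _ "\<lambda>_. 1"] borel_integrable_atLeastAtMost'[of a b "\<lambda>_. 1"]) auto
    then have i: "L1_on ({a..b}\<times>{c..d}) (\<lambda>z. LBINT s:{?a..?b}. \<bar>D (s, snd z)\<bar>)" by simp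
    show ?thesis
    proof (rule L1_bound[OF i])
      show "set_borel_measurable lborel ({a..b} \<times> {c..d}) (lint D x0)"
        by (intro Bor_set m borel_Times) auto
      show "AE z in lborel. z \<in> {a..b} \<times> {c..d} \<longrightarrow> \<bar>lint D x0 z\<bar> \<le> (LBINT s:{?a..?b}. \<bar>D (s, snd z)\<bar>)"
        using AE_lborel_snd[OF locint_slices[OF D]]
      proof eventually_elim
        case (elim z)
        show ?case
        proof
          assume z: "z \<in> {a..b} \<times> {c..d}"
          then have "snd z \<in> J" using cd by auto
          then have "L1_on {?a..?b} (\<lambda>x. D (x, snd z))"
            using elim enlarge_x0[OF ab True] by auto
          then have ia: "L1_on {?a..?b} (\<lambda>x. \<bar>D (x, snd z)\<bar>)" by (rule set_integrable_abs)
          have "\<bar>lint D x0 z\<bar> \<le> (LINT s|lborel. \<bar>(indicator {x0..fst z} s - indicator {fst z..x0} s) * D (s, snd z)\<bar>)"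
            unfolding lint_def by (rule integral_abs_bound)
          also have "\<dots> \<le> (LINT s|lborel. indicator {?a..?b} s *\<^sub>R \<bar>D (s, snd z)\<bar>)"
            using ia unfolding set_integrable_def
            by (rule Bochner_Integration.integral_mono') (use z in \<open>auto simp: indicator_def abs_mult\<close>)
          finally show "\<bar>lint D x0 z\<bar> \<le> (LBINT s:{?a..?b}. \<bar>D (s, snd z)\<bar>)" by (simp add: set_lebesgue_integral_def)
        qed
      qed
    qed
  qed (simp add: set_integrable_def)
qed

text \<open>Integration by parts on almost every line, without boundary terms because
  \<open>a\<close> vanishes at both ends, followed by Fubini.\<close>

lemma lint_weak_derivative:
  assumes D: "locint I J D" and a: "c1 a a'" and b: "continuous_on UNIV b"
    and rs: "{r..s} \<subseteq> I" "{r'..s'} \<subseteq> J" "r \<le> s"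
    and az: "\<And>x. x \<notin> {r<..<s} \<Longrightarrow> a x = 0" and bz: "\<And>y. y \<notin> {r'..s'} \<Longrightarrow> b y = 0"
  shows "(LINT z|lborel. lint D x0 z * (a' (fst z) * b (snd z))) = - (LINT z|lborel. D z * (a (fst z) * b (snd z)))"
proof -
  have Dz: "x \<notin> {r..s} \<Longrightarrow> a x = 0" for x using az[of x] by auto
  have Wz: "x \<notin> {r..s} \<Longrightarrow> a' x = 0" for x by (rule c1_zero_outside[OF a Dz])
  note W = locint_integrable_mult[OF locint_lint[OF D] rs(1,2) c1D'[OF a] Wz b bz]
  note DD = locint_integrable_mult[OF D rs(1,2) c1_continuous[OF a] Dz b bz]
  have Wi: "L1_on ({r..s}\<times>{r'..s'}) (\<lambda>z. lint D x0 z * (a' (fst z) * b (snd z)))"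
    unfolding set_integrable_def by (rule integrable_mult_indicator[OF _ W(1)]) (auto intro: borel_Times)
  have Di: "L1_on ({r..s}\<times>{r'..s'}) (\<lambda>z. D z * (a (fst z) * b (snd z)))"
    unfolding set_integrable_def by (rule integrable_mult_indicator[OF _ DD(1)]) (auto intro: borel_Times)
  have "AE y in lborel. y \<in> {r'..s'} \<longrightarrow>
     (LBINT x:{r..s}. lint D x0 (x, y) * (a' x * b y)) = - (LBINT x:{r..s}. D (x, y) * (a x * b y))"
    using lint_ac_slices[OF D]
  proof eventually_elim
    case (elim y)
    show ?case
    proof
      assume y: "y \<in> {r'..s'}"
      have w: "ac r s (\<lambda>x. lint D x0 (x, y)) (\<lambda>x. D (x, y))" using elim y rs by blast
      note aa = c1_ac[OF a, of r s]
      have "(LBINT x:{r..s}. D (x, y) * a x + lint D x0 (x, y) * a' x) = 0"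
        using acD[OF ac_mult[OF w aa], of r s] az[of r] az[of s] rs by simp
      moreover have "(LBINT x:{r..s}. D (x, y) * a x + lint D x0 (x, y) * a' x) =
          (LBINT x:{r..s}. D (x, y) * a x) + (LBINT x:{r..s}. lint D x0 (x, y) * a' x)"
        by (rule set_integral_add(2)) (use ac_integrable_mult[OF aa ac_integrable[OF w]] ac_integrable_mult[OF w ac_integrable[OF aa]] in auto)
      ultimately have "(LBINT x:{r..s}. lint D x0 (x, y) * a' x) = - (LBINT x:{r..s}. D (x, y) * a x)" by simp
      then show "(LBINT x:{r..s}. lint D x0 (x, y) * (a' x * b y)) = - (LBINT x:{r..s}. D (x, y) * (a x * b y))"
        by (simp add: mult.assoc[symmetric])
    qed
  qed
  then have "AE y in lborel. indicator {r'..s'} y *\<^sub>R (LBINT x:{r..s}. lint D x0 (x, y) * (a' x * b y))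
      = - (indicator {r'..s'} y *\<^sub>R (LBINT x:{r..s}. D (x, y) * (a x * b y)))"
    by eventually_elim (auto simp: indicator_def)
  then have "(LBINT y:{r'..s'}. LBINT x:{r..s}. lint D x0 (x, y) * (a' x * b y))
      = (LINT y|lborel. - (indicator {r'..s'} y *\<^sub>R (LBINT x:{r..s}. D (x, y) * (a x * b y))))"
    unfolding set_lebesgue_integral_def[of _ "{r'..s'}"]
    by (intro integral_cong_AE)
       (use set_Fubini(6)[OF Wi] set_Fubini(6)[OF Di] in \<open>auto simp: set_integrable_def\<close>)
  also have "\<dots> = - (LBINT y:{r'..s'}. LBINT x:{r..s}. D (x, y) * (a x * b y))"
    by (simp add: set_lebesgue_integral_def)
  finally show ?thesis
    using W(2) DD(2) set_Fubini(4)[OF Wi] set_Fubini(4)[OF Di] by simp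
qed

text \<open>\<open>E\<close>, the difference of \<open>F\<close> and the line integral of
  \<open>D\<close>, has weak derivative zero along the lines, so it should depend on
  \<open>y\<close> alone. The candidate \<open>k\<close> is the average of \<open>E\<close> along
  the line against a fixed bump \<beta>; a general bump differs from a multiple of \<beta> by the
  derivative of a test function, which \<open>E\<close> annihilates.\<close>

theorem weak_derivative_imp_ac:
  assumes F: "locint I J F" and D: "locint I J D"
    and weak: "\<And>a a' b b' r s r' s'. c1 a a' \<Longrightarrow> c1 b b' \<Longrightarrow> {r..s} \<subseteq> I \<Longrightarrow> {r'..s'} \<subseteq> J \<Longrightarrow>
      (\<And>x. x \<notin> {r..s} \<Longrightarrow> a x = 0) \<Longrightarrow> (\<And>y. y \<notin> {r'..s'} \<Longrightarrow> b y = 0) \<Longrightarrow>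
      (LINT z|lborel. F z * (a' (fst z) * b (snd z))) = - (LINT z|lborel. D z * (a (fst z) * b (snd z)))"
  obtains G where "G \<in> Bor" "AE z in lborel. z \<in> I \<times> J \<longrightarrow> F z = G z"
    "AE y in lborel. y \<in> J \<longrightarrow> (\<forall>a b. {a..b} \<subseteq> I \<longrightarrow> ac a b (\<lambda>x. G (x, y)) (\<lambda>x. D (x, y)))"
proof -
  let ?W = "lint D x0"
  define E where "E z = F z - ?W z" for z
  have mF: "F \<in> Bor" and mW: "?W \<in> Bor"
    using F locint_lint[OF D] by (auto simp: locint_def)
  have mE: "E \<in> Bor" unfolding E_def[abs_def] using mF mW by simp
  have E: "locint I J E"
    using F locint_lint[OF D] mE unfolding locint_def E_def[abs_def] by (auto intro: set_integral_diff(1))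
  have E0: "(LINT z|lborel. E z * (h (fst z) * b (snd z))) = 0"
    if h: "c1 a h" and b: "c1 b b'" and rs: "{r..s} \<subseteq> I" "{r'..s'} \<subseteq> J" "r \<le> s"
      and az: "\<And>x. x \<notin> {r<..<s} \<Longrightarrow> a x = 0" and bz: "\<And>y. y \<notin> {r'..s'} \<Longrightarrow> b y = 0"
    for a h b b' r s r' s'
  proof -
    have az': "a x = 0" if "x \<notin> {r..s}" for x using az[of x] that by auto
    have hz: "h x = 0" if "x \<notin> {r..s}" for x by (rule c1_zero_outside[OF h az' that])
    note i = locint_integrable_mult(1)[OF F rs(1,2) c1D'[OF h] hz c1_continuous[OF b] bz]
      locint_integrable_mult(1)[OF locint_lint[OF D] rs(1,2) c1D'[OF h] hz c1_continuous[OF b] bz]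
    have "(LINT z|lborel. E z * (h (fst z) * b (snd z))) =
      (LINT z|lborel. F z * (h (fst z) * b (snd z)) - ?W z * (h (fst z) * b (snd z)))"
      by (simp add: E_def left_diff_distrib)
    also have "\<dots> = (LINT z|lborel. F z * (h (fst z) * b (snd z))) - (LINT z|lborel. ?W z * (h (fst z) * b (snd z)))"
      by (rule Bochner_Integration.integral_diff[OF i])
    finally show ?thesis
      using weak[OF h b rs(1,2) az' bz] lint_weak_derivative[OF D h c1_continuous[OF b] rs az bz] by simp
  qed
  obtain r0 s0 where rs0: "r0 < x0" "x0 < s0" "{r0..s0} \<subseteq> I"
    by (rule rational_enlarge[OF openI, of x0 x0]) (use x0 in auto)
  have bint: "integrable lborel (bump n r s)" for n r s
  proof -
    have "L1_on {r..s} (bump n r s)"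
      by (rule borel_integrable_atLeastAtMost') (auto intro: continuous_on_subset[OF bump_continuous])
    moreover have "(\<lambda>x. indicator {r..s} x *\<^sub>R bump n r s x) = bump n r s"
    proof
      fix x show "indicator {r..s} x *\<^sub>R bump n r s x = bump n r s x"
        using bump_eq_0[of x r s n] by (cases "x \<in> {r..s}") auto
    qed
    ultimately show ?thesis by (simp add: set_integrable_def)
  qed
  have "(\<lambda>n. LINT x|lborel. bump n r0 s0 x) \<longlonglongrightarrow> (LINT x|lborel. indicator {r0<..<s0} x)"
  proof (rule integral_dominated_convergence[where w="indicator {r0..s0}"])
    show "AE x in lborel. norm (bump n r0 s0 x) \<le> indicator {r0..s0} x" for n
      by (intro AE_I2) (simp add: bump_bounds bump_le_indicator)
    show "bump n r0 s0 \<in> borel_measurable lborel" for n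
      using borel_measurable_continuous_onI[OF bump_continuous] by simp
    show "integrable lborel (indicator {r0..s0} :: real \<Rightarrow> real)"
      using borel_integrable_atLeastAtMost'[of r0 s0 "\<lambda>_. 1::real"] by (simp add: set_integrable_def)
  qed (auto simp: bump_tendsto)
  moreover have "(LINT x|lborel. indicator {r0<..<s0} x) = s0 - r0" using rs0 by simp
  ultimately have "eventually (\<lambda>n. (LINT x|lborel. bump n r0 s0 x) > 0) sequentially"
    using rs0 by (intro order_tendstoD(1)[where y="s0 - r0"]) auto
  \<comment> \<open>The bumps converge to the indicator of an interval of positive length, so one of
    them has positive mass and can serve as reference weight.\<close>
  then obtain n0 where n0: "(LINT x|lborel. bump n0 r0 s0 x) > 0"
    by (auto simp: eventually_sequentially)
  define \<beta> where "\<beta> = bump n0 r0 s0"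
  define C where "C = (LINT x|lborel. \<beta> x)"
  have C: "C > 0" using n0 by (simp add: C_def \<beta>_def)
  have \<beta>c: "continuous_on UNIV \<beta>" and \<beta>z: "\<And>x. x \<notin> {r0..s0} \<Longrightarrow> \<beta> x = 0" and \<beta>z': "\<And>x. x \<notin> {r0<..<s0} \<Longrightarrow> \<beta> x = 0"
    by (auto simp: \<beta>_def bump_continuous bump_eq_0)
  define k where "k y = (LBINT x. E (x, y) * \<beta> x) / C" for y
  have m\<beta>: "\<beta> \<in> Bor" using borel_measurable_continuous_onI[OF \<beta>c] .
  have E\<beta>: "L1_on ({r0..s0} \<times> {c..d}) (\<lambda>z. E z * \<beta> (fst z))" if "{c..d} \<subseteq> J" for c d
  proof (rule L1_mult_bounded(1)[of _ _ _ _ 1])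
    show "L1_on ({r0..s0} \<times> {c..d}) E" using E rs0 that by (auto simp: locint_def)
    show "set_borel_measurable lborel ({r0..s0} \<times> {c..d}) (\<lambda>z. \<beta> (fst z))"
      by (intro Bor_set borel_fst_snd m\<beta> borel_Times) auto
  qed (simp add: \<beta>_def bump_bounds)
  have k\<beta>: "k y = (LBINT x:{r0..s0}. E (x, y) * \<beta> x) / C" for y
  proof -
    have "(\<lambda>x. indicator {r0..s0} x *\<^sub>R (E (x, y) * \<beta> x)) = (\<lambda>x. E (x, y) * \<beta> x)"
    proof
      fix x show "indicator {r0..s0} x *\<^sub>R (E (x, y) * \<beta> x) = E (x, y) * \<beta> x"
        using \<beta>z[of x] by (cases "x \<in> {r0..s0}") auto
    qed
    then show ?thesis by (simp add: k_def set_lebesgue_integral_def)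
  qed
  have mk: "k \<in> Bor"
  proof -
    have "(\<lambda>w. E (snd w, fst w)) \<in> Bor"
      by (rule measurable_compose[OF _ mE], intro borel_measurable_continuous_onI continuous_intros)
    then have "(\<lambda>w. E (snd w, fst w) * \<beta> (snd w)) \<in> borel_measurable (borel \<Otimes>\<^sub>M borel)"
      unfolding borel_prod by (intro borel_measurable_times borel_fst_snd m\<beta>)
    then have "(\<lambda>y. LINT x|lborel. E (x, y) * \<beta> x) \<in> Bor"
      by (intro sigma_finite_measure.borel_measurable_lebesgue_integral[OF sigma_finite_lborel])
         (simp add: case_prod_beta' cong: measurable_cong_sets)
    then show ?thesis unfolding k_def[abs_def] by simp
  qed
  have ki: "L1_on {c..d} k" if "{c..d} \<subseteq> J" for c d
    using set_Fubini(6)[OF E\<beta>[OF that]] unfolding k\<beta>[abs_def] by simp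
  have K: "locint I J (\<lambda>z. E z - k (snd z))"
    unfolding locint_def
  proof (intro conjI allI impI)
    show "(\<lambda>z. E z - k (snd z)) \<in> Bor"
      by (intro borel_measurable_diff mE borel_fst_snd mk)
    fix a b c d assume "{a..b} \<subseteq> I" "{c..d} \<subseteq> J"
    moreover from this have "L1_on ({a..b}\<times>{c..d}) (\<lambda>z. 1 * k (snd z))"
      by (intro L1_tensor[of _ "\<lambda>_. 1"] borel_integrable_atLeastAtMost'[of a b "\<lambda>_. 1"] ki) auto
    ultimately show "L1_on ({a..b}\<times>{c..d}) (\<lambda>z. E z - k (snd z))"
      using E by (intro set_integral_diff(1)) (auto simp: locint_def)
  qed
  have "AE z in lborel. z \<in> I \<times> J \<longrightarrow> E z - k (snd z) = 0"
  proof (rule AE_zero_bump_integrals[OF openI openJ K])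
    fix n r s r' s' assume rs: "{r..s} \<subseteq> I" "{r'..s'} \<subseteq> J" "r < s" "r' < s'"
    let ?q = "bump n r s" and ?b = "bump n r' s'"
    have qz: "\<And>x. x \<notin> {r..s} \<Longrightarrow> ?q x = 0" and bz: "\<And>x. x \<notin> {r'..s'} \<Longrightarrow> ?b x = 0" by (auto simp: bump_eq_0)
    \<comment> \<open>\<kappa> matches the masses of the two bumps, so that
      \<open>?q - \<kappa> \<beta>\<close> has integral zero and hence a compactly supported
      antiderivative.\<close>
    define \<kappa> where "\<kappa> = (LINT x|lborel. ?q x) / C"
    define m where "m = min r r0" define M where "M = max s s0"
    have "m \<in> I" "M \<in> I" using rs rs0 by (auto simp: m_def M_def min_def max_def)
    then have mM: "{m..M} \<subseteq> I" by (rule conv)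
    have h0: "(LBINT x. ?q x - \<kappa> * \<beta> x) = 0"
      using C bint[of n r s] bint[of n0 r0 s0] by (simp add: \<kappa>_def C_def \<beta>_def)
    obtain a where a: "c1 a (\<lambda>x. ?q x - \<kappa> * \<beta> x)" "\<And>x. x \<notin> {m<..<M} \<Longrightarrow> a x = 0"
    proof (rule antiderivative_compact_support[OF _ _ _ h0])
      show "continuous_on UNIV (\<lambda>x. ?q x - \<kappa> * \<beta> x)" by (intro continuous_intros bump_continuous \<beta>c)
      show "?q x - \<kappa> * \<beta> x = 0" if "x \<notin> {m<..<M}" for x
      proof -
        have "x \<notin> {r<..<s}" "x \<notin> {r0<..<s0}" using that unfolding m_def M_def by auto
        from bump_eq_0[OF this(1), of n] \<beta>z'[OF this(2)] show ?thesis by simp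
      qed
      show "m \<le> M" using rs by (auto simp: m_def M_def)
    qed auto
    obtain b' where b': "c1 ?b b'" using c1_bump by blast
    have mM': "m \<le> M" using rs by (auto simp: m_def M_def)
    note i1 = locint_integrable_mult[OF E rs(1,2) bump_continuous qz bump_continuous bz]
    note i2 = locint_integrable_mult[OF E rs0(3) rs(2) \<beta>c \<beta>z bump_continuous bz]
    have "0 = (LINT z|lborel. E z * ((?q (fst z) - \<kappa> * \<beta> (fst z)) * ?b (snd z)))"
      using E0[OF a(1) b' mM rs(2) mM' a(2) bz] by simp
    also have "\<dots> = (LINT z|lborel. E z * (?q (fst z) * ?b (snd z)) - \<kappa> * (E z * (\<beta> (fst z) * ?b (snd z))))"
      by (simp add: algebra_simps)
    also have "\<dots> = (LINT z|lborel. E z * (?q (fst z) * ?b (snd z))) - \<kappa> * (LINT z|lborel. E z * (\<beta> (fst z) * ?b (snd z)))"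
      using i1(1) i2(1) by (subst Bochner_Integration.integral_diff) auto
    finally have e1: "(LINT z|lborel. E z * (?q (fst z) * ?b (snd z))) = \<kappa> * (LINT z|lborel. E z * (\<beta> (fst z) * ?b (snd z)))"
      by simp
    have si2: "L1_on ({r0..s0} \<times> {r'..s'}) (\<lambda>z. E z * (\<beta> (fst z) * ?b (snd z)))"
      unfolding set_integrable_def by (rule integrable_mult_indicator[OF _ i2(1)]) (auto intro: borel_Times)
    have "(LINT z|lborel. E z * (\<beta> (fst z) * ?b (snd z))) = (LBINT y:{r'..s'}. LBINT x:{r0..s0}. E (x, y) * (\<beta> x * ?b y))"
      using i2(2) set_Fubini(4)[OF si2] by simp
    also have "\<dots> = (LBINT y:{r'..s'}. C * (k y * ?b y))"
      using C by (simp add: k\<beta> mult.assoc[symmetric])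
    finally have e2: "(LINT z|lborel. E z * (\<beta> (fst z) * ?b (snd z))) = C * (LBINT y:{r'..s'}. k y * ?b y)" by simp
    have kb: "L1_on {r'..s'} (\<lambda>y. k y * ?b y)"
      by (rule L1_mult_bounded(1)[of _ _ _ _ 1, OF ki[OF rs(2)]])
         (auto simp: bump_bounds intro!: Bor_set borel_measurable_continuous_onI[OF bump_continuous])
    have qs: "L1_on {r..s} ?q"
      by (rule borel_integrable_atLeastAtMost') (auto intro: continuous_on_subset[OF bump_continuous])
    note t = L1_tensor[OF qs kb]
    have eq: "indicator ({r..s} \<times> {r'..s'}) z *\<^sub>R (?q (fst z) * (k (snd z) * ?b (snd z))) = k (snd z) * (?q (fst z) * ?b (snd z))" for z
      using qz[of "fst z"] bz[of "snd z"] by (cases z) (auto simp: indicator_def)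
    have i3: "integrable lborel (\<lambda>z. k (snd z) * (?q (fst z) * ?b (snd z)))"
      using t unfolding set_integrable_def eq .
    have qe: "(LBINT x:{r..s}. ?q x) = (LINT x|lborel. ?q x)"
      unfolding set_lebesgue_integral_def
      by (intro Bochner_Integration.integral_cong) (use qz in \<open>auto simp: indicator_def\<close>)
    have "(LINT z|lborel. k (snd z) * (?q (fst z) * ?b (snd z))) = (LINT z:{r..s} \<times> {r'..s'}|lborel. ?q (fst z) * (k (snd z) * ?b (snd z)))"
      unfolding set_lebesgue_integral_def eq ..
    also have "\<dots> = (LBINT y:{r'..s'}. LBINT x:{r..s}. ?q x * (k y * ?b y))"
      using set_Fubini(4)[OF t] by simp
    also have "\<dots> = (LINT x|lborel. ?q x) * (LBINT y:{r'..s'}. k y * ?b y)"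
      by (simp add: qe)
    finally have e3: "(LINT z|lborel. k (snd z) * (?q (fst z) * ?b (snd z))) = (LINT x|lborel. ?q x) * (LBINT y:{r'..s'}. k y * ?b y)" .
    have "(LINT z|lborel. (E z - k (snd z)) * (?q (fst z) * ?b (snd z))) =
       (LINT z|lborel. E z * (?q (fst z) * ?b (snd z)) - k (snd z) * (?q (fst z) * ?b (snd z)))"
      by (simp add: left_diff_distrib)
    also have "\<dots> = (LINT z|lborel. E z * (?q (fst z) * ?b (snd z))) - (LINT z|lborel. k (snd z) * (?q (fst z) * ?b (snd z)))"
      by (rule Bochner_Integration.integral_diff[OF i1(1) i3])
    also have "\<dots> = 0" unfolding e1 e2 e3 using C by (simp add: \<kappa>_def)
    finally show "(LINT z|lborel. (E z - k (snd z)) * (?q (fst z) * ?b (snd z))) = 0" .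
  qed
  then have 1: "AE z in lborel. z \<in> I \<times> J \<longrightarrow> F z = k (snd z) + ?W z"
    by eventually_elim (auto simp: E_def)
  have 2: "AE y in lborel. y \<in> J \<longrightarrow> (\<forall>a b. {a..b} \<subseteq> I \<longrightarrow> ac a b (\<lambda>x. k (snd (x, y)) + ?W (x, y)) (\<lambda>x. D (x, y)))"
    using lint_ac_slices[OF D] by eventually_elim (auto simp: ac_def)
  have 3: "(\<lambda>z. k (snd z) + ?W z) \<in> Bor"
    by (intro borel_measurable_add mW borel_fst_snd mk)
  from that[OF 3 1 2] show ?thesis .
qed

end

section \<open>Weak gradients on the half plane\<close>

lemma set_integral_restrict:
  fixes f :: "'a \<Rightarrow> real"
  assumes "\<And>z. z \<notin> A \<Longrightarrow> f z = 0"
  shows "(LINT z:A|M. f z) = (LINT z|M. f z)" and "set_integrable M A f \<longleftrightarrow> integrable M f"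
proof -
  have "(\<lambda>z. indicator A z *\<^sub>R f z) = f"
  proof
    fix z show "indicator A z *\<^sub>R f z = f z" using assms[of z] by (cases "z \<in> A") auto
  qed
  then show "(LINT z:A|M. f z) = (LINT z|M. f z)" "set_integrable M A f \<longleftrightarrow> integrable M f"
    by (simp_all add: set_lebesgue_integral_def set_integrable_def)
qed

lemma pd_eq:
  assumes "(f has_derivative f') (at x)"
  shows "pd j f x = f' (if j = 1 then (1, 0) else (0, 1))"
  using frechet_derivative_at[OF assms] by (simp add: pd_def)

lemma C1_tensor:
  assumes a: "c1 a a'" and b: "c1 b b'"
  shows "C1_function (\<lambda>z. a (fst z) * b (snd z))"
    and "pd 1 (\<lambda>z. a (fst z) * b (snd z)) = (\<lambda>z. a' (fst z) * b (snd z))"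
    and "pd 2 (\<lambda>z. a (fst z) * b (snd z)) = (\<lambda>z. a (fst z) * b' (snd z))"
proof -
  have "(a has_derivative (\<lambda>h. a' (fst z) * h)) (at (fst z))" for z :: "real \<times> real"
    using c1D[OF a, of "fst z"] by (simp add: has_field_derivative_def)
  moreover have "(b has_derivative (\<lambda>h. b' (snd z) * h)) (at (snd z))" for z :: "real \<times> real"
    using c1D[OF b, of "snd z"] by (simp add: has_field_derivative_def)
  ultimately have d: "((\<lambda>z. a (fst z) * b (snd z)) has_derivative
      (\<lambda>h. a (fst z) * (b' (snd z) * snd h) + a' (fst z) * fst h * b (snd z))) (at z)" for z
    by (intro has_derivative_mult has_derivative_compose[of fst fst _ _ a] has_derivative_compose[of snd snd _ _ b]
        derivative_intros) auto
  show 1: "pd 1 (\<lambda>z. a (fst z) * b (snd z)) = (\<lambda>z. a' (fst z) * b (snd z))"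
    and 2: "pd 2 (\<lambda>z. a (fst z) * b (snd z)) = (\<lambda>z. a (fst z) * b' (snd z))"
    using pd_eq[OF d] by (auto simp: fun_eq_iff)
  have c: "continuous_on UNIV (\<lambda>z::real\<times>real. h (fst z))" "continuous_on UNIV (\<lambda>z::real\<times>real. h (snd z))"
    if "continuous_on UNIV h" for h :: "real \<Rightarrow> real"
    by (rule continuous_on_compose2[OF that]; auto intro: continuous_intros)+
  have "continuous_on UNIV (pd j (\<lambda>z. a (fst z) * b (snd z)))" for j
  proof (cases "j = 1")
    case True
    then show ?thesis using 1 by (auto intro!: continuous_intros c c1D'[OF a] c1_continuous[OF b])
  next
    case False
    then have "j = 2" using exhaust_2 by blast
    then show ?thesis using 2 by (auto intro!: continuous_intros c c1D'[OF b] c1_continuous[OF a])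
  qed
  then show "C1_function (\<lambda>z. a (fst z) * b (snd z))"
    using d by (auto simp: C1_function_def differentiable_def)
qed

lemma C1_function_has_derivative:
  assumes "C1_function f"
  shows "(f has_derivative (\<lambda>h. fst h * pd 1 f z + snd h * pd 2 f z)) (at z)"
proof -
  have d: "(f has_derivative frechet_derivative f (at z)) (at z)"
    using assms frechet_derivative_works unfolding C1_function_def by blast
  have "frechet_derivative f (at z) h = fst h * pd 1 f z + snd h * pd 2 f z" for h
  proof -
    have l: "linear (frechet_derivative f (at z))" by (rule has_derivative_linear[OF d])
    have "h = fst h *\<^sub>R (1, 0) + snd h *\<^sub>R (0, 1)" by (cases h) auto
    then have "frechet_derivative f (at z) h = frechet_derivative f (at z) (fst h *\<^sub>R (1, 0) + snd h *\<^sub>R (0, 1))" by simp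
    also have "\<dots> = fst h * pd 1 f z + snd h * pd 2 f z"
      by (simp only: linear_add[OF l] linear_scale[OF l]) (simp add: pd_def)
    finally show ?thesis .
  qed
  then have "frechet_derivative f (at z) = (\<lambda>h. fst h * pd 1 f z + snd h * pd 2 f z)" by (rule ext)
  with d show ?thesis by simp
qed

lemma C1_function_slices:
  assumes f: "C1_function f"
  shows "c1 (\<lambda>t. f (t, \<theta>)) (\<lambda>t. pd 1 f (t, \<theta>))" and "c1 (\<lambda>\<theta>. f (t, \<theta>)) (\<lambda>\<theta>. pd 2 f (t, \<theta>))"
proof -
  note D = C1_function_has_derivative[OF f]
  have c: "continuous_on UNIV (pd j f)" for j using f by (simp add: C1_function_def)
  have p: "((\<lambda>t. (t, \<theta>)) has_derivative (\<lambda>h. (h, 0::real))) (at t)" for t \<theta> :: real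
    by (auto intro!: derivative_eq_intros)
  have "((\<lambda>t. f (t, \<theta>)) has_derivative (\<lambda>h. fst (h, 0::real) * pd 1 f (t, \<theta>) + snd (h, 0::real) * pd 2 f (t, \<theta>))) (at t)" for t \<theta>
    using has_derivative_compose[OF p D] by simp
  then have "((\<lambda>t. f (t, \<theta>)) has_real_derivative pd 1 f (t, \<theta>)) (at t)" for t \<theta>
    by (simp add: has_field_derivative_def mult_commute_abs)
  then show "c1 (\<lambda>t. f (t, \<theta>)) (\<lambda>t. pd 1 f (t, \<theta>))"
    by (auto simp: c1_def intro!: continuous_on_compose2[OF c] continuous_intros)
  have p: "((\<lambda>\<theta>. (t, \<theta>)) has_derivative (\<lambda>h. (0::real, h))) (at \<theta>)" for t \<theta> :: real
    by (auto intro!: derivative_eq_intros)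
  have "((\<lambda>\<theta>. f (t, \<theta>)) has_derivative (\<lambda>h. fst (0::real, h) * pd 1 f (t, \<theta>) + snd (0::real, h) * pd 2 f (t, \<theta>))) (at \<theta>)" for t \<theta>
    using has_derivative_compose[OF p D] by simp
  then have "((\<lambda>\<theta>. f (t, \<theta>)) has_real_derivative pd 2 f (t, \<theta>)) (at \<theta>)" for t \<theta>
    by (simp add: has_field_derivative_def mult_commute_abs)
  then show "c1 (\<lambda>\<theta>. f (t, \<theta>)) (\<lambda>\<theta>. pd 2 f (t, \<theta>))"
    by (auto simp: c1_def intro!: continuous_on_compose2[OF c] continuous_intros)
qed

lemma C1_function_continuous: "C1_function f \<Longrightarrow> continuous_on UNIV f"
  by (auto simp: C1_function_def continuous_on_eq_continuous_at differentiable_imp_continuous_within)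

lemma loc_integrable_locint:
  assumes "loc_integrable u"
  shows "locint {0<..} UNIV u"
  unfolding locint_def
proof (intro conjI allI impI)
  show "u \<in> Bor" using assms by (simp add: loc_integrable_def)
  fix a b c d :: real assume "{a..b} \<subseteq> {0<..}"
  then have "{a..b}\<times>{c..d} \<subseteq> halfplane" by (auto simp: halfplane_def)
  then show "L1_on ({a..b}\<times>{c..d}) u"
    using assms by (auto simp: loc_integrable_def intro!: compact_Times)
qed

lemma continuous_loc_integrable:
  fixes f :: "real \<times> real \<Rightarrow> real"
  assumes "continuous_on UNIV f"
  shows "loc_integrable f"
  unfolding loc_integrable_def
proof (intro conjI allI impI)
  show "f \<in> Bor" using assms by (rule borel_measurable_continuous_onI)
  fix K :: "(real \<times> real) set" assume "compact K"
  then show "L1_on K f"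
    unfolding set_integrable_def
    by (intro borel_integrable_compact) (use assms in \<open>auto intro: continuous_on_subset\<close>)
qed

lemma C1_test_tensor:
  assumes a: "c1 a a'" and b: "c1 b b'" and rs: "{r..s} \<subseteq> {0<..}"
    and az: "\<And>x. x \<notin> {r..s} \<Longrightarrow> a x = 0" and bz: "\<And>y. y \<notin> {r'..s'} \<Longrightarrow> b y = 0"
  shows "C1_test (\<lambda>z. a (fst z) * b (snd z))"
  unfolding C1_test_def
proof (intro conjI exI)
  show "compact ({r..s} \<times> {r'..s'})" by (intro compact_Times) auto
  show "{r..s} \<times> {r'..s'} \<subseteq> halfplane" using rs by (auto simp: halfplane_def)
  show "\<forall>x. x \<notin> {r..s} \<times> {r'..s'} \<longrightarrow> a (fst x) * b (snd x) = 0"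
    using az bz by (metis mem_Times_iff mult_eq_0_iff)
qed (rule C1_tensor[OF a b])

lemma weak_gradient_tests:
  assumes w: "has_weak_gradient u p" and a: "c1 a a'" and b: "c1 b b'" and rs: "{r..s} \<subseteq> {0<..}"
    and az: "\<And>x. x \<notin> {r..s} \<Longrightarrow> a x = 0" and bz: "\<And>y. y \<notin> {r'..s'} \<Longrightarrow> b y = 0"
  shows "(LINT z|lborel. u z * (a' (fst z) * b (snd z))) = - (LINT z|lborel. p z $ 1 * (a (fst z) * b (snd z)))"
    and "(LINT z|lborel. u z * (a (fst z) * b' (snd z))) = - (LINT z|lborel. p z $ 2 * (a (fst z) * b (snd z)))"
proof -
  have "a' x = 0" if "x \<le> 0" for x
    by (rule c1_zero_outside[OF a az]) (use that rs in auto)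
  then have a0: "a x = 0" "a' x = 0" if "x \<le> 0" for x
    using that rs az[of x] by force+
  have e: "(LBINT z:halfplane. F z * (h (fst z) * k (snd z))) = (LINT z|lborel. F z * (h (fst z) * k (snd z)))"
    if "\<And>x. x \<le> 0 \<Longrightarrow> h x = 0" for F :: "real\<times>real \<Rightarrow> real" and h k :: "real \<Rightarrow> real"
  proof (rule set_integral_restrict(1))
    fix z assume "z \<notin> halfplane"
    then have "fst z \<le> 0" by (cases z) (auto simp: halfplane_def)
    with that show "F z * (h (fst z) * k (snd z)) = 0" by simp
  qed
  have "(LBINT x:halfplane. u x * pd j (\<lambda>z. a (fst z) * b (snd z)) x)
     = - (LBINT x:halfplane. p x $ j * (a (fst x) * b (snd x)))" for j
    using w C1_test_tensor[OF a b rs az bz] by (auto simp: has_weak_gradient_def)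
  from this[of 1] this[of 2]
  show "(LINT z|lborel. u z * (a' (fst z) * b (snd z))) = - (LINT z|lborel. p z $ 1 * (a (fst z) * b (snd z)))"
    and "(LINT z|lborel. u z * (a (fst z) * b' (snd z))) = - (LINT z|lborel. p z $ 2 * (a (fst z) * b (snd z)))"
    unfolding C1_tensor[OF a b]
    using e[where F="\<lambda>z. p z $ 1" and h=a and k=b, OF a0(1)] e[where F="\<lambda>z. p z $ 2" and h=a and k=b, OF a0(1)]
      e[where F=u and h=a' and k=b, OF a0(2)] e[where F=u and h=a and k=b', OF a0(1)] by simp_all
qed

text \<open>\<open>weak_gradient\<close> is defined by choice, so every computation with it passes
  through this uniqueness up to null sets. Products of bumps are enough as tests.\<close>

lemma weak_gradient_unique:
  assumes p: "has_weak_gradient u p" and q: "has_weak_gradient u q"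
  shows "AE z in lborel. z \<in> halfplane \<longrightarrow> p z = q z"
proof -
  have li: "locint {0<..} UNIV (\<lambda>z. p z $ j)" "locint {0<..} UNIV (\<lambda>z. q z $ j)" for j
    using p q by (auto simp: has_weak_gradient_def intro: loc_integrable_locint)
  have "AE z in lborel. z \<in> {0<..} \<times> UNIV \<longrightarrow> p z $ j - q z $ j = 0" for j
  proof (rule AE_zero_bump_integrals)
    show "locint {0<..} UNIV (\<lambda>z. p z $ j - q z $ j)"
      using li[of j] by (auto simp: locint_def intro: set_integral_diff(1))
    fix n and r s r' s' :: real assume rs: "{r..s} \<subseteq> {0<..}" and "r < s"
    obtain a' where a: "c1 (bump n r s) a'" using c1_bump by blast
    obtain b' where b: "c1 (bump n r' s') b'" using c1_bump by blast
    have az: "bump n r s x = 0" if "x \<notin> {r..s}" for x using that by (intro bump_eq_0) auto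
    have bz: "bump n r' s' x = 0" if "x \<notin> {r'..s'}" for x using that by (intro bump_eq_0) auto
    note tp = weak_gradient_tests[OF p a b rs az bz] and tq = weak_gradient_tests[OF q a b rs az bz]
    have "(LINT z|lborel. p z $ j * (bump n r s (fst z) * bump n r' s' (snd z))) =
       (LINT z|lborel. q z $ j * (bump n r s (fst z) * bump n r' s' (snd z)))"
      using tp tq by (cases "j = 1") (use exhaust_2[of j] in auto)
    then show "(LINT z|lborel. (p z $ j - q z $ j) * (bump n r s (fst z) * bump n r' s' (snd z))) = 0"
      using locint_integrable_mult(1)[OF li(1)[of j] rs subset_UNIV bump_continuous az bump_continuous bz]
        locint_integrable_mult(1)[OF li(2)[of j] rs subset_UNIV bump_continuous az bump_continuous bz]
      by (simp add: left_diff_distrib)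
  qed auto
  from this[of 1] this[of 2] show ?thesis
    by eventually_elim (auto simp: halfplane_def vec_eq_iff forall_2)
qed

lemma integral_pd_zero:
  assumes g: "C1_function g" and K: "compact K" "\<And>x. x \<notin> K \<Longrightarrow> g x = 0"
  shows "(LINT z|lborel. pd j g z) = 0"
proof -
  obtain M where M: "M > 0" "\<And>x. x \<in> K \<Longrightarrow> norm x \<le> M"
    using compact_imp_bounded[OF K(1)] unfolding bounded_pos by blast
  have z: "g (x, y) = 0" if "M < \<bar>x\<bar> \<or> M < \<bar>y\<bar>" for x y
  proof (rule K(2), rule)
    assume "(x, y) \<in> K"
    with M(2)[OF this] that norm_fst_le[of x y] norm_snd_le[of y x] show False by auto
  qed
  \<comment> \<open>The margin 1 makes \<open>g\<close> vanish on the edges of the square as well,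
    so the one-dimensional integrals have no boundary values.\<close>
  let ?A = "{-(M+1)..M+1}"
  have e: "g (x, y) = 0" if "x \<notin> {-(M+1)<..<M+1} \<or> y \<notin> {-(M+1)<..<M+1}" for x y
    by (rule z) (use that in auto)
  have pz1: "pd 1 g (x, y) = 0" if "(x, y) \<notin> ?A \<times> ?A" for x y
  proof (cases "y \<in> ?A")
    case True
    then show ?thesis using that
      by (intro c1_zero_outside[OF C1_function_slices(1)[OF g, of y], of "-(M+1)" "M+1"] e) auto
  next
    case False
    then have "(\<lambda>t. g (t, y)) = (\<lambda>_. 0)" by (intro ext e) auto
    then have "((\<lambda>_. 0) has_real_derivative pd 1 g (x, y)) (at x)"
      using c1D[OF C1_function_slices(1)[OF g, of y], of x] by simp
    then show ?thesis by (metis DERIV_const DERIV_unique)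
  qed
  have pz2: "pd 2 g (x, y) = 0" if "(x, y) \<notin> ?A \<times> ?A" for x y
  proof (cases "x \<in> ?A")
    case True
    then show ?thesis using that
      by (intro c1_zero_outside[OF C1_function_slices(2)[OF g, of x], of "-(M+1)" "M+1"] e) auto
  next
    case False
    then have "(\<lambda>t. g (x, t)) = (\<lambda>_. 0)" by (intro ext e) auto
    then have "((\<lambda>_. 0) has_real_derivative pd 2 g (x, y)) (at y)"
      using c1D[OF C1_function_slices(2)[OF g, of x], of y] by simp
    then show ?thesis by (metis DERIV_const DERIV_unique)
  qed
  have c: "continuous_on UNIV (pd j g)" for j using g by (simp add: C1_function_def)
  have i: "L1_on (?A \<times> ?A) (pd j g)" for j
    unfolding set_integrable_def
    by (intro borel_integrable_compact compact_Times) (auto intro: continuous_on_subset[OF c])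
  have b: "-(M+1) \<le> M + 1" using M by simp
  have "(LINT z|lborel. pd 1 g z) = (LBINT z:?A\<times>?A. pd 1 g z)"
    by (rule set_integral_restrict(1)[symmetric]) (metis pz1 surj_pair)
  also have "\<dots> = (LBINT y:?A. LBINT x:?A. pd 1 g (x, y))" by (rule set_Fubini(4)[OF i])
  also have "(\<lambda>y. LBINT x:?A. pd 1 g (x, y)) = (\<lambda>y. 0)"
    using acD[OF c1_ac[OF C1_function_slices(1)[OF g]] order_refl b order_refl] e by simp
  finally have 1: "(LINT z|lborel. pd 1 g z) = 0" by (simp add: set_lebesgue_integral_def)
  have "(LINT z|lborel. pd 2 g z) = (LBINT z:?A\<times>?A. pd 2 g z)"
    by (rule set_integral_restrict(1)[symmetric]) (metis pz2 surj_pair)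
  also have "\<dots> = (LBINT x:?A. LBINT y:?A. pd 2 g (x, y))" by (rule set_Fubini(3)[OF i])
  also have "(\<lambda>x. LBINT y:?A. pd 2 g (x, y)) = (\<lambda>y. 0)"
    using acD[OF c1_ac[OF C1_function_slices(2)[OF g]] order_refl b order_refl] e by simp
  finally have 2: "(LINT z|lborel. pd 2 g z) = 0" by (simp add: set_lebesgue_integral_def)
  show ?thesis using 1 2 exhaust_2[of j] by auto
qed

lemma C1_has_weak_gradient:
  assumes u: "C1_function u"
  shows "has_weak_gradient u (\<lambda>z. \<chi> j. pd j u z)"
  unfolding has_weak_gradient_def
proof (intro conjI allI impI)
  show "loc_integrable u" by (rule continuous_loc_integrable[OF C1_function_continuous[OF u]])
  fix j :: 2
  have cu: "continuous_on UNIV (pd i u)" for i using u by (simp add: C1_function_def)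
  then show "loc_integrable (\<lambda>x. (\<chi> j. pd j u x) $ j)" by (simp add: continuous_loc_integrable)
  fix f assume f: "C1_test f"
  then obtain K where K: "compact K" "K \<subseteq> halfplane" "\<And>x. x \<notin> K \<Longrightarrow> f x = 0" and f1: "C1_function f"
    by (auto simp: C1_test_def)
  note Du = C1_function_has_derivative[OF u] and Df = C1_function_has_derivative[OF f1]
  have cf: "continuous_on UNIV (pd j f)" for j using f1 by (simp add: C1_function_def)
  have d: "((\<lambda>z. u z * f z) has_derivative (\<lambda>h. u z * (fst h * pd 1 f z + snd h * pd 2 f z) +
     (fst h * pd 1 u z + snd h * pd 2 u z) * f z)) (at z)" for z
    by (rule has_derivative_mult[OF Du Df])
  have pd: "pd j (\<lambda>z. u z * f z) z = u z * pd j f z + pd j u z * f z" for z j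
    using pd_eq[OF d[of z], of j] exhaust_2[of j] by auto
  have cpd: "continuous_on UNIV (pd j (\<lambda>z. u z * f z))" for j
    unfolding pd[abs_def]
    by (intro continuous_intros cf cu C1_function_continuous[OF u] C1_function_continuous[OF f1])
  then have "C1_function (\<lambda>z. u z * f z)"
    using d by (auto simp: C1_function_def differentiable_def)
  from integral_pd_zero[OF this K(1), of j] have 0: "(LINT z|lborel. u z * pd j f z + pd j u z * f z) = 0"
    using K(3) by (simp add: pd)
  have fz: "pd j f z = 0" if "z \<notin> K" for z
  proof -
    have "((\<lambda>_. 0) has_derivative (\<lambda>_. 0)) (at z)" by simp
    then have "(f has_derivative (\<lambda>_. 0)) (at z)"
      by (rule has_derivative_transform_within_open[of _ _ _ _ "- K"]) (use K that compact_imp_closed[OF K(1)] in \<open>auto simp: open_Compl\<close>)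
    from pd_eq[OF this, of j] show ?thesis by simp
  qed
  have iK: "integrable lborel g" if "continuous_on UNIV g" "\<And>z. z \<notin> K \<Longrightarrow> g z = 0" for g :: "real\<times>real \<Rightarrow> real"
  proof -
    have "L1_on K g" unfolding set_integrable_def
      by (intro borel_integrable_compact K(1)) (use that in \<open>auto intro: continuous_on_subset\<close>)
    with set_integral_restrict(2)[of K g, OF that(2)] show ?thesis by simp
  qed
  have hp: "(LBINT z:halfplane. g z) = (LINT z|lborel. g z)" if "\<And>z. z \<notin> K \<Longrightarrow> g z = 0" for g :: "real\<times>real \<Rightarrow> real"
    by (rule set_integral_restrict(1)) (use that K(2) in blast)
  note cont = cf cu C1_function_continuous[OF u] C1_function_continuous[OF f1]
  have "integrable lborel (\<lambda>z. u z * pd j f z)"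
    by (rule iK, intro continuous_intros cont) (simp add: fz)
  moreover have "integrable lborel (\<lambda>z. pd j u z * f z)"
    by (rule iK, intro continuous_intros cont) (simp add: K(3))
  ultimately have "(LINT z|lborel. u z * pd j f z) = - (LINT z|lborel. pd j u z * f z)" using 0 by simp
  then show "(LBINT x:halfplane. u x * pd j f x) = - (LBINT x:halfplane. (\<chi> j. pd j u x) $ j * f x)"
    by (subst hp, simp add: fz, subst hp, simp add: K(3)) simp
qed

lemma has_weak_gradient_weak_gradient:
  "has_weak_gradient u p \<Longrightarrow> has_weak_gradient u (weak_gradient u)"
  unfolding weak_gradient_def by (rule someI[of "has_weak_gradient u"])

lemma weak_gradient_C1:
  assumes "C1_function u"
  shows "AE z in lborel. z \<in> halfplane \<longrightarrow> weak_gradient u z = (\<chi> j. pd j u z)"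
  using weak_gradient_unique has_weak_gradient_weak_gradient C1_has_weak_gradient[OF assms] by blast

section \<open>Representatives of admissible functions\<close>

lemma AE_interval_ex:
  assumes "AE x in lborel. P x" "c < (d::real)"
  shows "\<exists>x. c < x \<and> x < d \<and> P x"
proof (rule ccontr)
  assume n: "\<not> ?thesis"
  have "AE x in lborel. x \<notin> {c<..<d}" using assms(1) by eventually_elim (use n in auto)
  then have "{c<..<d} \<in> null_sets lborel" by (subst AE_iff_null_sets) auto
  with assms(2) show False by (simp add: null_sets_def)
qed

lemma continuous_AE_eq:
  fixes f g :: "real \<Rightarrow> real"
  assumes f: "continuous_on {a..b} f" and g: "continuous_on {a..b} g" and ab: "a < b"
    and ae: "AE x in lborel. a < x \<longrightarrow> x < b \<longrightarrow> f x = g x" and x: "x \<in> {a..b}"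
  shows "f x = g x"
proof (rule ccontr)
  assume "f x \<noteq> g x"
  then have "0 < \<bar>f x - g x\<bar>" by simp
  moreover have "continuous_on {a..b} (\<lambda>x. f x - g x)" by (intro continuous_intros f g)
  ultimately obtain e where e: "e > 0" "\<And>y. y \<in> {a..b} \<Longrightarrow> dist y x < e \<Longrightarrow> dist (f y - g y) (f x - g x) < \<bar>f x - g x\<bar>"
    using x unfolding continuous_on_iff by meson
  have "max a (x - e) < min b (x + e)" using ab e(1) x by auto
  from AE_interval_ex[OF ae this] obtain y where y: "max a (x - e) < y" "y < min b (x + e)"
    and "a < y \<longrightarrow> y < b \<longrightarrow> f y = g y" by blast
  then have "f y = g y" by auto
  moreover have "dist (f y - g y) (f x - g x) < \<bar>f x - g x\<bar>"
    using y by (intro e(2)) (auto simp: dist_real_def)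
  ultimately show False by (simp add: dist_real_def)
qed

lemma AE_shift:
  assumes "AE x in lborel. P (x::real)"
  shows "AE x in lborel. P (x + c)"
proof -
  have "AE x in distr lborel borel ((+) c). P x" using assms unfolding lborel_distr_plus .
  then have "AE x in lborel. P (c + x)" by (rule AE_distrD[rotated]) simp
  then show ?thesis by (simp add: add.commute)
qed

lemma AE_productI':
  assumes "AE y in lborel. AE x in lborel. Q (x::real, y::real)" "{z. Q z} \<in> sets borel"
  shows "AE z in lborel. Q z"
proof (rule AE_productI[OF _ assms(2)])
  have "{z \<in> space (lborel \<Otimes>\<^sub>M lborel). Q (fst z, snd z)} \<in> sets (lborel \<Otimes>\<^sub>M lborel)"
    using assms(2) unfolding lborel_prod by simp
  from lborel_pair.AE_commute[of "\<lambda>x y. Q (x, y)", OF this] assms(1)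
  show "AE x in lborel. AE y in lborel. Q (x, y)" by blast
qed

lemma lborel_swap:
  fixes f :: "real \<times> real \<Rightarrow> real"
  shows "f \<in> Bor \<Longrightarrow> (LINT z|lborel. f (snd z, fst z)) = (LINT z|lborel. f z)"
    and "integrable lborel f \<Longrightarrow> integrable lborel (\<lambda>z. f (snd z, fst z))"
proof -
  assume "f \<in> Bor"
  then have "f \<in> borel_measurable (lborel \<Otimes>\<^sub>M lborel)" unfolding lborel_prod by simp
  from lborel_pair.integral_product_swap[OF this]
  show "(LINT z|lborel. f (snd z, fst z)) = (LINT z|lborel. f z)"
    by (simp only: lborel_prod case_prod_beta')
next
  assume "integrable lborel f"
  then have "integrable (lborel \<Otimes>\<^sub>M lborel) f" unfolding lborel_prod .
  from lborel_pair.integrable_product_swap[OF this]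
  show "integrable lborel (\<lambda>z. f (snd z, fst z))"
    by (simp only: lborel_prod case_prod_beta')
qed

lemma borel_swap:
  fixes f :: "real \<times> real \<Rightarrow> real"
  assumes "f \<in> Bor"
  shows "(\<lambda>z. f (snd z, fst z)) \<in> Bor"
  by (rule measurable_compose[OF _ assms], intro borel_measurable_continuous_onI continuous_intros)

lemma borel_slices:
  fixes f :: "real \<times> real \<Rightarrow> 'a::topological_space"
  assumes "f \<in> Bor"
  shows "(\<lambda>t. f (t, \<theta>)) \<in> Bor" "(\<lambda>\<theta>. f (t, \<theta>)) \<in> Bor"
  by (rule measurable_compose[OF _ assms], intro borel_measurable_continuous_onI continuous_intros)+

lemma locint_swap:
  assumes "locint I J u"
  shows "locint J I (\<lambda>z. u (snd z, fst z))"
  unfolding locint_def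
proof (intro conjI allI impI)
  show "(\<lambda>z. u (snd z, fst z)) \<in> Bor" using assms by (intro borel_swap) (simp add: locint_def)
  fix a b c d assume "{a..b} \<subseteq> J" "{c..d} \<subseteq> I"
  then have "integrable lborel (\<lambda>z. indicator ({c..d}\<times>{a..b}) z *\<^sub>R u z)"
    using assms by (simp add: locint_def set_integrable_def)
  from lborel_swap(2)[OF this]
  show "L1_on ({a..b} \<times> {c..d}) (\<lambda>z. u (snd z, fst z))"
    unfolding set_integrable_def by (rule back_subst[of "integrable _"]) (auto simp: fun_eq_iff indicator_def)
qed

lemma weak_gradient_measurable:
  assumes "has_weak_gradient u p"
  shows "u \<in> Bor" "(\<lambda>z. p z $ j) \<in> Bor"
  using assms by (auto simp: has_weak_gradient_def loc_integrable_def)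

text \<open>The representation theorem with the coordinates exchanged. Periodicity of
  \<open>u\<close> passes to the representative almost everywhere by translation, and then
  everywhere by continuity.\<close>

lemma theta_slices:
  assumes w: "has_weak_gradient u p" and per: "periodic u"
  shows "AE t in lborel. 0 < t \<longrightarrow> (\<exists>g. (\<forall>a b. ac a b g (\<lambda>\<theta>. p (t, \<theta>) $ 2)) \<and> (\<forall>\<theta>. g (\<theta> + 2*pi) = g \<theta>) \<and>
    (AE \<theta> in lborel. u (t, \<theta>) = g \<theta>))"
proof -
  interpret line_domain UNIV "{0<..}" 0 by unfold_locales auto
  have lu: "locint {0<..} UNIV u" and lp: "locint {0<..} UNIV (\<lambda>z. p z $ 2)"
    using w by (auto simp: has_weak_gradient_def intro: loc_integrable_locint)
  note m = weak_gradient_measurable[OF w]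
  obtain G where G: "G \<in> Bor"
    "AE z in lborel. z \<in> UNIV \<times> {0<..} \<longrightarrow> u (snd z, fst z) = G z"
    "AE y in lborel. y \<in> {0<..} \<longrightarrow> (\<forall>a b. {a..b} \<subseteq> UNIV \<longrightarrow> ac a b (\<lambda>x. G (x, y)) (\<lambda>x. p (snd (x, y), fst (x, y)) $ 2))"
  proof (rule weak_derivative_imp_ac[OF locint_swap[OF lu] locint_swap[OF lp]])
    fix a a' b b' and r s r' s' :: real
    assume a: "c1 a a'" and b: "c1 b b'" and rs: "{r'..s'} \<subseteq> {0<..}"
      and az: "\<And>x. x \<notin> {r..s} \<Longrightarrow> a x = 0" and bz: "\<And>y. y \<notin> {r'..s'} \<Longrightarrow> b y = 0"
    have mm: "a \<in> Bor" "a' \<in> Bor" "b \<in> Bor"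
      using c1_continuous[OF a] c1D'[OF a] c1_continuous[OF b] by (auto intro: borel_measurable_continuous_onI)
    have "(\<lambda>w. u w * (b (fst w) * a' (snd w))) \<in> Bor"
      by (intro borel_measurable_times m borel_fst_snd mm)
    from lborel_swap(1)[OF this]
    have 1: "(LINT z|lborel. u (snd z, fst z) * (a' (fst z) * b (snd z))) = (LINT w|lborel. u w * (b (fst w) * a' (snd w)))"
      by (simp add: mult.commute)
    have "(\<lambda>w. p w $ 2 * (b (fst w) * a (snd w))) \<in> Bor"
      by (intro borel_measurable_times m borel_fst_snd mm)
    from lborel_swap(1)[OF this]
    have 2: "(LINT z|lborel. p (snd z, fst z) $ 2 * (a (fst z) * b (snd z))) = (LINT w|lborel. p w $ 2 * (b (fst w) * a (snd w)))"
      by (simp add: mult.commute)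
    show "(LINT z|lborel. u (snd z, fst z) * (a' (fst z) * b (snd z))) = - (LINT z|lborel. p (snd z, fst z) $ 2 * (a (fst z) * b (snd z)))"
      unfolding 1 2 by (rule weak_gradient_tests(2)[OF w b a rs bz az])
  qed
  show ?thesis
    using AE_product(2)[OF G(2)] G(3)
  proof eventually_elim
    case (elim t)
    show ?case
    proof
      assume t: "0 < t"
      have ac: "ac a b (\<lambda>\<theta>. G (\<theta>, t)) (\<lambda>\<theta>. p (t, \<theta>) $ 2)" for a b using elim(2) t by simp
      have ae: "AE \<theta> in lborel. u (t, \<theta>) = G (\<theta>, t)" using elim(1) t by simp
      have "G (\<theta> + 2*pi, t) = G (\<theta>, t)" for \<theta>
      proof (rule continuous_AE_eq[of "\<theta> - 1" "\<theta> + 1" "\<lambda>\<theta>. G (\<theta> + 2*pi, t)" "\<lambda>\<theta>. G (\<theta>, t)" \<theta>])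
        show "continuous_on {\<theta> - 1..\<theta> + 1} (\<lambda>\<theta>. G (\<theta>, t))" by (rule ac_continuous[OF ac])
        have "continuous_on {\<theta> - 1 + 2*pi..\<theta> + 1 + 2*pi} (\<lambda>\<theta>. G (\<theta>, t))" by (rule ac_continuous[OF ac])
        then show "continuous_on {\<theta> - 1..\<theta> + 1} (\<lambda>\<theta>. G (\<theta> + 2*pi, t))"
          by (rule continuous_on_compose2) (auto intro!: continuous_intros)
        show "AE x in lborel. \<theta> - 1 < x \<longrightarrow> x < \<theta> + 1 \<longrightarrow> G (x + 2*pi, t) = G (x, t)"
          using ae AE_shift[OF ae, of "2*pi"]
          by eventually_elim (use per t in \<open>auto simp: periodic_def\<close>)
      qed auto
      with ac ae show "\<exists>g. (\<forall>a b. ac a b g (\<lambda>\<theta>. p (t, \<theta>) $ 2)) \<and> (\<forall>\<theta>. g (\<theta> + 2*pi) = g \<theta>) \<and>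
        (AE \<theta> in lborel. u (t, \<theta>) = g \<theta>)" by (intro exI[of _ "\<lambda>\<theta>. G (\<theta>, t)"]) auto
    qed
  qed
qed

lemma t_slices:
  assumes w: "has_weak_gradient u p"
  obtains G where "G \<in> Bor" "AE z in lborel. z \<in> halfplane \<longrightarrow> u z = G z"
    "AE \<theta> in lborel. \<forall>a b. {a..b} \<subseteq> {0<..} \<longrightarrow> ac a b (\<lambda>t. G (t, \<theta>)) (\<lambda>t. p (t, \<theta>) $ 1)"
proof -
  interpret line_domain "{0<..}" UNIV 1 by unfold_locales auto
  have lu: "locint {0<..} UNIV u" and lp: "locint {0<..} UNIV (\<lambda>z. p z $ 1)"
    using w by (auto simp: has_weak_gradient_def intro: loc_integrable_locint)
  show ?thesis
  proof (rule weak_derivative_imp_ac[OF lu lp])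
    fix G assume "G \<in> Bor" "AE z in lborel. z \<in> {0<..} \<times> UNIV \<longrightarrow> u z = G z"
      "AE y in lborel. y \<in> UNIV \<longrightarrow> (\<forall>a b. {a..b} \<subseteq> {0<..} \<longrightarrow> ac a b (\<lambda>x. G (x, y)) (\<lambda>x. p (x, y) $ 1))"
    then show thesis by (intro that[of G]) (auto simp: halfplane_def)
  qed (rule weak_gradient_tests(1)[OF w])
qed

section \<open>Traces as initial values on almost every line\<close>

definition ray :: "real set" where "ray = {0..}"
definition circ :: "real set" where "circ = {0..<2*pi}"

lemma ray_circ: "strip = ray \<times> circ" "ray \<in> sets borel" "circ \<in> sets borel" "strip \<in> sets borel"
  by (auto simp: strip_def ray_def circ_def intro!: borel_Times)

lemma nn_integral_Times:
  fixes f :: "real \<times> real \<Rightarrow> ennreal"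
  assumes f: "f \<in> Bor" and A: "A \<in> sets borel" and B: "B \<in> sets borel"
  shows "(\<integral>\<^sup>+z\<in>A\<times>B. f z \<partial>lborel) = (\<integral>\<^sup>+y\<in>B. (\<integral>\<^sup>+x\<in>A. f (x, y) \<partial>lborel) \<partial>lborel)"
proof -
  let ?g = "\<lambda>z. f z * indicator (A\<times>B) z"
  have m: "?g \<in> borel_measurable (lborel \<Otimes>\<^sub>M lborel)"
    unfolding lborel_prod using f borel_Times[OF A B] by auto
  have "(\<integral>\<^sup>+z. ?g z \<partial>(lborel \<Otimes>\<^sub>M lborel)) = (\<integral>\<^sup>+y. \<integral>\<^sup>+x. ?g (x, y) \<partial>lborel \<partial>lborel)"
    using lborel_pair.nn_integral_snd[OF m] by simp
  also have "\<dots> = (\<integral>\<^sup>+y. (\<integral>\<^sup>+x. f (x, y) * indicator A x * indicator B y \<partial>lborel) \<partial>lborel)"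
    by (intro nn_integral_cong) (auto simp: indicator_def)
  also have "\<dots> = (\<integral>\<^sup>+y. (\<integral>\<^sup>+x. f (x, y) * indicator A x \<partial>lborel) * indicator B y \<partial>lborel)"
  proof (intro nn_integral_cong)
    fix y :: real
    have "(\<lambda>x. f (x, y) * indicator A x) \<in> borel_measurable lborel"
      using borel_slices(1)[OF f, of y] A by auto
    then show "(\<integral>\<^sup>+x. f (x, y) * indicator A x * indicator B y \<partial>lborel) = (\<integral>\<^sup>+x. f (x, y) * indicator A x \<partial>lborel) * indicator B y"
      by (rule nn_integral_multc)
  qed
  finally show ?thesis unfolding lborel_prod .
qed

lemma set_integrable_L1_of_L2:
  fixes f :: "real \<Rightarrow> real"
  assumes "f \<in> Bor" "L1_on {a..b} (\<lambda>x. (f x)\<^sup>2)"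
  shows "L1_on {a..b} f"
proof -
  have "L1_on {a..b} (\<lambda>x. f x * 1)"
    by (rule L2_mult_integrable) (use assms borel_integrable_atLeastAtMost'[of a b "\<lambda>_. 1"] in auto)
  then show ?thesis by simp
qed

lemma nn_integral_sq_set:
  fixes f :: "'a::euclidean_space \<Rightarrow> real"
  assumes "L1_on A (\<lambda>x. (f x)\<^sup>2)"
  shows "(\<integral>\<^sup>+x\<in>A. ennreal ((f x)\<^sup>2) \<partial>lborel) = ennreal (LBINT x:A. (f x)\<^sup>2)"
proof -
  have "(\<integral>\<^sup>+x\<in>A. ennreal ((f x)\<^sup>2) \<partial>lborel) = (\<integral>\<^sup>+x. ennreal (indicator A x *\<^sub>R (f x)\<^sup>2) \<partial>lborel)"
    by (intro nn_integral_cong) (auto simp: indicator_def)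
  also have "\<dots> = ennreal (LINT x|lborel. indicator A x *\<^sub>R (f x)\<^sup>2)"
    by (rule nn_integral_eq_integral) (use assms in \<open>auto simp: set_integrable_def\<close>)
  finally show ?thesis by (simp add: set_lebesgue_integral_def)
qed

lemma set_integrable_sq_nn:
  fixes f :: "'a::euclidean_space \<Rightarrow> real"
  assumes "f \<in> Bor" "A \<in> sets borel" "(\<integral>\<^sup>+x\<in>A. ennreal ((f x)\<^sup>2) \<partial>lborel) < \<infinity>"
  shows "L1_on A (\<lambda>x. (f x)\<^sup>2)"
  unfolding set_integrable_def
proof (rule integrableI_bounded)
  show "(\<lambda>x. indicator A x *\<^sub>R (f x)\<^sup>2) \<in> borel_measurable lborel" using assms by simp
  have "(\<integral>\<^sup>+x. ennreal (norm (indicator A x *\<^sub>R (f x)\<^sup>2)) \<partial>lborel) = (\<integral>\<^sup>+x\<in>A. ennreal ((f x)\<^sup>2) \<partial>lborel)"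
    by (intro nn_integral_cong) (auto simp: indicator_def)
  with assms(3) show "(\<integral>\<^sup>+x. ennreal (norm (indicator A x *\<^sub>R (f x)\<^sup>2)) \<partial>lborel) < \<infinity>" by simp
qed

text \<open>The representative that the trace dictates: it starts from \<tau> on t = 0 and
  integrates the normal derivative \<open>P\<close> along the line.\<close>

definition trace_rep :: "(real \<times> real \<Rightarrow> real) \<Rightarrow> (real \<Rightarrow> real) \<Rightarrow> real \<times> real \<Rightarrow> real" where
  "trace_rep P \<tau> z = \<tau> (snd z) + lint P 0 z"

lemma trace_rep_measurable:
  assumes "P \<in> Bor" "\<tau> \<in> Bor"
  shows "trace_rep P \<tau> \<in> Bor"
  unfolding trace_rep_def[abs_def] by (intro borel_measurable_add borel_fst_snd lint_measurable assms)

lemma trace_rep_0 [simp]: "trace_rep P \<tau> (0, \<theta>) = \<tau> \<theta>"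
  by (simp add: trace_rep_def lint_def)

lemma trace_rep_ac:
  assumes "L1_on {0..b} (\<lambda>s. P (s, \<theta>))"
  shows "ac 0 b (\<lambda>t. trace_rep P \<tau> (t, \<theta>)) (\<lambda>t. P (t, \<theta>))"
proof (cases "0 \<le> b")
  case True
  with lint_ac[OF assms, of 0] have "ac 0 b (\<lambda>t. lint P 0 (t, \<theta>)) (\<lambda>t. P (t, \<theta>))" by simp
  then show ?thesis by (auto simp: ac_def trace_rep_def)
qed (auto simp: ac_def set_integrable_def)

lemma AE_strip_slices:
  fixes P :: "real \<times> real \<Rightarrow> real"
  assumes m: "P \<in> Bor" and P2: "L1_on strip (\<lambda>z. (P z)\<^sup>2)"
  shows "AE \<theta> in lborel. \<theta> \<in> circ \<longrightarrow> (\<forall>b. L1_on {0..b} (\<lambda>t. P (t, \<theta>)) \<and> L1_on {0..b} (\<lambda>t. (P (t, \<theta>))\<^sup>2))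
      \<and> L1_on ray (\<lambda>t. (P (t, \<theta>))\<^sup>2)"
  using set_Fubini(2)[OF P2[unfolded ray_circ]]
proof eventually_elim
  case (elim \<theta>)
  have "L1_on {0..b} (\<lambda>t. (P (t, \<theta>))\<^sup>2)" if "L1_on ray (\<lambda>t. (P (t, \<theta>))\<^sup>2)" for b
    using that by (rule set_integrable_subset) (auto simp: ray_def)
  then show ?case using elim set_integrable_L1_of_L2[OF borel_slices(1)[OF m]] by blast
qed

text \<open>On almost every line the error has initial value
  \<open>v (0, \<theta>) - \<tau> \<theta>\<close> and derivative \<open>pd 1 v - P\<close>, so
  Cauchy-Schwarz on an interval of length 1 controls it. The two terms on the right are among the
  quantities that tend to zero in \<open>has_trace\<close>.\<close>

lemma trace_approx:
  assumes mP: "P \<in> Bor" and m\<tau>: "\<tau> \<in> Bor"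
    and P2: "L1_on strip (\<lambda>z. (P z)\<^sup>2)" and v: "C1_function v"
  shows "(\<integral>\<^sup>+z\<in>collar. ennreal ((v z - trace_rep P \<tau> z)\<^sup>2) \<partial>lborel)
     \<le> 2 * (\<integral>\<^sup>+\<theta>\<in>{0..<2*pi}. ennreal ((v (0, \<theta>) - \<tau> \<theta>)\<^sup>2) \<partial>lborel)
       + 2 * (\<integral>\<^sup>+z\<in>collar. ennreal ((pd 1 v z - P z)\<^sup>2) \<partial>lborel)"
proof -
  let ?U = "trace_rep P \<tau>"
  have mU: "?U \<in> Bor" by (rule trace_rep_measurable[OF mP m\<tau>])
  have mv: "v \<in> Bor" "pd 1 v \<in> Bor"
    using v C1_function_continuous[OF v] by (auto simp: C1_function_def intro: borel_measurable_continuous_onI)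
  have c: "collar = {0..1} \<times> {0..<2*pi}" by (simp add: collar_def)
  have mm: "(\<lambda>z. ennreal ((v z - ?U z)\<^sup>2)) \<in> Bor"
    "(\<lambda>z. ennreal ((pd 1 v z - P z)\<^sup>2)) \<in> Bor"
    using mU mv mP by auto
  have m0: "(\<lambda>\<theta>. ennreal ((v (0, \<theta>) - \<tau> \<theta>)\<^sup>2)) \<in> Bor"
    using borel_slices(2)[OF mv(1), of 0] m\<tau> by auto
  have mB: "(\<lambda>\<theta>. \<integral>\<^sup>+t\<in>{0..1}. ennreal ((pd 1 v (t, \<theta>) - P (t, \<theta>))\<^sup>2) \<partial>lborel) \<in> Bor"
  proof -
    have "(\<lambda>z. ennreal ((pd 1 v (snd z, fst z) - P (snd z, fst z))\<^sup>2) * indicator {0..1} (snd z)) \<in> borel_measurable (borel \<Otimes>\<^sub>M borel)"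
      unfolding borel_prod
    proof (rule borel_measurable_times_ennreal)
      show "(\<lambda>z. ennreal ((pd 1 v (snd z, fst z) - P (snd z, fst z))\<^sup>2)) \<in> Bor"
        using borel_swap[OF mv(2)] borel_swap[OF mP] by auto
      have "snd \<in> borel_measurable (borel :: (real \<times> real) measure)"
        by (intro borel_measurable_continuous_onI continuous_intros)
      then show "(\<lambda>z. indicator {0..1} (snd z)) \<in> borel_measurable (borel :: (real \<times> real) measure)"
        by (rule measurable_compose) simp
    qed
    then show ?thesis
      by (intro sigma_finite_measure.borel_measurable_nn_integral[OF sigma_finite_lborel])
         (simp add: case_prod_beta' cong: measurable_cong_sets)
  qed
  have "(\<integral>\<^sup>+z\<in>collar. ennreal ((v z - ?U z)\<^sup>2) \<partial>lborel) =
     (\<integral>\<^sup>+\<theta>\<in>{0..<2*pi}. (\<integral>\<^sup>+t\<in>{0..1}. ennreal ((v (t, \<theta>) - ?U (t, \<theta>))\<^sup>2) \<partial>lborel) \<partial>lborel)"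
    unfolding c by (rule nn_integral_Times[OF mm(1)]) auto
  also have "\<dots> \<le> (\<integral>\<^sup>+\<theta>\<in>{0..<2*pi}. (2 * ennreal ((v (0, \<theta>) - \<tau> \<theta>)\<^sup>2) +
      2 * (\<integral>\<^sup>+t\<in>{0..1}. ennreal ((pd 1 v (t, \<theta>) - P (t, \<theta>))\<^sup>2) \<partial>lborel)) \<partial>lborel)"
  proof (rule nn_integral_mono_AE)
    show "AE \<theta> in lborel. (\<integral>\<^sup>+t\<in>{0..1}. ennreal ((v (t, \<theta>) - ?U (t, \<theta>))\<^sup>2) \<partial>lborel) * indicator {0..<2*pi} \<theta>
       \<le> (2 * ennreal ((v (0, \<theta>) - \<tau> \<theta>)\<^sup>2) + 2 * (\<integral>\<^sup>+t\<in>{0..1}. ennreal ((pd 1 v (t, \<theta>) - P (t, \<theta>))\<^sup>2) \<partial>lborel)) * indicator {0..<2*pi} \<theta>"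
      using AE_strip_slices[OF mP P2]
    proof eventually_elim
      case (elim \<theta>)
      show ?case
      proof (cases "\<theta> \<in> circ")
        case True
        note i = elim[rule_format, OF True, THEN conjunct1, rule_format]
        have U: "ac 0 1 (\<lambda>t. ?U (t, \<theta>)) (\<lambda>t. P (t, \<theta>))" by (rule trace_rep_ac) (use i in auto)
        have V: "ac 0 1 (\<lambda>t. v (t, \<theta>)) (\<lambda>t. pd 1 v (t, \<theta>))" by (rule c1_ac[OF C1_function_slices(1)[OF v]])
        define d where "d t = pd 1 v (t, \<theta>) - P (t, \<theta>)" for t
        have D: "ac 0 1 (\<lambda>t. v (t, \<theta>) - ?U (t, \<theta>)) d"
          using ac_lin[OF V U, of 1 "-1"] by (simp add: d_def[abs_def])
        have cp: "continuous_on {0..1} (\<lambda>t. pd 1 v (t, \<theta>))"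
          using c1D'[OF C1_function_slices(1)[OF v]] by (rule continuous_on_subset) auto
        have p2: "L1_on {0..1} (\<lambda>t. (pd 1 v (t, \<theta>))\<^sup>2)"
          by (intro borel_integrable_atLeastAtMost' continuous_intros cp)
        have d2: "L1_on {0..1} (\<lambda>t. (d t)\<^sup>2)"
          using L2_add_integrable[of "\<lambda>t. pd 1 v (t, \<theta>)" "\<lambda>t. P (t, \<theta>)" "{0..1}" 1 "-1"]
            borel_slices(1)[OF mv(2)] borel_slices(1)[OF mP] p2 i by (simp add: d_def)
        let ?B = "LBINT t:{0..1}. (d t)\<^sup>2"
        have key: "(v (t, \<theta>) - ?U (t, \<theta>))\<^sup>2 \<le> 2 * (v (0, \<theta>) - \<tau> \<theta>)\<^sup>2 + 2 * ?B" if t: "t \<in> {0..1}" for t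
        proof -
          define e where "e = v (t, \<theta>) - ?U (t, \<theta>)"
          define e0 where "e0 = v (0, \<theta>) - \<tau> \<theta>"
          have d2t: "L1_on {0..t} (\<lambda>t. (d t)\<^sup>2)" by (rule set_integrable_subset[OF d2]) (use t in auto)
          have "ac 0 t (\<lambda>t. v (t, \<theta>) - ?U (t, \<theta>)) d" by (rule ac_subinterval[OF D]) (use t in auto)
          from ac_increment_sq[OF this _ d2t] t have "(e - e0)\<^sup>2 \<le> t * (LBINT t:{0..t}. (d t)\<^sup>2)" by (simp add: e_def e0_def)
          also have "\<dots> \<le> 1 * (LBINT t:{0..t}. (d t)\<^sup>2)"
            using t by (intro mult_right_mono) (auto simp: set_lebesgue_integral_def intro!: Bochner_Integration.integral_nonneg)
          also have "\<dots> \<le> ?B" using t by (simp, intro LBINT_mono_set[OF d2]) auto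
          finally have "(e - e0)\<^sup>2 \<le> ?B" .
          \<comment> \<open>Expanding this square gives e^2 \<le> 2 e0^2 + 2 (e - e0)^2.\<close>
          moreover have "0 \<le> (e - 2 * e0)\<^sup>2" by simp
          ultimately show ?thesis unfolding e_def[symmetric] e0_def[symmetric] by (simp add: power2_eq_square algebra_simps)
        qed
        have "(\<integral>\<^sup>+t\<in>{0..1}. ennreal ((v (t, \<theta>) - ?U (t, \<theta>))\<^sup>2) \<partial>lborel)
          \<le> (\<integral>\<^sup>+(t::real). (2 * ennreal ((v (0, \<theta>) - \<tau> \<theta>)\<^sup>2) + 2 * ennreal ?B) * indicator {0..1} t \<partial>lborel)"
        proof (rule nn_integral_mono)
          fix t :: real
          have B0: "0 \<le> ?B" unfolding set_lebesgue_integral_def by (intro Bochner_Integration.integral_nonneg) auto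
          have "ennreal ((v (t, \<theta>) - ?U (t, \<theta>))\<^sup>2) \<le> 2 * ennreal ((v (0, \<theta>) - \<tau> \<theta>)\<^sup>2) + 2 * ennreal ?B" if "t \<in> {0..1}"
          proof -
            have "ennreal ((v (t, \<theta>) - ?U (t, \<theta>))\<^sup>2) \<le> ennreal (2 * (v (0, \<theta>) - \<tau> \<theta>)\<^sup>2 + 2 * ?B)"
              using key[OF that] by (rule ennreal_leI)
            also have "\<dots> = 2 * ennreal ((v (0, \<theta>) - \<tau> \<theta>)\<^sup>2) + 2 * ennreal ?B"
              using B0 by (simp add: ennreal_plus ennreal_mult)
            finally show ?thesis .
          qed
          then show "ennreal ((v (t, \<theta>) - ?U (t, \<theta>))\<^sup>2) * indicator {0..1} t \<le>
             (2 * ennreal ((v (0, \<theta>) - \<tau> \<theta>)\<^sup>2) + 2 * ennreal ?B) * indicator {0..1} t"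
            by (auto simp: indicator_def)
        qed
        also have "\<dots> = 2 * ennreal ((v (0, \<theta>) - \<tau> \<theta>)\<^sup>2) + 2 * ennreal ?B"
          by (subst nn_integral_cmult) (auto simp: nn_integral_indicator)
        also have "ennreal ?B = (\<integral>\<^sup>+t\<in>{0..1}. ennreal ((d t)\<^sup>2) \<partial>lborel)"
          by (rule nn_integral_sq_set[OF d2, symmetric])
        finally show ?thesis unfolding d_def by (rule mult_right_mono) simp
      qed (simp add: circ_def)
    qed
  qed
  also have "\<dots> = (\<integral>\<^sup>+\<theta>. (2 * (ennreal ((v (0, \<theta>) - \<tau> \<theta>)\<^sup>2) * indicator {0..<2*pi} \<theta>) +
      2 * ((\<integral>\<^sup>+t\<in>{0..1}. ennreal ((pd 1 v (t, \<theta>) - P (t, \<theta>))\<^sup>2) \<partial>lborel) * indicator {0..<2*pi} \<theta>)) \<partial>lborel)"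
    by (intro nn_integral_cong) (auto simp: indicator_def)
  also have "\<dots> = 2 * (\<integral>\<^sup>+\<theta>\<in>{0..<2*pi}. ennreal ((v (0, \<theta>) - \<tau> \<theta>)\<^sup>2) \<partial>lborel)
       + 2 * (\<integral>\<^sup>+\<theta>\<in>{0..<2*pi}. (\<integral>\<^sup>+t\<in>{0..1}. ennreal ((pd 1 v (t, \<theta>) - P (t, \<theta>))\<^sup>2) \<partial>lborel) \<partial>lborel)"
    using m0 mB by (subst nn_integral_add) (auto simp: nn_integral_cmult)
  also have "(\<integral>\<^sup>+\<theta>\<in>{0..<2*pi}. (\<integral>\<^sup>+t\<in>{0..1}. ennreal ((pd 1 v (t, \<theta>) - P (t, \<theta>))\<^sup>2) \<partial>lborel) \<partial>lborel)
     = (\<integral>\<^sup>+z\<in>collar. ennreal ((pd 1 v z - P z)\<^sup>2) \<partial>lborel)"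
    unfolding c by (rule nn_integral_Times[OF mm(2), symmetric]) auto
  finally show ?thesis .
qed

text \<open>In the collar the C^1 approximants of \<open>has_trace\<close> converge in L^2 both to
  \<open>u\<close> and to \<open>trace_rep\<close>, so the two agree there. Beyond the collar they
  agree because both have derivative \<open>P\<close> on almost every line.\<close>

lemma trace_representation:
  assumes w: "has_weak_gradient u (weak_gradient u)" and tr: "has_trace u \<tau>"
    and P2: "L1_on strip (\<lambda>z. (weak_gradient u z $ 1)\<^sup>2)"
  shows "AE z in lborel. z \<in> strip \<longrightarrow> u z = trace_rep (\<lambda>z. weak_gradient u z $ 1) \<tau> z"
    and "L1_on circ (\<lambda>\<theta>. (\<tau> \<theta>)\<^sup>2)"
proof -
  define P where "P z = weak_gradient u z $ 1" for z
  let ?U = "trace_rep P \<tau>"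
  have mu: "u \<in> Bor" and mP: "P \<in> Bor"
    using weak_gradient_measurable[OF w] by (auto simp: P_def[abs_def])
  have m\<tau>: "\<tau> \<in> Bor" using tr by (simp add: has_trace_def)
  have mU: "?U \<in> Bor" by (rule trace_rep_measurable[OF mP m\<tau>])
  have P2: "L1_on strip (\<lambda>z. (P z)\<^sup>2)" using P2 by (simp add: P_def)
  obtain v where v: "\<And>n::nat. C1_function (v n)"
    and v1: "(\<lambda>n. \<integral>\<^sup>+x\<in>collar. ennreal ((v n x - u x)\<^sup>2) \<partial>lborel) \<longlonglongrightarrow> 0"
    and v2: "(\<lambda>n. \<integral>\<^sup>+x\<in>collar. ennreal ((pd 1 (v n) x - P x)\<^sup>2) \<partial>lborel) \<longlonglongrightarrow> 0"
    and v3: "(\<lambda>n. \<integral>\<^sup>+\<theta>\<in>{0..<2*pi}. ennreal ((v n (0, \<theta>) - \<tau> \<theta>)\<^sup>2) \<partial>lborel) \<longlonglongrightarrow> 0"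
    using tr unfolding has_trace_def P_def by auto
  have mv: "v n \<in> Bor" for n
    using C1_function_continuous[OF v] by (rule borel_measurable_continuous_onI)
  have mc: "collar \<in> sets borel" unfolding collar_def by (intro borel_Times) auto
  have "(\<integral>\<^sup>+z\<in>collar. ennreal ((u z - ?U z)\<^sup>2) \<partial>lborel) \<le>
     2 * (\<integral>\<^sup>+x\<in>collar. ennreal ((v n x - u x)\<^sup>2) \<partial>lborel) +
     2 * (2 * (\<integral>\<^sup>+\<theta>\<in>{0..<2*pi}. ennreal ((v n (0, \<theta>) - \<tau> \<theta>)\<^sup>2) \<partial>lborel)
       + 2 * (\<integral>\<^sup>+x\<in>collar. ennreal ((pd 1 (v n) x - P x)\<^sup>2) \<partial>lborel))" for n
  proof -
    have "(\<integral>\<^sup>+z\<in>collar. ennreal ((u z - ?U z)\<^sup>2) \<partial>lborel) \<le>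
      (\<integral>\<^sup>+z. (2 * (ennreal ((v n z - u z)\<^sup>2) * indicator collar z) + 2 * (ennreal ((v n z - ?U z)\<^sup>2) * indicator collar z)) \<partial>lborel)"
    proof (rule nn_integral_mono)
      fix z
      have "(u z - ?U z)\<^sup>2 \<le> 2 * (v n z - u z)\<^sup>2 + 2 * (v n z - ?U z)\<^sup>2"
      proof -
        have "0 \<le> ((v n z - u z) + (v n z - ?U z))\<^sup>2" by simp
        then show ?thesis by (simp add: power2_eq_square algebra_simps)
      qed
      then have "ennreal ((u z - ?U z)\<^sup>2) \<le> ennreal (2 * (v n z - u z)\<^sup>2 + 2 * (v n z - ?U z)\<^sup>2)" by (rule ennreal_leI)
      also have "\<dots> = 2 * ennreal ((v n z - u z)\<^sup>2) + 2 * ennreal ((v n z - ?U z)\<^sup>2)"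
        by (simp add: ennreal_plus ennreal_mult)
      finally show "ennreal ((u z - ?U z)\<^sup>2) * indicator collar z \<le>
        2 * (ennreal ((v n z - u z)\<^sup>2) * indicator collar z) + 2 * (ennreal ((v n z - ?U z)\<^sup>2) * indicator collar z)"
        by (auto simp: indicator_def)
    qed
    also have "\<dots> = 2 * (\<integral>\<^sup>+x\<in>collar. ennreal ((v n x - u x)\<^sup>2) \<partial>lborel) + 2 * (\<integral>\<^sup>+x\<in>collar. ennreal ((v n x - ?U x)\<^sup>2) \<partial>lborel)"
      using mv mu mU mc by (subst nn_integral_add) (auto simp: nn_integral_cmult)
    finally show ?thesis
      by (rule order_trans) (intro add_mono mult_left_mono trace_approx[OF mP m\<tau> P2 v] order_refl, auto)
  qed
  moreover have "(\<lambda>n. 2 * (\<integral>\<^sup>+x\<in>collar. ennreal ((v n x - u x)\<^sup>2) \<partial>lborel) +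
     2 * (2 * (\<integral>\<^sup>+\<theta>\<in>{0..<2*pi}. ennreal ((v n (0, \<theta>) - \<tau> \<theta>)\<^sup>2) \<partial>lborel)
       + 2 * (\<integral>\<^sup>+x\<in>collar. ennreal ((pd 1 (v n) x - P x)\<^sup>2) \<partial>lborel))) \<longlonglongrightarrow> 2 * 0 + 2 * (2 * 0 + 2 * 0)"
    by (intro tendsto_add ennreal_tendsto_cmult v1 v2 v3) auto
  ultimately have "(\<integral>\<^sup>+z\<in>collar. ennreal ((u z - ?U z)\<^sup>2) \<partial>lborel) \<le> 2 * 0 + 2 * (2 * 0 + 2 * 0)"
    by (intro LIMSEQ_le_const) auto
  then have "(\<integral>\<^sup>+z\<in>collar. ennreal ((u z - ?U z)\<^sup>2) \<partial>lborel) = 0" by simp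
  then have "AE z in lborel. ennreal ((u z - ?U z)\<^sup>2) * indicator collar z = 0"
    using mu mU mc by (subst (asm) nn_integral_0_iff_AE) auto
  then have uU: "AE z in lborel. z \<in> collar \<longrightarrow> u z = ?U z"
    by eventually_elim (auto simp: indicator_def split: if_splits)
  obtain G where G: "G \<in> Bor" "AE z in lborel. z \<in> halfplane \<longrightarrow> u z = G z"
    "AE \<theta> in lborel. \<forall>a b. {a..b} \<subseteq> {0<..} \<longrightarrow> ac a b (\<lambda>t. G (t, \<theta>)) (\<lambda>t. P (t, \<theta>))"
    using t_slices[OF w] unfolding P_def by blast
  have t0: "AE t in lborel. t \<noteq> (0::real)" by (simp add: AE_lborel_singleton)
  have "AE \<theta> in lborel. AE t in lborel. (t, \<theta>) \<in> strip \<longrightarrow> u (t, \<theta>) = ?U (t, \<theta>)"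
    using AE_product(2)[OF uU] AE_product(2)[OF G(2)] G(3) AE_strip_slices[OF mP P2]
  proof eventually_elim
    case (elim \<theta>)
    show ?case
    proof (cases "\<theta> \<in> circ")
      case True
      have U: "ac 0 b (\<lambda>t. ?U (t, \<theta>)) (\<lambda>t. P (t, \<theta>))" for b
        using elim(4) True by (intro trace_rep_ac) auto
      have "AE t in lborel. 0 < t \<longrightarrow> t < 1 \<longrightarrow> G (t, \<theta>) = ?U (t, \<theta>)"
        using elim(1,2) by eventually_elim (use True in \<open>auto simp: collar_def halfplane_def circ_def\<close>)
      \<comment> \<open>One common value inside the collar is enough: from there \<open>G\<close>
        and \<open>?U\<close> have equal increments along the line.\<close>
      from AE_interval_ex[OF this, of 0 1]
      obtain s where s: "0 < s" "s < 1" "G (s, \<theta>) = ?U (s, \<theta>)" by auto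
      have eq: "G (t, \<theta>) = ?U (t, \<theta>)" if t: "0 < t" for t
      proof -
        let ?a = "min s t" and ?b = "max s t"
        have "{?a..?b} \<subseteq> {0<..}" using s t by auto
        then have g: "ac ?a ?b (\<lambda>t. G (t, \<theta>)) (\<lambda>t. P (t, \<theta>))" using elim(3) by blast
        have "ac ?a ?b (\<lambda>t. ?U (t, \<theta>)) (\<lambda>t. P (t, \<theta>))"
          by (rule ac_subinterval[OF U[of ?b]]) (use s t in auto)
        from ac_lin[OF g this, of 1 "-1"]
        have "ac ?a ?b (\<lambda>t. 1 * G (t, \<theta>) + -1 * ?U (t, \<theta>)) (\<lambda>t. 1 * P (t, \<theta>) + -1 * P (t, \<theta>))" .
        from ac_zero_const[OF this, of s] ac_zero_const[OF this, of t] s(3) show ?thesis by auto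
      qed
      show ?thesis
        using elim(2) t0 by eventually_elim (use eq in \<open>auto simp: strip_def halfplane_def\<close>)
    qed (auto simp: strip_def circ_def)
  qed
  then show "AE z in lborel. z \<in> strip \<longrightarrow> u z = trace_rep (\<lambda>z. weak_gradient u z $ 1) \<tau> z"
    unfolding P_def[abs_def, symmetric]
  proof (rule AE_productI'[where Q="\<lambda>z. z \<in> strip \<longrightarrow> u z = ?U z"])
    have "{z. z \<in> strip \<longrightarrow> u z = ?U z} = (- strip) \<union> {z \<in> space borel. u z = ?U z}" by auto
    moreover have "{z \<in> space borel. u z = ?U z} \<in> sets borel" using mu mU by (rule borel_measurable_eq)
    ultimately show "{z. z \<in> strip \<longrightarrow> u z = ?U z} \<in> sets borel" using ray_circ(4) by auto
  qed
  \<comment> \<open>A single approximant with finite boundary error makes \<tau> square integrable,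
    since the approximant is continuous on the closed circle interval.\<close>
  have "eventually (\<lambda>n. (\<integral>\<^sup>+\<theta>\<in>{0..<2*pi}. ennreal ((v n (0, \<theta>) - \<tau> \<theta>)\<^sup>2) \<partial>lborel) < 1) sequentially"
    by (rule order_tendstoD(2)[OF v3]) simp
  then obtain n where n: "(\<integral>\<^sup>+\<theta>\<in>circ. ennreal ((v n (0, \<theta>) - \<tau> \<theta>)\<^sup>2) \<partial>lborel) < 1"
    by (auto simp: eventually_sequentially circ_def)
  have 1: "L1_on circ (\<lambda>\<theta>. (v n (0, \<theta>) - \<tau> \<theta>)\<^sup>2)"
    by (rule set_integrable_sq_nn) (use n borel_slices(2)[OF mv[of n], of 0] m\<tau> ray_circ in \<open>auto intro: order_less_trans simp: less_top[symmetric]\<close>)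
  have "continuous_on UNIV (\<lambda>\<theta>. v n (0, \<theta>))" by (rule c1_continuous[OF C1_function_slices(2)[OF v]])
  then have "L1_on {0..2*pi} (\<lambda>\<theta>. (v n (0, \<theta>))\<^sup>2)"
    by (intro borel_integrable_atLeastAtMost' continuous_intros) (auto intro: continuous_on_subset)
  then have 2: "L1_on circ (\<lambda>\<theta>. (v n (0, \<theta>))\<^sup>2)"
    by (rule set_integrable_subset) (auto simp: circ_def)
  have "L1_on circ (\<lambda>\<theta>. (1 * v n (0, \<theta>) + -1 * (v n (0, \<theta>) - \<tau> \<theta>))\<^sup>2)"
    by (rule L2_add_integrable) (use borel_slices(2)[OF mv[of n], of 0] m\<tau> ray_circ 1 2 in auto)
  then show "L1_on circ (\<lambda>\<theta>. (\<tau> \<theta>)\<^sup>2)" by simp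
qed

text \<open>\<open>bdry_trace\<close> is a choice too. Two traces of \<open>u\<close> give two
  representatives whose difference is independent of t, and both equal \<open>u\<close> almost
  everywhere.\<close>

lemma trace_unique:
  assumes w: "has_weak_gradient u (weak_gradient u)" and tr: "has_trace u \<tau>" "has_trace u \<tau>'"
    and P2: "L1_on strip (\<lambda>z. (weak_gradient u z $ 1)\<^sup>2)"
  shows "AE \<theta> in lborel. \<theta> \<in> circ \<longrightarrow> \<tau> \<theta> = \<tau>' \<theta>"
  using AE_product(2)[OF trace_representation(1)[OF w tr(1) P2]] AE_product(2)[OF trace_representation(1)[OF w tr(2) P2]]
proof eventually_elim
  case (elim \<theta>)
  then have "AE t in lborel. (t, \<theta>) \<in> strip \<longrightarrow> \<tau> \<theta> = \<tau>' \<theta>"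
    by eventually_elim (auto simp: trace_rep_def)
  from AE_interval_ex[OF this, of 0 1] show ?case by (auto simp: strip_def circ_def)
qed

lemma has_trace_bdry_trace: "has_trace u \<tau> \<Longrightarrow> has_trace u (bdry_trace u)"
  unfolding bdry_trace_def by (rule someI[of "has_trace u"])

lemma C1_has_trace:
  assumes u: "C1_function u" and per: "periodic u"
  shows "has_trace u (\<lambda>\<theta>. u (0, \<theta>))"
  unfolding has_trace_def
proof (intro conjI exI[of _ "\<lambda>_. u"] allI assms)
  show "(\<lambda>\<theta>. u (0, \<theta>)) \<in> Bor"
    by (rule borel_slices(2)[OF borel_measurable_continuous_onI[OF C1_function_continuous[OF u]]])
  fix j :: 2
  have "AE t in lborel. t \<noteq> (0::real)" by (simp add: AE_lborel_singleton)
  then have "AE z in lborel. fst (z::real\<times>real) \<noteq> 0"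
    by (intro AE_productI) (auto intro!: borel_open open_Collect_neq continuous_intros)
  then have "AE z in lborel. ennreal ((pd j u z - weak_gradient u z $ j)\<^sup>2) * indicator collar z = 0"
    using weak_gradient_C1[OF u]
    by eventually_elim (auto simp: indicator_def collar_def halfplane_def)
  then have "(\<integral>\<^sup>+z\<in>collar. ennreal ((pd j u z - weak_gradient u z $ j)\<^sup>2) \<partial>lborel) = (\<integral>\<^sup>+(z::real\<times>real). 0 \<partial>lborel)"
    by (rule nn_integral_cong_AE)
  then show "(\<lambda>n. \<integral>\<^sup>+z\<in>collar. ennreal ((pd j u z - weak_gradient u z $ j)\<^sup>2) \<partial>lborel) \<longlonglongrightarrow> 0" by simp
qed auto

text \<open>Everything that the energy estimates need to know about one component of a variation: its
  partial derivatives \<open>P\<close>, \<open>R\<close> and its trace \<open>\<tau>\<close>, linked by absolute continuity on almost all lines.\<close>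

definition strip_function ::
    "(real \<times> real \<Rightarrow> real) \<Rightarrow> (real \<times> real \<Rightarrow> real) \<Rightarrow> (real \<times> real \<Rightarrow> real) \<Rightarrow> (real \<Rightarrow> real) \<Rightarrow> bool" where
  "strip_function u P R \<tau> \<longleftrightarrow>
     u \<in> Bor \<and> P \<in> Bor \<and> R \<in> Bor \<and> \<tau> \<in> Bor \<and>
     L1_on strip (\<lambda>z. (P z)\<^sup>2) \<and> L1_on strip (\<lambda>z. (R z)\<^sup>2) \<and>
     L1_on circ (\<lambda>\<theta>. (\<tau> \<theta>)\<^sup>2) \<and>
     (AE z in lborel. z \<in> strip \<longrightarrow> u z = trace_rep P \<tau> z) \<and>
     (AE t in lborel. t \<in> ray \<longrightarrow> (\<exists>g. ac 0 (2*pi) g (\<lambda>\<theta>. R (t, \<theta>)) \<and> g (2*pi) = g 0 \<and>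
        (AE \<theta> in lborel. \<theta> \<in> circ \<longrightarrow> u (t, \<theta>) = g \<theta>)))"

lemma admissible_strip_function:
  assumes w: "has_weak_gradient u p" and tr: "has_trace u \<tau>" and per: "periodic u"
    and "L1_on strip (\<lambda>z. (weak_gradient u z $ 1)\<^sup>2)"
    and "L1_on strip (\<lambda>z. (weak_gradient u z $ 2)\<^sup>2)"
  shows "strip_function u (\<lambda>z. weak_gradient u z $ 1) (\<lambda>z. weak_gradient u z $ 2) (bdry_trace u)"
proof -
  note W = has_weak_gradient_weak_gradient[OF w] and T = has_trace_bdry_trace[OF tr]
  have m: "bdry_trace u \<in> Bor" using T by (simp add: has_trace_def)
  have "AE t in lborel. t \<noteq> (0::real)" by (simp add: AE_lborel_singleton)
  then have "AE t in lborel. t \<in> ray \<longrightarrow> (\<exists>g. ac 0 (2*pi) g (\<lambda>\<theta>. weak_gradient u (t, \<theta>) $ 2) \<and> g (2*pi) = g 0 \<and>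
        (AE \<theta> in lborel. \<theta> \<in> circ \<longrightarrow> u (t, \<theta>) = g \<theta>))"
    using theta_slices[OF W per]
  proof eventually_elim
    case (elim t)
    show ?case
    proof
      assume "t \<in> ray"
      then obtain g where g: "\<And>a b. ac a b g (\<lambda>\<theta>. weak_gradient u (t, \<theta>) $ 2)" "\<And>\<theta>. g (\<theta> + 2*pi) = g \<theta>"
        "AE \<theta> in lborel. u (t, \<theta>) = g \<theta>" using elim by (auto simp: ray_def)
      then show "\<exists>g. ac 0 (2*pi) g (\<lambda>\<theta>. weak_gradient u (t, \<theta>) $ 2) \<and> g (2*pi) = g 0 \<and>
        (AE \<theta> in lborel. \<theta> \<in> circ \<longrightarrow> u (t, \<theta>) = g \<theta>)"
        using g(2)[of 0] by (intro exI[of _ g]) auto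
    qed
  qed
  then show ?thesis
    unfolding strip_function_def
    using assms(4,5) trace_representation[OF W T assms(4)] weak_gradient_measurable[OF W] m by blast
qed

section \<open>One-dimensional energy estimates\<close>

definition sech2 :: "real \<Rightarrow> real" where
  "sech2 s = 1 - (tanh s)\<^sup>2"

lemma DERIV_tanh: "(tanh has_real_derivative sech2 s) (at s)"
  unfolding sech2_def by (auto intro!: derivative_eq_intros)

lemma DERIV_sech2: "(sech2 has_real_derivative - 2 * tanh s * sech2 s) (at s)"
  unfolding sech2_def[abs_def] by (auto intro!: derivative_eq_intros simp: power2_eq_square)

lemma sech2_alt: "sech2 s = 1 / (cosh s)\<^sup>2"
proof -
  have "0 < 1 + (sinh s)\<^sup>2" by (intro add_pos_nonneg) auto
  then show ?thesis by (simp add: sech2_def tanh_def power_divide cosh_square_eq field_simps)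
qed

lemma sech2_bounds: "0 < sech2 s" "sech2 s \<le> 1"
  by (simp add: sech2_alt, simp add: sech2_def)

lemma sech2_minus [simp]: "sech2 (- s) = sech2 s"
  by (simp add: sech2_def)

lemma continuous_on_tanh_sech2 [continuous_intros]:
  assumes "continuous_on A f"
  shows "continuous_on A (\<lambda>x. tanh (f x :: real))" "continuous_on A (\<lambda>x. sech2 (f x))"
proof -
  have "continuous_on UNIV (tanh :: real \<Rightarrow> real)" using DERIV_tanh DERIV_continuous_on by blast
  then show 1: "continuous_on A (\<lambda>x. tanh (f x :: real))" by (rule continuous_on_compose2) (use assms in auto)
  show "continuous_on A (\<lambda>x. sech2 (f x))" unfolding sech2_def by (intro continuous_intros 1)
qed

lemma sech2_le_exp: "sech2 s \<le> 4 * exp (- 2 * s)"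
proof -
  have "exp s / 2 \<le> cosh s" by (simp add: cosh_def)
  then have "(exp s / 2)\<^sup>2 \<le> (cosh s)\<^sup>2" by (intro power_mono) auto
  then have "(exp s)\<^sup>2 / 4 \<le> (cosh s)\<^sup>2" by (simp add: power_divide)
  then have "sech2 s \<le> 1 / ((exp s)\<^sup>2 / 4)" unfolding sech2_alt by (intro divide_left_mono) auto
  also have "\<dots> = 4 * exp (- 2 * s)" by (simp add: exp_minus exp_double[symmetric] field_simps)
  finally show ?thesis .
qed

section \<open>Integrals over the ray and the first angular mode\<close>

lemma integrable_exp_ray: "L1_on ray (\<lambda>t. exp (- t))"
proof -
  have "(\<integral>\<^sup>+(x::real). ennreal (exp (- x)) * indicator {0..} x \<partial>lborel) = 0 - (- exp (- 0 :: real))"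
  proof (rule nn_integral_FTC_atLeast)
    show "((\<lambda>x::real. - exp (- x)) \<longlongrightarrow> 0) at_top"
      using tendsto_minus[OF filterlim_compose[OF exp_at_bot filterlim_uminus_at_bot_at_top]] by simp
  qed (auto intro!: derivative_eq_intros)
  moreover have "(\<integral>\<^sup>+x. ennreal (norm (indicator {0..} x *\<^sub>R exp (- x :: real))) \<partial>lborel) = (\<integral>\<^sup>+(x::real). ennreal (exp (- x)) * indicator {0..} x \<partial>lborel)"
    by (intro nn_integral_cong) (auto simp: indicator_def)
  ultimately show ?thesis
    unfolding set_integrable_def ray_def by (intro integrableI_bounded) auto
qed

lemma sech2_measurable: "(\<lambda>t. sech2 (t + T)) \<in> Bor"
  by (intro borel_measurable_continuous_onI continuous_intros)

text \<open>The weight with the extra factor t is there because a function of finite Dirichlet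
  energy may grow like the square root of t, so its square may grow linearly.\<close>

lemma sech2_integrable_ray:
  "L1_on ray (\<lambda>t. sech2 (t + T))" "L1_on ray (\<lambda>t. t * sech2 (t + T))"
proof -
  have i: "L1_on ray (\<lambda>t. (4 * exp (- 2 * T)) * exp (- t))"
    by (intro set_integrable_mult_right integrable_exp_ray)
  have e: "4 * exp (- 2 * (t + T)) = (4 * exp (- 2 * T)) * exp (- t) * exp (- t)" for t :: real
    by (simp add: exp_add[symmetric] algebra_simps)
  have te: "t * exp (- t) \<le> 1" if "0 \<le> t" for t :: real
  proof -
    have "t \<le> exp t" using exp_ge_add_one_self[of t] by linarith
    then show ?thesis by (simp add: exp_minus field_simps)
  qed
  show "L1_on ray (\<lambda>t. sech2 (t + T))"
  proof (rule L1_bound[OF i])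
    show "set_borel_measurable lborel ray (\<lambda>t. sech2 (t + T))"
      by (intro Bor_set sech2_measurable ray_circ)
    have "sech2 (t + T) \<le> (4 * exp (- 2 * T)) * exp (- t)" if "0 \<le> t" for t
    proof -
      have "(4 * exp (- 2 * T)) * exp (- t) * exp (- t) \<le> (4 * exp (- 2 * T)) * exp (- t) * 1"
        using that by (intro mult_left_mono) auto
      then show ?thesis using sech2_le_exp[of "t + T"] unfolding e[of t] by linarith
    qed
    then show "AE t in lborel. t \<in> ray \<longrightarrow> \<bar>sech2 (t + T)\<bar> \<le> (4 * exp (- 2 * T)) * exp (- t)"
      using sech2_bounds(1) by (auto simp: ray_def abs_of_pos)
  qed
  show "L1_on ray (\<lambda>t. t * sech2 (t + T))"
  proof (rule L1_bound[OF i])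
    show "set_borel_measurable lborel ray (\<lambda>t. t * sech2 (t + T))"
      by (intro Bor_set borel_measurable_times sech2_measurable ray_circ) auto
    have "t * sech2 (t + T) \<le> (4 * exp (- 2 * T)) * exp (- t)" if t: "0 \<le> t" for t
    proof -
      have "t * sech2 (t + T) \<le> t * ((4 * exp (- 2 * T)) * exp (- t) * exp (- t))"
        using t sech2_le_exp[of "t + T"] unfolding e[of t] by (rule mult_left_mono[rotated])
      also have "\<dots> = (4 * exp (- 2 * T)) * exp (- t) * (t * exp (- t))" by simp
      also have "\<dots> \<le> (4 * exp (- 2 * T)) * exp (- t) * 1"
        using te[OF t] by (intro mult_left_mono) auto
      finally show ?thesis by simp
    qed
    then show "AE t in lborel. t \<in> ray \<longrightarrow> \<bar>t * sech2 (t + T)\<bar> \<le> (4 * exp (- 2 * T)) * exp (- t)"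
      using sech2_bounds(1) by (auto simp: ray_def abs_mult abs_of_pos)
  qed
qed

lemma ray_limit:
  fixes f :: "real \<Rightarrow> real"
  assumes "L1_on ray f"
  shows "((\<lambda>b. LBINT t:{0..b}. f t) \<longlongrightarrow> (LBINT t:ray. f t)) at_top"
  using tendsto_set_lebesgue_integral_at_top[of 0 lborel f] assms by (simp add: ray_def)

lemma ray_sub:
  fixes f :: "real \<Rightarrow> real"
  assumes "L1_on ray f" "0 \<le> a"
  shows "L1_on {a..b} f"
  by (rule set_integrable_subset[OF assms(1)]) (use assms(2) in \<open>auto simp: ray_def\<close>)

lemma integrable_limit_zero:
  fixes f :: "real \<Rightarrow> real"
  assumes i: "L1_on ray f" and nn: "\<And>t. 0 \<le> f t" and lim: "(f \<longlongrightarrow> L) at_top"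
  shows "L = 0"
proof (rule ccontr)
  assume "L \<noteq> 0"
  moreover have "0 \<le> L" by (rule tendsto_lowerbound[OF lim]) (use nn in auto)
  ultimately have L: "L > 0" by simp
  have "eventually (\<lambda>t. f t > L / 2) at_top" by (rule order_tendstoD(1)[OF lim]) (use L in simp)
  then obtain N where N: "\<And>t. t \<ge> N \<Longrightarrow> f t > L / 2" by (auto simp: eventually_at_top_linorder)
  define a where "a = max N 0"
  define I where "I = (LBINT t:ray. f t)"
  \<comment> \<open>The length is chosen so that the constant L/2 integrates to \<open>I + 1\<close>
    over \<open>{a..b}\<close>, more than the whole integral.\<close>
  define b where "b = a + 2 * (I + 1) / L"
  have I0: "0 \<le> I" unfolding I_def set_lebesgue_integral_def by (intro Bochner_Integration.integral_nonneg) (use nn in auto)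
  have ab: "0 \<le> a" "a \<le> b" using L I0 by (auto simp: a_def b_def)
  have "I + 1 = (b - a) * (L / 2)" using L by (simp add: b_def)
  also have "\<dots> = (LBINT t:{a..b}. L / 2)" using ab by (simp add: set_lebesgue_integral_def)
  also have "\<dots> \<le> (LBINT t:{a..b}. f t)"
  proof (rule set_integral_mono)
    show "L1_on {a..b} (\<lambda>t. L / 2)" by (rule borel_integrable_atLeastAtMost'[of a b "\<lambda>_. L/2"]) auto
    show "L1_on {a..b} f" by (rule ray_sub[OF i ab(1)])
    show "L / 2 \<le> f t" if "t \<in> {a..b}" for t using N[of t] that by (simp add: a_def)
  qed
  also have "\<dots> \<le> I"
    unfolding I_def using ab nn by (intro LBINT_mono_set[OF i]) (auto simp: ray_def)
  finally show False by simp
qed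

text \<open>The Riccati identity with q = - tanh, the logarithmic derivative of 1/cosh. The
  potential 2 sech2 - 1 is the Jacobi potential reduced by the first angular eigenvalue 1.\<close>

lemma line_identity:
  assumes y: "\<And>b. ac 0 b y d" and y2: "L1_on ray (\<lambda>t. (y t)\<^sup>2)" and d2: "L1_on ray (\<lambda>t. (d t)\<^sup>2)"
    and mm: "y \<in> Bor" "d \<in> Bor"
  shows "(LBINT t:ray. (d t)\<^sup>2) - (LBINT t:ray. (2 * sech2 (t + T) - 1) * (y t)\<^sup>2)
     = (LBINT t:ray. (d t + tanh (t + T) * y t)\<^sup>2) + tanh T * (y 0)\<^sup>2"
    and "L1_on ray (\<lambda>t. (d t + tanh (t + T) * y t)\<^sup>2)"
    and "L1_on ray (\<lambda>t. (2 * sech2 (t + T) - 1) * (y t)\<^sup>2)"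
proof -
  have mt: "(\<lambda>t. tanh (t + T)) \<in> Bor" by (intro borel_measurable_continuous_onI continuous_intros)
  have tb: "\<bar>tanh s\<bar> \<le> 1" for s :: real using tanh_real_bounds[of s] by auto
  have "L1_on ray (\<lambda>t. (y t)\<^sup>2 * (tanh (t + T))\<^sup>2)"
    by (rule L1_mult_bounded(1)[OF y2, of _ 1])
       (use tb mt ray_circ in \<open>auto intro!: Bor_set simp: abs_square_le_1\<close>)
  then have ty2: "L1_on ray (\<lambda>t. (tanh (t + T) * y t)\<^sup>2)" by (simp add: power_mult_distrib mult.commute)
  show i1: "L1_on ray (\<lambda>t. (d t + tanh (t + T) * y t)\<^sup>2)"
    using L2_add_integrable[of d "\<lambda>t. tanh (t + T) * y t" ray 1 1] mm mt ty2 d2 ray_circ by auto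
  have sb: "\<bar>2 * sech2 s - 1\<bar> \<le> 1" for s using sech2_bounds[of s] by (auto simp: abs_le_iff)
  show i2: "L1_on ray (\<lambda>t. (2 * sech2 (t + T) - 1) * (y t)\<^sup>2)"
    by (rule L1_mult_bounded(2)[OF y2, of _ 1])
       (use sb sech2_measurable ray_circ in \<open>auto intro!: Bor_set\<close>)
  define c where "c = (LBINT t:ray. (d t + tanh (t + T) * y t)\<^sup>2) + tanh T * (y 0)\<^sup>2
     - ((LBINT t:ray. (d t)\<^sup>2) - (LBINT t:ray. (2 * sech2 (t + T) - 1) * (y t)\<^sup>2))"
  have id: "tanh (b + T) * (y b)\<^sup>2 = (LBINT t:{0..b}. (d t + tanh (t + T) * y t)\<^sup>2) + tanh T * (y 0)\<^sup>2
     - ((LBINT t:{0..b}. (d t)\<^sup>2) - (LBINT t:{0..b}. (2 * sech2 (t + T) - 1) * (y t)\<^sup>2))" if "0 \<le> b" for b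
  proof -
    have "((\<lambda>t. - tanh (t + T)) has_real_derivative - (2 * sech2 (x + T) - 1) - (- tanh (x + T))\<^sup>2) (at x)" for x
      by (auto intro!: derivative_eq_intros DERIV_chain2[OF DERIV_tanh] simp: sech2_def)
    from riccati_identity(2)[OF y that ray_sub[OF d2] this]
    show ?thesis by (simp add: continuous_intros)
  qed
  have "((\<lambda>b. (LBINT t:{0..b}. (d t + tanh (t + T) * y t)\<^sup>2) + tanh T * (y 0)\<^sup>2
     - ((LBINT t:{0..b}. (d t)\<^sup>2) - (LBINT t:{0..b}. (2 * sech2 (t + T) - 1) * (y t)\<^sup>2))) \<longlongrightarrow> c) at_top"
    unfolding c_def by (intro tendsto_intros ray_limit i1 i2 d2)
  then have l1: "((\<lambda>b. tanh (b + T) * (y b)\<^sup>2) \<longlongrightarrow> c) at_top"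
    by (rule Lim_transform_eventually) (rule eventually_mono[OF eventually_ge_at_top[of 0]], simp add: id)
  have l2: "((\<lambda>b. tanh (b + T)) \<longlongrightarrow> 1) at_top"
    by (rule filterlim_compose[OF tanh_real_at_top], subst add.commute,
        rule filterlim_tendsto_add_at_top[OF tendsto_const filterlim_ident])
  \<comment> \<open>The boundary term at \<open>b\<close> converges because all other terms do.
    Dividing by tanh, which tends to 1, shows that the square of \<open>y\<close> has a limit;
    integrability makes this limit 0.\<close>
  have "((\<lambda>b. tanh (b + T) * (y b)\<^sup>2 / tanh (b + T)) \<longlongrightarrow> c / 1) at_top"
    by (intro tendsto_divide l1 l2) auto
  moreover have "eventually (\<lambda>b. tanh (b + T) * (y b)\<^sup>2 / tanh (b + T) = (y b)\<^sup>2) at_top"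
    using eventually_gt_at_top[of "- T"] by eventually_elim auto
  ultimately have "((\<lambda>b. (y b)\<^sup>2) \<longlongrightarrow> c) at_top" by (simp add: tendsto_cong)
  from integrable_limit_zero[OF y2 _ this] have "c = 0" by simp
  then show "(LBINT t:ray. (d t)\<^sup>2) - (LBINT t:ray. (2 * sech2 (t + T) - 1) * (y t)\<^sup>2)
     = (LBINT t:ray. (d t + tanh (t + T) * y t)\<^sup>2) + tanh T * (y 0)\<^sup>2" by (simp add: c_def)
qed

section \<open>The Hardy inequality at the neck and radial functions\<close>

lemma x_le_sinh_cosh:
  assumes "0 \<le> x"
  shows "x \<le> sinh x * cosh (x::real)"
proof -
  have "sinh 0 * cosh 0 - 0 \<le> sinh x * cosh x - x"
  proof (rule DERIV_nonneg_imp_nondecreasing[OF assms])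
    fix y :: real
    show "\<exists>z. ((\<lambda>x. sinh x * cosh x - x) has_real_derivative z) (at y) \<and> 0 \<le> z"
      by (rule exI[of _ "2 * (sinh y)\<^sup>2"])
         (auto intro!: derivative_eq_intros simp: power2_eq_square cosh_square_eq[unfolded power2_eq_square])
  qed
  then show ?thesis by simp
qed

text \<open>The weight is the logarithmic derivative of tanh, which solves w'' + 2 sech2 w = 0 and
  has its only zero at the neck x = 0.\<close>

lemma DERIV_catenoid_weight:
  assumes "x \<noteq> (0::real)"
  shows "((\<lambda>x. 1 / (sinh x * cosh x)) has_real_derivative (- (2 * sech2 x) - (1 / (sinh x * cosh x))\<^sup>2)) (at x)"
proof -
  have nz: "sinh x \<noteq> 0" "cosh x \<noteq> 0" using assms by auto
  have "((\<lambda>x. 1 / (sinh x * cosh x)) has_real_derivative - ((cosh x)\<^sup>2 + (sinh x)\<^sup>2) / (sinh x * cosh x)\<^sup>2) (at x)"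
    using nz by (auto intro!: derivative_eq_intros simp: power2_eq_square)
  moreover have "- ((cosh x)\<^sup>2 + (sinh x)\<^sup>2) / (sinh x * cosh x)\<^sup>2 = - (2 * sech2 x) - (1 / (sinh x * cosh x))\<^sup>2"
    using nz unfolding sech2_alt by (simp add: field_simps power_mult_distrib) (simp add: cosh_square_eq algebra_simps)
  ultimately show ?thesis by simp
qed

lemma catenoid_hardy:
  assumes f: "ac 0 b f d" and b: "0 < b" and d2: "L1_on {0..b} (\<lambda>x. (d x)\<^sup>2)" and f0: "f 0 = 0"
  shows "1 / (sinh b * cosh b) * (f b)\<^sup>2 + (LBINT x:{0..b}. 2 * sech2 x * (f x)\<^sup>2) \<le> (LBINT x:{0..b}. (d x)\<^sup>2)"
proof (rule hardy(1)[OF f b d2 f0])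
  show "1 / (sinh x * cosh x) \<le> 1 / x" if "0 < x" "x \<le> b" for x
    using that x_le_sinh_cosh[of x] by (intro divide_left_mono) auto
qed (use DERIV_catenoid_weight sech2_bounds(1) in \<open>auto intro!: continuous_intros simp: less_imp_le\<close>)

text \<open>One face of the index form on functions of t alone, up to the factor 1/(2 pi) that
  arises because \<open>m\<close> will be a circle integral and not an average.\<close>

definition radial_form :: "real \<Rightarrow> (real \<Rightarrow> real) \<Rightarrow> (real \<Rightarrow> real) \<Rightarrow> real" where
  "radial_form T m d = (LBINT t:ray. (d t)\<^sup>2) - (LBINT t:ray. 2 * sech2 (t + T) * (m t)\<^sup>2) - tanh T * (m 0)\<^sup>2"

text \<open>For T > 0 the ray misses the neck and the weight 1/(sinh cosh) is regular on it. For T <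
  0 it is singular at t = -T, where \<open>m\<close> vanishes, and Hardy's inequality applies on
  both sides. With the curvature term the boundary coefficient becomes -1/(sinh T cosh T) - tanh T =
  -1/tanh T.\<close>

lemma radial_form_lower_bound:
  assumes m: "\<And>b. ac 0 b m d" and d2: "L1_on ray (\<lambda>t. (d t)\<^sup>2)"
    and m2: "L1_on ray (\<lambda>t. sech2 (t + T) * (m t)\<^sup>2)"
    and T: "T > 0 \<or> T < 0 \<and> m (- T) = 0"
  shows "- (m 0)\<^sup>2 / tanh T \<le> radial_form T m d"
proof -
  have m2': "L1_on ray (\<lambda>t. 2 * sech2 (t + T) * (m t)\<^sup>2)"
    using set_integrable_mult_right[OF m2, of 2] by (simp add: mult.assoc)
  define B where "B = - (1 / (sinh T * cosh T)) * (m 0)\<^sup>2"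
  have "B \<le> (LBINT t:ray. (d t)\<^sup>2) - (LBINT t:ray. 2 * sech2 (t + T) * (m t)\<^sup>2)"
  proof (rule tendsto_lowerbound)
    show "((\<lambda>b. (LBINT t:{0..b}. (d t)\<^sup>2) - (LBINT t:{0..b}. 2 * sech2 (t + T) * (m t)\<^sup>2)) \<longlongrightarrow>
        (LBINT t:ray. (d t)\<^sup>2) - (LBINT t:ray. 2 * sech2 (t + T) * (m t)\<^sup>2)) at_top"
      by (intro tendsto_intros ray_limit d2 m2')
    show "\<forall>\<^sub>F b in at_top. B \<le> (LBINT t:{0..b}. (d t)\<^sup>2) - (LBINT t:{0..b}. 2 * sech2 (t + T) * (m t)\<^sup>2)"
      using eventually_gt_at_top[of "max 0 (- T)"]
    proof eventually_elim
      case (elim b)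
      then have b: "0 < b" "- T < b" by auto
      show ?case
      proof (cases "T > 0")
        case True
        have "((\<lambda>t. 1 / (sinh (t + T) * cosh (t + T))) has_real_derivative
            - (2 * sech2 (x + T)) - (1 / (sinh (x + T) * cosh (x + T)))\<^sup>2) (at x)" if "0 \<le> x" for x
        proof -
          have "x + T \<noteq> 0" using that True by simp
          from DERIV_shift[THEN iffD1, OF DERIV_catenoid_weight[OF this]] show ?thesis .
        qed
        from riccati_identity(2)[OF m less_imp_le[OF b(1)] ray_sub[OF d2] this]
        have "(LBINT t:{0..b}. (d t)\<^sup>2) - (LBINT t:{0..b}. 2 * sech2 (t + T) * (m t)\<^sup>2) =
          (LBINT x:{0..b}. (d x - 1 / (sinh (x + T) * cosh (x + T)) * m x)\<^sup>2)
          + 1 / (sinh (b + T) * cosh (b + T)) * (m b)\<^sup>2 + B"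
          by (simp add: B_def continuous_intros)
        moreover have "0 \<le> (LBINT x:{0..b}. (d x - 1 / (sinh (x + T) * cosh (x + T)) * m x)\<^sup>2)"
          unfolding set_lebesgue_integral_def by (intro Bochner_Integration.integral_nonneg) auto
        moreover have "0 \<le> 1 / (sinh (b + T) * cosh (b + T)) * (m b)\<^sup>2" using b True by (intro mult_nonneg_nonneg) auto
        ultimately show ?thesis by linarith
      next
        case False
        with T have T: "T < 0" "m (- T) = 0" by auto
        define a where "a = - T"
        have a: "0 < a" "a < b" "m a = 0" using T b by (auto simp: a_def)
        have i2: "L1_on {x..y} (\<lambda>t. (d t)\<^sup>2)" "L1_on {x..y} (\<lambda>t. 2 * sech2 (t + T) * (m t)\<^sup>2)"
          if "0 \<le> x" for x y using ray_sub[OF d2 that] ray_sub[OF m2' that] by auto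
        \<comment> \<open>The neck sits at \<open>a\<close>. The left piece is reflected and the
          right one shifted, so that each starts at the neck, where \<open>m\<close> vanishes. Only
          the left one contributes a boundary term on \<Gamma>.\<close>
        have "ac 0 a (\<lambda>x. m (- (x + - a))) (\<lambda>x. - d (- (x + - a)))"
          using ac_shift[OF ac_reflect[OF m[of a]], of "- a"] by simp
        then have r: "ac 0 a (\<lambda>x. m (a - x)) (\<lambda>x. - d (a - x))" by simp
        have "L1_on {0..a} (\<lambda>x. (- d (a - x))\<^sup>2)"
          using LBINT_reflect(2)[where F="\<lambda>x. (d x)\<^sup>2" and k=a and a=0 and b=a] i2(1)[of 0 a] by simp
        from catenoid_hardy[OF r a(1) this] a
        have "1 / (sinh a * cosh a) * (m 0)\<^sup>2 + (LBINT x:{0..a}. 2 * sech2 x * (m (a - x))\<^sup>2) \<le> (LBINT x:{0..a}. (d (a - x))\<^sup>2)"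
          by simp
        moreover have "(LBINT x:{0..a}. (d (a - x))\<^sup>2) = (LBINT t:{0..a}. (d t)\<^sup>2)"
          using LBINT_reflect(1)[where F="\<lambda>x. (d x)\<^sup>2" and k=a and a=0 and b=a] by simp
        moreover have "(LBINT x:{0..a}. 2 * sech2 x * (m (a - x))\<^sup>2) = (LBINT t:{0..a}. 2 * sech2 (t + T) * (m t)\<^sup>2)"
          using LBINT_reflect(1)[where F="\<lambda>t. 2 * sech2 (t + T) * (m t)\<^sup>2" and k=a and a=0 and b=a] by (simp add: a_def)
        moreover have "1 / (sinh a * cosh a) * (m 0)\<^sup>2 = B" by (simp add: a_def B_def)
        ultimately have 1: "B + (LBINT t:{0..a}. 2 * sech2 (t + T) * (m t)\<^sup>2) \<le> (LBINT t:{0..a}. (d t)\<^sup>2)" by simp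
        have "ac 0 (b - a) (\<lambda>x. m (x + a)) (\<lambda>x. d (x + a))"
          using ac_shift[OF ac_subinterval[OF m[of b], of a b], of a] a by simp
        moreover have "L1_on {0..b - a} (\<lambda>x. (d (x + a))\<^sup>2)"
          using LBINT_shift(2)[where F="\<lambda>x. (d x)\<^sup>2" and k=a and a=0 and b="b-a"] i2(1)[of a b] a by simp
        ultimately have "1 / (sinh (b - a) * cosh (b - a)) * (m b)\<^sup>2 + (LBINT x:{0..b-a}. 2 * sech2 x * (m (x + a))\<^sup>2) \<le> (LBINT x:{0..b-a}. (d (x + a))\<^sup>2)"
          using catenoid_hardy[of "b - a" "\<lambda>x. m (x + a)" "\<lambda>x. d (x + a)"] a by simp
        moreover have "(LBINT x:{0..b-a}. (d (x + a))\<^sup>2) = (LBINT t:{a..b}. (d t)\<^sup>2)"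
          using LBINT_shift(1)[where F="\<lambda>x. (d x)\<^sup>2" and k=a and a=0 and b="b-a"] by simp
        moreover have "(LBINT x:{0..b-a}. 2 * sech2 x * (m (x + a))\<^sup>2) = (LBINT t:{a..b}. 2 * sech2 (t + T) * (m t)\<^sup>2)"
          using LBINT_shift(1)[where F="\<lambda>t. 2 * sech2 (t + T) * (m t)\<^sup>2" and k=a and a=0 and b="b-a"] by (simp add: a_def)
        moreover have "0 \<le> 1 / (sinh (b - a) * cosh (b - a)) * (m b)\<^sup>2" using a by (intro mult_nonneg_nonneg) auto
        ultimately have 2: "(LBINT t:{a..b}. 2 * sech2 (t + T) * (m t)\<^sup>2) \<le> (LBINT t:{a..b}. (d t)\<^sup>2)" by simp
        show ?thesis
          using 1 2 LBINT_split[OF i2(1)[of 0 b], of a] LBINT_split[OF i2(2)[of 0 b], of a] a by simp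
      qed
    qed
  qed simp
  moreover have "B - tanh T * (m 0)\<^sup>2 = - (m 0)\<^sup>2 / tanh T"
  proof -
    have nz: "sinh T \<noteq> 0" "cosh T \<noteq> 0" using T by auto
    have "B - tanh T * (m 0)\<^sup>2 = - ((1 + (sinh T)\<^sup>2) / (sinh T * cosh T)) * (m 0)\<^sup>2"
      using nz by (simp add: B_def tanh_def field_simps power2_eq_square)
    also have "1 + (sinh T)\<^sup>2 = (cosh T)\<^sup>2" by (simp add: cosh_square_eq)
    also have "- ((cosh T)\<^sup>2 / (sinh T * cosh T)) * (m 0)\<^sup>2 = - (m 0)\<^sup>2 / tanh T"
      using nz by (simp add: tanh_def field_simps power2_eq_square)
    finally show ?thesis .
  qed
  ultimately show ?thesis by (simp add: radial_form_def)
qed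
text \<open>The du Bois-Reymond lemma on the half line, obtained from the planar representation
  theorem by viewing \<open>W\<close> as a function of the first variable with derivative 0.\<close>

lemma constant_of_integral_derivative:
  fixes W :: "real \<Rightarrow> real"
  assumes W: "W \<in> Bor" "\<And>a b. 0 < a \<Longrightarrow> L1_on {a..b} W"
    and z: "\<And>h h' r s. c1 h h' \<Longrightarrow> 0 < r \<Longrightarrow> (\<And>x. x \<notin> {r..s} \<Longrightarrow> h x = 0) \<Longrightarrow> (LINT x|lborel. W x * h' x) = 0"
  obtains K where "AE x in lborel. 0 < x \<longrightarrow> W x = K"
proof -
  interpret line_domain "{0<..}" UNIV 1 by unfold_locales auto
  have Wi: "L1_on {a..b} W" if "{a..b} \<subseteq> {0<..}" for a b
  proof (cases "a \<le> b")
    case True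
    then have "0 < a" using that by auto
    then show ?thesis by (rule W(2))
  qed (simp add: set_integrable_def)
  have F: "locint {0<..} UNIV (\<lambda>z. W (fst z))"
    unfolding locint_def
  proof (intro conjI allI impI)
    fix a b c d :: real assume "{a..b} \<subseteq> {0<..}"
    from L1_tensor[OF Wi[OF this] borel_integrable_atLeastAtMost'[of c d "\<lambda>_. 1"]]
    show "L1_on ({a..b}\<times>{c..d}) (\<lambda>z. W (fst z))" by simp
  qed (rule borel_fst_snd[OF W(1)])
  have D: "locint {0<..} UNIV (\<lambda>z. 0)" by (simp add: locint_def set_integrable_def)
  obtain G :: "real \<times> real \<Rightarrow> real" where G: "AE z in lborel. z \<in> {0<..} \<times> UNIV \<longrightarrow> W (fst z) = G z"
    "AE y in lborel. y \<in> UNIV \<longrightarrow> (\<forall>a b. {a..b} \<subseteq> {0<..} \<longrightarrow> ac a b (\<lambda>x. G (x, y)) (\<lambda>x. 0))"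
  proof (rule weak_derivative_imp_ac[OF F D])
    fix a a' b b' and r s r' s' :: real
    assume a: "c1 a a'" and b: "c1 b b'" and rs: "{r..s} \<subseteq> {0<..}"
      and az: "\<And>x. x \<notin> {r..s} \<Longrightarrow> a x = 0" and bz: "\<And>y. y \<notin> {r'..s'} \<Longrightarrow> b y = 0"
    have az': "x \<notin> {r..s} \<Longrightarrow> a' x = 0" for x by (rule c1_zero_outside[OF a az])
    have 0: "(LINT x|lborel. W x * a' x) = 0"
    proof (cases "r \<le> s")
      case True
      then show ?thesis using rs by (intro z[OF a _ az]) auto
    next
      case False
      then have "a' = (\<lambda>_. 0)" using az' by (intro ext) auto
      then show ?thesis by simp
    qed
    have ca: "continuous_on {r..s} a'" using c1D'[OF a] by (rule continuous_on_subset) auto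
    have cb: "continuous_on {r'..s'} b" using c1_continuous[OF b] by (rule continuous_on_subset) auto
    have "compact (a' ` {r..s})" using ca by (intro compact_continuous_image) auto
    then obtain B where B: "\<forall>y\<in>a' ` {r..s}. norm y \<le> B" using compact_imp_bounded bounded_iff by metis
    have i: "L1_on {r..s} (\<lambda>x. W x * a' x)"
      by (rule L1_mult_bounded(1)[where B=B, OF Wi[OF rs]])
         (use B in \<open>auto intro!: Bor_set borel_measurable_continuous_onI[OF c1D'[OF a]]\<close>)
    note T = L1_tensor[OF i borel_integrable_atLeastAtMost'[OF cb]]
    have zz: "(LINT z:{r..s}\<times>{r'..s'}|lborel. W (fst z) * a' (fst z) * b (snd z)) = (LINT z|lborel. W (fst z) * a' (fst z) * b (snd z))"
      by (rule set_integral_restrict(1)) (use az' bz in \<open>auto simp: mem_Times_iff\<close>)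
    have z1: "(LINT x:{r..s}|lborel. W x * a' x) = (LINT x|lborel. W x * a' x)"
      by (rule set_integral_restrict(1)) (use az' in auto)
    have "(LINT z|lborel. W (fst z) * a' (fst z) * b (snd z)) = (LBINT y:{r'..s'}. LBINT x:{r..s}. W x * a' x * b y)"
      using zz set_Fubini(4)[OF T] by simp
    also have "\<dots> = 0" using 0 z1 by simp
    finally show "(LINT z|lborel. W (fst z) * (a' (fst z) * b (snd z))) = - (LINT z|lborel. 0 * (a (fst z) * b (snd z)))"
      by (simp add: mult.assoc)
  next
    fix G :: "real \<times> real \<Rightarrow> real"
    assume "AE z in lborel. z \<in> {0<..} \<times> UNIV \<longrightarrow> W (fst z) = G z"
      "AE y in lborel. y \<in> UNIV \<longrightarrow> (\<forall>a b. {a..b} \<subseteq> {0<..} \<longrightarrow> ac a b (\<lambda>x. G (x, y)) (\<lambda>x. 0))"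
    then show thesis by (rule that)
  qed
  have "AE (y::real) in lborel. \<exists>K. AE x in lborel. 0 < x \<longrightarrow> W x = K"
    using AE_product(2)[OF G(1)] G(2)
  proof eventually_elim
    case (elim y)
    have eq: "G (x, y) = G (1, y)" if "0 < x" for x
    proof -
      have "{min x 1..max x 1} \<subseteq> {0<..}" using that by auto
      then have "ac (min x 1) (max x 1) (\<lambda>x. G (x, y)) (\<lambda>x. 0)" using elim(2) by blast
      from ac_zero_const[OF this, of x] ac_zero_const[OF this, of 1] show ?thesis by auto
    qed
    have "AE x in lborel. 0 < x \<longrightarrow> W x = G (1, y)"
      using elim(1)
    proof eventually_elim
      case (elim x)
      then show ?case using eq[of x] by auto
    qed
    then show ?case by blast
  qed
  from AE_interval_ex[OF this, of 0 1] that show ?thesis by auto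
qed

text \<open>The Jacobi equation holds only weakly, so it is solved by Wronskians: testing with w h,
  for each of two classical solutions \<open>w\<close>, shows that d w - m w' is constant almost
  everywhere. The two constants determine \<open>m\<close> and \<open>d\<close> by Cramer's rule,
  and finite energy makes one of them zero.\<close>

lemma jacobi_solution:
  assumes m: "\<And>b. ac 0 b m d" and mm: "m \<in> Bor" "d \<in> Bor"
    and d2: "L1_on ray (\<lambda>t. (d t)\<^sup>2)"
    and m2: "L1_on ray (\<lambda>t. sech2 (t + T) * (m t)\<^sup>2)"
    and weak: "\<And>h h' r s. c1 h h' \<Longrightarrow> 0 < r \<Longrightarrow> (\<And>x. x \<notin> {r..s} \<Longrightarrow> h x = 0) \<Longrightarrow>
      (LBINT t:ray. d t * h' t - 2 * sech2 (t + T) * m t * h t) = 0"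
  obtains K where "\<And>t. 0 \<le> t \<Longrightarrow> m t = K * tanh (t + T)" "AE t in lborel. 0 < t \<longrightarrow> d t = K * sech2 (t + T)"
proof -
  define f where "f t = tanh (t + T)" for t
  define f' where "f' t = sech2 (t + T)" for t
  \<comment> \<open>The second Jacobi solution, induced up to sign and scale by homotheties of the
    catenoid about the centre of its neck; its Wronskian with tanh is normalised to 1.\<close>
  define g where "g t = 1 - (t + T) * tanh (t + T)" for t
  define g' where "g' t = - tanh (t + T) - (t + T) * sech2 (t + T)" for t
  have tD: "((\<lambda>t. tanh (t + T)) has_real_derivative sech2 (t + T)) (at t)" for t
    by (rule DERIV_shift[THEN iffD1, OF DERIV_tanh])
  have sD: "((\<lambda>t. sech2 (t + T)) has_real_derivative - 2 * tanh (t + T) * sech2 (t + T)) (at t)" for t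
    by (rule DERIV_shift[THEN iffD1, OF DERIV_sech2])
  have ff: "c1 f f'" and ff': "c1 f' (\<lambda>t. - 2 * sech2 (t + T) * f t)"
    using tD sD unfolding c1_def f_def f'_def by (auto intro!: continuous_intros simp: mult_ac)
  have gg: "c1 g g'" and gg': "c1 g' (\<lambda>t. - 2 * sech2 (t + T) * g t)"
    unfolding c1_def g_def g'_def
    by (auto intro!: continuous_intros derivative_eq_intros tD sD simp: sech2_def algebra_simps power2_eq_square)
  have main: "\<exists>K. AE x in lborel. 0 < x \<longrightarrow> d x * w x - m x * w' x = K"
    if ww: "c1 w w'" and ww': "c1 w' (\<lambda>t. - 2 * sech2 (t + T) * w t)" for w w'
  proof -
    have mw: "w \<in> Bor" "w' \<in> Bor"
      using c1_continuous[OF ww] c1D'[OF ww] by (auto intro: borel_measurable_continuous_onI)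
    have Wi: "L1_on {a..b} (\<lambda>x. d x * w x - m x * w' x)" if "0 < a" for a b
    proof (rule set_integral_diff(1))
      have ma: "ac a b m d" by (rule ac_subinterval[OF m]) (use that in auto)
      show "L1_on {a..b} (\<lambda>x. d x * w x)"
        by (rule ac_integrable_mult(2)[OF c1_ac[OF ww] ac_integrable[OF ma]])
      show "L1_on {a..b} (\<lambda>x. m x * w' x)"
        by (rule ac_integrable_mult(1)[OF ma ac_integrable[OF c1_ac[OF ww]]])
    qed
    have "(LINT x|lborel. (d x * w x - m x * w' x) * h' x) = 0"
      if h: "c1 h h'" and r': "0 < r'" and hz': "\<And>x. x \<notin> {r'..s'} \<Longrightarrow> h x = 0" for h h' r' s'
    proof (cases "r' \<le> s'")
      case rs: True
      define r s where "r = r' / 2" and "s = s' + 1"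
      have r: "0 < r" and True: "r \<le> s" using r' rs by (auto simp: r_def s_def)
      have hz: "h x = 0" if "x \<notin> {r<..<s}" for x
        using r' hz'[of x] that by (cases "x \<in> {r'..s'}") (auto simp: r_def s_def)
      have hzc: "h x = 0" if "x \<notin> {r..s}" for x using that by (intro hz) auto
      have hz': "h' x = 0" if "x \<notin> {r..s}" for x by (rule c1_zero_outside[OF h hzc that])
      have hr: "h r = 0" "h s = 0" using hz by auto
      have mr: "ac r s m d" by (rule ac_subinterval[OF m]) (use r in auto)
      note prod = ac_mult[OF mr ac_mult[OF c1_ac[OF ww', of r s] c1_ac[OF h, of r s]]]
      have zero: "(LBINT x:{r..s}. d x * (w' x * h x) + m x * ((- 2 * sech2 (x + T) * w x) * h x + w' x * h' x)) = 0"
        using acD[OF prod order_refl True order_refl] hr by simp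
      have "0 = (LBINT t:ray. d t * (w' t * h t + w t * h' t) - 2 * sech2 (t + T) * m t * (w t * h t))"
        using weak[where s=s, OF c1_mult[OF ww h] r] hzc by simp
      also have "\<dots> = (LBINT t:{r..s}. d t * (w' t * h t + w t * h' t) - 2 * sech2 (t + T) * m t * (w t * h t))"
        unfolding set_lebesgue_integral_def
      proof (intro Bochner_Integration.integral_cong refl)
        fix t show "indicator ray t *\<^sub>R (d t * (w' t * h t + w t * h' t) - 2 * sech2 (t + T) * m t * (w t * h t))
          = indicator {r..s} t *\<^sub>R (d t * (w' t * h t + w t * h' t) - 2 * sech2 (t + T) * m t * (w t * h t))"
          using hzc[of t] hz'[of t] r by (cases "t \<in> {r..s}") (auto simp: ray_def)
      qed
      \<comment> \<open>With w'' = - 2 sech2 w the integrand is the Wronskian times h' plus the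
        derivative of m w' h, whose integral vanishes with \<open>h\<close> at both ends.\<close>
      also have "\<dots> = (LBINT t:{r..s}. (d t * w t - m t * w' t) * h' t +
          (d t * (w' t * h t) + m t * ((- 2 * sech2 (t + T) * w t) * h t + w' t * h' t)))"
        by (simp add: algebra_simps)
      also have "\<dots> = (LBINT t:{r..s}. (d t * w t - m t * w' t) * h' t)"
      proof (subst set_integral_add(2))
        have "continuous_on {r..s} h'" using c1D'[OF h] by (rule continuous_on_subset) auto
        then have "compact (h' ` {r..s})" by (intro compact_continuous_image) auto
        then obtain B where B: "\<forall>y\<in>h' ` {r..s}. norm y \<le> B" using compact_imp_bounded bounded_iff by metis
        show "L1_on {r..s} (\<lambda>t. (d t * w t - m t * w' t) * h' t)"
          by (rule L1_mult_bounded(1)[where B=B, OF Wi[OF r]])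
             (use B in \<open>auto intro!: Bor_set borel_measurable_continuous_onI[OF c1D'[OF h]]\<close>)
      qed (use zero ac_integrable[OF prod] in auto)
      also have "\<dots> = (LINT x|lborel. (d x * w x - m x * w' x) * h' x)"
        by (rule set_integral_restrict(1)) (use hz' in auto)
      finally show ?thesis by simp
    next
      case False
      then have "x \<notin> {r'..s'}" for x by auto
      from c1_zero_outside[OF h hz' this] have "h' = (\<lambda>_. 0)" by (intro ext)
      then show ?thesis by simp
    qed
    note z = this
    have mW: "(\<lambda>x. d x * w x - m x * w' x) \<in> Bor" using mm mw by auto
    obtain K where "AE x in lborel. 0 < x \<longrightarrow> d x * w x - m x * w' x = K"
    proof (rule constant_of_integral_derivative[OF mW Wi])
      fix h h' :: "real \<Rightarrow> real" and r s :: real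
      assume "c1 h h'" "0 < r" "\<And>x. x \<notin> {r..s} \<Longrightarrow> h x = 0"
      then show "(LINT x|lborel. (d x * w x - m x * w' x) * h' x) = 0" by (rule z)
    next
      fix K assume "AE x in lborel. 0 < x \<longrightarrow> d x * w x - m x * w' x = K"
      then show thesis by (rule that)
    qed assumption
    then show ?thesis by blast
  qed
  obtain K1 where K1: "AE x in lborel. 0 < x \<longrightarrow> d x * f x - m x * f' x = K1" using main[OF ff ff'] by blast
  obtain K2 where K2: "AE x in lborel. 0 < x \<longrightarrow> d x * g x - m x * g' x = K2" using main[OF gg gg'] by blast
  have mf: "f \<in> Bor" "f' \<in> Bor"
    using c1_continuous[OF ff] c1D'[OF ff] by (auto intro: borel_measurable_continuous_onI)
  \<comment> \<open>The Wronskian with tanh is square integrable on the ray, and a square integrable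
    constant is zero. This excludes the linearly growing solution \<open>g\<close>.\<close>
  have "K1\<^sup>2 = 0"
  proof (rule integrable_limit_zero[where f="\<lambda>_. K1\<^sup>2"])
    have "L1_on ray (\<lambda>t. (d t)\<^sup>2 * (f t)\<^sup>2)"
    proof (rule L1_mult_bounded(1)[OF d2, of _ 1])
      show "set_borel_measurable lborel ray (\<lambda>t. (f t)\<^sup>2)"
        using mf ray_circ by (intro Bor_set) auto
      show "\<bar>(f t)\<^sup>2\<bar> \<le> 1" for t
        using sech2_bounds(1)[of "t + T"] by (simp add: f_def sech2_def)
    qed
    then have 1: "L1_on ray (\<lambda>t. (d t * f t)\<^sup>2)" by (simp add: power_mult_distrib)
    have "L1_on ray (\<lambda>t. (sech2 (t + T) * (m t)\<^sup>2) * f' t)"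
    proof (rule L1_mult_bounded(1)[OF m2, of _ 1])
      show "set_borel_measurable lborel ray f'"
        using mf ray_circ by (intro Bor_set) auto
      show "\<bar>f' t\<bar> \<le> 1" for t
        using sech2_bounds[of "t + T"] by (simp add: f'_def)
    qed
    then have 2: "L1_on ray (\<lambda>t. (m t * f' t)\<^sup>2)" by (simp add: f'_def power2_eq_square mult_ac)
    have i: "L1_on ray (\<lambda>t. (1 * (d t * f t) + -1 * (m t * f' t))\<^sup>2)"
      by (rule L2_add_integrable) (use 1 2 mm mf ray_circ in auto)
    have "AE t in lborel. t \<noteq> (0::real)" by (simp add: AE_lborel_singleton)
    then have ae: "AE t in lborel. indicator ray t *\<^sub>R (1 * (d t * f t) + -1 * (m t * f' t))\<^sup>2 = indicator ray t *\<^sub>R K1\<^sup>2"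
      using K1 by eventually_elim (auto simp: ray_def indicator_def)
    have "(\<lambda>t. indicator ray t *\<^sub>R K1\<^sup>2) \<in> borel_measurable lborel" using ray_circ by auto
    from integrable_cong_AE_imp[OF i[unfolded set_integrable_def] this] ae
    show "L1_on ray (\<lambda>_. K1\<^sup>2)" unfolding set_integrable_def by auto
  qed auto
  then have K1: "AE x in lborel. 0 < x \<longrightarrow> d x * f x = m x * f' x" using K1 by simp
  have wr: "f' t * g t - f t * g' t = 1" for t
    by (simp add: f_def f'_def g_def g'_def sech2_def algebra_simps power2_eq_square)
  have ae: "AE x in lborel. 0 < x \<longrightarrow> m x = K2 * f x"
    using K1 K2
  proof eventually_elim
    case (elim x)
    show ?case
    proof
      assume "0 < x"
      then have e: "d x * f x = m x * f' x" "K2 = d x * g x - m x * g' x" using elim by auto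
      have "K2 * f x = (d x * f x) * g x - m x * (f x * g' x)" unfolding e(2) by (simp add: algebra_simps)
      also have "\<dots> = m x * (f' x * g x - f x * g' x)" unfolding e(1) by (simp add: algebra_simps)
      finally show "m x = K2 * f x" unfolding wr by simp
    qed
  qed
  have aed: "AE x in lborel. 0 < x \<longrightarrow> d x = K2 * sech2 (x + T)"
    using K1 K2
  proof eventually_elim
    case (elim x)
    show ?case
    proof
      assume "0 < x"
      then have e: "d x * f x = m x * f' x" "K2 = d x * g x - m x * g' x" using elim by auto
      have "K2 * f' x = (d x * g x) * f' x - (m x * f' x) * g' x" unfolding e(2) by (simp add: algebra_simps)
      also have "\<dots> = d x * (f' x * g x - f x * g' x)" unfolding e(1)[symmetric] by (simp add: algebra_simps)
      finally show "d x = K2 * sech2 (x + T)" unfolding wr by (simp add: f'_def)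
    qed
  qed
  have "m t = K2 * tanh (t + T)" if "0 \<le> t" for t
  proof (rule continuous_AE_eq[of 0 "t + 1" m "\<lambda>t. K2 * tanh (t + T)"])
    show "AE x in lborel. 0 < x \<longrightarrow> x < t + 1 \<longrightarrow> m x = K2 * tanh (x + T)"
      using ae by eventually_elim (auto simp: f_def)
    show "continuous_on {0..t + 1} m" by (rule ac_continuous[OF m])
    show "continuous_on {0..t + 1} (\<lambda>t. K2 * tanh (t + T))" by (intro continuous_intros)
  qed (use that in auto)
  then show ?thesis using aed by (rule that)
qed

section \<open>Energies on the strip\<close>

lemma LBINT_cong_AE:
  fixes f g :: "'a::euclidean_space \<Rightarrow> real"
  assumes "f \<in> Bor" "g \<in> Bor" "A \<in> sets borel"
    and "AE x in lborel. x \<in> A \<longrightarrow> f x = g x"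
  shows "(LBINT x:A. f x) = (LBINT x:A. g x)"
    and "L1_on A f \<Longrightarrow> L1_on A g"
proof -
  have m: "(\<lambda>x. indicator A x *\<^sub>R f x) \<in> borel_measurable lborel" "(\<lambda>x. indicator A x *\<^sub>R g x) \<in> borel_measurable lborel"
    using assms by auto
  have ae: "AE x in lborel. indicator A x *\<^sub>R f x = indicator A x *\<^sub>R g x"
    using assms(4) by eventually_elim (auto simp: indicator_def)
  show "(LBINT x:A. f x) = (LBINT x:A. g x)"
    unfolding set_lebesgue_integral_def by (rule integral_cong_AE[OF m ae])
  show "L1_on A g" if "L1_on A f"
    using that unfolding set_integrable_def by (rule integrable_cong_AE_imp[OF _ m(2)]) (use ae in auto)
qed

lemma circ_closed:
  fixes f :: "real \<Rightarrow> real"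
  assumes "set_borel_measurable lborel {0..2*pi} f"
  shows "L1_on circ f \<longleftrightarrow> L1_on {0..2*pi} f"
    and "(LBINT x:circ. f x) = (LBINT x:{0..2*pi}. f x)"
proof -
  have m: "(\<lambda>x. indicator {0..2*pi} x *\<^sub>R f x) \<in> borel_measurable lborel"
    using assms by (simp add: set_borel_measurable_def)
  have "(\<lambda>x. indicator circ x *\<^sub>R (indicator {0..2*pi} x *\<^sub>R f x)) \<in> borel_measurable lborel"
    using ray_circ(3) by (intro borel_measurable_scaleR m borel_measurable_indicator) simp
  moreover have "(\<lambda>x. indicator circ x *\<^sub>R (indicator {0..2*pi} x *\<^sub>R f x)) = (\<lambda>x. indicator circ x *\<^sub>R f x)"
    by (auto simp: circ_def indicator_def fun_eq_iff)
  ultimately have m': "(\<lambda>x. indicator circ x *\<^sub>R f x) \<in> borel_measurable lborel" by simp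
  have "AE x in lborel. x \<noteq> 2 * pi" by (simp add: AE_lborel_singleton)
  then have ae: "AE x in lborel. indicator circ x *\<^sub>R f x = indicator {0..2*pi} x *\<^sub>R f x"
    by eventually_elim (auto simp: circ_def indicator_def)
  show "L1_on circ f \<longleftrightarrow> L1_on {0..2*pi} f"
    unfolding set_integrable_def by (rule integrable_cong_AE[OF m' m ae])
  show "(LBINT x:circ. f x) = (LBINT x:{0..2*pi}. f x)"
    unfolding set_lebesgue_integral_def by (rule integral_cong_AE[OF m' m ae])
qed

lemma circ_const: "L1_on circ (\<lambda>\<theta>. c::real)" "(LBINT \<theta>:circ. c) = 2 * pi * c"
proof -
  have "L1_on {0..2*pi} (\<lambda>\<theta>. c)" by (rule borel_integrable_atLeastAtMost') auto
  then show "L1_on circ (\<lambda>\<theta>. c)" by (rule set_integrable_subset) (auto simp: circ_def)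
  show "(LBINT \<theta>:circ. c) = 2 * pi * c" by (simp add: set_lebesgue_integral_def circ_def)
qed

lemma circ_L1:
  fixes f :: "real \<Rightarrow> real"
  assumes "f \<in> Bor" "L1_on circ (\<lambda>\<theta>. (f \<theta>)\<^sup>2)"
  shows "L1_on circ f"
  using L2_mult_integrable[of f "\<lambda>_. 1" circ] assms ray_circ circ_const(1)[of 1] by simp

lemma circ_variance:
  fixes f :: "real \<Rightarrow> real"
  assumes "f \<in> Bor" "L1_on circ (\<lambda>\<theta>. (f \<theta>)\<^sup>2)"
  shows "(LBINT \<theta>:circ. (f \<theta> - (LBINT \<theta>:circ. f \<theta>) / (2*pi))\<^sup>2)
    = (LBINT \<theta>:circ. (f \<theta>)\<^sup>2) - (LBINT \<theta>:circ. f \<theta>)\<^sup>2 / (2*pi)"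
proof -
  note f1 = circ_L1[OF assms]
  define a where "a = (LBINT \<theta>:circ. f \<theta>)"
  have "(LBINT \<theta>:circ. (f \<theta> - a / (2*pi))\<^sup>2) = (LBINT \<theta>:circ. ((f \<theta>)\<^sup>2 - (a / pi) * f \<theta>) + (a / (2*pi))\<^sup>2)"
    by (rule set_lebesgue_integral_cong) (use ray_circ in \<open>auto simp: power2_eq_square field_simps\<close>)
  also have "\<dots> = (LBINT \<theta>:circ. (f \<theta>)\<^sup>2) - (a / pi) * a + 2 * pi * (a / (2*pi))\<^sup>2"
    by (subst set_integral_add(2), intro set_integral_diff(1) assms set_integrable_mult_right f1 impI, rule circ_const,
        subst set_integral_diff(2)[OF assms(2) set_integrable_mult_right[OF f1]])
       (simp add: circ_const a_def)
  also have "\<dots> = (LBINT \<theta>:circ. (f \<theta>)\<^sup>2) - a\<^sup>2 / (2*pi)" by (simp add: power2_eq_square field_simps)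
  finally show ?thesis by (simp add: a_def)
qed

lemma circ_cauchy:
  fixes f :: "real \<Rightarrow> real"
  assumes "f \<in> Bor" "L1_on circ (\<lambda>\<theta>. (f \<theta>)\<^sup>2)"
  shows "(LBINT \<theta>:circ. f \<theta>)\<^sup>2 \<le> 2 * pi * (LBINT \<theta>:circ. (f \<theta>)\<^sup>2)"
proof -
  have "0 \<le> (LBINT \<theta>:circ. (f \<theta> - (LBINT \<theta>:circ. f \<theta>) / (2*pi))\<^sup>2)"
    unfolding set_lebesgue_integral_def by (intro Bochner_Integration.integral_nonneg) auto
  then show ?thesis unfolding circ_variance[OF assms] by (simp add: field_simps)
qed

section \<open>Growth and integrability of variations of finite energy\<close>

lemma strip_functionD:
  assumes "strip_function u P R \<tau>"
  shows "u \<in> Bor" "P \<in> Bor" "R \<in> Bor" "\<tau> \<in> Bor"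
    "L1_on strip (\<lambda>z. (P z)\<^sup>2)" "L1_on strip (\<lambda>z. (R z)\<^sup>2)"
    "L1_on circ (\<lambda>\<theta>. (\<tau> \<theta>)\<^sup>2)"
    "AE z in lborel. z \<in> strip \<longrightarrow> u z = trace_rep P \<tau> z"
    "AE t in lborel. t \<in> ray \<longrightarrow> (\<exists>g. ac 0 (2*pi) g (\<lambda>\<theta>. R (t, \<theta>)) \<and> g (2*pi) = g 0 \<and>
        (AE \<theta> in lborel. \<theta> \<in> circ \<longrightarrow> u (t, \<theta>) = g \<theta>))"
  using assms unfolding strip_function_def by blast+

lemma borel_fst_snd':
  fixes h :: "real \<Rightarrow> real"
  assumes "h \<in> Bor"
  shows "(\<lambda>z::real\<times>real. h (fst z + T)) \<in> Bor"
  by (rule measurable_compose[OF _ assms], intro borel_measurable_continuous_onI continuous_intros)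

lemma sech2_borel: "sech2 \<in> Bor" "(tanh :: real \<Rightarrow> real) \<in> Bor"
  using continuous_on_tanh_sech2[of UNIV "\<lambda>x. x"] by (auto intro: borel_measurable_continuous_onI)

text \<open>Cauchy-Schwarz along the line: finite energy allows growth of the order of the square
  root of t and no more.\<close>

lemma trace_rep_sq_bound:
  assumes "strip_function u P R \<tau>"
  shows "AE \<theta> in lborel. \<theta> \<in> circ \<longrightarrow> (\<forall>t. 0 \<le> t \<longrightarrow>
     (trace_rep P \<tau> (t, \<theta>))\<^sup>2 \<le> 2 * (\<tau> \<theta>)\<^sup>2 + 2 * (t * (LBINT s:ray. (P (s, \<theta>))\<^sup>2)))"
  using AE_strip_slices[OF strip_functionD(2,5)[OF assms]]
proof eventually_elim
  case (elim \<theta>)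
  show ?case
  proof (intro impI allI)
    fix t :: real assume \<theta>: "\<theta> \<in> circ" and t: "0 \<le> t"
    have i: "L1_on {0..t} (\<lambda>t. P (t, \<theta>))" "L1_on {0..t} (\<lambda>t. (P (t, \<theta>))\<^sup>2)"
      "L1_on ray (\<lambda>t. (P (t, \<theta>))\<^sup>2)" using elim \<theta> by auto
    define a where "a = trace_rep P \<tau> (t, \<theta>)"
    have "(a - \<tau> \<theta>)\<^sup>2 \<le> t * (LBINT s:{0..t}. (P (s, \<theta>))\<^sup>2)"
      using ac_increment_sq[OF trace_rep_ac[OF i(1)] t i(2)] by (simp add: a_def)
    also have "\<dots> \<le> t * (LBINT s:ray. (P (s, \<theta>))\<^sup>2)"
      using t by (intro mult_left_mono LBINT_mono_set[OF i(3)]) (auto simp: ray_def)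
    finally have "(a - \<tau> \<theta>)\<^sup>2 \<le> t * (LBINT s:ray. (P (s, \<theta>))\<^sup>2)" .
    \<comment> \<open>This square encodes a^2 \<le> 2 \<tau>^2 + 2 (a - \<tau>)^2.\<close>
    moreover have "0 \<le> (a - 2 * \<tau> \<theta>)\<^sup>2" by simp
    ultimately show "(trace_rep P \<tau> (t, \<theta>))\<^sup>2 \<le> 2 * (\<tau> \<theta>)\<^sup>2 + 2 * (t * (LBINT s:ray. (P (s, \<theta>))\<^sup>2))"
      unfolding a_def[symmetric] by (simp add: power2_eq_square algebra_simps)
  qed
qed

text \<open>The exponential decay of \<open>sech2\<close> beats the linear growth of u^2. Hence the
  potential term of the index form is finite for every variation of finite Dirichlet energy.\<close>

lemma weighted_integrable:
  assumes S: "strip_function u P R \<tau>"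
  shows "L1_on strip (\<lambda>z. sech2 (fst z + T) * (u z)\<^sup>2)"
proof -
  note D = strip_functionD[OF S]
  let ?N = "\<lambda>\<theta>. LBINT s:ray. (P (s, \<theta>))\<^sup>2"
  have N: "L1_on circ ?N" by (rule set_Fubini(6)[OF D(5)[unfolded ray_circ(1)]])
  have 1: "L1_on strip (\<lambda>z. sech2 (fst z + T) * (\<tau> (snd z))\<^sup>2)"
    unfolding ray_circ(1) by (rule L1_tensor[OF sech2_integrable_ray(1) D(7)])
  have 2: "L1_on strip (\<lambda>z. (fst z * sech2 (fst z + T)) * ?N (snd z))"
    unfolding ray_circ(1) by (rule L1_tensor[OF sech2_integrable_ray(2) N])
  have "L1_on strip (\<lambda>z. 2 * (sech2 (fst z + T) * (\<tau> (snd z))\<^sup>2) + 2 * ((fst z * sech2 (fst z + T)) * ?N (snd z)))"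
    by (intro set_integral_add(1) set_integrable_mult_right 1 2)
  then show ?thesis
  proof (rule L1_bound)
    show "set_borel_measurable lborel strip (\<lambda>z. sech2 (fst z + T) * (u z)\<^sup>2)"
      using D(1) borel_fst_snd'[OF sech2_borel(1), of T] by (intro Bor_set ray_circ) auto
    show "AE z in lborel. z \<in> strip \<longrightarrow> \<bar>sech2 (fst z + T) * (u z)\<^sup>2\<bar> \<le>
      2 * (sech2 (fst z + T) * (\<tau> (snd z))\<^sup>2) + 2 * ((fst z * sech2 (fst z + T)) * ?N (snd z))"
      using D(8) AE_lborel_snd[OF trace_rep_sq_bound[OF S]]
    proof eventually_elim
      case (elim z)
      show ?case
      proof
        assume z: "z \<in> strip"
        then have "(u z)\<^sup>2 \<le> 2 * (\<tau> (snd z))\<^sup>2 + 2 * (fst z * ?N (snd z))"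
          using elim by (cases z) (auto simp: strip_def circ_def)
        then have "sech2 (fst z + T) * (u z)\<^sup>2 \<le> sech2 (fst z + T) * (2 * (\<tau> (snd z))\<^sup>2 + 2 * (fst z * ?N (snd z)))"
          using sech2_bounds(1)[of "fst z + T"] by (intro mult_left_mono) auto
        then show "\<bar>sech2 (fst z + T) * (u z)\<^sup>2\<bar> \<le>
          2 * (sech2 (fst z + T) * (\<tau> (snd z))\<^sup>2) + 2 * ((fst z * sech2 (fst z + T)) * ?N (snd z))"
          using sech2_bounds(1)[of "fst z + T"] by (simp add: abs_mult algebra_simps)
      qed
    qed
  qed
qed

text \<open>The integral over the circle, not divided by 2 pi; that factor is restored where means
  are subtracted.\<close>

definition cmean :: "(real \<times> real \<Rightarrow> real) \<Rightarrow> real \<Rightarrow> real" where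
  "cmean f t = (LBINT \<theta>:circ. f (t, \<theta>))"

text \<open>The absolutely continuous representative of \<open>cmean u\<close>: the integral of the
  trace plus the integral of \<open>cmean P\<close>. The planar \<open>lint\<close> is reused with a
  dummy second coordinate.\<close>

definition mean_rep :: "(real \<times> real \<Rightarrow> real) \<Rightarrow> (real \<Rightarrow> real) \<Rightarrow> real \<Rightarrow> real" where
  "mean_rep P \<tau> t = (LBINT \<theta>:circ. \<tau> \<theta>) + lint (\<lambda>z. cmean P (fst z)) 0 (t, 0)"

lemma cmean_measurable:
  assumes "f \<in> Bor"
  shows "cmean f \<in> Bor"
proof -
  have "(\<lambda>w. indicator circ (snd w) *\<^sub>R f (fst w, snd w)) \<in> borel_measurable (borel \<Otimes>\<^sub>M borel)"
    unfolding borel_prod using assms borel_fst_snd(2)[of "indicator circ"] ray_circ(3)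
    by (intro borel_measurable_scaleR) auto
  then have "(\<lambda>t. LINT \<theta>|lborel. indicator circ \<theta> *\<^sub>R f (t, \<theta>)) \<in> Bor"
    by (intro sigma_finite_measure.borel_measurable_lebesgue_integral[OF sigma_finite_lborel])
       (simp add: case_prod_beta' cong: measurable_cong_sets)
  then show ?thesis unfolding cmean_def[abs_def] set_lebesgue_integral_def .
qed

lemma strip_box_integrable:
  fixes P :: "real \<times> real \<Rightarrow> real"
  assumes m: "P \<in> Bor" and P2: "L1_on strip (\<lambda>z. (P z)\<^sup>2)"
  shows "L1_on ({0..b} \<times> circ) P"
proof -
  have B: "{0..b} \<times> circ \<in> sets borel" using ray_circ by (intro borel_Times) auto
  have "L1_on ({0..b} \<times> circ) (\<lambda>z. (P z)\<^sup>2)"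
    by (rule set_integrable_subset[OF P2]) (use B in \<open>auto simp: ray_circ(1) ray_def\<close>)
  moreover have "L1_on ({0..b} \<times> circ) (\<lambda>z. 1 * (1::real))"
    by (rule L1_tensor[where a="\<lambda>_. 1" and b="\<lambda>_. 1"]) (auto intro!: borel_integrable_atLeastAtMost'[of 0 b "\<lambda>_. 1"] circ_const)
  ultimately show ?thesis
    using L2_mult_integrable[of P "\<lambda>_. 1" "{0..b} \<times> circ"] m B by simp
qed

lemma cmean_sq:
  assumes m: "f \<in> Bor" and w: "w \<in> Bor" "\<And>t. 0 \<le> w t"
    and wf: "L1_on strip (\<lambda>z. w (fst z) * (f z)\<^sup>2)"
    and sl: "AE t in lborel. t \<in> ray \<longrightarrow> L1_on circ (\<lambda>\<theta>. (f (t, \<theta>))\<^sup>2)"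
  shows "L1_on ray (\<lambda>t. w t * (cmean f t)\<^sup>2)"
proof -
  have i: "L1_on ray (\<lambda>t. (2 * pi) * (LBINT \<theta>:circ. w (fst (t, \<theta>)) * (f (t, \<theta>))\<^sup>2))"
    using set_Fubini(5)[OF wf[unfolded ray_circ(1)]] by (rule set_integrable_mult_right)
  show ?thesis
  proof (rule L1_bound[OF i])
    show "set_borel_measurable lborel ray (\<lambda>t. w t * (cmean f t)\<^sup>2)"
      using w cmean_measurable[OF m] by (intro Bor_set ray_circ) auto
    show "AE t in lborel. t \<in> ray \<longrightarrow> \<bar>w t * (cmean f t)\<^sup>2\<bar> \<le> (2 * pi) * (LBINT \<theta>:circ. w (fst (t, \<theta>)) * (f (t, \<theta>))\<^sup>2)"
      using sl
    proof eventually_elim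
      case (elim t)
      show ?case
      proof
        assume "t \<in> ray"
        then have "(cmean f t)\<^sup>2 \<le> 2 * pi * (LBINT \<theta>:circ. (f (t, \<theta>))\<^sup>2)"
          using elim unfolding cmean_def by (intro circ_cauchy borel_slices(2)[OF m]) auto
        then have "w t * (cmean f t)\<^sup>2 \<le> w t * (2 * pi * (LBINT \<theta>:circ. (f (t, \<theta>))\<^sup>2))"
          using w(2) by (rule mult_left_mono)
        then show "\<bar>w t * (cmean f t)\<^sup>2\<bar> \<le> (2 * pi) * (LBINT \<theta>:circ. w (fst (t, \<theta>)) * (f (t, \<theta>))\<^sup>2)"
          using w(2)[of t] by (simp add: abs_mult mult_ac)
      qed
    qed
  qed
qed

lemma slice_sq_integrable:
  assumes "strip_function u P R \<tau>"
  shows "AE t in lborel. t \<in> ray \<longrightarrow> L1_on circ (\<lambda>\<theta>. (u (t, \<theta>))\<^sup>2)"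
    and "AE t in lborel. t \<in> ray \<longrightarrow> L1_on circ (\<lambda>\<theta>. (P (t, \<theta>))\<^sup>2)"
    and "AE t in lborel. t \<in> ray \<longrightarrow> L1_on circ (\<lambda>\<theta>. (R (t, \<theta>))\<^sup>2)"
proof -
  note D = strip_functionD[OF assms]
  show "AE t in lborel. t \<in> ray \<longrightarrow> L1_on circ (\<lambda>\<theta>. (P (t, \<theta>))\<^sup>2)"
    by (rule set_Fubini(1)[OF D(5)[unfolded ray_circ(1)]])
  show "AE t in lborel. t \<in> ray \<longrightarrow> L1_on circ (\<lambda>\<theta>. (R (t, \<theta>))\<^sup>2)"
    by (rule set_Fubini(1)[OF D(6)[unfolded ray_circ(1)]])
  show "AE t in lborel. t \<in> ray \<longrightarrow> L1_on circ (\<lambda>\<theta>. (u (t, \<theta>))\<^sup>2)"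
    using set_Fubini(1)[OF weighted_integrable[OF assms, of 0, unfolded ray_circ(1)]]
  proof eventually_elim
    case (elim t)
    show ?case
    proof
      assume "t \<in> ray"
      then have "L1_on circ (\<lambda>\<theta>. (1 / sech2 t) * (sech2 t * (u (t, \<theta>))\<^sup>2))"
        using elim by (intro set_integrable_mult_right) auto
      then show "L1_on circ (\<lambda>\<theta>. (u (t, \<theta>))\<^sup>2)" using sech2_bounds(1)[of t] by simp
    qed
  qed
qed

lemma mean_rep:
  assumes S: "strip_function u P R \<tau>"
  shows "ac 0 b (mean_rep P \<tau>) (cmean P)"
    and "mean_rep P \<tau> 0 = (LBINT \<theta>:circ. \<tau> \<theta>)"
    and "AE t in lborel. t \<in> ray \<longrightarrow> cmean u t = mean_rep P \<tau> t"
    and "mean_rep P \<tau> \<in> Bor"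
    and "L1_on ray (\<lambda>t. (cmean P t)\<^sup>2)"
    and "L1_on ray (\<lambda>t. sech2 (t + T) * (mean_rep P \<tau> t)\<^sup>2)"
proof -
  note D = strip_functionD[OF S]
  have box: "L1_on ({0..b} \<times> circ) P" for b by (rule strip_box_integrable[OF D(2,5)])
  have pm: "L1_on {0..b} (cmean P)" for b
    using set_Fubini(5)[OF box] unfolding cmean_def[abs_def] .
  show acm: "ac 0 b (mean_rep P \<tau>) (cmean P)" for b
  proof (cases "0 \<le> b")
    case True
    from lint_ac[of 0 b "\<lambda>z. cmean P (fst z)" 0 0] pm True
    have "ac 0 b (\<lambda>t. lint (\<lambda>z. cmean P (fst z)) 0 (t, 0)) (cmean P)" by simp
    then show ?thesis by (simp add: ac_def mean_rep_def)
  qed (auto simp: ac_def set_integrable_def)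
  show m0: "mean_rep P \<tau> 0 = (LBINT \<theta>:circ. \<tau> \<theta>)" by (simp add: mean_rep_def lint_def)
  have mP: "(\<lambda>z::real\<times>real. cmean P (fst z)) \<in> Bor"
    by (rule borel_fst_snd(1)[OF cmean_measurable[OF D(2)]])
  show mm: "mean_rep P \<tau> \<in> Bor"
    unfolding mean_rep_def[abs_def] using borel_slices(1)[OF lint_measurable[OF mP, of 0], of 0] by auto
  have \<tau>1: "L1_on circ \<tau>" by (rule circ_L1[OF D(4,7)])
  have mU: "trace_rep P \<tau> \<in> Bor" by (rule trace_rep_measurable[OF D(2,4)])
  have U: "(LBINT \<theta>:circ. trace_rep P \<tau> (t, \<theta>)) = mean_rep P \<tau> t" if t: "0 \<le> t" for t
  proof -
    have mI: "(\<lambda>\<theta>. LBINT s:{0..t}. P (s, \<theta>)) \<in> Bor"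
    proof -
      have "(\<lambda>w. P (snd w, fst w)) \<in> Bor" by (rule borel_swap[OF D(2)])
      then have "(\<lambda>w. indicator {0..t} (snd w) *\<^sub>R P (snd w, fst w)) \<in> borel_measurable (borel \<Otimes>\<^sub>M borel)"
        unfolding borel_prod using borel_fst_snd(2)[of "indicator {0..t}"] by (intro borel_measurable_scaleR) auto
      then show ?thesis unfolding set_lebesgue_integral_def
        by (intro sigma_finite_measure.borel_measurable_lebesgue_integral[OF sigma_finite_lborel])
           (simp add: case_prod_beta' cong: measurable_cong_sets)
    qed
    have "(LBINT \<theta>:circ. trace_rep P \<tau> (t, \<theta>)) = (LBINT \<theta>:circ. \<tau> \<theta> + (LBINT s:{0..t}. P (s, \<theta>)))"
    proof (rule LBINT_cong_AE(1)[OF borel_slices(2)[OF mU] _ ray_circ(3)])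
      show "(\<lambda>\<theta>. \<tau> \<theta> + (LBINT s:{0..t}. P (s, \<theta>))) \<in> Bor" using D(4) mI by simp
      show "AE \<theta> in lborel. \<theta> \<in> circ \<longrightarrow> trace_rep P \<tau> (t, \<theta>) = \<tau> \<theta> + (LBINT s:{0..t}. P (s, \<theta>))"
        using AE_strip_slices[OF D(2,5)]
      proof eventually_elim
        case (elim \<theta>)
        show ?case
        proof
          assume "\<theta> \<in> circ"
          then have "ac 0 t (\<lambda>t. trace_rep P \<tau> (t, \<theta>)) (\<lambda>t. P (t, \<theta>))"
            using elim by (intro trace_rep_ac) auto
          from acD[OF this, of 0 t] t show "trace_rep P \<tau> (t, \<theta>) = \<tau> \<theta> + (LBINT s:{0..t}. P (s, \<theta>))" by simp
        qed
      qed
    qed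
    also have "\<dots> = (LBINT \<theta>:circ. \<tau> \<theta>) + (LBINT \<theta>:circ. LBINT s:{0..t}. P (s, \<theta>))"
      by (rule set_integral_add(2)[OF \<tau>1 set_Fubini(6)[OF box]])
    also have "(LBINT \<theta>:circ. LBINT s:{0..t}. P (s, \<theta>)) = (LBINT s:{0..t}. cmean P s)"
      using set_Fubini(3,4)[OF box[of t]] by (simp add: cmean_def)
    also have "(LBINT \<theta>:circ. \<tau> \<theta>) + (LBINT s:{0..t}. cmean P s) = mean_rep P \<tau> t"
      using acD[OF acm[of t], of 0 t] t m0 by simp
    finally show ?thesis .
  qed
  show cm: "AE t in lborel. t \<in> ray \<longrightarrow> cmean u t = mean_rep P \<tau> t"
    using AE_product(1)[OF D(8)]
  proof eventually_elim
    case (elim t)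
    show ?case
    proof
      assume t: "t \<in> ray"
      have "cmean u t = (LBINT \<theta>:circ. trace_rep P \<tau> (t, \<theta>))"
        unfolding cmean_def
        by (rule LBINT_cong_AE(1)[OF borel_slices(2)[OF D(1)] borel_slices(2)[OF mU] ray_circ(3)])
           (use elim t in \<open>auto simp: ray_circ(1)\<close>)
      with U[of t] t show "cmean u t = mean_rep P \<tau> t" by (simp add: ray_def)
    qed
  qed
  show "L1_on ray (\<lambda>t. (cmean P t)\<^sup>2)"
    using cmean_sq[OF D(2), of "\<lambda>_. 1"] D(5) slice_sq_integrable(2)[OF S] by simp
  have "L1_on ray (\<lambda>t. sech2 (t + T) * (cmean u t)\<^sup>2)"
    by (rule cmean_sq[OF D(1)])
       (use sech2_measurable sech2_bounds(1) weighted_integrable[OF S] slice_sq_integrable(1)[OF S] in \<open>auto simp: less_imp_le\<close>)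
  then show "L1_on ray (\<lambda>t. sech2 (t + T) * (mean_rep P \<tau> t)\<^sup>2)"
    by (rule LBINT_cong_AE(2)[OF _ _ ray_circ(2), rotated 3])
       (use cm sech2_measurable[of T] cmean_measurable[OF D(1)] mm in \<open>auto elim!: eventually_mono\<close>)
qed

text \<open>Pythagoras between a function and its mean on almost every circle. The weight depends on
  t alone and so does not disturb the orthogonality.\<close>

lemma variance_strip:
  fixes f :: "real \<times> real \<Rightarrow> real" and a :: "real \<Rightarrow> real"
  assumes mf: "f \<in> Bor" and ma: "a \<in> Bor"
    and w: "w \<in> Bor" "\<And>t. 0 \<le> w t"
    and sl: "AE t in lborel. t \<in> ray \<longrightarrow> L1_on circ (\<lambda>\<theta>. (f (t, \<theta>))\<^sup>2)"
    and mean: "AE t in lborel. t \<in> ray \<longrightarrow> cmean f t = a t"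
    and i: "L1_on strip (\<lambda>z. w (fst z) * (f z)\<^sup>2)"
    and ia: "L1_on ray (\<lambda>t. w t * (a t)\<^sup>2)"
  shows "L1_on strip (\<lambda>z. w (fst z) * (f z - a (fst z) / (2*pi))\<^sup>2)"
    and "(LBINT z:strip. w (fst z) * (f z)\<^sup>2) = (LBINT z:strip. w (fst z) * (f z - a (fst z) / (2*pi))\<^sup>2)
      + (LBINT t:ray. w t * (a t)\<^sup>2) / (2*pi)"
proof -
  have mw: "(\<lambda>z::real\<times>real. w (fst z)) \<in> Bor" "(\<lambda>z::real\<times>real. a (fst z)) \<in> Bor"
    by (rule borel_fst_snd w ma)+
  define i2 where "i2 z = 2 * (w (fst z) * (f z)\<^sup>2) + (2 / (2*pi)\<^sup>2) * (w (fst z) * (a (fst z))\<^sup>2 * 1)" for z :: "real \<times> real"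
  have t: "L1_on strip (\<lambda>z. w (fst z) * (a (fst z))\<^sup>2 * 1)"
    unfolding ray_circ(1) by (rule L1_tensor[OF ia circ_const(1)])
  have "L1_on strip i2"
    unfolding i2_def by (intro set_integral_add(1) set_integrable_mult_right i t)
  then show v: "L1_on strip (\<lambda>z. w (fst z) * (f z - a (fst z) / (2*pi))\<^sup>2)"
  proof (rule L1_bound)
    show "set_borel_measurable lborel strip (\<lambda>z. w (fst z) * (f z - a (fst z) / (2*pi))\<^sup>2)"
      using mf mw by (intro Bor_set ray_circ) auto
    have "\<bar>w (fst z) * (f z - a (fst z) / (2*pi))\<^sup>2\<bar> \<le> i2 z" for z
    proof -
      have "(f z - a (fst z) / (2*pi))\<^sup>2 \<le> 2 * (f z)\<^sup>2 + 2 * (a (fst z) / (2*pi))\<^sup>2"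
      proof -
        have "0 \<le> (f z + a (fst z) / (2*pi))\<^sup>2" by simp
        then show ?thesis by (simp add: power2_sum power2_diff)
      qed
      then have "w (fst z) * (f z - a (fst z) / (2*pi))\<^sup>2 \<le> w (fst z) * (2 * (f z)\<^sup>2 + 2 * (a (fst z) / (2*pi))\<^sup>2)"
        using w(2) by (rule mult_left_mono)
      also have "\<dots> = i2 z" by (simp add: i2_def algebra_simps power_divide)
      finally show ?thesis using w(2)[of "fst z"] by (simp add: abs_mult)
    qed
    then show "AE z in lborel. z \<in> strip \<longrightarrow> \<bar>w (fst z) * (f z - a (fst z) / (2*pi))\<^sup>2\<bar> \<le> i2 z" by simp
  qed
  note F1 = set_Fubini(3,5)[OF i[unfolded ray_circ(1)]] and F2 = set_Fubini(3,5)[OF v[unfolded ray_circ(1)]]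
  have "(LBINT t:ray. LBINT \<theta>:circ. w t * (f (t, \<theta>))\<^sup>2) =
     (LBINT t:ray. (LBINT \<theta>:circ. w t * (f (t, \<theta>) - a t / (2*pi))\<^sup>2) + w t * (a t)\<^sup>2 / (2*pi))"
  proof (rule LBINT_cong_AE(1)[OF _ _ ray_circ(2)])
    have "(\<lambda>t. cmean (\<lambda>z. w (fst z) * (f z)\<^sup>2) t) \<in> Bor"
      using mf mw by (intro cmean_measurable) auto
    then show "(\<lambda>t. LBINT \<theta>:circ. w t * (f (t, \<theta>))\<^sup>2) \<in> Bor" by (simp add: cmean_def)
    have "(\<lambda>t. cmean (\<lambda>z. w (fst z) * (f z - a (fst z) / (2*pi))\<^sup>2) t) \<in> Bor"
      using mf mw by (intro cmean_measurable) auto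
    then show "(\<lambda>t. (LBINT \<theta>:circ. w t * (f (t, \<theta>) - a t / (2*pi))\<^sup>2) + w t * (a t)\<^sup>2 / (2*pi)) \<in> Bor"
      using w ma by (simp add: cmean_def)
    show "AE t in lborel. t \<in> ray \<longrightarrow> (LBINT \<theta>:circ. w t * (f (t, \<theta>))\<^sup>2) =
      (LBINT \<theta>:circ. w t * (f (t, \<theta>) - a t / (2*pi))\<^sup>2) + w t * (a t)\<^sup>2 / (2*pi)"
      using sl mean
    proof eventually_elim
      case (elim t)
      show ?case
      proof
        assume "t \<in> ray"
        with elim circ_variance[OF borel_slices(2)[OF mf, of t]]
        have e: "(LBINT \<theta>:circ. (f (t, \<theta>))\<^sup>2) = (LBINT \<theta>:circ. (f (t, \<theta>) - a t / (2*pi))\<^sup>2) + (a t)\<^sup>2 / (2*pi)"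
          by (simp add: cmean_def)
        show "(LBINT \<theta>:circ. w t * (f (t, \<theta>))\<^sup>2) =
          (LBINT \<theta>:circ. w t * (f (t, \<theta>) - a t / (2*pi))\<^sup>2) + w t * (a t)\<^sup>2 / (2*pi)"
          unfolding set_integral_mult_right e by (simp add: distrib_left)
      qed
    qed
  qed
  also have "\<dots> = (LBINT t:ray. LBINT \<theta>:circ. w t * (f (t, \<theta>) - a t / (2*pi))\<^sup>2) + (LBINT t:ray. w t * (a t)\<^sup>2) / (2*pi)"
    using F2(2) set_integrable_divide[OF ia, of "2*pi"] by (subst set_integral_add(2)) auto
  finally show "(LBINT z:strip. w (fst z) * (f z)\<^sup>2) = (LBINT z:strip. w (fst z) * (f z - a (fst z) / (2*pi))\<^sup>2)
      + (LBINT t:ray. w t * (a t)\<^sup>2) / (2*pi)"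
    using F1(1) F2(1) by (simp add: ray_circ(1)[symmetric])
qed

text \<open>Partial derivatives and traces are separate arguments, so that the form can be evaluated
  on remainders after subtraction of means, whose derivatives and traces are explicit and not
  chosen.\<close>

definition face_form ::
    "real \<Rightarrow> (real\<times>real \<Rightarrow> real) \<Rightarrow> (real\<times>real \<Rightarrow> real) \<Rightarrow> (real\<times>real \<Rightarrow> real) \<Rightarrow> (real \<Rightarrow> real) \<Rightarrow>
     (real\<times>real \<Rightarrow> real) \<Rightarrow> (real\<times>real \<Rightarrow> real) \<Rightarrow> (real\<times>real \<Rightarrow> real) \<Rightarrow> (real \<Rightarrow> real) \<Rightarrow> real" where
  "face_form T u P R \<tau> v P' R' \<tau>' =
     (LBINT z:strip. P z * P' z + R z * R' z - 2 * sech2 (fst z + T) * u z * v z)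
     - tanh T * (LBINT \<theta>:circ. \<tau> \<theta> * \<tau>' \<theta>)"

lemma face_form_diag:
  assumes S: "strip_function u P R \<tau>"
  shows "face_form T u P R \<tau> u P R \<tau> = (LBINT z:strip. (P z)\<^sup>2) + (LBINT z:strip. (R z)\<^sup>2)
    - 2 * (LBINT z:strip. sech2 (fst z + T) * (u z)\<^sup>2) - tanh T * (LBINT \<theta>:circ. (\<tau> \<theta>)\<^sup>2)"
proof -
  note D = strip_functionD[OF S]
  have "(LBINT z:strip. P z * P z + R z * R z - 2 * sech2 (fst z + T) * u z * u z)
     = (LBINT z:strip. ((P z)\<^sup>2 + (R z)\<^sup>2) - 2 * (sech2 (fst z + T) * (u z)\<^sup>2))"
    by (simp add: power2_eq_square mult.assoc)
  also have "\<dots> = (LBINT z:strip. (P z)\<^sup>2) + (LBINT z:strip. (R z)\<^sup>2)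
    - 2 * (LBINT z:strip. sech2 (fst z + T) * (u z)\<^sup>2)"
    by (subst set_integral_diff(2)[OF set_integral_add(1)[OF D(5,6)] set_integrable_mult_right[OF weighted_integrable[OF S]]],
        subst set_integral_add(2)[OF D(5,6)]) simp
  finally show ?thesis by (simp add: face_form_def power2_eq_square)
qed

context
  fixes u P R \<tau>
  assumes S: "strip_function u P R \<tau>"
begin

private abbreviation "m \<equiv> mean_rep P \<tau>"
private abbreviation "c0 \<equiv> LBINT \<theta>:circ. \<tau> \<theta>"
private abbreviation "V \<equiv> (\<lambda>z. u z - m (fst z) / (2*pi))"
private abbreviation "PV \<equiv> (\<lambda>z. P z - cmean P (fst z) / (2*pi))"
private abbreviation "\<tau>V \<equiv> (\<lambda>\<theta>. \<tau> \<theta> - c0 / (2*pi))"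

lemma demeaned_strip_function: "strip_function V PV R \<tau>V"
  unfolding strip_function_def
proof (intro conjI)
  note D = strip_functionD[OF S] and M = mean_rep[OF S]
  have mc: "cmean P \<in> Bor" by (rule cmean_measurable[OF D(2)])
  show "V \<in> Bor" using D(1) borel_fst_snd(1)[OF M(4)] by simp
  show mPV: "PV \<in> Bor" using D(2) borel_fst_snd(1)[OF mc] by simp
  show "R \<in> Bor" by (rule D(3))
  show "\<tau>V \<in> Bor" using D(4) by simp
  show "L1_on strip (\<lambda>z. (R z)\<^sup>2)" by (rule D(6))
  have "L1_on strip (\<lambda>z. (cmean P (fst z))\<^sup>2 * 1)"
    unfolding ray_circ(1) by (rule L1_tensor[OF M(5) circ_const(1)])
  then show PV2: "L1_on strip (\<lambda>z. (PV z)\<^sup>2)"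
    using L2_add_integrable[of P "\<lambda>z. cmean P (fst z)" strip 1 "- (1 / (2*pi))"] D(2,5) borel_fst_snd(1)[OF mc] ray_circ by simp
  show "L1_on circ (\<lambda>\<theta>. (\<tau>V \<theta>)\<^sup>2)"
    using L2_add_integrable[of \<tau> "\<lambda>_. 1" circ 1 "- (c0 / (2*pi))"] D(4,7) ray_circ circ_const(1)[of 1] by simp
  have "AE \<theta> in lborel. \<theta> \<in> circ \<longrightarrow> (\<forall>t\<in>ray. trace_rep PV \<tau>V (t, \<theta>) = trace_rep P \<tau> (t, \<theta>) - m t / (2*pi))"
    using AE_strip_slices[OF D(2,5)] AE_strip_slices[OF mPV PV2]
  proof eventually_elim
    case (elim \<theta>)
    show ?case
    proof (intro impI ballI)
      fix t assume \<theta>: "\<theta> \<in> circ" and t: "t \<in> ray"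
      have 1: "ac 0 t (\<lambda>t. trace_rep P \<tau> (t, \<theta>)) (\<lambda>t. P (t, \<theta>))" using elim \<theta> by (intro trace_rep_ac) auto
      have 2: "ac 0 t (\<lambda>t. trace_rep PV \<tau>V (t, \<theta>)) (\<lambda>t. P (t, \<theta>) - cmean P t / (2*pi))"
        using trace_rep_ac[of t PV \<theta> \<tau>V] elim \<theta> by simp
      have "ac 0 t (\<lambda>t. 1 * (1 * trace_rep P \<tau> (t, \<theta>) + (- (1 / (2*pi))) * m t) + (-1) * trace_rep PV \<tau>V (t, \<theta>))
        (\<lambda>t. 1 * (1 * P (t, \<theta>) + (- (1 / (2*pi))) * cmean P t) + (-1) * (P (t, \<theta>) - cmean P t / (2*pi)))"
        by (intro ac_lin 1 2 M(1))
      from ac_zero_const[OF this, of t] t M(2)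
      show "trace_rep PV \<tau>V (t, \<theta>) = trace_rep P \<tau> (t, \<theta>) - m t / (2*pi)" by (simp add: ray_def)
    qed
  qed
  from D(8) AE_lborel_snd[OF this] show "AE z in lborel. z \<in> strip \<longrightarrow> V z = trace_rep PV \<tau>V z"
  proof eventually_elim
    case (elim z)
    then show ?case by (cases z) (auto simp: ray_circ(1))
  qed
  show "AE t in lborel. t \<in> ray \<longrightarrow> (\<exists>g. ac 0 (2*pi) g (\<lambda>\<theta>. R (t, \<theta>)) \<and> g (2*pi) = g 0 \<and>
        (AE \<theta> in lborel. \<theta> \<in> circ \<longrightarrow> V (t, \<theta>) = g \<theta>))"
    using D(9)
  proof eventually_elim
    case (elim t)
    show ?case
    proof
      assume "t \<in> ray"
      then obtain g where g: "ac 0 (2*pi) g (\<lambda>\<theta>. R (t, \<theta>))" "g (2*pi) = g 0" "AE \<theta> in lborel. \<theta> \<in> circ \<longrightarrow> u (t, \<theta>) = g \<theta>"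
        using elim by blast
      from g(3) have "AE \<theta> in lborel. \<theta> \<in> circ \<longrightarrow> V (t, \<theta>) = g \<theta> - m t / (2*pi)"
        by eventually_elim auto
      with ac_diff_const[OF g(1)] g(2) show "\<exists>g. ac 0 (2*pi) g (\<lambda>\<theta>. R (t, \<theta>)) \<and> g (2*pi) = g 0 \<and>
        (AE \<theta> in lborel. \<theta> \<in> circ \<longrightarrow> V (t, \<theta>) = g \<theta>)"
        by (intro exI[of _ "\<lambda>\<theta>. g \<theta> - m t / (2*pi)"]) auto
    qed
  qed
qed

lemma demeaned_mean_zero: "AE t in lborel. t \<in> ray \<longrightarrow> cmean V t = 0"
  using mean_rep(3)[OF S] slice_sq_integrable(1)[OF S]
proof eventually_elim
  case (elim t)
  show ?case
  proof
    assume t: "t \<in> ray"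
    then have "L1_on circ (\<lambda>\<theta>. u (t, \<theta>))"
      using elim by (intro circ_L1[OF borel_slices(2)[OF strip_functionD(1)[OF S]]]) auto
    then have "cmean V t = cmean u t - (LBINT \<theta>:circ. m t / (2*pi))"
      by (simp add: cmean_def set_integral_diff(2)[OF _ circ_const(1)])
    then show "cmean V t = 0" using elim t by (simp add: circ_const(2))
  qed
qed

text \<open>The mean depends on t only, so \<open>R\<close> is unchanged, and the cross terms in the
  other three integrals vanish by orthogonality of constants and mean zero functions on the
  circle.\<close>

lemma face_form_demean:
  "face_form T u P R \<tau> u P R \<tau> = face_form T V PV R \<tau>V V PV R \<tau>V + radial_form T m (cmean P) / (2*pi)"
proof -
  note D = strip_functionD[OF S] and M = mean_rep[OF S]
  have 1: "(LBINT z:strip. (P z)\<^sup>2) = (LBINT z:strip. (PV z)\<^sup>2) + (LBINT t:ray. (cmean P t)\<^sup>2) / (2*pi)"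
    using variance_strip(2)[OF D(2) cmean_measurable[OF D(2)], of "\<lambda>_. 1"] slice_sq_integrable(2)[OF S] D(5) M(5) by simp
  have 2: "(LBINT z:strip. sech2 (fst z + T) * (u z)\<^sup>2) = (LBINT z:strip. sech2 (fst z + T) * (V z)\<^sup>2)
     + (LBINT t:ray. sech2 (t + T) * (m t)\<^sup>2) / (2*pi)"
    by (rule variance_strip(2)[OF D(1) M(4), of "\<lambda>t. sech2 (t + T)"])
       (use sech2_measurable sech2_bounds(1) slice_sq_integrable(1)[OF S] M(3) M(6) weighted_integrable[OF S] in \<open>auto simp: less_imp_le\<close>)
  have 3: "(LBINT \<theta>:circ. (\<tau> \<theta>)\<^sup>2) = (LBINT \<theta>:circ. (\<tau>V \<theta>)\<^sup>2) + c0\<^sup>2 / (2*pi)"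
    using circ_variance[OF D(4,7)] by simp
  have 4: "(LBINT t:ray. 2 * sech2 (t + T) * (m t)\<^sup>2) = 2 * (LBINT t:ray. sech2 (t + T) * (m t)\<^sup>2)"
    by (simp add: mult.assoc)
  show ?thesis
    unfolding face_form_diag[OF S] face_form_diag[OF demeaned_strip_function] 1 2 3 radial_form_def 4 M(2)
    by (simp add: field_simps)
qed

end

text \<open>Wirtinger's inequality on almost every circle, integrated over t. Square integrability
  of \<open>v\<close> on the strip is a conclusion: for mean zero functions the angular derivative
  controls it, whereas finite energy alone does not.\<close>

lemma wirtinger_strip:
  assumes S: "strip_function v P R \<tau>" and mean: "AE t in lborel. t \<in> ray \<longrightarrow> cmean v t = 0"
  shows "L1_on strip (\<lambda>z. (v z)\<^sup>2)"
    and "(LBINT z:strip. (v z)\<^sup>2) \<le> (LBINT z:strip. (R z)\<^sup>2)"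
    and "(LBINT z:strip. (R z)\<^sup>2) \<le> (LBINT z:strip. (v z)\<^sup>2) \<Longrightarrow>
      AE t in lborel. t \<in> ray \<longrightarrow> (\<exists>A B. AE \<theta> in lborel. \<theta> \<in> circ \<longrightarrow> v (t, \<theta>) = A * cos \<theta> + B * sin \<theta>)"
proof -
  note D = strip_functionD[OF S]
  have sl: "AE t in lborel. t \<in> ray \<longrightarrow> (LBINT \<theta>:circ. (v (t, \<theta>))\<^sup>2) \<le> (LBINT \<theta>:circ. (R (t, \<theta>))\<^sup>2) \<and>
    ((LBINT \<theta>:circ. (R (t, \<theta>))\<^sup>2) \<le> (LBINT \<theta>:circ. (v (t, \<theta>))\<^sup>2) \<longrightarrow>
       (\<exists>A B. AE \<theta> in lborel. \<theta> \<in> circ \<longrightarrow> v (t, \<theta>) = A * cos \<theta> + B * sin \<theta>))"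
    using D(9) mean slice_sq_integrable(3)[OF S]
  proof eventually_elim
    case (elim t)
    show ?case
    proof (rule impI)
      assume t: "t \<in> ray"
      then obtain g where g: "ac 0 (2*pi) g (\<lambda>\<theta>. R (t, \<theta>))" "g (2*pi) = g 0" "AE \<theta> in lborel. \<theta> \<in> circ \<longrightarrow> v (t, \<theta>) = g \<theta>"
        using elim by blast
      note mR = borel_slices(2)[OF D(3), of t] and mv = borel_slices(2)[OF D(1), of t]
      have "(\<lambda>\<theta>. R (t, \<theta>)) \<in> Bor" by (rule mR)
      then have R2: "set_borel_measurable lborel {0..2*pi} (\<lambda>\<theta>. (R (t, \<theta>))\<^sup>2)"
        by (intro Bor_set) auto
      note cg = ac_continuous[OF g(1)]
      \<comment> \<open>\<open>g\<close> is controlled only on the closed interval, where it is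
        continuous; cutting it off yields a Borel function on the line.\<close>
      define gg where "gg \<theta> = indicator {0..2*pi} \<theta> *\<^sub>R g \<theta>" for \<theta>
      have mg: "gg \<in> Bor"
        using borel_measurable_continuous_on_indicator[OF _ cg] by (simp add: gg_def[abs_def])
      have vg: "AE \<theta> in lborel. \<theta> \<in> circ \<longrightarrow> v (t, \<theta>) = gg \<theta>"
        using g(3) by eventually_elim (auto simp: gg_def circ_def)
      have i1: "(LBINT \<theta>:circ. v (t, \<theta>)) = (LBINT \<theta>:{0..2*pi}. g \<theta>)"
      proof -
        have "(LBINT \<theta>:circ. v (t, \<theta>)) = (LBINT \<theta>:circ. gg \<theta>)"
          by (rule LBINT_cong_AE(1)[OF mv mg ray_circ(3) vg])
        also have "\<dots> = (LBINT \<theta>:{0..2*pi}. gg \<theta>)"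
          by (rule circ_closed(2)) (use mg in \<open>auto intro: Bor_set\<close>)
        also have "\<dots> = (LBINT \<theta>:{0..2*pi}. g \<theta>)"
          by (rule set_lebesgue_integral_cong) (auto simp: gg_def)
        finally show ?thesis .
      qed
      have i2: "(LBINT \<theta>:circ. (v (t, \<theta>))\<^sup>2) = (LBINT \<theta>:{0..2*pi}. (g \<theta>)\<^sup>2)"
      proof -
        have "(LBINT \<theta>:circ. (v (t, \<theta>))\<^sup>2) = (LBINT \<theta>:circ. (gg \<theta>)\<^sup>2)"
          by (rule LBINT_cong_AE(1)[OF _ _ ray_circ(3)]) (use mv mg vg in \<open>auto elim!: eventually_mono\<close>)
        also have "\<dots> = (LBINT \<theta>:{0..2*pi}. (gg \<theta>)\<^sup>2)"
          by (rule circ_closed(2)) (use mg in \<open>auto intro: Bor_set\<close>)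
        also have "\<dots> = (LBINT \<theta>:{0..2*pi}. (g \<theta>)\<^sup>2)"
          by (rule set_lebesgue_integral_cong) (auto simp: gg_def)
        finally show ?thesis .
      qed
      have d2: "L1_on {0..2*pi} (\<lambda>\<theta>. (R (t, \<theta>))\<^sup>2)"
        using circ_closed(1)[OF R2] elim t by simp
      have m0: "(LBINT \<theta>:{0..2*pi}. g \<theta>) = 0" using i1 elim t by (simp add: cmean_def)
      note W = wirtinger[OF g(1) d2 mR g(2) m0]
      show "(LBINT \<theta>:circ. (v (t, \<theta>))\<^sup>2) \<le> (LBINT \<theta>:circ. (R (t, \<theta>))\<^sup>2) \<and>
        ((LBINT \<theta>:circ. (R (t, \<theta>))\<^sup>2) \<le> (LBINT \<theta>:circ. (v (t, \<theta>))\<^sup>2) \<longrightarrow>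
           (\<exists>A B. AE \<theta> in lborel. \<theta> \<in> circ \<longrightarrow> v (t, \<theta>) = A * cos \<theta> + B * sin \<theta>))"
        unfolding i2 circ_closed(2)[OF R2]
      proof (intro conjI impI W(1))
        assume "(LBINT \<theta>:{0..2*pi}. (R (t, \<theta>))\<^sup>2) \<le> (LBINT \<theta>:{0..2*pi}. (g \<theta>)\<^sup>2)"
        from W(2)[OF this] obtain A B where "\<forall>x\<in>{0..2*pi}. g x = A * cos x + B * sin x" by blast
        then have "AE \<theta> in lborel. \<theta> \<in> circ \<longrightarrow> v (t, \<theta>) = A * cos \<theta> + B * sin \<theta>"
          using g(3) by (auto elim!: eventually_mono simp: circ_def)
        then show "\<exists>A B. AE \<theta> in lborel. \<theta> \<in> circ \<longrightarrow> v (t, \<theta>) = A * cos \<theta> + B * sin \<theta>" by blast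
      qed
    qed
  qed
  have mv2: "(\<lambda>z. (v z)\<^sup>2) \<in> Bor" using D(1) by simp
  have mcm: "(\<lambda>t. LBINT \<theta>:circ. (v (t, \<theta>))\<^sup>2) \<in> Bor" "(\<lambda>t. LBINT \<theta>:circ. (R (t, \<theta>))\<^sup>2) \<in> Bor"
    using cmean_measurable[of "\<lambda>z. (v z)\<^sup>2"] cmean_measurable[of "\<lambda>z. (R z)\<^sup>2"] D(1,3) by (auto simp: cmean_def[abs_def])
  note FR = set_Fubini(3,5)[OF D(6)[unfolded ray_circ(1)]]
  have nn: "0 \<le> (LBINT \<theta>:circ. (v (t, \<theta>))\<^sup>2)" for t
    unfolding set_lebesgue_integral_def by (intro Bochner_Integration.integral_nonneg) auto
  show v2: "L1_on strip (\<lambda>z. (v z)\<^sup>2)"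
    unfolding ray_circ(1)
  proof (rule set_Tonelli[OF mv2 ray_circ(2,3) slice_sq_integrable(1)[OF S]])
    have "L1_on ray (\<lambda>t. LBINT \<theta>:circ. (v (t, \<theta>))\<^sup>2)"
      by (rule L1_bound[OF FR(2)])
         (use mcm ray_circ sl nn in \<open>auto intro!: Bor_set elim!: eventually_mono\<close>)
    then show "L1_on ray (\<lambda>t. LBINT \<theta>:circ. \<bar>(v (t, \<theta>))\<^sup>2\<bar>)" by simp
  qed
  note FV = set_Fubini(3,5)[OF v2[unfolded ray_circ(1)]]
  have ile: "integrable lborel (\<lambda>t. indicator ray t *\<^sub>R (LBINT \<theta>:circ. (v (t, \<theta>))\<^sup>2))"
    "integrable lborel (\<lambda>t. indicator ray t *\<^sub>R (LBINT \<theta>:circ. (R (t, \<theta>))\<^sup>2))"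
    using FV(2) FR(2) by (auto simp: set_integrable_def)
  have ale: "AE t in lborel. indicator ray t *\<^sub>R (LBINT \<theta>:circ. (v (t, \<theta>))\<^sup>2) \<le> indicator ray t *\<^sub>R (LBINT \<theta>:circ. (R (t, \<theta>))\<^sup>2)"
    using sl by eventually_elim (auto simp: indicator_def)
  show "(LBINT z:strip. (v z)\<^sup>2) \<le> (LBINT z:strip. (R z)\<^sup>2)"
    unfolding ray_circ(1) FV(1) FR(1) using integral_mono_AE[OF ile ale] by (simp add: set_lebesgue_integral_def)
  assume "(LBINT z:strip. (R z)\<^sup>2) \<le> (LBINT z:strip. (v z)\<^sup>2)"
  then have "(LINT t|lborel. indicator ray t *\<^sub>R (LBINT \<theta>:circ. (R (t, \<theta>))\<^sup>2) - indicator ray t *\<^sub>R (LBINT \<theta>:circ. (v (t, \<theta>))\<^sup>2)) = 0"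
    unfolding ray_circ(1) FV(1) FR(1) using integral_mono_AE[OF ile ale] ile
    by (subst Bochner_Integration.integral_diff) (auto simp: set_lebesgue_integral_def)
  then have "AE t in lborel. indicator ray t *\<^sub>R (LBINT \<theta>:circ. (R (t, \<theta>))\<^sup>2) - indicator ray t *\<^sub>R (LBINT \<theta>:circ. (v (t, \<theta>))\<^sup>2) = 0"
    using ale ile by (subst (asm) integral_nonneg_eq_0_iff_AE) auto
  then show "AE t in lborel. t \<in> ray \<longrightarrow> (\<exists>A B. AE \<theta> in lborel. \<theta> \<in> circ \<longrightarrow> v (t, \<theta>) = A * cos \<theta> + B * sin \<theta>)"
    using sl by eventually_elim (auto simp: indicator_def split: if_splits)
qed

text \<open>\<open>line_identity\<close> on almost every line. Its boundary term tanh T \<tau>^2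
  cancels the curvature term of the face form, and its potential 2 sech2 - 1 leaves the difference
  between the integrals of R^2 and v^2.\<close>

lemma mean_zero_form:
  assumes S: "strip_function v P R \<tau>" and v2: "L1_on strip (\<lambda>z. (v z)\<^sup>2)"
  shows "face_form T v P R \<tau> v P R \<tau> = (LBINT z:strip. (P z + tanh (fst z + T) * v z)\<^sup>2)
      + ((LBINT z:strip. (R z)\<^sup>2) - (LBINT z:strip. (v z)\<^sup>2))"
    and "L1_on strip (\<lambda>z. (P z + tanh (fst z + T) * v z)\<^sup>2)"
proof -
  note D = strip_functionD[OF S]
  let ?U = "trace_rep P \<tau>"
  have mU: "?U \<in> Bor" by (rule trace_rep_measurable[OF D(2,4)])
  have mt: "(\<lambda>z::real\<times>real. tanh (fst z + T)) \<in> Bor" by (rule borel_fst_snd'[OF sech2_borel(2)])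
  have ms: "(\<lambda>z::real\<times>real. sech2 (fst z + T)) \<in> Bor" by (rule borel_fst_snd'[OF sech2_borel(1)])
  have tb: "\<bar>(tanh s)\<^sup>2\<bar> \<le> 1" for s :: real using sech2_bounds(1)[of s] by (simp add: sech2_def)
  have "L1_on strip (\<lambda>z. (v z)\<^sup>2 * (tanh (fst z + T))\<^sup>2)"
    by (rule L1_mult_bounded(1)[OF v2, of _ 1])
       (use tb mt ray_circ in \<open>auto intro!: Bor_set\<close>)
  then have tv2: "L1_on strip (\<lambda>z. (tanh (fst z + T) * v z)\<^sup>2)" by (simp add: power_mult_distrib mult.commute)
  show X: "L1_on strip (\<lambda>z. (P z + tanh (fst z + T) * v z)\<^sup>2)"
    using L2_add_integrable[of P "\<lambda>z. tanh (fst z + T) * v z" strip 1 1] D(1,2,5) mt tv2 ray_circ by simp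
  have Y: "L1_on strip (\<lambda>z. 2 * (sech2 (fst z + T) * (v z)\<^sup>2) - (v z)\<^sup>2)"
    by (intro set_integral_diff(1) set_integrable_mult_right weighted_integrable[OF S] v2)
  note FP = set_Fubini(4,6)[OF D(5)[unfolded ray_circ(1)]] and FX = set_Fubini(4,6)[OF X[unfolded ray_circ(1)]]
    and FY = set_Fubini(4,6)[OF Y[unfolded ray_circ(1)]]
  let ?p = "\<lambda>\<theta>. LBINT t:ray. (P (t, \<theta>))\<^sup>2"
  let ?x = "\<lambda>\<theta>. LBINT t:ray. (P (t, \<theta>) + tanh (fst (t, \<theta>) + T) * v (t, \<theta>))\<^sup>2"
  let ?y = "\<lambda>\<theta>. LBINT t:ray. 2 * (sech2 (fst (t, \<theta>) + T) * (v (t, \<theta>))\<^sup>2) - (v (t, \<theta>))\<^sup>2"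
  have "AE \<theta> in lborel. \<theta> \<in> circ \<longrightarrow> ?p \<theta> - ?y \<theta> = ?x \<theta> + tanh T * (\<tau> \<theta>)\<^sup>2"
    using AE_strip_slices[OF D(2,5)] AE_product(2)[OF D(8)] set_Fubini(2)[OF v2[unfolded ray_circ(1)]]
  proof eventually_elim
    case (elim \<theta>)
    show ?case
    proof
      assume \<theta>: "\<theta> \<in> circ"
      have ae: "AE t in lborel. t \<in> ray \<longrightarrow> v (t, \<theta>) = ?U (t, \<theta>)" using elim(2) \<theta> by (auto simp: ray_circ(1))
      note mv = borel_slices(1)[OF D(1), of \<theta>] and mu = borel_slices(1)[OF mU, of \<theta>] and mp = borel_slices(1)[OF D(2), of \<theta>]
      have y: "ac 0 b (\<lambda>t. ?U (t, \<theta>)) (\<lambda>t. P (t, \<theta>))" for b using elim(1) \<theta> by (intro trace_rep_ac) auto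
      have U2: "L1_on ray (\<lambda>t. (?U (t, \<theta>))\<^sup>2)"
        by (rule LBINT_cong_AE(2)[of "\<lambda>t. (v (t, \<theta>))\<^sup>2"]) (use mv mu ray_circ ae elim(3) \<theta> in \<open>auto elim!: eventually_mono\<close>)
      have P2: "L1_on ray (\<lambda>t. (P (t, \<theta>))\<^sup>2)" using elim(1) \<theta> by simp
      note L = line_identity(1)[OF y U2 P2 mu mp, of T]
      have mt': "(\<lambda>t. tanh (t + T)) \<in> Bor" by (intro borel_measurable_continuous_onI continuous_intros)
      have "?x \<theta> = (LBINT t:ray. (P (t, \<theta>) + tanh (t + T) * ?U (t, \<theta>))\<^sup>2)"
        by (rule LBINT_cong_AE(1)) (use mv mu mp mt' ray_circ ae in \<open>auto elim!: eventually_mono\<close>)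
      moreover have "?y \<theta> = (LBINT t:ray. (2 * sech2 (t + T) - 1) * (?U (t, \<theta>))\<^sup>2)"
        by (rule LBINT_cong_AE(1))
           (use mv mu sech2_measurable[of T] ray_circ ae in \<open>auto elim!: eventually_mono simp: algebra_simps\<close>)
      ultimately show "?p \<theta> - ?y \<theta> = ?x \<theta> + tanh T * (\<tau> \<theta>)\<^sup>2" using L by simp
    qed
  qed
  then have ae: "AE \<theta> in lborel. indicator circ \<theta> *\<^sub>R (?p \<theta> - ?y \<theta>) = indicator circ \<theta> *\<^sub>R (?x \<theta> + tanh T * (\<tau> \<theta>)\<^sup>2)"
    by eventually_elim (auto simp: indicator_def)
  have i1: "L1_on circ (\<lambda>\<theta>. ?p \<theta> - ?y \<theta>)" by (rule set_integral_diff(1)[OF FP(2) FY(2)])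
  have i2: "L1_on circ (\<lambda>\<theta>. ?x \<theta> + tanh T * (\<tau> \<theta>)\<^sup>2)"
    by (rule set_integral_add(1)[OF FX(2) set_integrable_mult_right]) (use D(7) in simp)
  have "(LBINT \<theta>:circ. ?p \<theta> - ?y \<theta>) = (LBINT \<theta>:circ. ?x \<theta> + tanh T * (\<tau> \<theta>)\<^sup>2)"
    using i1 i2 unfolding set_lebesgue_integral_def[of _ circ] set_integrable_def
    by (intro integral_cong_AE ae) auto
  moreover have "(LBINT \<theta>:circ. ?p \<theta> - ?y \<theta>) = (LBINT \<theta>:circ. ?p \<theta>) - (LBINT \<theta>:circ. ?y \<theta>)"
    by (rule set_integral_diff(2)[OF FP(2) FY(2)])
  moreover have "(LBINT \<theta>:circ. ?x \<theta> + tanh T * (\<tau> \<theta>)\<^sup>2) = (LBINT \<theta>:circ. ?x \<theta>) + tanh T * (LBINT \<theta>:circ. (\<tau> \<theta>)\<^sup>2)"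
    using set_integral_add(2)[OF FX(2) set_integrable_mult_right[of "tanh T", OF D(7)]] by simp
  ultimately have "(LBINT z:strip. (P z)\<^sup>2) - (LBINT z:strip. 2 * (sech2 (fst z + T) * (v z)\<^sup>2) - (v z)\<^sup>2)
     = (LBINT z:strip. (P z + tanh (fst z + T) * v z)\<^sup>2) + tanh T * (LBINT \<theta>:circ. (\<tau> \<theta>)\<^sup>2)"
    unfolding ray_circ(1) FP(1) FX(1) FY(1) by linarith
  moreover have "(LBINT z:strip. 2 * (sech2 (fst z + T) * (v z)\<^sup>2) - (v z)\<^sup>2)
     = 2 * (LBINT z:strip. sech2 (fst z + T) * (v z)\<^sup>2) - (LBINT z:strip. (v z)\<^sup>2)"
    by (subst set_integral_diff(2)[OF set_integrable_mult_right[OF weighted_integrable[OF S]] v2]) simp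
  ultimately show "face_form T v P R \<tau> v P R \<tau> = (LBINT z:strip. (P z + tanh (fst z + T) * v z)\<^sup>2)
      + ((LBINT z:strip. (R z)\<^sup>2) - (LBINT z:strip. (v z)\<^sup>2))"
    unfolding face_form_diag[OF S] by linarith
qed

section \<open>Geometry of the faces\<close>

definition e_th :: "real \<Rightarrow> real^3" where
  "e_th \<theta> = (- sin \<theta>) *\<^sub>R axis 1 1 + cos \<theta> *\<^sub>R axis 2 1"

lemma frame_components:
  "e_r \<theta> $ 1 = cos \<theta>" "e_r \<theta> $ 2 = sin \<theta>" "e_r \<theta> $ 3 = 0"
  "e_th \<theta> $ 1 = - sin \<theta>" "e_th \<theta> $ 2 = cos \<theta>" "e_th \<theta> $ 3 = 0"
  "e_3 $ 1 = 0" "e_3 $ 2 = 0" "e_3 $ 3 = 1"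
  by (simp_all add: e_r_def e_th_def e_3_def axis_def)

lemma frame_inner [simp]:
  "e_r \<theta> \<bullet> e_r \<theta> = 1" "e_th \<theta> \<bullet> e_th \<theta> = 1" "e_3 \<bullet> e_3 = 1" "e_r \<theta> \<bullet> e_th \<theta> = 0" "e_th \<theta> \<bullet> e_r \<theta> = 0"
  "e_r \<theta> \<bullet> e_3 = 0" "e_3 \<bullet> e_r \<theta> = 0" "e_th \<theta> \<bullet> e_3 = 0" "e_3 \<bullet> e_th \<theta> = 0"
  by (simp_all add: inner_vec_def sum_3 frame_components power2_eq_square[symmetric])

lemma frame_derivatives:
  "(e_r has_vector_derivative e_th \<theta>) (at \<theta>)" "(e_th has_vector_derivative - e_r \<theta>) (at \<theta>)"
  unfolding e_r_def[abs_def] e_th_def[abs_def]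
  by (auto intro!: derivative_eq_intros simp: has_vector_derivative_def scaleR_add_right algebra_simps)

lemma frame_has_derivative:
  "((\<lambda>z. e_r (snd z)) has_derivative (\<lambda>h. snd h *\<^sub>R e_th (snd z))) (at (z::real\<times>real))"
  "((\<lambda>z. e_th (snd z)) has_derivative (\<lambda>h. snd h *\<^sub>R (- e_r (snd z)))) (at (z::real\<times>real))"
proof -
  have p: "(snd has_derivative snd) (at z)" by (auto intro!: derivative_eq_intros)
  show "((\<lambda>z. e_r (snd z)) has_derivative (\<lambda>h. snd h *\<^sub>R e_th (snd z))) (at z)"
    using has_derivative_compose[OF p frame_derivatives(1)[unfolded has_vector_derivative_def]] .
  show "((\<lambda>z. e_th (snd z)) has_derivative (\<lambda>h. snd h *\<^sub>R (- e_r (snd z)))) (at z)"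
    using has_derivative_compose[OF p frame_derivatives(2)[unfolded has_vector_derivative_def]] .
qed

locale catenoid_face =
  fixes k T \<epsilon> :: real and X :: "real \<times> real \<Rightarrow> real^3"
  assumes k: "k > 0" and \<epsilon>: "\<epsilon> * \<epsilon> = 1"
    and X: "X = (\<lambda>z. k *\<^sub>R (cosh (fst z + T) *\<^sub>R e_r (snd z) + (\<epsilon> * fst z) *\<^sub>R e_3))"
begin

abbreviation "sh z \<equiv> sinh (fst z + T)"
abbreviation "ch z \<equiv> cosh (fst z + T)"

lemma ch_sh_derivative:
  "((\<lambda>z::real\<times>real. ch z) has_derivative (\<lambda>h. fst h * sh z)) (at z)"
  "((\<lambda>z::real\<times>real. sh z) has_derivative (\<lambda>h. fst h * ch z)) (at z)"
proof -
  have p: "((\<lambda>z::real\<times>real. fst z + T) has_derivative fst) (at z)" by (auto intro!: derivative_eq_intros)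
  have "(cosh has_derivative (\<lambda>h. h * sh z)) (at (fst z + T))" "(sinh has_derivative (\<lambda>h. h * ch z)) (at (fst z + T))"
    by (auto intro!: derivative_eq_intros simp: has_field_derivative_def[symmetric] mult_commute_abs)
  from has_derivative_compose[OF p this(1)] has_derivative_compose[OF p this(2)]
  show "((\<lambda>z::real\<times>real. ch z) has_derivative (\<lambda>h. fst h * sh z)) (at z)"
    "((\<lambda>z::real\<times>real. sh z) has_derivative (\<lambda>h. fst h * ch z)) (at z)" by auto
qed

lemma pd_X:
  "pd 1 X = (\<lambda>z. k *\<^sub>R (sh z *\<^sub>R e_r (snd z) + \<epsilon> *\<^sub>R e_3))"
  "pd 2 X = (\<lambda>z. k *\<^sub>R (ch z *\<^sub>R e_th (snd z)))"
proof -
  have "(X has_derivative (\<lambda>h. k *\<^sub>R ((ch z *\<^sub>R (snd h *\<^sub>R e_th (snd z)) + (fst h * sh z) *\<^sub>R e_r (snd z)) + (\<epsilon> * fst h) *\<^sub>R e_3))) (at z)" for z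
  proof -
    have b: "((\<lambda>z. (\<epsilon> * fst z) *\<^sub>R e_3) has_derivative (\<lambda>h. (\<epsilon> * fst h) *\<^sub>R e_3)) (at z)"
      by (auto intro!: derivative_eq_intros)
    show ?thesis unfolding X
      by (rule has_derivative_scaleR_right[OF has_derivative_add[OF has_derivative_scaleR[OF ch_sh_derivative(1) frame_has_derivative(1)] b]])
  qed
  from pd_eq[OF this] show "pd 1 X = (\<lambda>z. k *\<^sub>R (sh z *\<^sub>R e_r (snd z) + \<epsilon> *\<^sub>R e_3))"
    "pd 2 X = (\<lambda>z. k *\<^sub>R (ch z *\<^sub>R e_th (snd z)))" by auto
qed

lemma pd_pd_X:
  "pd 1 (pd 1 X) z = k *\<^sub>R (ch z *\<^sub>R e_r (snd z))"
  "pd 2 (pd 1 X) z = k *\<^sub>R (sh z *\<^sub>R e_th (snd z))"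
  "pd 1 (pd 2 X) z = k *\<^sub>R (sh z *\<^sub>R e_th (snd z))"
  "pd 2 (pd 2 X) z = k *\<^sub>R (- ch z *\<^sub>R e_r (snd z))"
proof -
  have 1: "(pd 1 X has_derivative (\<lambda>h. k *\<^sub>R (sh z *\<^sub>R (snd h *\<^sub>R e_th (snd z)) + (fst h * ch z) *\<^sub>R e_r (snd z)))) (at z)"
    unfolding pd_X
    using has_derivative_scaleR_right[OF has_derivative_add[OF has_derivative_scaleR[OF ch_sh_derivative(2) frame_has_derivative(1)] has_derivative_const]]
    by simp
  have 2: "(pd 2 X has_derivative (\<lambda>h. k *\<^sub>R (ch z *\<^sub>R (snd h *\<^sub>R (- e_r (snd z))) + (fst h * sh z) *\<^sub>R e_th (snd z)))) (at z)"
    unfolding pd_X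
    by (rule has_derivative_scaleR_right[OF has_derivative_scaleR[OF ch_sh_derivative(1) frame_has_derivative(2)]])
  show "pd 1 (pd 1 X) z = k *\<^sub>R (ch z *\<^sub>R e_r (snd z))"
    "pd 2 (pd 1 X) z = k *\<^sub>R (sh z *\<^sub>R e_th (snd z))"
    "pd 1 (pd 2 X) z = k *\<^sub>R (sh z *\<^sub>R e_th (snd z))"
    "pd 2 (pd 2 X) z = k *\<^sub>R (- ch z *\<^sub>R e_r (snd z))"
    using pd_eq[OF 1] pd_eq[OF 2] by auto
qed

lemma first_ff_X: "first_ff X z = (\<chi> i j. if i = j then (k * ch z)\<^sup>2 else 0)"
proof -
  have e: "k * k * (sh z * sh z + \<epsilon> * \<epsilon>) = (k * ch z)\<^sup>2"
    unfolding \<epsilon> power_mult_distrib cosh_square_eq by (simp add: power2_eq_square)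
  have "pd 1 X z \<bullet> pd 1 X z = k * k * (sh z * sh z + \<epsilon> * \<epsilon>)"
    by (simp add: pd_X inner_add_left inner_add_right algebra_simps)
  moreover have "pd 2 X z \<bullet> pd 2 X z = (k * ch z)\<^sup>2" "pd 1 X z \<bullet> pd 2 X z = 0" "pd 2 X z \<bullet> pd 1 X z = 0"
    by (simp_all add: pd_X inner_add_left inner_add_right power2_eq_square)
  ultimately show ?thesis unfolding first_ff_def e by (simp add: vec_eq_iff forall_2)
qed

lemma area_density_X: "area_density X z = (k * ch z)\<^sup>2"
proof -
  have "det (first_ff X z) = ((k * ch z)\<^sup>2)\<^sup>2" unfolding first_ff_X by (simp add: det_2 power2_eq_square)
  then have "area_density X z = sqrt (((k * ch z)\<^sup>2)\<^sup>2)" unfolding area_density_def by (rule arg_cong)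
  also have "\<dots> = (k * ch z)\<^sup>2" by (simp only: real_sqrt_abs) simp
  finally show ?thesis .
qed

lemma matrix_inv_X: "matrix_inv (first_ff X z) = (\<chi> i j. if i = j then 1 / (k * ch z)\<^sup>2 else 0)"
proof -
  let ?B = "(\<chi> i j. if i = j then 1 / (k * ch z)\<^sup>2 else 0) :: real^2^2"
  have nz: "(k * ch z)\<^sup>2 \<noteq> 0" using k by simp
  have AB: "first_ff X z ** ?B = mat 1" "?B ** first_ff X z = mat 1"
    unfolding first_ff_X using nz
    by (simp_all add: matrix_matrix_mult_def mat_def vec_eq_iff forall_2 sum_2)
  \<comment> \<open>\<open>matrix_inv\<close> is itself a choice; the explicit matrix
    \<open>?B\<close> shows that the chosen one is a genuine inverse.\<close>
  have inv: "first_ff X z ** matrix_inv (first_ff X z) = mat 1 \<and> matrix_inv (first_ff X z) ** first_ff X z = mat 1"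
    unfolding matrix_inv_def by (rule someI[of _ ?B]) (use AB in auto)
  have "matrix_inv (first_ff X z) = matrix_inv (first_ff X z) ** (first_ff X z ** ?B)"
    using AB by simp
  also have "\<dots> = ?B" using inv by (simp add: matrix_mul_assoc)
  finally show ?thesis .
qed

lemma cometric_area: "cometric X z p q * area_density X z = p $ 1 * q $ 1 + p $ 2 * q $ 2"
proof -
  have nz: "(k * ch z)\<^sup>2 \<noteq> 0" using k by simp
  have "cometric X z p q = (p $ 1 * q $ 1 + p $ 2 * q $ 2) / (k * ch z)\<^sup>2"
    unfolding cometric_def matrix_inv_X by (simp add: matrix_vector_mult_def inner_vec_def sum_2 add_divide_distrib)
  then show ?thesis unfolding area_density_X using nz by simp
qed

text \<open>The components of the normal are the Jacobi functions of translations: tanh in the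
  vertical direction, and up to sign cos \<theta> and sin \<theta> over cosh in the horizontal
  ones.\<close>

lemma unit_normal_X: "unit_normal X z = (1 / ch z) *\<^sub>R (sh z *\<^sub>R e_3 - \<epsilon> *\<^sub>R e_r (snd z))"
proof -
  have c: "cross3 (pd 1 X z) (pd 2 X z) = (k\<^sup>2 * ch z) *\<^sub>R (sh z *\<^sub>R e_3 - \<epsilon> *\<^sub>R e_r (snd z))"
  proof -
    have h: "k * (k * (cos (snd z) * (cos (snd z) * x))) + k * (k * (sin (snd z) * (sin (snd z) * x))) = k * (k * x)" for x
      using sin_cos_squared_add3[of "snd z"] by algebra
    show ?thesis
      by (simp add: pd_X cross3_def vec_eq_iff forall_3 frame_components power2_eq_square algebra_simps h)
  qed
  have "(sh z *\<^sub>R e_3 - \<epsilon> *\<^sub>R e_r (snd z)) \<bullet> (sh z *\<^sub>R e_3 - \<epsilon> *\<^sub>R e_r (snd z)) = sh z * sh z + \<epsilon> * \<epsilon>"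
    by (simp add: inner_diff_left inner_diff_right)
  also have "\<dots> = (ch z)\<^sup>2" unfolding \<epsilon> cosh_square_eq by (simp add: power2_eq_square)
  finally have n: "norm (sh z *\<^sub>R e_3 - \<epsilon> *\<^sub>R e_r (snd z)) = ch z" by (simp add: norm_eq_sqrt_inner)
  have pos: "k\<^sup>2 * ch z > 0" using k by simp
  show ?thesis unfolding unit_normal_def c sgn_div_norm norm_scaleR n using pos k
    by (simp add: field_simps)
qed

lemma normA_area: "normA_sq X z * area_density X z = 2 * sech2 (fst z + T)"
proof -
  have nz: "ch z \<noteq> 0" "k \<noteq> 0" using k by auto
  have "second_ff X z $ 1 $ 1 = - \<epsilon> * k" "second_ff X z $ 2 $ 2 = \<epsilon> * k" "second_ff X z $ 1 $ 2 = 0" "second_ff X z $ 2 $ 1 = 0"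
    unfolding second_ff_def using nz
    by (simp_all add: pd_pd_X unit_normal_X inner_diff_right)
  then have S: "matrix_inv (first_ff X z) ** second_ff X z = (\<chi> i j. if i = j then (if i = 1 then - \<epsilon> * k else \<epsilon> * k) / (k * ch z)\<^sup>2 else 0)"
    unfolding matrix_inv_X by (simp add: matrix_matrix_mult_def vec_eq_iff forall_2 sum_2)
  have "normA_sq X z = (\<epsilon> * k / (k * ch z)\<^sup>2)\<^sup>2 + (\<epsilon> * k / (k * ch z)\<^sup>2)\<^sup>2"
    unfolding normA_sq_def Let_def S by (simp add: matrix_matrix_mult_def trace_def sum_2 power2_eq_square)
  also have "\<dots> = 2 * (\<epsilon> * \<epsilon>) * k\<^sup>2 / ((k * ch z)\<^sup>2)\<^sup>2" by (simp add: power_divide power_mult_distrib power2_eq_square)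
  also have "\<dots> = 2 * k\<^sup>2 / ((k * ch z)\<^sup>2)\<^sup>2" unfolding \<epsilon> by simp
  finally show ?thesis unfolding area_density_X sech2_alt using nz
    by (simp add: power2_eq_square)
qed

lemma norm_X: "(norm (X z))\<^sup>2 = k\<^sup>2 * ((ch z)\<^sup>2 + (fst z)\<^sup>2)"
proof -
  have "(norm (X z))\<^sup>2 = k * k * (ch z * ch z + (\<epsilon> * \<epsilon>) * (fst z * fst z))"
    unfolding power2_norm_eq_inner X by (simp add: inner_add_left inner_add_right algebra_simps)
  then show ?thesis unfolding \<epsilon> by (simp add: power2_eq_square)
qed

end

text \<open>The curvature vector is \<open>- e_r \<theta> / c\<close> and the speed is
  \<open>c\<close>, so the radius cancels. Combined with tanh T_i = - cos \<alpha>_i, this is the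
  boundary coefficient tanh T_i of the face form.\<close>

lemma boundary_curvature:
  assumes c: "c > 0"
  shows "(curvature_vector (Gam c) \<theta> \<bullet> conormal \<alpha> i \<theta>) * speed (Gam c) \<theta> = - cos (ang \<alpha> i)"
proof -
  have d: "vector_derivative (Gam c) (at \<theta>) = c *\<^sub>R e_th \<theta>" for \<theta>
    unfolding Gam_def[abs_def]
    by (rule vector_derivative_at) (auto intro!: derivative_eq_intros frame_derivatives)
  have n: "norm (e_th \<theta>) = 1" for \<theta> by (simp add: norm_eq_sqrt_inner)
  have s: "speed (Gam c) \<theta> = c" using c by (simp add: speed_def d n)
  have "sgn (vector_derivative (Gam c) (at r)) = e_th r" for r
    using c by (simp add: d sgn_div_norm n)
  then have "vector_derivative (\<lambda>r. sgn (vector_derivative (Gam c) (at r))) (at \<theta>) = - e_r \<theta>"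
    using vector_derivative_at[OF frame_derivatives(2)] by simp
  then have "curvature_vector (Gam c) \<theta> = (1 / c) *\<^sub>R (- e_r \<theta>)" by (simp add: curvature_vector_def s)
  then show ?thesis unfolding s conormal_def using c by (simp add: inner_add_right)
qed

section \<open>The three faces of a Y-noid\<close>

lemma tanh_artanh_real:
  assumes "\<bar>x\<bar> < 1"
  shows "tanh (artanh x) = (x::real)"
proof -
  have p: "1 + x > 0" "1 - x > 0" using assms by auto
  have "- 2 * artanh x = ln ((1 - x) / (1 + x))"
    using p by (simp add: artanh_def ln_div)
  then have e: "exp (- 2 * artanh x) = (1 - x) / (1 + x)" using p by simp
  show ?thesis unfolding tanh_real_altdef e using p by (simp add: field_simps)
qed

locale noid =
  fixes \<alpha> c :: real
  assumes \<alpha>: "pi / 6 < \<alpha>" "\<alpha> < pi / 3" and c: "c > 0"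
begin

abbreviation "TT i \<equiv> T_par \<alpha> i"

text \<open>The lower bound on \<alpha> enters in the third sign, as \<alpha> - 2 pi/3 > - pi/2.
  Since tanh T_i = - cos \<alpha>_i, positive cosines mark the faces that contain a neck.\<close>

lemma cos_ang_signs: "cos (ang \<alpha> 1) > 0" "cos (ang \<alpha> 2) < 0" "cos (ang \<alpha> 3) > 0"
proof -
  have p: "pi > 0" by simp
  show "cos (ang \<alpha> 1) > 0" using \<alpha> p by (simp add: ang_def) (rule cos_gt_zero_pi; linarith)
  show "cos (ang \<alpha> 3) > 0" using \<alpha> p by (simp add: ang_def) (rule cos_gt_zero_pi; linarith)
  have "cos (pi - (\<alpha> + 2 * pi / 3)) > 0" using \<alpha> p by (intro cos_gt_zero_pi; linarith)
  then have "- cos (\<alpha> + 2 * pi / 3) > 0" by (simp only: cos_pi_minus)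
  then show "cos (ang \<alpha> 2) < 0" by (simp add: ang_def)
qed

lemma cos_ang_sum: "cos (ang \<alpha> 1) + cos (ang \<alpha> 2) + cos (ang \<alpha> 3) = 0"
  by (simp add: ang_def cos_add cos_diff cos_120 sin_120)

lemma cos_ang_bound: "\<bar>cos (ang \<alpha> i)\<bar> < 1"
proof -
  have p: "pi > 0" by simp
  have "sin (ang \<alpha> i) \<noteq> 0"
  proof -
    consider "i = 1" | "i = 2" | "i = 3" using exhaust_3[of i] by blast
    then show ?thesis
    proof cases
      case 1
      have "sin \<alpha> > 0" using \<alpha> p by (intro sin_gt_zero; linarith)
      with 1 show ?thesis by (simp add: ang_def)
    next
      case 2
      have "sin (\<alpha> + 2 * pi / 3) > 0" using \<alpha> p by (intro sin_gt_zero; linarith)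
      with 2 show ?thesis by (simp add: ang_def)
    next
      case 3
      have "sin (2 * pi / 3 - \<alpha>) > 0" using \<alpha> p by (intro sin_gt_zero; linarith)
      moreover have "sin (\<alpha> - 2 * pi / 3) = - sin (2 * pi / 3 - \<alpha>)"
        by (metis minus_diff_eq sin_minus)
      ultimately show ?thesis using 3 by (simp add: ang_def)
    qed
  qed
  then have "(sin (ang \<alpha> i))\<^sup>2 > 0" by simp
  then have "(cos (ang \<alpha> i))\<^sup>2 < 1" using sin_cos_squared_add[of "ang \<alpha> i"] by linarith
  then show ?thesis by (simp add: abs_square_less_1)
qed

lemma tanh_T: "tanh (TT i) = - cos (ang \<alpha> i)"
  unfolding T_par_def by (rule tanh_artanh_real) (use cos_ang_bound in simp)

lemma T_signs: "TT 1 < 0" "TT 2 > 0" "TT 3 < 0"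
  using cos_ang_signs tanh_T[of 1] tanh_T[of 2] tanh_T[of 3]
    tanh_real_neg_iff[of "TT 1"] tanh_real_pos_iff[of "TT 2"] tanh_real_neg_iff[of "TT 3"] by auto

sublocale face: catenoid_face "c_par \<alpha> c i" "TT i" "eps i" "face \<alpha> c i" for i
proof
  show "0 < c_par \<alpha> c i" using c by (simp add: c_par_def)
  show "eps i * eps i = 1" by (simp add: eps_def)
  show "face \<alpha> c i = (\<lambda>z. c_par \<alpha> c i *\<^sub>R (cosh (fst z + TT i) *\<^sub>R e_r (snd z) + (eps i * fst z) *\<^sub>R e_3))"
    by (auto simp: face_def)
qed

abbreviation "D1 u \<equiv> (\<lambda>z. weak_gradient u z $ 1)"
abbreviation "D2 u \<equiv> (\<lambda>z. weak_gradient u z $ 2)"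

lemma index_form_eq:
  "index_form \<alpha> c \<phi> \<psi> = (\<Sum>i\<in>UNIV. face_form (TT i) (\<phi> i) (D1 (\<phi> i)) (D2 (\<phi> i)) (bdry_trace (\<phi> i))
     (\<psi> i) (D1 (\<psi> i)) (D2 (\<psi> i)) (bdry_trace (\<psi> i)))"
  unfolding index_form_def
proof (rule sum.cong[OF refl])
  fix i :: 3
  have 1: "(cometric (face \<alpha> c i) x p q - normA_sq (face \<alpha> c i) x * a * b) * area_density (face \<alpha> c i) x
    = p $ 1 * q $ 1 + p $ 2 * q $ 2 - 2 * sech2 (fst x + TT i) * a * b" for x p q a b
  proof -
    have "(cometric (face \<alpha> c i) x p q - normA_sq (face \<alpha> c i) x * a * b) * area_density (face \<alpha> c i) x
      = cometric (face \<alpha> c i) x p q * area_density (face \<alpha> c i) x - (normA_sq (face \<alpha> c i) x * area_density (face \<alpha> c i) x) * a * b"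
      by (simp add: algebra_simps)
    then show ?thesis unfolding face.cometric_area face.normA_area .
  qed
  have 2: "(curvature_vector (Gam c) \<theta> \<bullet> conormal \<alpha> i \<theta>) * s * t * speed (Gam c) \<theta> = - cos (ang \<alpha> i) * (s * t)" for \<theta> s t
    unfolding boundary_curvature[OF c, of \<theta> \<alpha> i, symmetric] by simp
  show "(LBINT x:strip. (cometric (face \<alpha> c i) x (weak_gradient (\<phi> i) x) (weak_gradient (\<psi> i) x)
          - normA_sq (face \<alpha> c i) x * \<phi> i x * \<psi> i x) * area_density (face \<alpha> c i) x)
     - (LINT \<theta>:{0..<2*pi}|lborel. (curvature_vector (Gam c) \<theta> \<bullet> conormal \<alpha> i \<theta>)
          * bdry_trace (\<phi> i) \<theta> * bdry_trace (\<psi> i) \<theta> * speed (Gam c) \<theta>)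
    = face_form (TT i) (\<phi> i) (D1 (\<phi> i)) (D2 (\<phi> i)) (bdry_trace (\<phi> i)) (\<psi> i) (D1 (\<psi> i)) (D2 (\<psi> i)) (bdry_trace (\<psi> i))"
    unfolding 1 2 set_integral_mult_right face_form_def tanh_T circ_def by simp
qed

lemma gradient_in_L2_eq:
  "gradient_in_L2 \<alpha> c i u \<longleftrightarrow> L1_on strip (\<lambda>z. (D1 u z)\<^sup>2 + (D2 u z)\<^sup>2)"
  unfolding gradient_in_L2_def face.cometric_area by (simp add: power2_eq_square)

lemma admissible_strip:
  assumes a: "admissible \<phi>" and g: "gradient_in_L2 \<alpha> c i (\<phi> i)"
  shows "strip_function (\<phi> i) (D1 (\<phi> i)) (D2 (\<phi> i)) (bdry_trace (\<phi> i))"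
proof -
  obtain p \<tau> where p: "has_weak_gradient (\<phi> i) p" and \<tau>: "has_trace (\<phi> i) \<tau>" and per: "periodic (\<phi> i)"
    using a unfolding admissible_def by blast
  note m = weak_gradient_measurable[OF has_weak_gradient_weak_gradient[OF p]]
  note g' = g[unfolded gradient_in_L2_eq]
  have "L1_on strip (\<lambda>z. (D1 (\<phi> i) z)\<^sup>2)" "L1_on strip (\<lambda>z. (D2 (\<phi> i) z)\<^sup>2)"
    by (rule L1_bound[OF g']; use m ray_circ in \<open>auto intro!: Bor_set\<close>)+
  then show ?thesis by (rule admissible_strip_function[OF p \<tau> per])
qed

lemma in_L2_compact:
  assumes m: "u \<in> Bor" and b: "\<And>z. z \<in> strip \<Longrightarrow> \<bar>u z\<bar> \<le> B" and z: "\<And>z. fst z > r \<Longrightarrow> u z = 0"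
  shows "in_L2 \<alpha> c i u"
  unfolding in_L2_def face.area_density_X
proof (intro conjI m)
  let ?k = "\<lambda>z. (c_par \<alpha> c i * cosh (fst z + TT i))\<^sup>2"
  have "L1_on ({0..r} \<times> circ) (\<lambda>z. B\<^sup>2 * ((c_par \<alpha> c i * cosh (fst z + TT i))\<^sup>2 * 1))"
    by (intro set_integrable_mult_right L1_tensor[where a="\<lambda>t. (c_par \<alpha> c i * cosh (t + TT i))\<^sup>2" and b="\<lambda>_. 1"]
        borel_integrable_atLeastAtMost' continuous_intros circ_const)
  then have "L1_on ({0..r} \<times> circ) (\<lambda>z. (u z)\<^sup>2 * ?k z)"
  proof (rule L1_bound)
    have mk: "?k \<in> Bor" by (intro borel_measurable_continuous_onI continuous_intros)
    show "set_borel_measurable lborel ({0..r} \<times> circ) (\<lambda>z. (u z)\<^sup>2 * ?k z)"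
      by (intro Bor_set borel_Times borel_measurable_times[OF _ mk]) (use m ray_circ in auto)
    have "\<bar>(u z)\<^sup>2 * ?k z\<bar> \<le> B\<^sup>2 * (?k z * 1)" if "z \<in> {0..r} \<times> circ" for z
    proof -
      have "\<bar>u z\<bar> \<le> B" using b that by (auto simp: ray_circ(1) ray_def)
      then have "(u z)\<^sup>2 \<le> B\<^sup>2" using power_mono[of "\<bar>u z\<bar>" B 2] by simp
      then have "(u z)\<^sup>2 * ?k z \<le> B\<^sup>2 * ?k z" by (intro mult_right_mono) auto
      then show ?thesis by (simp add: abs_mult)
    qed
    then show "AE z in lborel. z \<in> {0..r} \<times> circ \<longrightarrow> \<bar>(u z)\<^sup>2 * ?k z\<bar> \<le> B\<^sup>2 * (?k z * 1)" by simp
  qed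
  moreover have "(\<lambda>z. indicator ({0..r} \<times> circ) z *\<^sub>R ((u z)\<^sup>2 * ?k z)) = (\<lambda>z. indicator strip z *\<^sub>R ((u z)\<^sup>2 * ?k z))"
  proof
    fix w show "indicator ({0..r} \<times> circ) w *\<^sub>R ((u w)\<^sup>2 * ?k w) = indicator strip w *\<^sub>R ((u w)\<^sup>2 * ?k w)"
      using z[of w] by (cases w; cases "fst w > r") (auto simp: ray_circ(1) ray_def indicator_def)
  qed
  ultimately show "L1_on strip (\<lambda>z. (u z)\<^sup>2 * ?k z)" by (simp add: set_integrable_def)
qed

text \<open>The area density is at most 1 + |X|^2, and |X| grows exponentially in t, so the
  logarithmic factor leaves a weight of order 1/(1 + t)^2, which is integrable. This puts bounded
  test fields such as tanh into the energy space.\<close>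

lemma in_L2_star_bounded:
  assumes m: "u \<in> Bor" and b: "\<And>z. z \<in> strip \<Longrightarrow> \<bar>u z\<bar> \<le> B"
  shows "in_L2_star \<alpha> c i u"
  unfolding in_L2_star_def
proof (intro conjI m)
  define k where "k = c_par \<alpha> c i"
  have k: "k > 0" unfolding k_def by (rule face.k)
  define K where "K = \<bar>ln (k / 2) + TT i\<bar>"
  \<comment> \<open>Chosen so that the two lower bounds \<open>t - K\<close> and \<open>ln 2\<close>
    for ln (2 + |X|), averaged with weights ln 2 and 1 + K, give \<delta> (1 + t).\<close>
  define \<delta> where "\<delta> = ln 2 / (ln 2 + 1 + K)"
  have l2: "ln 2 > (0::real)" by simp
  have K0: "0 \<le> K" by (simp add: K_def)
  have \<delta>0: "\<delta> > 0" unfolding \<delta>_def using l2 K0 by (intro divide_pos_pos; linarith)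
  let ?w = "\<lambda>z. (1 / (1 + (norm (face \<alpha> c i z))\<^sup>2)) * (1 / (ln (2 + norm (face \<alpha> c i z)))\<^sup>2) * area_density (face \<alpha> c i) z"
  have w0: "0 \<le> ?w z" for z unfolding face.area_density_X by (intro mult_nonneg_nonneg) auto
  have w: "?w z \<le> (1 / \<delta>\<^sup>2) * (1 / (1 + t)\<^sup>2)" if z: "z \<in> strip" and t: "t = fst z" for z t
  proof -
    have t0: "0 \<le> t" using z t by (auto simp: strip_def)
    define N where "N = norm (face \<alpha> c i z)"
    have N2: "N\<^sup>2 = k\<^sup>2 * ((cosh (t + TT i))\<^sup>2 + t\<^sup>2)" unfolding N_def t k_def by (rule face.norm_X)
    have N0: "0 \<le> N" by (simp add: N_def)
    have "(k * cosh (t + TT i))\<^sup>2 \<le> N\<^sup>2" unfolding N2 power_mult_distrib by (intro mult_left_mono) auto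
    then have kN: "k * cosh (t + TT i) \<le> N" using N0 by (rule power2_le_imp_le)
    have "area_density (face \<alpha> c i) z \<le> 1 + N\<^sup>2"
      unfolding face.area_density_X using \<open>(k * cosh (t + TT i))\<^sup>2 \<le> N\<^sup>2\<close> by (simp add: k_def t)
    then have a: "(1 / (1 + N\<^sup>2)) * area_density (face \<alpha> c i) z \<le> 1"
      by (simp add: divide_le_eq add_pos_nonneg)
    have "k / 2 * exp (t + TT i) \<le> N"
    proof -
      have "exp (t + TT i) / 2 \<le> cosh (t + TT i)" by (simp add: cosh_def)
      then have "k * (exp (t + TT i) / 2) \<le> k * cosh (t + TT i)" using k by (intro mult_left_mono) auto
      with kN show ?thesis by simp
    qed
    then have "ln (k / 2 * exp (t + TT i)) \<le> ln (2 + N)" using k N0 by (subst ln_le_cancel_iff) auto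
    moreover have "ln (k / 2 * exp (t + TT i)) = ln (k / 2) + (t + TT i)" using k by (subst ln_mult) auto
    ultimately have 1: "t - K \<le> ln (2 + N)" unfolding K_def by linarith
    have 2: "ln 2 \<le> ln (2 + N)" using N0 by simp
    have "\<delta> * (1 + t) \<le> ln (2 + N)"
    proof -
      have p: "0 < ln 2 + 1 + K" using l2 K0 by linarith
      have "ln 2 * (t - K) + (1 + K) * ln 2 \<le> ln 2 * ln (2 + N) + (1 + K) * ln (2 + N)"
        using 1 2 l2 K0 by (intro add_mono mult_left_mono) auto
      then have "ln 2 * (1 + t) \<le> (ln 2 + 1 + K) * ln (2 + N)" by (simp add: algebra_simps)
      then show ?thesis unfolding \<delta>_def using p by (simp add: field_simps)
    qed
    then have "(\<delta> * (1 + t))\<^sup>2 \<le> (ln (2 + N))\<^sup>2" using \<delta>0 t0 by (intro power_mono) auto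
    then have l: "1 / (ln (2 + N))\<^sup>2 \<le> 1 / (\<delta> * (1 + t))\<^sup>2"
      using \<delta>0 t0 by (intro divide_left_mono mult_pos_pos) (auto intro: order_less_le_trans[of 0 "(\<delta> * (1 + t))\<^sup>2"])
    have "?w z = ((1 / (1 + N\<^sup>2)) * area_density (face \<alpha> c i) z) * (1 / (ln (2 + N))\<^sup>2)" by (simp add: N_def)
    also have "\<dots> \<le> 1 * (1 / (\<delta> * (1 + t))\<^sup>2)" using a l by (intro mult_mono) auto
    finally show ?thesis by (simp add: power_mult_distrib)
  qed
  have mw: "?w \<in> Bor"
  proof -
    have "continuous_on UNIV (face \<alpha> c i)"
      unfolding face.X e_r_def by (intro continuous_intros)
    moreover have "(\<lambda>x. 2 + norm x :: real) = (\<lambda>x::real^3. 2 + norm x)" ..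
    ultimately have n: "(\<lambda>z. norm (face \<alpha> c i z)) \<in> Bor"
      by (intro borel_measurable_continuous_onI continuous_intros)
    have "area_density (face \<alpha> c i) \<in> Bor"
      unfolding face.area_density_X[abs_def] by (intro borel_measurable_continuous_onI continuous_intros)
    with n show ?thesis by measurable
  qed
  have inv: "L1_on ray (\<lambda>t. 1 / (1 + t)\<^sup>2)"
  proof -
    have "(\<integral>\<^sup>+x. ennreal (1 / (1 + x)\<^sup>2) * indicator {0..} x \<partial>lborel) = 0 - (- (1 / (1 + 0 :: real)))"
    proof (rule nn_integral_FTC_atLeast)
      show "(\<lambda>x::real. 1 / (1 + x)\<^sup>2) \<in> Bor" by measurable
      show "((\<lambda>x. - (1 / (1 + x))) has_real_derivative 1 / (1 + x)\<^sup>2) (at x)" if "0 \<le> x" for x :: real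
        using that by (auto intro!: derivative_eq_intros simp: power2_eq_square)
      have "((\<lambda>x::real. inverse (1 + x)) \<longlongrightarrow> 0) at_top"
        by (rule tendsto_inverse_0_at_top, rule filterlim_tendsto_add_at_top[OF tendsto_const filterlim_ident])
      then show "((\<lambda>x::real. - (1 / (1 + x))) \<longlongrightarrow> 0) at_top"
        using tendsto_minus[of "\<lambda>x::real. inverse (1 + x)" 0 at_top] by (simp add: inverse_eq_divide)
    qed auto
    moreover have "(\<integral>\<^sup>+(x::real). ennreal (norm (indicator {0..} x *\<^sub>R (1 / (1 + x)\<^sup>2))) \<partial>lborel) = (\<integral>\<^sup>+(x::real). ennreal (1 / (1 + x)\<^sup>2) * indicator {0..} x \<partial>lborel)"
      by (intro nn_integral_cong) (auto simp: indicator_def)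
    ultimately show ?thesis
      unfolding set_integrable_def ray_def by (intro integrableI_bounded) auto
  qed
  have "L1_on strip (\<lambda>z. (B\<^sup>2 * (1 / \<delta>\<^sup>2)) * ((1 / (1 + fst z)\<^sup>2) * 1))"
    unfolding ray_circ(1)
    by (intro set_integrable_mult_right L1_tensor[where a="\<lambda>t. 1 / (1 + t)\<^sup>2" and b="\<lambda>_. 1"] inv circ_const)
  then have "L1_on strip (\<lambda>z. (u z)\<^sup>2 * ?w z)"
  proof (rule L1_bound)
    show "set_borel_measurable lborel strip (\<lambda>z. (u z)\<^sup>2 * ?w z)"
      by (intro Bor_set ray_circ borel_measurable_times[OF _ mw]) (use m in auto)
    have "\<bar>(u z)\<^sup>2 * ?w z\<bar> \<le> (B\<^sup>2 * (1 / \<delta>\<^sup>2)) * ((1 / (1 + fst z)\<^sup>2) * 1)" if z: "z \<in> strip" for z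
    proof -
      have "(u z)\<^sup>2 \<le> B\<^sup>2" using power_mono[OF b[OF z], of 2] by simp
      then have "(u z)\<^sup>2 * ?w z \<le> B\<^sup>2 * ((1 / \<delta>\<^sup>2) * (1 / (1 + fst z)\<^sup>2))"
        by (rule mult_mono[OF _ w[OF z refl] _ w0]) auto
      moreover have "\<bar>(u z)\<^sup>2 * ?w z\<bar> = (u z)\<^sup>2 * ?w z" by (rule abs_of_nonneg[OF mult_nonneg_nonneg[OF zero_le_power2 w0]])
      ultimately show ?thesis by (simp only: mult.assoc mult_1_right)
    qed
    then show "AE z in lborel. z \<in> strip \<longrightarrow> \<bar>(u z)\<^sup>2 * ?w z\<bar> \<le> (B\<^sup>2 * (1 / \<delta>\<^sup>2)) * ((1 / (1 + fst z)\<^sup>2) * 1)" by simp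
  qed
  then show "L1_on strip (\<lambda>x. (u x)\<^sup>2 * (1 / (1 + (norm (face \<alpha> c i x))\<^sup>2)) *
      (1 / (ln (2 + norm (face \<alpha> c i x)))\<^sup>2) * area_density (face \<alpha> c i) x)"
    by (simp add: mult.assoc)
qed

end

section \<open>Separated variations\<close>

lemma exp_ray:
  assumes "k > 0"
  shows "L1_on ray (\<lambda>t. exp (- (k * t)))"
proof -
  have "integrable lborel (\<lambda>t. indicator ray (0 + k * t) *\<^sub>R exp (- (0 + k * t)))"
    using lborel_integrable_real_affine[where c=k and t=0 and f="\<lambda>t. indicator ray t *\<^sub>R exp (- t)"]
      integrable_exp_ray assms unfolding set_integrable_def by simp
  moreover have "(\<lambda>t. indicator ray (0 + k * t) *\<^sub>R exp (- (0 + k * t))) = (\<lambda>t. indicator ray t *\<^sub>R exp (- (k * t)))"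
    using assms by (auto simp: ray_def indicator_def fun_eq_iff zero_le_mult_iff)
  ultimately show ?thesis by (simp add: set_integrable_def)
qed

lemma t_exp_ray: "L1_on ray (\<lambda>t. t * exp (- t))"
proof (rule L1_bound[OF set_integrable_mult_right[of 2, OF exp_ray[of "1/2"]]])
  show "set_borel_measurable lborel ray (\<lambda>t. t * exp (- t))"
    by (intro Bor_set ray_circ borel_measurable_continuous_onI continuous_intros)
  have "t * exp (- t) \<le> 2 * exp (- (1 / 2 * t))" for t :: real
  proof -
    have "t / 2 \<le> exp (t / 2)" using exp_ge_add_one_self[of "t / 2"] by linarith
    then have "2 * (t / 2) * exp (- t) \<le> 2 * exp (t / 2) * exp (- t)" by (intro mult_right_mono) auto
    also have "\<dots> = 2 * exp (- (1 / 2 * t))" by (simp add: exp_add[symmetric])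
    finally show ?thesis by simp
  qed
  then show "AE t in lborel. t \<in> ray \<longrightarrow> \<bar>t * exp (- t)\<bar> \<le> 2 * exp (- (1 / 2 * t))"
    by (simp add: ray_def abs_mult)
qed auto

text \<open>The growth bound of \<open>weighted_integrable\<close> again, now with weight exp (-t),
  which dominates the decaying Jacobi profiles in Green's formula.\<close>

lemma exp_weighted_integrable:
  assumes S: "strip_function u P R \<tau>"
  shows "L1_on strip (\<lambda>z. exp (- fst z) * (u z)\<^sup>2)"
    and "L1_on strip (\<lambda>z. exp (- fst z) * \<bar>u z\<bar>)"
proof -
  note D = strip_functionD[OF S]
  let ?N = "\<lambda>\<theta>. LBINT s:ray. (P (s, \<theta>))\<^sup>2"
  have N: "L1_on circ ?N" by (rule set_Fubini(6)[OF D(5)[unfolded ray_circ(1)]])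
  have 1: "L1_on strip (\<lambda>z. exp (- fst z) * (\<tau> (snd z))\<^sup>2)"
    unfolding ray_circ(1) by (rule L1_tensor[where a="\<lambda>t. exp (- t)", OF integrable_exp_ray D(7)])
  have 2: "L1_on strip (\<lambda>z. (fst z * exp (- fst z)) * ?N (snd z))"
    unfolding ray_circ(1) by (rule L1_tensor[OF t_exp_ray N])
  have me: "(\<lambda>z::real\<times>real. exp (- fst z)) \<in> Bor"
    by (intro borel_measurable_continuous_onI continuous_intros)
  have "L1_on strip (\<lambda>z. 2 * (exp (- fst z) * (\<tau> (snd z))\<^sup>2) + 2 * ((fst z * exp (- fst z)) * ?N (snd z)))"
    by (intro set_integral_add(1) set_integrable_mult_right 1 2)
  then show u2: "L1_on strip (\<lambda>z. exp (- fst z) * (u z)\<^sup>2)"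
  proof (rule L1_bound)
    show "set_borel_measurable lborel strip (\<lambda>z. exp (- fst z) * (u z)\<^sup>2)"
      using D(1) me by (intro Bor_set ray_circ) auto
    show "AE z in lborel. z \<in> strip \<longrightarrow> \<bar>exp (- fst z) * (u z)\<^sup>2\<bar> \<le>
      2 * (exp (- fst z) * (\<tau> (snd z))\<^sup>2) + 2 * ((fst z * exp (- fst z)) * ?N (snd z))"
      using D(8) AE_lborel_snd[OF trace_rep_sq_bound[OF S]]
    proof eventually_elim
      case (elim z)
      show ?case
      proof
        assume z: "z \<in> strip"
        then have "(u z)\<^sup>2 \<le> 2 * (\<tau> (snd z))\<^sup>2 + 2 * (fst z * ?N (snd z))"
          using elim by (cases z) (auto simp: strip_def circ_def)
        then have "exp (- fst z) * (u z)\<^sup>2 \<le> exp (- fst z) * (2 * (\<tau> (snd z))\<^sup>2 + 2 * (fst z * ?N (snd z)))"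
          by (intro mult_left_mono) auto
        then show "\<bar>exp (- fst z) * (u z)\<^sup>2\<bar> \<le>
          2 * (exp (- fst z) * (\<tau> (snd z))\<^sup>2) + 2 * ((fst z * exp (- fst z)) * ?N (snd z))"
          by (simp add: abs_mult algebra_simps)
      qed
    qed
  qed
  have "L1_on strip (\<lambda>z. exp (- fst z) * 1)"
    unfolding ray_circ(1) by (rule L1_tensor[where a="\<lambda>t. exp (- t)", OF integrable_exp_ray circ_const(1)])
  from set_integral_add(1)[OF u2 this]
  show "L1_on strip (\<lambda>z. exp (- fst z) * \<bar>u z\<bar>)"
  proof (rule L1_bound)
    show "set_borel_measurable lborel strip (\<lambda>z. exp (- fst z) * \<bar>u z\<bar>)"
      using D(1) me by (intro Bor_set ray_circ) auto
    have "\<bar>exp (- fst z) * \<bar>u z\<bar>\<bar> \<le> exp (- fst z) * (u z)\<^sup>2 + exp (- fst z) * 1" for z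
    proof -
      have "0 \<le> (\<bar>u z\<bar> - 1)\<^sup>2" "0 \<le> \<bar>u z\<bar>" by simp_all
      then have "\<bar>u z\<bar> \<le> (u z)\<^sup>2 + 1" by (simp add: power2_diff)
      then have "exp (- fst z) * \<bar>u z\<bar> \<le> exp (- fst z) * ((u z)\<^sup>2 + 1)" by (intro mult_left_mono) auto
      then show ?thesis by (simp add: abs_mult distrib_left)
    qed
    then show "AE z in lborel. z \<in> strip \<longrightarrow> \<bar>exp (- fst z) * \<bar>u z\<bar>\<bar> \<le> exp (- fst z) * (u z)\<^sup>2 + exp (- fst z) * 1" by simp
  qed
qed

text \<open>Products a(t) b(\<theta>) of finite energy. The alternative in \<open>a2\<close> covers
  the two kinds of test function: radial ones, whose profile may stay bounded away from 0, and first
  harmonics with a square integrable profile.\<close>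

locale separated =
  fixes a a' b b' :: "real \<Rightarrow> real" and B :: real
  assumes a: "c1 a a'" and b: "c1 b b'" and per: "\<And>\<theta>. b (\<theta> + 2 * pi) = b \<theta>"
    and bB: "\<And>\<theta>. \<bar>b \<theta>\<bar> \<le> B" "\<And>\<theta>. \<bar>b' \<theta>\<bar> \<le> B"
    and a'2: "L1_on ray (\<lambda>t. (a' t)\<^sup>2)"
    and a2: "(\<forall>\<theta>. b' \<theta> = 0) \<or> L1_on ray (\<lambda>t. (a t)\<^sup>2)"
begin

definition f :: "real \<times> real \<Rightarrow> real" where "f z = a (fst z) * b (snd z)"

lemma f_C1: "C1_function f" and pd_f: "pd 1 f = (\<lambda>z. a' (fst z) * b (snd z))" "pd 2 f = (\<lambda>z. a (fst z) * b' (snd z))"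
  using C1_tensor[OF a b] by (simp_all add: f_def[abs_def])

lemma f_periodic: "periodic f"
  by (simp add: periodic_def f_def per)

lemma borel_ab: "a \<in> Bor" "a' \<in> Bor" "b \<in> Bor" "b' \<in> Bor"
  using c1_continuous[OF a] c1_continuous[OF b] c1D'[OF a] c1D'[OF b] by (auto intro: borel_measurable_continuous_onI)

lemma borel_f: "f \<in> Bor" "(\<lambda>z. a' (fst z) * b (snd z)) \<in> Bor"
  "(\<lambda>z. a (fst z) * b' (snd z)) \<in> Bor"
  using borel_fst_snd borel_ab unfolding f_def[abs_def] by (auto intro!: borel_measurable_times)

lemma f_gradient: "has_weak_gradient f (\<lambda>z. \<chi> j. pd j f z)" "has_weak_gradient f (weak_gradient f)"
  using C1_has_weak_gradient[OF f_C1] has_weak_gradient_weak_gradient by auto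

lemma f_weak_gradient:
  "AE z in lborel. z \<in> strip \<longrightarrow> weak_gradient f z $ 1 = a' (fst z) * b (snd z) \<and> weak_gradient f z $ 2 = a (fst z) * b' (snd z)"
proof -
  have "AE t in lborel. t \<noteq> (0::real)" by (simp add: AE_lborel_singleton)
  then have "AE z in lborel. fst (z::real\<times>real) \<noteq> 0"
    by (intro AE_productI) (auto intro!: borel_open open_Collect_neq continuous_intros)
  with weak_gradient_C1[OF f_C1] show ?thesis
    by eventually_elim (auto simp: strip_def halfplane_def pd_f)
qed

lemma sq_circ: "L1_on circ (\<lambda>\<theta>. (b \<theta>)\<^sup>2)" "L1_on circ (\<lambda>\<theta>. (b' \<theta>)\<^sup>2)"
proof -
  have "continuous_on {0..2*pi} b" "continuous_on {0..2*pi} b'"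
    using c1_continuous[OF b] c1D'[OF b] by (auto intro: continuous_on_subset)
  then have i: "L1_on {0..2*pi} (\<lambda>\<theta>. (b \<theta>)\<^sup>2)" "L1_on {0..2*pi} (\<lambda>\<theta>. (b' \<theta>)\<^sup>2)"
    by (auto intro!: borel_integrable_atLeastAtMost' continuous_intros)
  show "L1_on circ (\<lambda>\<theta>. (b \<theta>)\<^sup>2)" by (rule set_integrable_subset[OF i(1)]) (auto simp: circ_def)
  show "L1_on circ (\<lambda>\<theta>. (b' \<theta>)\<^sup>2)" by (rule set_integrable_subset[OF i(2)]) (auto simp: circ_def)
qed

lemma explicit_sq: "L1_on strip (\<lambda>z. (a' (fst z) * b (snd z))\<^sup>2)" "L1_on strip (\<lambda>z. (a (fst z) * b' (snd z))\<^sup>2)"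
proof -
  show "L1_on strip (\<lambda>z. (a' (fst z) * b (snd z))\<^sup>2)"
    unfolding ray_circ(1) power_mult_distrib by (rule L1_tensor[OF a'2 sq_circ(1)])
  show "L1_on strip (\<lambda>z. (a (fst z) * b' (snd z))\<^sup>2)"
    using a2
  proof
    assume "\<forall>\<theta>. b' \<theta> = 0" then show ?thesis by (simp add: set_integrable_def)
  next
    assume "L1_on ray (\<lambda>t. (a t)\<^sup>2)"
    then show ?thesis unfolding ray_circ(1) power_mult_distrib by (rule L1_tensor[OF _ sq_circ(2)])
  qed
qed

lemma gradient_sq: "L1_on strip (\<lambda>z. (weak_gradient f z $ 1)\<^sup>2)" "L1_on strip (\<lambda>z. (weak_gradient f z $ 2)\<^sup>2)"
proof -
  note m = weak_gradient_measurable(2)[OF f_gradient(2)]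
  show "L1_on strip (\<lambda>z. (weak_gradient f z $ 1)\<^sup>2)"
    by (rule LBINT_cong_AE(2)[OF _ _ _ _ explicit_sq(1)])
       (use m borel_f f_weak_gradient ray_circ in \<open>auto elim!: eventually_mono\<close>)
  show "L1_on strip (\<lambda>z. (weak_gradient f z $ 2)\<^sup>2)"
    by (rule LBINT_cong_AE(2)[OF _ _ _ _ explicit_sq(2)])
       (use m borel_f f_weak_gradient ray_circ in \<open>auto elim!: eventually_mono\<close>)
qed

lemma f_trace: "has_trace f (\<lambda>\<theta>. a 0 * b \<theta>)"
  using C1_has_trace[OF f_C1 f_periodic] by (simp add: f_def)

lemma f_bdry_trace: "AE \<theta> in lborel. \<theta> \<in> circ \<longrightarrow> bdry_trace f \<theta> = a 0 * b \<theta>"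
  by (rule trace_unique[OF f_gradient(2) has_trace_bdry_trace[OF f_trace] f_trace gradient_sq(1)])

lemma f_strip_function: "strip_function f (\<lambda>z. weak_gradient f z $ 1) (\<lambda>z. weak_gradient f z $ 2) (bdry_trace f)"
  by (rule admissible_strip_function[OF f_gradient(1) f_trace f_periodic gradient_sq])

lemma f_gradient_in_L2: "noid \<alpha> c \<Longrightarrow> gradient_in_L2 \<alpha> c i f"
  unfolding noid.gradient_in_L2_eq using gradient_sq by (rule set_integral_add(1))

lemma face_form_f:
  assumes S: "strip_function v P R \<tau>"
  shows "face_form T v P R \<tau> f (\<lambda>z. weak_gradient f z $ 1) (\<lambda>z. weak_gradient f z $ 2) (bdry_trace f)
    = (LBINT z:strip. P z * (a' (fst z) * b (snd z)) + R z * (a (fst z) * b' (snd z)) - 2 * sech2 (fst z + T) * v z * f z)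
      - tanh T * a 0 * (LBINT \<theta>:circ. \<tau> \<theta> * b \<theta>)"
proof -
  note D = strip_functionD[OF S] and m = weak_gradient_measurable(2)[OF f_gradient(2)] and F = strip_functionD[OF f_strip_function]
  have ms: "(\<lambda>z::real\<times>real. sech2 (fst z + T)) \<in> Bor" by (rule borel_fst_snd'[OF sech2_borel(1)])
  have 1: "(LBINT z:strip. P z * weak_gradient f z $ 1 + R z * weak_gradient f z $ 2 - 2 * sech2 (fst z + T) * v z * f z)
     = (LBINT z:strip. P z * (a' (fst z) * b (snd z)) + R z * (a (fst z) * b' (snd z)) - 2 * sech2 (fst z + T) * v z * f z)"
  proof (rule LBINT_cong_AE(1))
    show "AE z in lborel. z \<in> strip \<longrightarrow> P z * weak_gradient f z $ 1 + R z * weak_gradient f z $ 2 - 2 * sech2 (fst z + T) * v z * f z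
      = P z * (a' (fst z) * b (snd z)) + R z * (a (fst z) * b' (snd z)) - 2 * sech2 (fst z + T) * v z * f z"
      using f_weak_gradient by eventually_elim auto
    show "(\<lambda>z. P z * weak_gradient f z $ 1 + R z * weak_gradient f z $ 2 - 2 * sech2 (fst z + T) * v z * f z) \<in> Bor"
      by (intro borel_measurable_diff borel_measurable_add borel_measurable_times m D borel_f ms borel_measurable_const)
    show "(\<lambda>z. P z * (a' (fst z) * b (snd z)) + R z * (a (fst z) * b' (snd z)) - 2 * sech2 (fst z + T) * v z * f z) \<in> Bor"
      by (intro borel_measurable_diff borel_measurable_add borel_measurable_times[OF D(2) borel_f(2)] borel_measurable_times[OF D(3) borel_f(3)]
         borel_measurable_times[OF _ borel_f(1)] borel_measurable_times[OF _ D(1)] borel_measurable_times[OF _ ms] borel_measurable_const)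
  qed (rule ray_circ)
  have "(LBINT \<theta>:circ. \<tau> \<theta> * bdry_trace f \<theta>) = (LBINT \<theta>:circ. a 0 * (\<tau> \<theta> * b \<theta>))"
    by (rule LBINT_cong_AE(1)) (use D(4) F(4) borel_ab ray_circ f_bdry_trace in \<open>auto elim!: eventually_mono\<close>)
  then show ?thesis unfolding face_form_def 1 by simp
qed

lemma green:
  assumes S: "strip_function v P R \<tau>" and a'': "c1 a' a''" and b'': "c1 b' (\<lambda>\<theta>. - \<kappa> * b \<theta>)"
    and b'per: "\<And>\<theta>. b' (\<theta> + 2 * pi) = b' \<theta>"
    and jac: "\<And>t. 2 * sech2 (t + T) * a t = \<kappa> * a t - a'' t"
    and dec: "\<And>t. 0 \<le> t \<Longrightarrow> \<bar>a' t\<bar> \<le> C * exp (- t)" "\<And>t. 0 \<le> t \<Longrightarrow> \<bar>a'' t\<bar> \<le> C * exp (- t)"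
    and adec: "\<kappa> = 0 \<or> (\<forall>t\<ge>0. \<bar>a t\<bar> \<le> C * exp (- t))"
  shows "(LBINT z:strip. P z * (a' (fst z) * b (snd z)) + R z * (a (fst z) * b' (snd z)) - 2 * sech2 (fst z + T) * v z * f z)
    = - a' 0 * (LBINT \<theta>:circ. \<tau> \<theta> * b \<theta>)"
proof -
  note D = strip_functionD[OF S]
  let ?U = "trace_rep P \<tau>"
  have mU: "?U \<in> Bor" by (rule trace_rep_measurable[OF D(2,4)])
  have ma'': "a'' \<in> Bor" using c1D'[OF a''] by (rule borel_measurable_continuous_onI)
  have B0: "0 \<le> B" using bB(1)[of 0] by linarith
  have C0: "0 \<le> C" using dec(1)[of 0] by simp
  have m2: "(\<lambda>z. a'' (fst z) * b (snd z)) \<in> Bor"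
    using borel_fst_snd(1)[OF ma''] borel_fst_snd(2)[OF borel_ab(3)] by (rule borel_measurable_times)
  note me = exp_weighted_integrable(2)[OF S]
  have bnd: "L1_on strip (\<lambda>z. v z * (h (fst z) * b (snd z)))"
    if h: "h \<in> Bor" "\<And>t. 0 \<le> t \<Longrightarrow> \<bar>h t\<bar> \<le> C * exp (- t)" for h
  proof (rule L1_bound[OF set_integrable_mult_right[of "C * B", OF me]])
    show "set_borel_measurable lborel strip (\<lambda>z. v z * (h (fst z) * b (snd z)))"
      by (intro Bor_set ray_circ borel_measurable_times D(1) borel_fst_snd h borel_ab)
    have "\<bar>v z * (h (fst z) * b (snd z))\<bar> \<le> C * B * (exp (- fst z) * \<bar>v z\<bar>)" if z: "z \<in> strip" for z
    proof -
      have "0 \<le> fst z" using z by (auto simp: strip_def)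
      then have "\<bar>h (fst z)\<bar> * \<bar>b (snd z)\<bar> \<le> (C * exp (- fst z)) * B"
        using h(2) bB(1) C0 by (intro mult_mono) auto
      then have "\<bar>v z\<bar> * (\<bar>h (fst z)\<bar> * \<bar>b (snd z)\<bar>) \<le> \<bar>v z\<bar> * ((C * exp (- fst z)) * B)" by (rule mult_left_mono) simp
      then show ?thesis by (simp add: abs_mult mult_ac)
    qed
    then show "AE z in lborel. z \<in> strip \<longrightarrow> \<bar>v z * (h (fst z) * b (snd z))\<bar> \<le> C * B * (exp (- fst z) * \<bar>v z\<bar>)" by simp
  qed
  have i1: "L1_on strip (\<lambda>z. P z * (a' (fst z) * b (snd z)))"
    by (rule L2_mult_integrable[OF D(2) borel_f(2) ray_circ(4) D(5) explicit_sq(1)])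
  have i2: "L1_on strip (\<lambda>z. v z * (a'' (fst z) * b (snd z)))" by (rule bnd[OF ma'' dec(2)])
  have i3: "L1_on strip (\<lambda>z. R z * (a (fst z) * b' (snd z)))"
    by (rule L2_mult_integrable[OF D(3) borel_f(3) ray_circ(4) D(6) explicit_sq(2)])
  have i4: "L1_on strip (\<lambda>z. \<kappa> * (v z * (a (fst z) * b (snd z))))"
    using adec
  proof
    assume "\<kappa> = 0" then show ?thesis by (simp add: set_integrable_def)
  next
    assume "\<forall>t\<ge>0. \<bar>a t\<bar> \<le> C * exp (- t)"
    then show ?thesis by (intro set_integrable_mult_right bnd borel_ab) auto
  qed
  \<comment> \<open>\<open>J1\<close> is the t-derivative of v a' b and \<open>J2\<close> the
    \<theta>-derivative of v a b'. The Jacobi equation makes the integrand their sum.\<close>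
  define J1 where "J1 z = P z * (a' (fst z) * b (snd z)) + v z * (a'' (fst z) * b (snd z))" for z
  define J2 where "J2 z = R z * (a (fst z) * b' (snd z)) - \<kappa> * (v z * (a (fst z) * b (snd z)))" for z
  have j1: "L1_on strip J1" unfolding J1_def by (rule set_integral_add(1)[OF i1 i2])
  have j2: "L1_on strip J2" unfolding J2_def by (rule set_integral_diff(1)[OF i3 i4])
  have mJ: "J1 \<in> Bor" "J2 \<in> Bor"
    unfolding J1_def[abs_def] J2_def[abs_def]
    by (intro borel_measurable_add borel_measurable_diff borel_measurable_times D borel_fst_snd borel_ab ma'' borel_measurable_const)+
  have "(LBINT z:strip. P z * (a' (fst z) * b (snd z)) + R z * (a (fst z) * b' (snd z)) - 2 * sech2 (fst z + T) * v z * f z)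
     = (LBINT z:strip. J1 z + J2 z)"
  proof (rule set_lebesgue_integral_cong)
    show "\<forall>z. z \<in> strip \<longrightarrow> P z * (a' (fst z) * b (snd z)) + R z * (a (fst z) * b' (snd z)) - 2 * sech2 (fst z + T) * v z * f z = J1 z + J2 z"
    proof (intro allI impI)
      fix z
      have "2 * sech2 (fst z + T) * v z * f z = (2 * sech2 (fst z + T) * a (fst z)) * v z * b (snd z)" by (simp add: f_def)
      then show "P z * (a' (fst z) * b (snd z)) + R z * (a (fst z) * b' (snd z)) - 2 * sech2 (fst z + T) * v z * f z = J1 z + J2 z"
        unfolding jac J1_def J2_def by (simp add: algebra_simps)
    qed
  qed (use ray_circ in simp)
  also have "\<dots> = (LBINT z:strip. J1 z) + (LBINT z:strip. J2 z)" by (rule set_integral_add(2)[OF j1 j2])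
  also have "(LBINT z:strip. J2 z) = 0"
  proof -
    have "AE t in lborel. t \<in> ray \<longrightarrow> (LBINT \<theta>:circ. J2 (t, \<theta>)) = 0"
      using D(9)
    proof eventually_elim
      case (elim t)
      show ?case
      proof
        assume "t \<in> ray"
        then obtain g where g: "ac 0 (2*pi) g (\<lambda>\<theta>. R (t, \<theta>))" "g (2*pi) = g 0" "AE \<theta> in lborel. \<theta> \<in> circ \<longrightarrow> v (t, \<theta>) = g \<theta>"
          using elim by blast
        define gg where "gg \<theta> = indicator {0..2*pi} \<theta> *\<^sub>R g \<theta>" for \<theta>
        have mg: "gg \<in> Bor"
          using borel_measurable_continuous_on_indicator[OF _ ac_continuous[OF g(1)]] by (simp add: gg_def[abs_def])
        let ?G = "\<lambda>h \<theta>. a t * (R (t, \<theta>) * b' \<theta> + h \<theta> * (- \<kappa> * b \<theta>))"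
        have mG: "?G gg \<in> Bor"
          using mg borel_slices(2)[OF D(3), of t] borel_ab by auto
        have "(LBINT \<theta>:circ. J2 (t, \<theta>)) = (LBINT \<theta>:circ. ?G gg \<theta>)"
        proof (rule LBINT_cong_AE(1)[OF borel_slices(2)[OF mJ(2)] mG ray_circ(3)])
          show "AE \<theta> in lborel. \<theta> \<in> circ \<longrightarrow> J2 (t, \<theta>) = ?G gg \<theta>"
            using g(3) by eventually_elim (auto simp: J2_def gg_def circ_def algebra_simps)
        qed
        also have "\<dots> = (LBINT \<theta>:{0..2*pi}. ?G gg \<theta>)"
          by (rule circ_closed(2)) (use mG in \<open>auto intro!: Bor_set\<close>)
        also have "\<dots> = (LBINT \<theta>:{0..2*pi}. ?G g \<theta>)"
          by (rule set_lebesgue_integral_cong) (auto simp: gg_def)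
        also have "\<dots> = a t * (LBINT \<theta>:{0..2*pi}. R (t, \<theta>) * b' \<theta> + g \<theta> * (- \<kappa> * b \<theta>))" by simp
        also have "(LBINT \<theta>:{0..2*pi}. R (t, \<theta>) * b' \<theta> + g \<theta> * (- \<kappa> * b \<theta>)) = g (2*pi) * b' (2*pi) - g 0 * b' 0"
          using acD[OF ac_mult[OF g(1) c1_ac[OF b'', of 0 "2*pi"]], of 0 "2*pi"] by simp
        also have "\<dots> = 0" using g(2) b'per[of 0] by simp
        finally show "(LBINT \<theta>:circ. J2 (t, \<theta>)) = 0" by simp
      qed
    qed
    then have "(LBINT t:ray. LBINT \<theta>:circ. J2 (t, \<theta>)) = (LBINT t:ray. 0)"
      by (intro LBINT_cong_AE(1)) (use cmean_measurable[OF mJ(2)] ray_circ in \<open>auto simp: cmean_def[abs_def]\<close>)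
    then show ?thesis unfolding ray_circ(1) set_Fubini(3)[OF j2[unfolded ray_circ(1)]] by (simp add: set_lebesgue_integral_def)
  qed
  also have "(LBINT z:strip. J1 z) = - a' 0 * (LBINT \<theta>:circ. \<tau> \<theta> * b \<theta>)"
  proof -
    have ae: "AE \<theta> in lborel. \<theta> \<in> circ \<longrightarrow> (LBINT t:ray. J1 (t, \<theta>)) = - a' 0 * (\<tau> \<theta> * b \<theta>)"
      using AE_strip_slices[OF D(2,5)] AE_product(2)[OF D(8)] set_Fubini(2)[OF j1[unfolded ray_circ(1)]] trace_rep_sq_bound[OF S]
    proof eventually_elim
      case (elim \<theta>)
      show ?case
      proof
        assume \<theta>: "\<theta> \<in> circ"
        let ?N = "LBINT s:ray. (P (s, \<theta>))\<^sup>2"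
        have ae: "AE t in lborel. t \<in> ray \<longrightarrow> v (t, \<theta>) = ?U (t, \<theta>)" using elim(2) \<theta> by (auto simp: ray_circ(1))
        have y: "ac 0 s (\<lambda>t. ?U (t, \<theta>)) (\<lambda>t. P (t, \<theta>))" for s using elim(1) \<theta> by (intro trace_rep_ac) auto
        let ?H = "\<lambda>t. b \<theta> * (P (t, \<theta>) * a' t + ?U (t, \<theta>) * a'' t)"
        have mH: "?H \<in> Bor"
          using borel_slices(1)[OF D(2), of \<theta>] borel_slices(1)[OF mU, of \<theta>] borel_ab ma'' by auto
        have aeH: "AE t in lborel. t \<in> ray \<longrightarrow> J1 (t, \<theta>) = ?H t"
          using ae by eventually_elim (auto simp: J1_def algebra_simps)
        note cg = LBINT_cong_AE[OF borel_slices(1)[OF mJ(1)] mH ray_circ(2) aeH]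
        have iH: "L1_on ray ?H" by (rule cg(2)) (use elim(3) \<theta> in simp)
        have fin: "(LBINT t:{0..s}. ?H t) = b \<theta> * (?U (s, \<theta>) * a' s) - b \<theta> * (\<tau> \<theta> * a' 0)" if "0 \<le> s" for s
          using acD[OF ac_mult[OF y[of s] c1_ac[OF a'', of 0 s]], of 0 s] that by (simp add: right_diff_distrib[symmetric])
        \<comment> \<open>|U| \<le> 1 + U^2 grows at most linearly in \<open>s\<close>, and s exp
          (-s) \<le> 2 exp (-s/2) turns this growth into decay.\<close>
        have lim0: "((\<lambda>s. b \<theta> * (?U (s, \<theta>) * a' s)) \<longlongrightarrow> 0) at_top"
        proof (rule Lim_null_comparison)
          let ?E = "\<lambda>s. B * (C * ((1 + 2 * (\<tau> \<theta>)\<^sup>2) * exp (- s) + 2 * ?N * (2 * exp (- (s / 2)))))"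
          show "\<forall>\<^sub>F s in at_top. norm (b \<theta> * (?U (s, \<theta>) * a' s)) \<le> ?E s"
            using eventually_ge_at_top[of 0]
          proof eventually_elim
            case (elim s)
            have N0: "0 \<le> ?N" unfolding set_lebesgue_integral_def by (intro Bochner_Integration.integral_nonneg) auto
            have q: "(?U (s, \<theta>))\<^sup>2 \<le> 2 * (\<tau> \<theta>)\<^sup>2 + 2 * (s * ?N)"
              using \<open>\<theta> \<in> circ \<longrightarrow> (\<forall>t. 0 \<le> t \<longrightarrow> (?U (t, \<theta>))\<^sup>2 \<le> 2 * (\<tau> \<theta>)\<^sup>2 + 2 * (t * ?N))\<close> \<theta> elim by blast
            have "0 \<le> (\<bar>?U (s, \<theta>)\<bar> - 1)\<^sup>2" "0 \<le> \<bar>?U (s, \<theta>)\<bar>" by simp_all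
            then have u: "\<bar>?U (s, \<theta>)\<bar> \<le> 1 + 2 * (\<tau> \<theta>)\<^sup>2 + 2 * (s * ?N)" using q by (simp add: power2_diff)
            have se: "s * exp (- s) \<le> 2 * exp (- (s / 2))"
            proof -
              have "s / 2 \<le> exp (s / 2)" using exp_ge_add_one_self[of "s / 2"] by linarith
              then have "2 * (s / 2) * exp (- s) \<le> 2 * exp (s / 2) * exp (- s)" by (intro mult_right_mono) auto
              also have "\<dots> = 2 * exp (- (s / 2))" by (simp add: exp_add[symmetric])
              finally show ?thesis by simp
            qed
            have "\<bar>?U (s, \<theta>)\<bar> * \<bar>a' s\<bar> \<le> (1 + 2 * (\<tau> \<theta>)\<^sup>2 + 2 * (s * ?N)) * (C * exp (- s))"
              using u dec(1)[OF elim] elim N0 by (intro mult_mono) auto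
            also have "\<dots> = C * ((1 + 2 * (\<tau> \<theta>)\<^sup>2) * exp (- s) + 2 * ?N * (s * exp (- s)))" by (simp add: algebra_simps)
            also have "\<dots> \<le> C * ((1 + 2 * (\<tau> \<theta>)\<^sup>2) * exp (- s) + 2 * ?N * (2 * exp (- (s / 2))))"
              using se C0 N0 by (intro mult_left_mono add_left_mono) auto
            finally have h: "\<bar>?U (s, \<theta>)\<bar> * \<bar>a' s\<bar> \<le> C * ((1 + 2 * (\<tau> \<theta>)\<^sup>2) * exp (- s) + 2 * ?N * (2 * exp (- (s / 2))))" .
            have "\<bar>b \<theta>\<bar> * (\<bar>?U (s, \<theta>)\<bar> * \<bar>a' s\<bar>) \<le> ?E s"
              by (rule mult_mono[OF bB(1) h B0]) auto
            then show ?case by (simp add: abs_mult)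
          qed
          have e1: "((\<lambda>s::real. exp (- s)) \<longlongrightarrow> 0) at_top"
            by (rule filterlim_compose[OF exp_at_bot filterlim_uminus_at_bot_at_top])
          have e2: "((\<lambda>s::real. exp (- (s / 2))) \<longlongrightarrow> 0) at_top"
            by (rule filterlim_compose[OF e1]) (rule filterlim_at_top_mono[OF filterlim_tendsto_pos_mult_at_top[of "\<lambda>_. 1/2" "1/2", OF _ _ filterlim_ident]], auto)
          have "(?E \<longlongrightarrow> B * (C * ((1 + 2 * (\<tau> \<theta>)\<^sup>2) * 0 + 2 * ?N * (2 * 0)))) at_top"
            by (intro tendsto_intros e1 e2)
          then show "(?E \<longlongrightarrow> 0) at_top" by simp
        qed
        have "((\<lambda>s. b \<theta> * (?U (s, \<theta>) * a' s) - b \<theta> * (\<tau> \<theta> * a' 0)) \<longlongrightarrow> 0 - b \<theta> * (\<tau> \<theta> * a' 0)) at_top"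
          by (intro tendsto_diff lim0 tendsto_const)
        then have "((\<lambda>s. LBINT t:{0..s}. ?H t) \<longlongrightarrow> 0 - b \<theta> * (\<tau> \<theta> * a' 0)) at_top"
          by (rule Lim_transform_eventually) (rule eventually_mono[OF eventually_ge_at_top[of 0]], simp only: fin)
        with ray_limit[OF iH] have "(LBINT t:ray. ?H t) = 0 - b \<theta> * (\<tau> \<theta> * a' 0)"
          by (rule tendsto_unique[rotated]) simp
        with cg(1) show "(LBINT t:ray. J1 (t, \<theta>)) = - a' 0 * (\<tau> \<theta> * b \<theta>)" by simp
      qed
    qed
    have mI: "(\<lambda>\<theta>. LBINT t:ray. J1 (t, \<theta>)) \<in> Bor"
    proof -
      have "(\<lambda>w. indicator ray (snd w) *\<^sub>R J1 (snd w, fst w)) \<in> borel_measurable (borel \<Otimes>\<^sub>M borel)"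
        unfolding borel_prod using borel_swap[OF mJ(1)] borel_fst_snd(2)[of "indicator ray"] ray_circ(2)
        by (intro borel_measurable_scaleR) auto
      then show ?thesis unfolding set_lebesgue_integral_def
        by (intro sigma_finite_measure.borel_measurable_lebesgue_integral[OF sigma_finite_lborel])
           (simp add: case_prod_beta' cong: measurable_cong_sets)
    qed
    have "(LBINT \<theta>:circ. LBINT t:ray. J1 (t, \<theta>)) = (LBINT \<theta>:circ. - a' 0 * (\<tau> \<theta> * b \<theta>))"
      by (rule LBINT_cong_AE(1)[OF mI _ ray_circ(3) ae]) (use D(4) borel_ab in auto)
    also have "\<dots> = - a' 0 * (LBINT \<theta>:circ. \<tau> \<theta> * b \<theta>)" by (rule set_integral_mult_right)
    finally show ?thesis unfolding ray_circ(1) set_Fubini(4)[OF j1[unfolded ray_circ(1)]] .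
  qed
  finally show ?thesis by simp
qed

text \<open>Against a test function of t alone only the circle integrals of \<open>v\<close> and
  \<open>P\<close> matter; the bound on \<open>a\<close> makes the potential term absolutely
  convergent, as Fubini requires.\<close>

lemma radial_test:
  assumes S: "strip_function v P R \<tau>" and b1: "\<And>\<theta>. b \<theta> = 1" "\<And>\<theta>. b' \<theta> = 0" and aC: "\<And>t. 0 \<le> t \<Longrightarrow> \<bar>a t\<bar> \<le> C"
  shows "(LBINT z:strip. P z * (a' (fst z) * b (snd z)) + R z * (a (fst z) * b' (snd z)) - 2 * sech2 (fst z + T) * v z * f z)
    = (LBINT t:ray. cmean P t * a' t - 2 * sech2 (t + T) * mean_rep P \<tau> t * a t)"
proof -
  note D = strip_functionD[OF S]
  have i1: "L1_on strip (\<lambda>z. P z * a' (fst z))"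
    using L2_mult_integrable[OF D(2) borel_f(2) ray_circ(4) D(5) explicit_sq(1)] by (simp add: b1)
  have i2: "L1_on strip (\<lambda>z. 2 * sech2 (fst z + T) * v z * a (fst z))"
  proof (rule L1_bound)
    have "L1_on strip (\<lambda>z. sech2 (fst z + T) * 1)"
      unfolding ray_circ(1) by (rule L1_tensor[OF sech2_integrable_ray(1) circ_const(1)])
    then show "L1_on strip (\<lambda>z. (2 * C) * (sech2 (fst z + T) * (v z)\<^sup>2 + sech2 (fst z + T) * 1))"
      by (intro set_integrable_mult_right set_integral_add(1) weighted_integrable[OF S])
    have ms: "(\<lambda>z::real\<times>real. sech2 (fst z + T)) \<in> Bor" by (rule borel_fst_snd'[OF sech2_borel(1)])
    show "set_borel_measurable lborel strip (\<lambda>z. 2 * sech2 (fst z + T) * v z * a (fst z))"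
      by (intro Bor_set ray_circ borel_measurable_times borel_measurable_const ms D(1) borel_fst_snd borel_ab)
    have "\<bar>2 * sech2 (fst z + T) * v z * a (fst z)\<bar> \<le> (2 * C) * (sech2 (fst z + T) * (v z)\<^sup>2 + sech2 (fst z + T) * 1)" if z: "z \<in> strip" for z
    proof -
      have t: "0 \<le> fst z" using z by (auto simp: strip_def)
      have s: "0 \<le> sech2 (fst z + T)" using sech2_bounds(1)[of "fst z + T"] by linarith
      have "0 \<le> (\<bar>v z\<bar> - 1)\<^sup>2" "0 \<le> \<bar>v z\<bar>" by simp_all
      then have "\<bar>v z\<bar> \<le> (v z)\<^sup>2 + 1" by (simp add: power2_diff)
      then have "\<bar>v z\<bar> * \<bar>a (fst z)\<bar> \<le> ((v z)\<^sup>2 + 1) * C" using aC[OF t] by (intro mult_mono) auto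
      then have "(2 * sech2 (fst z + T)) * (\<bar>v z\<bar> * \<bar>a (fst z)\<bar>) \<le> (2 * sech2 (fst z + T)) * (((v z)\<^sup>2 + 1) * C)"
        using s by (intro mult_left_mono) auto
      then show ?thesis using s by (simp add: abs_mult algebra_simps)
    qed
    then show "AE z in lborel. z \<in> strip \<longrightarrow> \<bar>2 * sech2 (fst z + T) * v z * a (fst z)\<bar> \<le> (2 * C) * (sech2 (fst z + T) * (v z)\<^sup>2 + sech2 (fst z + T) * 1)" by simp
  qed
  have "(LBINT z:strip. P z * (a' (fst z) * b (snd z)) + R z * (a (fst z) * b' (snd z)) - 2 * sech2 (fst z + T) * v z * f z)
    = (LBINT z:strip. P z * a' (fst z) - 2 * sech2 (fst z + T) * v z * a (fst z))" by (simp add: b1 f_def)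
  also have "\<dots> = (LBINT t:ray. LBINT \<theta>:circ. P (t, \<theta>) * a' t - 2 * sech2 (t + T) * v (t, \<theta>) * a t)"
    using set_Fubini(3)[OF set_integral_diff(1)[OF i1 i2, unfolded ray_circ(1)]] by (simp add: ray_circ(1))
  also have "\<dots> = (LBINT t:ray. cmean P t * a' t - 2 * sech2 (t + T) * mean_rep P \<tau> t * a t)"
  proof (rule LBINT_cong_AE(1)[OF _ _ ray_circ(2)])
    have ms: "(\<lambda>z::real\<times>real. sech2 (fst z + T)) \<in> Bor" by (rule borel_fst_snd'[OF sech2_borel(1)])
    have "(\<lambda>z. P z * a' (fst z) - 2 * sech2 (fst z + T) * v z * a (fst z)) \<in> Bor"
      by (intro borel_measurable_diff borel_measurable_times borel_measurable_const ms D borel_fst_snd borel_ab)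
    from cmean_measurable[OF this]
    show "(\<lambda>t. LBINT \<theta>:circ. P (t, \<theta>) * a' t - 2 * sech2 (t + T) * v (t, \<theta>) * a t) \<in> Bor"
      by (simp add: cmean_def[abs_def])
    show "(\<lambda>t. cmean P t * a' t - 2 * sech2 (t + T) * mean_rep P \<tau> t * a t) \<in> Bor"
      by (intro borel_measurable_diff borel_measurable_times borel_measurable_const sech2_measurable mean_rep(4)[OF S] cmean_measurable D borel_ab)
    show "AE t in lborel. t \<in> ray \<longrightarrow> (LBINT \<theta>:circ. P (t, \<theta>) * a' t - 2 * sech2 (t + T) * v (t, \<theta>) * a t)
      = cmean P t * a' t - 2 * sech2 (t + T) * mean_rep P \<tau> t * a t"
      using mean_rep(3)[OF S] slice_sq_integrable(1,2)[OF S]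
    proof eventually_elim
      case (elim t)
      show ?case
      proof
        assume t: "t \<in> ray"
        have "L1_on circ (\<lambda>\<theta>. P (t, \<theta>))" "L1_on circ (\<lambda>\<theta>. v (t, \<theta>))"
          using circ_L1[OF borel_slices(2)[OF D(2)], of t] circ_L1[OF borel_slices(2)[OF D(1)], of t] elim t by auto
        then have "(LBINT \<theta>:circ. P (t, \<theta>) * a' t - 2 * sech2 (t + T) * v (t, \<theta>) * a t)
           = cmean P t * a' t - 2 * sech2 (t + T) * cmean v t * a t"
          by (subst set_integral_diff(2)) (auto simp: cmean_def)
        then show "(LBINT \<theta>:circ. P (t, \<theta>) * a' t - 2 * sech2 (t + T) * v (t, \<theta>) * a t)
          = cmean P t * a' t - 2 * sech2 (t + T) * mean_rep P \<tau> t * a t" using elim t by simp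
      qed
    qed
  qed
  finally show ?thesis .
qed

end

section \<open>Dimension counts\<close>

text \<open>Gaussian elimination in coordinates: fewer linear conditions than unknowns leave a
  nonzero solution. Dimensions are defined by independent families modulo null triples, so this is
  the only linear algebra that the upper bounds need.\<close>

lemma nontrivial_combination_on:
  fixes c :: "nat \<Rightarrow> 'a \<Rightarrow> real"
  assumes "finite I" "d < card I"
  shows "\<exists>a. (\<exists>k\<in>I. a k \<noteq> 0) \<and> (\<forall>j<d. (\<Sum>k\<in>I. a k * c j k) = 0)"
  using assms
proof (induction d arbitrary: I c)
  case 0
  then obtain k where "k \<in> I" by fastforce
  then show ?case by (intro exI[of _ "\<lambda>_. 1"]) auto
next
  case (Suc d)
  show ?case
  proof (cases "\<forall>k\<in>I. c d k = 0")
    case True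
    obtain a where a: "\<exists>k\<in>I. a k \<noteq> 0" "\<forall>j<d. (\<Sum>k\<in>I. a k * c j k) = 0"
      using Suc.IH[of I c] Suc.prems by auto
    have "(\<Sum>k\<in>I. a k * c j k) = 0" if "j < Suc d" for j
      using that a(2) True by (cases "j = d") auto
    with a(1) show ?thesis by blast
  next
    case False
    then obtain p where p: "p \<in> I" "c d p \<noteq> 0" by blast
    \<comment> \<open>Equation \<open>d\<close> with pivot \<open>p\<close> eliminates the unknown
      \<open>p\<close> from all other equations; afterwards \<open>a' p\<close> is the value that
      solves equation \<open>d\<close>.\<close>
    define e where "e j k = c j k - c j p * c d k / c d p" for j k
    have "d < card (I - {p})" using Suc.prems p by simp
    from Suc.IH[OF _ this, of e] obtain a where a: "\<exists>k\<in>I - {p}. a k \<noteq> 0" "\<forall>j<d. (\<Sum>k\<in>I - {p}. a k * e j k) = 0"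
      using Suc.prems by auto
    define a' where "a' k = (if k = p then - (\<Sum>k\<in>I - {p}. a k * c d k) / c d p else a k)" for k
    have "(\<Sum>k\<in>I. a' k * c j k) = 0" if j: "j < Suc d" for j
    proof -
      have 1: "(\<Sum>k\<in>I. a' k * c j k) = a' p * c j p + (\<Sum>k\<in>I - {p}. a k * c j k)"
        by (subst sum.remove[OF Suc.prems(1) p(1)]) (auto simp: a'_def intro!: sum.cong)
      have 2: "(\<Sum>k\<in>I - {p}. a k * e j k) = (\<Sum>k\<in>I - {p}. a k * c j k) - (\<Sum>k\<in>I - {p}. a k * c d k) * (c j p / c d p)"
        by (simp add: e_def right_diff_distrib sum_subtractf sum_distrib_right sum_distrib_left divide_inverse mult_ac)
      show ?thesis
      proof (cases "j = d")
        case True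
        then show ?thesis using 1 p(2) by (simp add: a'_def)
      next
        case False
        then have "(\<Sum>k\<in>I - {p}. a k * e j k) = 0" using a(2) j by auto
        then show ?thesis using 1 2 by (simp add: a'_def)
      qed
    qed
    moreover have "\<exists>k\<in>I. a' k \<noteq> 0" using a(1) by (auto simp: a'_def)
    ultimately show ?thesis by blast
  qed
qed

lemma nontrivial_combination:
  fixes c :: "nat \<Rightarrow> nat \<Rightarrow> real"
  assumes "d < n"
  obtains a where "\<exists>k<n. a k \<noteq> 0" "\<And>j. j < d \<Longrightarrow> (\<Sum>k<n. a k * c j k) = 0"
  using nontrivial_combination_on[of "{..<n}" d c] assms by auto

lemma dimension_le:
  assumes "\<And>n b. (\<And>k. k < n \<Longrightarrow> b k \<in> V) \<Longrightarrow> independent_family n b \<Longrightarrow> n \<le> d"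
  shows "dimension V \<le> enat d"
  unfolding dimension_def using assms by (intro SUP_least) auto

lemma dimension_ge:
  assumes "\<And>k. k < n \<Longrightarrow> b k \<in> V" "independent_family n b"
  shows "enat n \<le> dimension V"
  unfolding dimension_def using assms by (intro SUP_upper) auto

text \<open>A nonempty open set is not negligible. The independence proofs use this to evaluate null
  combinations at chosen points.\<close>

lemma continuous_AE_strip_zero:
  fixes g :: "real \<times> real \<Rightarrow> real"
  assumes g: "continuous_on UNIV g" and ae: "AE z in lborel. z \<in> strip \<longrightarrow> g z = 0"
    and t: "0 < t" and \<theta>: "0 < \<theta>" "\<theta> < 2 * pi"
  shows "g (t, \<theta>) = 0"
proof (rule ccontr)
  assume n: "g (t, \<theta>) \<noteq> 0"
  define U where "U = {z. g z \<noteq> 0} \<inter> ({0<..} \<times> {0<..<2*pi})"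
  have "open U" unfolding U_def
    by (intro open_Int open_Times open_greaterThan open_greaterThanLessThan open_Collect_neq g continuous_on_const)
  moreover have "U \<noteq> {}" using n t \<theta> by (auto simp: U_def)
  ultimately have 1: "\<not> negligible U" by (rule open_not_negligible)
  have "AE z in lborel. z \<notin> U" using ae by eventually_elim (auto simp: U_def strip_def)
  then have "AE z in lebesgue. z \<notin> U" by (rule AE_completion)
  moreover have "U \<in> sets lebesgue" using \<open>open U\<close> by (simp add: borel_open)
  ultimately have "U \<in> null_sets lebesgue" by (simp add: AE_iff_null_sets)
  then show False using 1 by (simp add: negligible_iff_null_sets)
qed

section \<open>Variations of a Y-noid\<close>

context noid
begin

definition form_on :: "triple \<Rightarrow> 3 \<Rightarrow> real" where
  "form_on \<phi> i = face_form (TT i) (\<phi> i) (D1 (\<phi> i)) (D2 (\<phi> i)) (bdry_trace (\<phi> i))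
     (\<phi> i) (D1 (\<phi> i)) (D2 (\<phi> i)) (bdry_trace (\<phi> i))"

definition mean :: "triple \<Rightarrow> 3 \<Rightarrow> real \<Rightarrow> real" where
  "mean \<phi> i = mean_rep (D1 (\<phi> i)) (bdry_trace (\<phi> i))"

definition rem :: "triple \<Rightarrow> 3 \<Rightarrow> real \<times> real \<Rightarrow> real" where
  "rem \<phi> i = (\<lambda>z. \<phi> i z - mean \<phi> i (fst z) / (2 * pi))"

definition rem1 :: "triple \<Rightarrow> 3 \<Rightarrow> real \<times> real \<Rightarrow> real" where
  "rem1 \<phi> i = (\<lambda>z. D1 (\<phi> i) z - cmean (D1 (\<phi> i)) (fst z) / (2 * pi))"

definition rem_trace :: "triple \<Rightarrow> 3 \<Rightarrow> real \<Rightarrow> real" where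
  "rem_trace \<phi> i = (\<lambda>\<theta>. bdry_trace (\<phi> i) \<theta> - mean \<phi> i 0 / (2 * pi))"

text \<open>The common ground of the compactly supported triples and the energy space, so that one
  set of estimates serves both index and nullity.\<close>

definition energy_variation :: "triple \<Rightarrow> bool" where
  "energy_variation \<phi> \<longleftrightarrow> admissible \<phi> \<and> (\<forall>i. gradient_in_L2 \<alpha> c i (\<phi> i))"

lemma energy_strip:
  assumes "energy_variation \<phi>"
  shows "strip_function (\<phi> i) (D1 (\<phi> i)) (D2 (\<phi> i)) (bdry_trace (\<phi> i))"
  using assms admissible_strip by (auto simp: energy_variation_def)

lemma rem_strip:
  assumes E: "energy_variation \<phi>"
  shows "strip_function (rem \<phi> i) (rem1 \<phi> i) (D2 (\<phi> i)) (rem_trace \<phi> i)"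
    and "AE t in lborel. t \<in> ray \<longrightarrow> cmean (rem \<phi> i) t = 0"
  using demeaned_strip_function[OF energy_strip[OF E]] demeaned_mean_zero[OF energy_strip[OF E]]
  by (simp_all add: rem_def[abs_def] rem1_def[abs_def] rem_trace_def[abs_def] mean_def mean_rep(2)[OF energy_strip[OF E]])

text \<open>Both upper bounds start here: the first two terms are nonnegative, so only the radial
  part can make the form negative.\<close>

lemma form_split:
  assumes E: "energy_variation \<phi>"
  shows "form_on \<phi> i = (LBINT z:strip. (rem1 \<phi> i z + tanh (fst z + TT i) * rem \<phi> i z)\<^sup>2)
      + ((LBINT z:strip. (D2 (\<phi> i) z)\<^sup>2) - (LBINT z:strip. (rem \<phi> i z)\<^sup>2))
      + radial_form (TT i) (mean \<phi> i) (cmean (D1 (\<phi> i))) / (2 * pi)"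
    and "0 \<le> (LBINT z:strip. (rem1 \<phi> i z + tanh (fst z + TT i) * rem \<phi> i z)\<^sup>2)"
    and "(LBINT z:strip. (rem \<phi> i z)\<^sup>2) \<le> (LBINT z:strip. (D2 (\<phi> i) z)\<^sup>2)"
proof -
  note W = wirtinger_strip[OF rem_strip[OF E, of i]]
  show "form_on \<phi> i = (LBINT z:strip. (rem1 \<phi> i z + tanh (fst z + TT i) * rem \<phi> i z)\<^sup>2)
      + ((LBINT z:strip. (D2 (\<phi> i) z)\<^sup>2) - (LBINT z:strip. (rem \<phi> i z)\<^sup>2))
      + radial_form (TT i) (mean \<phi> i) (cmean (D1 (\<phi> i))) / (2 * pi)"
    unfolding mean_zero_form(1)[OF rem_strip(1)[OF E, of i] W(1), symmetric] form_on_def face_form_demean[OF energy_strip[OF E, of i]]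
    by (simp add: rem_def[abs_def] rem1_def[abs_def] rem_trace_def[abs_def] mean_def mean_rep(2)[OF energy_strip[OF E]])
  show "0 \<le> (LBINT z:strip. (rem1 \<phi> i z + tanh (fst z + TT i) * rem \<phi> i z)\<^sup>2)"
    unfolding set_lebesgue_integral_def by (intro Bochner_Integration.integral_nonneg) auto
  show "(LBINT z:strip. (rem \<phi> i z)\<^sup>2) \<le> (LBINT z:strip. (D2 (\<phi> i) z)\<^sup>2)" by (rule W(2))
qed

lemma index_form_split: "index_form \<alpha> c \<phi> \<phi> = (\<Sum>i\<in>UNIV. form_on \<phi> i)"
  by (simp add: index_form_eq form_on_def)

lemma trace_sum_weighted:
  assumes E: "energy_variation \<phi>" and w: "w \<in> Bor" "L1_on circ (\<lambda>\<theta>. (w \<theta>)\<^sup>2)"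
  shows "(\<Sum>i\<in>UNIV. LBINT \<theta>:circ. bdry_trace (\<phi> i) \<theta> * w \<theta>) = 0"
proof -
  note D = strip_functionD[OF energy_strip[OF E]]
  have i: "L1_on circ (\<lambda>\<theta>. bdry_trace (\<phi> i) \<theta> * w \<theta>)" for i
    by (rule L2_mult_integrable[OF D(4) w(1) ray_circ(3) D(7) w(2)])
  have z: "AE \<theta> in lborel. \<theta> \<in> circ \<longrightarrow> (\<Sum>i\<in>UNIV. bdry_trace (\<phi> i) \<theta>) = 0"
    using E by (simp add: energy_variation_def admissible_def circ_def)
  have "(\<Sum>i\<in>UNIV. LBINT \<theta>:circ. bdry_trace (\<phi> i) \<theta> * w \<theta>)
    = (LBINT \<theta>:circ. bdry_trace (\<phi> 1) \<theta> * w \<theta> + bdry_trace (\<phi> 2) \<theta> * w \<theta> + bdry_trace (\<phi> 3) \<theta> * w \<theta>)"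
    by (simp add: sum_3 set_integral_add[OF i i] set_integral_add[OF set_integral_add(1)[OF i i] i])
  also have "\<dots> = (LBINT \<theta>:circ. 0)"
  proof (rule LBINT_cong_AE(1)[OF _ _ ray_circ(3)])
    show "(\<lambda>\<theta>. bdry_trace (\<phi> 1) \<theta> * w \<theta> + bdry_trace (\<phi> 2) \<theta> * w \<theta> + bdry_trace (\<phi> 3) \<theta> * w \<theta>) \<in> Bor"
      by (intro borel_measurable_add borel_measurable_times D w)
    show "AE \<theta> in lborel. \<theta> \<in> circ \<longrightarrow> bdry_trace (\<phi> 1) \<theta> * w \<theta> + bdry_trace (\<phi> 2) \<theta> * w \<theta> + bdry_trace (\<phi> 3) \<theta> * w \<theta> = 0"
      using z by eventually_elim (simp add: sum_3 distrib_right[symmetric])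
  qed simp
  finally show ?thesis by (simp add: set_lebesgue_integral_def)
qed

lemma mean_sum: "energy_variation \<phi> \<Longrightarrow> mean \<phi> 1 0 + mean \<phi> 2 0 + mean \<phi> 3 0 = 0"
  using trace_sum_weighted[of \<phi> "\<lambda>_. 1"] by (simp add: circ_const sum_3 mean_def mean_rep(2)[OF energy_strip])

text \<open>\<open>weak_gradient\<close> and \<open>bdry_trace\<close> are choices, so linearity is
  not definitional. It is recovered from the circle integrals of the functions themselves, which
  agree with \<open>mean\<close> almost everywhere, and extends to every t by continuity.\<close>

lemma mean_linear:
  assumes E: "energy_variation \<phi>" "energy_variation \<psi>" "energy_variation (\<lambda>i z. a * \<phi> i z + b * \<psi> i z)" and t: "0 \<le> t"
  shows "mean (\<lambda>i z. a * \<phi> i z + b * \<psi> i z) i t = a * mean \<phi> i t + b * mean \<psi> i t"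
proof (rule continuous_AE_eq[where a=0 and b="t+1" and x=t and f="mean (\<lambda>i z. a * \<phi> i z + b * \<psi> i z) i"
      and g="\<lambda>t. a * mean \<phi> i t + b * mean \<psi> i t"])
  note S = energy_strip[OF E(1), of i] energy_strip[OF E(2), of i] energy_strip[OF E(3), of i]
  show "continuous_on {0..t + 1} (mean (\<lambda>i z. a * \<phi> i z + b * \<psi> i z) i)"
    unfolding mean_def by (rule ac_continuous[OF mean_rep(1)[OF S(3)]])
  show "continuous_on {0..t + 1} (\<lambda>t. a * mean \<phi> i t + b * mean \<psi> i t)"
    unfolding mean_def by (intro continuous_intros ac_continuous[OF mean_rep(1)[OF S(1)]] ac_continuous[OF mean_rep(1)[OF S(2)]])
  show "AE x in lborel. 0 < x \<longrightarrow> x < t + 1 \<longrightarrow> mean (\<lambda>i z. a * \<phi> i z + b * \<psi> i z) i x = a * mean \<phi> i x + b * mean \<psi> i x"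
    using mean_rep(3)[OF S(1)] mean_rep(3)[OF S(2)] mean_rep(3)[OF S(3)] slice_sq_integrable(1)[OF S(1)] slice_sq_integrable(1)[OF S(2)]
  proof eventually_elim
    case (elim x)
    show ?case
    proof (intro impI)
      assume "0 < x"
      then have x: "x \<in> ray" by (simp add: ray_def)
      have "L1_on circ (\<lambda>\<theta>. \<phi> i (x, \<theta>))" "L1_on circ (\<lambda>\<theta>. \<psi> i (x, \<theta>))"
        using circ_L1[OF borel_slices(2)[OF strip_functionD(1)[OF S(1)]], of x]
          circ_L1[OF borel_slices(2)[OF strip_functionD(1)[OF S(2)]], of x] elim x by auto
      then have "cmean (\<lambda>z. a * \<phi> i z + b * \<psi> i z) x = a * cmean (\<phi> i) x + b * cmean (\<psi> i) x"
        unfolding cmean_def by (subst set_integral_add(2)) auto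
      then show "mean (\<lambda>i z. a * \<phi> i z + b * \<psi> i z) i x = a * mean \<phi> i x + b * mean \<psi> i x"
        using elim x by (simp add: mean_def)
    qed
  qed
qed (use t in auto)

lemma mean_combination:
  fixes n :: nat
  assumes V: "triple_subspace V" "\<And>\<phi>. \<phi> \<in> V \<Longrightarrow> energy_variation \<phi>" and b: "\<And>k. k < n \<Longrightarrow> b k \<in> V" and t: "0 \<le> t"
  shows "(\<lambda>i z. \<Sum>k<n. a k * b k i z) \<in> V \<and> mean (\<lambda>i z. \<Sum>k<n. a k * b k i z) i t = (\<Sum>k<n. a k * mean (b k) i t)"
  using b
proof (induction n)
  case 0
  have 0: "(\<lambda>i x. 0) \<in> V" using V(1) by (simp add: triple_subspace_def)
  then show ?case using mean_linear[of "\<lambda>i x. 0" "\<lambda>i x. 0" 0 0 t i] V(2) t by simp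
next
  case (Suc n)
  let ?s = "\<lambda>i z. \<Sum>k<n. a k * b k i z"
  have s: "?s \<in> V" "mean ?s i t = (\<Sum>k<n. a k * mean (b k) i t)" "b n \<in> V" using Suc by auto
  have "(\<lambda>i x. 1 * ?s i x + a n * b n i x) \<in> V"
    by (rule V(1)[unfolded triple_subspace_def, THEN conjunct2, rule_format, OF s(1,3)])
  with mean_linear[of ?s "b n" 1 "a n" t i] s V(2) t show ?case by simp
qed

section \<open>The index is at most two\<close>

lemma mean_ac:
  assumes "energy_variation \<phi>"
  shows "ac 0 b (mean \<phi> i) (cmean (D1 (\<phi> i)))" "L1_on ray (\<lambda>t. (cmean (D1 (\<phi> i)) t)\<^sup>2)"
    "L1_on ray (\<lambda>t. sech2 (t + T) * (mean \<phi> i t)\<^sup>2)"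
    "mean \<phi> i \<in> Bor" "cmean (D1 (\<phi> i)) \<in> Bor"
  unfolding mean_def using mean_rep[OF energy_strip[OF assms, of i]] cmean_measurable strip_functionD(2)[OF energy_strip[OF assms, of i]] by auto

lemma index_form_nonneg:
  assumes E: "energy_variation \<phi>" and m: "mean \<phi> 1 (- TT 1) = 0" "mean \<phi> 3 (- TT 3) = 0"
  shows "0 \<le> index_form \<alpha> c \<phi> \<phi>"
proof -
  define x where "x i = mean \<phi> i 0" for i :: 3
  define k where "k i = cos (ang \<alpha> i)" for i :: 3
  have k: "k 1 > 0" "k 3 > 0" "k 2 = - (k 1 + k 3)" using cos_ang_signs cos_ang_sum by (auto simp: k_def)
  have "(x i)\<^sup>2 / k i \<le> radial_form (TT i) (mean \<phi> i) (cmean (D1 (\<phi> i)))" for i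
  proof -
    have "TT i > 0 \<or> TT i < 0 \<and> mean \<phi> i (- TT i) = 0" using T_signs m exhaust_3[of i] by auto
    from radial_form_lower_bound[OF mean_ac(1,2,3)[OF E] this] show ?thesis by (simp add: x_def k_def tanh_T)
  qed
  then have r: "(\<Sum>i\<in>UNIV. (x i)\<^sup>2 / k i) \<le> (\<Sum>i\<in>UNIV. radial_form (TT i) (mean \<phi> i) (cmean (D1 (\<phi> i))))"
    by (rule sum_mono)
  have x2: "x 2 = - (x 1 + x 3)" using mean_sum[OF E] by (simp add: x_def)
  \<comment> \<open>Since both \<open>k\<close> and \<open>x\<close> sum to zero over the faces, the
    index 2 is eliminated and the three quotients add up to a square over a positive number.\<close>
  have "(x 1)\<^sup>2 / k 1 + (x 3)\<^sup>2 / k 3 - (x 1 + x 3)\<^sup>2 / (k 1 + k 3) = (x 1 * k 3 - x 3 * k 1)\<^sup>2 / (k 1 * k 3 * (k 1 + k 3))"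
    using k(1,2) by (simp add: divide_simps add_pos_pos less_imp_neq[symmetric]) (simp add: power2_eq_square algebra_simps)
  then have "0 \<le> (x 1)\<^sup>2 / k 1 + (x 3)\<^sup>2 / k 3 - (x 1 + x 3)\<^sup>2 / (k 1 + k 3)" using k(1,2) by simp
  moreover have "(\<Sum>i\<in>UNIV. (x i)\<^sup>2 / k i) = (x 1)\<^sup>2 / k 1 + (x 3)\<^sup>2 / k 3 - (x 1 + x 3)\<^sup>2 / (k 1 + k 3)"
    unfolding sum_3 x2 k(3) power2_minus divide_minus_right by simp
  ultimately have "0 \<le> (\<Sum>i\<in>UNIV. radial_form (TT i) (mean \<phi> i) (cmean (D1 (\<phi> i))))" using r by linarith
  moreover have "(\<Sum>i\<in>UNIV. radial_form (TT i) (mean \<phi> i) (cmean (D1 (\<phi> i))) / (2*pi)) \<le> (\<Sum>i\<in>UNIV. form_on \<phi> i)"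
  proof (rule sum_mono)
    fix i show "radial_form (TT i) (mean \<phi> i) (cmean (D1 (\<phi> i))) / (2*pi) \<le> form_on \<phi> i"
      using form_split[OF E, of i] by linarith
  qed
  ultimately show ?thesis unfolding index_form_split sum_divide_distrib[symmetric]
    by (meson divide_nonneg_pos order_trans pi_gt_zero zero_less_mult_iff zero_less_numeral)
qed

text \<open>Vanishing of the means at the two necks is a pair of linear conditions. Three
  independent variations would have a nontrivial combination that satisfies both, and there the form
  is nonnegative.\<close>

lemma morse_index_le: "morse_index \<alpha> c \<le> 2"
  unfolding morse_index_def
proof (rule SUP_least)
  fix V assume "V \<in> {V. triple_subspace V \<and> V \<subseteq> compact_W12_triples \<alpha> c \<and> negative_definite_on \<alpha> c V}"
  then have V: "triple_subspace V" "V \<subseteq> compact_W12_triples \<alpha> c" "negative_definite_on \<alpha> c V" by auto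
  have EV: "energy_variation \<phi>" if "\<phi> \<in> V" for \<phi>
    using that V(2) by (auto simp: energy_variation_def compact_W12_triples_def)
  have "dimension V \<le> enat 2"
  proof (rule dimension_le, rule ccontr)
    fix n b assume b: "\<And>k. k < n \<Longrightarrow> b k \<in> V" and ind: "independent_family n b" and "\<not> n \<le> 2"
    then have "2 < n" by simp
    define g where "g j k = (if j = 0 then mean (b k) 1 (- TT 1) else mean (b k) 3 (- TT 3))" for j k :: nat
    obtain a where a: "\<exists>k<n. a k \<noteq> 0" and z: "\<And>j. j < 2 \<Longrightarrow> (\<Sum>k<n. a k * g j k) = 0"
      using nontrivial_combination[OF \<open>2 < n\<close>, of g] by blast
    let ?\<phi> = "\<lambda>i z. \<Sum>k<n. a k * b k i z"
    have t: "0 \<le> - TT 1" "0 \<le> - TT 3" using T_signs by auto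
    have "?\<phi> \<in> V" "mean ?\<phi> 1 (- TT 1) = 0" "mean ?\<phi> 3 (- TT 3) = 0"
      using mean_combination[OF V(1) EV b t(1), where a=a and i=1] mean_combination[OF V(1) EV b t(2), where a=a and i=3] z[of 0] z[of 1]
      by (auto simp: g_def)
    then have "0 \<le> index_form \<alpha> c ?\<phi> ?\<phi>" by (intro index_form_nonneg EV)
    then have "null_triple ?\<phi>" using V(3) \<open>?\<phi> \<in> V\<close> unfolding negative_definite_on_def by force
    then show False using ind a unfolding independent_family_def by blast
  qed
  then show "dimension V \<le> 2" by (simp add: numeral_eq_enat)
qed

end

section \<open>Triples of separated variations\<close>

lemma ray_compact:
  fixes g :: "real \<Rightarrow> real"
  assumes "\<And>t. r < t \<Longrightarrow> g t = 0"
  shows "(LBINT t:ray. g t) = (LINT t:{0..r}|lborel. g t)"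
    and "L1_on ray g \<longleftrightarrow> L1_on {0..r} g"
proof -
  have "(\<lambda>t. indicator ray t *\<^sub>R g t) = (\<lambda>t. indicator {0..r} t *\<^sub>R g t)"
  proof
    fix t show "indicator ray t *\<^sub>R g t = indicator {0..r} t *\<^sub>R g t"
      using assms[of t] by (cases "r < t") (auto simp: ray_def indicator_def)
  qed
  then show "(LBINT t:ray. g t) = (LINT t:{0..r}|lborel. g t)"
    "L1_on ray g \<longleftrightarrow> L1_on {0..r} g"
    by (simp_all add: set_lebesgue_integral_def set_integrable_def)
qed

lemma c1_eventually_zero:
  assumes h: "c1 h h'" and z: "\<And>t. r < t \<Longrightarrow> h t = 0" and t: "r < t"
  shows "h' t = 0"
proof -
  have "((\<lambda>_. 0) has_real_derivative h' t) (at t)"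
    by (rule has_field_derivative_transform_within_open[OF c1D[OF h] open_greaterThan[of r]]) (use z t in auto)
  then show ?thesis using DERIV_unique DERIV_const by blast
qed

lemma c1_sq_integrable_ray:
  assumes h: "c1 h h'" and z: "\<And>t. r < t \<Longrightarrow> h t = 0"
  shows "L1_on ray (\<lambda>t. (h' t)\<^sup>2)"
proof -
  have "L1_on {0..r} (\<lambda>t. (h' t)\<^sup>2)"
    using c1D'[OF h] by (intro borel_integrable_atLeastAtMost' continuous_intros) (auto intro: continuous_on_subset)
  then show ?thesis using c1_eventually_zero[OF h z] by (subst ray_compact(2)[of r]) auto
qed

lemma c1_bounded_ray:
  assumes h: "c1 h h'" and z: "\<And>t. r < t \<Longrightarrow> h t = 0"
  shows "\<exists>C. \<forall>t\<ge>0. \<bar>h t\<bar> \<le> C"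
proof -
  have "compact (h ` {0..r})" using c1_continuous[OF h] by (intro compact_continuous_image) (auto intro: continuous_on_subset)
  then obtain C where C: "\<And>x. x \<in> {0..r} \<Longrightarrow> \<bar>h x\<bar> \<le> C"
    using compact_imp_bounded bounded_iff by (metis imageI real_norm_def)
  have "\<bar>h t\<bar> \<le> max 0 C" if "0 \<le> t" for t
    using that C[of t] z[of t] by (cases "r < t") auto
  then show ?thesis by blast
qed

text \<open>All faces share the angular factor \<open>b\<close>, so admissibility along \<Gamma>
  reduces to one linear equation between the numbers \<open>a i 0\<close>.\<close>

locale separated_triple = noid +
  fixes a a' :: "3 \<Rightarrow> real \<Rightarrow> real" and b b' :: "real \<Rightarrow> real" and B :: real
  assumes sep: "\<And>i. separated (a i) (a' i) b b' B"
    and bounded_a: "\<And>i. \<exists>C. \<forall>t\<ge>0. \<bar>a i t\<bar> \<le> C"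
    and sum_a: "a 1 0 + a 2 0 + a 3 0 = 0"
begin

definition \<psi> :: triple where "\<psi> = (\<lambda>i. separated.f (a i) b)"

lemma \<psi>_apply: "\<psi> i z = a i (fst z) * b (snd z)"
  by (simp add: \<psi>_def separated.f_def[OF sep])

lemma \<psi>_admissible: "admissible \<psi>"
proof -
  have "AE \<theta> in lborel. \<theta> \<in> {0..<2*pi} \<longrightarrow> (\<Sum>i\<in>UNIV. bdry_trace (\<psi> i) \<theta>) = 0"
    using separated.f_bdry_trace[OF sep[of 1]] separated.f_bdry_trace[OF sep[of 2]] separated.f_bdry_trace[OF sep[of 3]]
  proof eventually_elim
    case (elim \<theta>)
    then show ?case using sum_a by (auto simp: sum_3 \<psi>_def circ_def distrib_right[symmetric])
  qed
  moreover have "\<psi> i \<in> Bor" "periodic (\<psi> i)" "\<exists>p. has_weak_gradient (\<psi> i) p" "\<exists>\<tau>. has_trace (\<psi> i) \<tau>" for i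
    unfolding \<psi>_def
    by (rule separated.borel_f(1)[OF sep], rule separated.f_periodic[OF sep], rule exI, rule separated.f_gradient(1)[OF sep],
        rule exI, rule separated.f_trace[OF sep])
  ultimately show ?thesis unfolding admissible_def by blast
qed

lemma \<psi>_gradient: "gradient_in_L2 \<alpha> c i (\<psi> i)"
  unfolding \<psi>_def by (rule separated.f_gradient_in_L2[OF sep]) unfold_locales

lemma \<psi>_energy_variation: "energy_variation \<psi>"
  using \<psi>_admissible \<psi>_gradient by (simp add: energy_variation_def)

lemma \<psi>_measurable: "\<psi> i \<in> Bor"
  unfolding \<psi>_def by (rule separated.borel_f(1)[OF sep])

lemma \<psi>_bounded: "\<exists>C. \<forall>z\<in>strip. \<bar>\<psi> i z\<bar> \<le> C"
proof -
  obtain C where C: "\<And>t. 0 \<le> t \<Longrightarrow> \<bar>a i t\<bar> \<le> C" using bounded_a[of i] by blast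
  have "0 \<le> C" using C[of 0] abs_ge_zero[of "a i 0"] by linarith
  have "\<bar>\<psi> i z\<bar> \<le> C * B" if "z \<in> strip" for z
  proof -
    have "\<bar>a i (fst z)\<bar> \<le> C" using that C by (auto simp: strip_def)
    then show ?thesis unfolding \<psi>_apply abs_mult
      using \<open>0 \<le> C\<close> separated.bB(1)[OF sep] by (intro mult_mono) auto
  qed
  then show ?thesis by blast
qed

lemma \<psi>_energy_space: "\<psi> \<in> energy_space \<alpha> c"
  unfolding energy_space_def using \<psi>_admissible \<psi>_gradient \<psi>_bounded in_L2_star_bounded[OF \<psi>_measurable]
  by blast

lemma \<psi>_compact:
  assumes "\<And>i t. r < t \<Longrightarrow> a i t = 0"
  shows "\<psi> \<in> compact_W12_triples \<alpha> c"
proof -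
  have z: "\<psi> i z = 0" if "r < fst z" for i z using assms[OF that] by (simp add: \<psi>_apply)
  have "in_L2 \<alpha> c i (\<psi> i)" for i
    using \<psi>_bounded[of i] in_L2_compact[OF \<psi>_measurable _ z] by blast
  moreover have "\<exists>R. AE x in lborel. x \<in> strip \<and> fst x > R \<longrightarrow> \<psi> i x = 0" for i
    using z by (intro exI[of _ r]) auto
  ultimately show ?thesis using \<psi>_admissible \<psi>_gradient by (simp add: compact_W12_triples_def)
qed

lemma index_form_\<psi>:
  assumes E: "energy_variation \<phi>"
  shows "index_form \<alpha> c \<phi> \<psi> = (\<Sum>i\<in>UNIV.
     (LBINT z:strip. D1 (\<phi> i) z * (a' i (fst z) * b (snd z)) + D2 (\<phi> i) z * (a i (fst z) * b' (snd z))
        - 2 * sech2 (fst z + TT i) * \<phi> i z * separated.f (a i) b z)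
     - tanh (TT i) * a i 0 * (LBINT \<theta>:circ. bdry_trace (\<phi> i) \<theta> * b \<theta>))"
  unfolding index_form_eq \<psi>_def separated.face_form_f[OF sep energy_strip[OF E]] ..

lemma index_form_\<psi>_radial:
  assumes E: "energy_variation \<phi>" and b: "\<And>\<theta>. b \<theta> = 1" "\<And>\<theta>. b' \<theta> = 0"
  shows "index_form \<alpha> c \<phi> \<psi> = (\<Sum>i\<in>UNIV.
     (LBINT t:ray. cmean (D1 (\<phi> i)) t * a' i t - 2 * sech2 (t + TT i) * mean \<phi> i t * a i t)
     - tanh (TT i) * a i 0 * mean \<phi> i 0)"
  unfolding index_form_\<psi>[OF E]
proof (rule sum.cong[OF refl])
  fix i
  obtain C where C: "\<And>t. 0 \<le> t \<Longrightarrow> \<bar>a i t\<bar> \<le> C" using bounded_a[of i] by blast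
  show "(LBINT z:strip. D1 (\<phi> i) z * (a' i (fst z) * b (snd z)) + D2 (\<phi> i) z * (a i (fst z) * b' (snd z))
        - 2 * sech2 (fst z + TT i) * \<phi> i z * separated.f (a i) b z)
     - tanh (TT i) * a i 0 * (LBINT \<theta>:circ. bdry_trace (\<phi> i) \<theta> * b \<theta>)
    = (LBINT t:ray. cmean (D1 (\<phi> i)) t * a' i t - 2 * sech2 (t + TT i) * mean \<phi> i t * a i t)
     - tanh (TT i) * a i 0 * mean \<phi> i 0"
    unfolding mean_def mean_rep(2)[OF energy_strip[OF E]]
    by (rule arg_cong2[where f="(-)"], rule separated.radial_test[OF sep energy_strip[OF E] b C]) (simp_all add: b)
qed

lemma mean_\<psi>_radial:
  assumes b: "\<And>\<theta>. b \<theta> = 1" "\<And>\<theta>. b' \<theta> = 0"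
  shows "mean \<psi> i 0 = 2 * pi * a i 0"
    and "AE t in lborel. t \<in> ray \<longrightarrow> mean \<psi> i t = 2 * pi * a i t"
    and "AE t in lborel. t \<in> ray \<longrightarrow> cmean (D1 (\<psi> i)) t = 2 * pi * a' i t"
proof -
  note S = energy_strip[OF \<psi>_energy_variation, of i]
  have "(LBINT \<theta>:circ. bdry_trace (\<psi> i) \<theta>) = (LBINT \<theta>:circ. a i 0)"
    using separated.f_bdry_trace[OF sep[of i]] strip_functionD(4)[OF S]
    by (intro LBINT_cong_AE(1)) (auto simp: \<psi>_def b ray_circ)
  then show "mean \<psi> i 0 = 2 * pi * a i 0" by (simp add: mean_def mean_rep(2)[OF S] circ_const)
  show "AE t in lborel. t \<in> ray \<longrightarrow> mean \<psi> i t = 2 * pi * a i t"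
    using mean_rep(3)[OF S] by eventually_elim (simp add: mean_def cmean_def \<psi>_apply b circ_const)
  show "AE t in lborel. t \<in> ray \<longrightarrow> cmean (D1 (\<psi> i)) t = 2 * pi * a' i t"
    using AE_product(1)[OF separated.f_weak_gradient[OF sep[of i]]]
  proof eventually_elim
    case (elim t)
    show ?case
    proof
      assume t: "t \<in> ray"
      have "cmean (D1 (\<psi> i)) t = (LBINT \<theta>:circ. a' i t)"
        unfolding cmean_def
      proof (rule LBINT_cong_AE(1)[OF borel_slices(2)[OF strip_functionD(2)[OF S]] _ ray_circ(3)])
        show "AE \<theta> in lborel. \<theta> \<in> circ \<longrightarrow> D1 (\<psi> i) (t, \<theta>) = a' i t"
          using elim by eventually_elim (use t in \<open>auto simp: ray_circ(1) \<psi>_def b\<close>)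
      qed simp
      then show "cmean (D1 (\<psi> i)) t = 2 * pi * a' i t" by (simp add: circ_const)
    qed
  qed
qed

end

text \<open>Two kinds of tests are needed. Those vanishing on \<Gamma> have free weights and isolate
  a single face; those with weights of sum zero may be nonzero on \<Gamma> and detect the junction
  condition.\<close>

lemma (in noid) radial_triple:
  assumes h: "c1 h h'" and z: "\<And>t. r < t \<Longrightarrow> h t = 0" and s: "h 0 = 0 \<or> \<beta> 1 + \<beta> 2 + \<beta> 3 = (0::real)"
  shows "separated_triple \<alpha> c (\<lambda>i t. \<beta> i * h t) (\<lambda>i t. \<beta> i * h' t) (\<lambda>_. 1) (\<lambda>_. 0) 1"
proof (unfold_locales)
  fix i
  show "c1 (\<lambda>t. \<beta> i * h t) (\<lambda>t. \<beta> i * h' t)" using c1_lin[OF h h, of "\<beta> i" 0] by simp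
  show "c1 (\<lambda>_. 1) (\<lambda>_. 0)" by (simp add: c1_def)
  show "L1_on ray (\<lambda>t. (\<beta> i * h' t)\<^sup>2)"
    unfolding power_mult_distrib by (intro set_integrable_mult_right c1_sq_integrable_ray[OF h z])
  obtain C where "\<And>t. 0 \<le> t \<Longrightarrow> \<bar>h t\<bar> \<le> C" using c1_bounded_ray[OF h z] by blast
  then show "\<exists>C. \<forall>t\<ge>0. \<bar>\<beta> i * h t\<bar> \<le> C" by (intro exI[of _ "\<bar>\<beta> i\<bar> * C"]) (auto simp: abs_mult intro!: mult_left_mono)
  show "\<beta> 1 * h 0 + \<beta> 2 * h 0 + \<beta> 3 * h 0 = 0" using s by (auto simp: distrib_right[symmetric])
qed auto

section \<open>The index is at least two\<close>

definition cutoff :: "real \<Rightarrow> real \<Rightarrow> real" where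
  "cutoff N t = smoothstep (- (1 / N) * t + 2)"

definition cutoff' :: "real \<Rightarrow> real \<Rightarrow> real" where
  "cutoff' N t = - (1 / N) * smoothstep' (- (1 / N) * t + 2)"

lemma c1_cutoff: "c1 (cutoff N) (cutoff' N)"
  unfolding cutoff_def[abs_def] cutoff'_def[abs_def] by (rule c1_compose_affine[OF c1_smoothstep])

lemma cutoff_values:
  assumes "N > 0"
  shows "2 * N < t \<Longrightarrow> cutoff N t = 0" and "t \<le> N \<Longrightarrow> cutoff N t = 1"
  using assms by (auto simp: cutoff_def field_simps intro!: smoothstep_eq_0 smoothstep_eq_1)

lemma cutoff'_sq:
  assumes "N > 0"
  shows "(cutoff' N t)\<^sup>2 \<le> 4 / N\<^sup>2"
proof -
  have "(smoothstep' (- (1 / N) * t + 2))\<^sup>2 \<le> 2\<^sup>2" by (intro power_mono smoothstep'_bounds)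
  then have "(1 / N)\<^sup>2 * (smoothstep' (- (1 / N) * t + 2))\<^sup>2 \<le> (1 / N)\<^sup>2 * 2\<^sup>2" by (intro mult_left_mono) auto
  then show ?thesis by (simp add: cutoff'_def power_mult_distrib power_divide)
qed

text \<open>8/N is the bound 4/N^2 for the squared slope times the length 2 N. The potential is kept
  only on \<open>{0..N}\<close>, where the cut-off is 1 and 2 sech2 integrates to a difference of
  values of 2 tanh.\<close>

lemma cutoff_energy:
  assumes N: "N > 0"
  shows "L1_on ray (\<lambda>t. (cutoff' N t)\<^sup>2)" "L1_on ray (\<lambda>t. 2 * sech2 (t + T) * (cutoff N t)\<^sup>2)"
    and "(LBINT t:ray. (cutoff' N t)\<^sup>2) - (LBINT t:ray. 2 * sech2 (t + T) * (cutoff N t)\<^sup>2)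
       \<le> 8 / N - 2 * tanh (N + T) + 2 * tanh T"
proof -
  note z = cutoff_values[OF N] and c = c1_cutoff[of N]
  have z': "2 * N < t \<Longrightarrow> cutoff' N t = 0" for t by (rule c1_eventually_zero[OF c z(1)])
  show i1: "L1_on ray (\<lambda>t. (cutoff' N t)\<^sup>2)" by (rule c1_sq_integrable_ray[OF c z(1)])
  have cs: "continuous_on A (\<lambda>t. 2 * sech2 (t + T) * (cutoff N t)\<^sup>2)" for A
    using c1_continuous[OF c] by (intro continuous_intros) (auto intro: continuous_on_subset)
  have "L1_on {0..2*N} (\<lambda>t. 2 * sech2 (t + T) * (cutoff N t)\<^sup>2)"
    by (intro borel_integrable_atLeastAtMost' cs)
  then show i2: "L1_on ray (\<lambda>t. 2 * sech2 (t + T) * (cutoff N t)\<^sup>2)"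
    by (subst ray_compact(2)[of "2 * N"]) (auto simp: z)
  have "(LBINT t:ray. (cutoff' N t)\<^sup>2) = (LINT t:{0..2*N}|lborel. (cutoff' N t)\<^sup>2)"
    by (rule ray_compact(1)) (simp add: z')
  also have "\<dots> \<le> (LINT t:{0..2*N}|lborel. 4 / N\<^sup>2)"
    by (intro set_integral_mono cutoff'_sq N borel_integrable_atLeastAtMost' continuous_on_power continuous_on_const continuous_on_subset[OF c1D'[OF c]] subset_UNIV)
  also have "\<dots> = 8 / N" using N by (simp add: set_lebesgue_integral_def power2_eq_square)
  finally have 1: "(LBINT t:ray. (cutoff' N t)\<^sup>2) \<le> 8 / N" .
  have "2 * tanh (N + T) - 2 * tanh (0 + T) = (LINT t:{0..N}|lborel. 2 * sech2 (t + T))"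
  proof (rule acD[OF c1_ac])
    show "c1 (\<lambda>t. 2 * tanh (t + T)) (\<lambda>t. 2 * sech2 (t + T))"
      unfolding c1_def by (auto intro!: derivative_eq_intros DERIV_chain2[OF DERIV_tanh] continuous_intros simp: sech2_def)
  qed (use N in auto)
  also have "\<dots> = (LINT t:{0..N}|lborel. 2 * sech2 (t + T) * (cutoff N t)\<^sup>2)"
    by (intro set_lebesgue_integral_cong) (auto simp: z)
  also have "\<dots> \<le> (LBINT t:ray. 2 * sech2 (t + T) * (cutoff N t)\<^sup>2)"
    by (rule LBINT_mono_set[OF i2]) (auto simp: ray_def sech2_bounds less_imp_le)
  finally show "(LBINT t:ray. (cutoff' N t)\<^sup>2) - (LBINT t:ray. 2 * sech2 (t + T) * (cutoff N t)\<^sup>2)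
       \<le> 8 / N - 2 * tanh (N + T) + 2 * tanh T" using 1 by simp
qed

context noid
begin

definition cut_triple :: "real \<Rightarrow> (3 \<Rightarrow> real) \<Rightarrow> triple" where
  "cut_triple N \<beta> = (\<lambda>i z. \<beta> i * cutoff N (fst z))"

lemma index_form_cut_triple:
  assumes N: "N > 0" and \<beta>: "\<beta> 1 + \<beta> 2 + \<beta> 3 = 0"
  shows "cut_triple N \<beta> \<in> compact_W12_triples \<alpha> c"
    and "index_form \<alpha> c (cut_triple N \<beta>) (cut_triple N \<beta>) = (\<Sum>i\<in>UNIV. 2 * pi * (\<beta> i)\<^sup>2 *
      ((LBINT t:ray. (cutoff' N t)\<^sup>2) - (LBINT t:ray. 2 * sech2 (t + TT i) * (cutoff N t)\<^sup>2) - tanh (TT i)))"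
proof -
  interpret s: separated_triple \<alpha> c "\<lambda>i t. \<beta> i * cutoff N t" "\<lambda>i t. \<beta> i * cutoff' N t" "\<lambda>_. 1" "\<lambda>_. 0" 1
    using \<beta> by (intro radial_triple[OF c1_cutoff, where r="2 * N"]) (auto simp: cutoff_values N)
  have eq: "cut_triple N \<beta> = s.\<psi>" by (intro ext) (simp add: s.\<psi>_apply cut_triple_def)
  show "cut_triple N \<beta> \<in> compact_W12_triples \<alpha> c"
    unfolding eq by (rule s.\<psi>_compact[where r="2 * N"]) (simp add: cutoff_values N)
  have c0: "cutoff N 0 = 1" using cutoff_values(2)[OF N, of 0] N by simp
  have mc: "cutoff N \<in> Bor" "cutoff' N \<in> Bor"
    using c1_continuous[OF c1_cutoff] c1D'[OF c1_cutoff] by (auto intro: borel_measurable_continuous_onI)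
  show "index_form \<alpha> c (cut_triple N \<beta>) (cut_triple N \<beta>) = (\<Sum>i\<in>UNIV. 2 * pi * (\<beta> i)\<^sup>2 *
      ((LBINT t:ray. (cutoff' N t)\<^sup>2) - (LBINT t:ray. 2 * sech2 (t + TT i) * (cutoff N t)\<^sup>2) - tanh (TT i)))"
    unfolding eq s.index_form_\<psi>_radial[OF s.\<psi>_energy_variation refl refl]
  proof (rule sum.cong[OF refl])
    fix i
    note M = s.mean_\<psi>_radial[OF refl refl, of i] and A = mean_ac[OF s.\<psi>_energy_variation, of i]
    have "(LBINT t:ray. cmean (D1 (s.\<psi> i)) t * (\<beta> i * cutoff' N t) - 2 * sech2 (t + TT i) * mean s.\<psi> i t * (\<beta> i * cutoff N t))
      = (LBINT t:ray. 2 * pi * (\<beta> i)\<^sup>2 * ((cutoff' N t)\<^sup>2 - 2 * sech2 (t + TT i) * (cutoff N t)\<^sup>2))"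
    proof (rule LBINT_cong_AE(1)[OF _ _ ray_circ(2)])
      show "AE t in lborel. t \<in> ray \<longrightarrow>
         cmean (D1 (s.\<psi> i)) t * (\<beta> i * cutoff' N t) - 2 * sech2 (t + TT i) * mean s.\<psi> i t * (\<beta> i * cutoff N t)
         = 2 * pi * (\<beta> i)\<^sup>2 * ((cutoff' N t)\<^sup>2 - 2 * sech2 (t + TT i) * (cutoff N t)\<^sup>2)"
        using M(2,3) by eventually_elim (auto simp: power2_eq_square algebra_simps)
    qed (intro borel_measurable_diff borel_measurable_times borel_measurable_const borel_measurable_power A mc sech2_measurable)+
    also have "\<dots> = 2 * pi * (\<beta> i)\<^sup>2 * ((LBINT t:ray. (cutoff' N t)\<^sup>2) - (LBINT t:ray. 2 * sech2 (t + TT i) * (cutoff N t)\<^sup>2))"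
      unfolding set_integral_mult_right set_integral_diff(2)[OF cutoff_energy(1,2)[OF N]] ..
    finally show "(LBINT t:ray. cmean (D1 (s.\<psi> i)) t * (\<beta> i * cutoff' N t) - 2 * sech2 (t + TT i) * mean s.\<psi> i t * (\<beta> i * cutoff N t))
       - tanh (TT i) * (\<beta> i * cutoff N 0) * mean s.\<psi> i 0
      = 2 * pi * (\<beta> i)\<^sup>2 * ((LBINT t:ray. (cutoff' N t)\<^sup>2) - (LBINT t:ray. 2 * sech2 (t + TT i) * (cutoff N t)\<^sup>2) - tanh (TT i))"
      unfolding M(1) c0 by (simp add: power2_eq_square algebra_simps)
  qed
qed

text \<open>The thresholds make every coefficient of the form on cut-off constants negative: 8/N - 2
  tanh (N + T) + 2 tanh T - tanh T < 1/2 - 3/2 + 1 = 0.\<close>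

lemma cutoff_scale: "\<exists>N>16. \<forall>i. tanh (N + TT i) > 3 / 4"
proof -
  have "\<forall>\<^sub>F x in at_top. tanh x > (3 / 4 :: real)" by (rule order_tendstoD(1)[OF tanh_real_at_top]) simp
  then obtain M where M: "\<And>x. M \<le> x \<Longrightarrow> tanh x > (3 / 4 :: real)" unfolding eventually_at_top_linorder by blast
  define N where "N = 17 + \<bar>M\<bar> + (\<Sum>i\<in>UNIV. \<bar>TT i\<bar>)"
  have "\<bar>TT i\<bar> \<le> (\<Sum>i\<in>UNIV. \<bar>TT i\<bar>)" for i by (rule member_le_sum) auto
  then have "M \<le> N + TT i" for i unfolding N_def by (smt (verit))
  moreover have "N > 16" unfolding N_def using sum_nonneg[of UNIV "\<lambda>i. \<bar>TT i\<bar>"] by (smt (verit))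
  ultimately show ?thesis using M by blast
qed

lemma morse_index_ge: "2 \<le> morse_index \<alpha> c"
proof -
  obtain N where N: "N > 16" "\<And>i. tanh (N + TT i) > 3 / 4" using cutoff_scale by blast
  then have N0: "N > 0" by simp
  define V where "V = {cut_triple N \<beta> | \<beta>. \<beta> 1 + \<beta> 2 + \<beta> 3 = 0}"
  have sub: "triple_subspace V"
    unfolding triple_subspace_def
  proof (intro conjI ballI allI)
    have "(\<lambda>i x. 0) = cut_triple N (\<lambda>_. 0)" by (simp add: cut_triple_def)
    then show "(\<lambda>i x. 0) \<in> V" unfolding V_def by force
    fix \<phi> \<psi> a b assume "\<phi> \<in> V" "\<psi> \<in> V"
    then obtain \<beta> \<gamma> where *: "\<beta> 1 + \<beta> 2 + \<beta> 3 = 0" "\<phi> = cut_triple N \<beta>" "\<gamma> 1 + \<gamma> 2 + \<gamma> 3 = 0" "\<psi> = cut_triple N \<gamma>"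
      unfolding V_def by blast
    have "(\<lambda>i x. a * \<phi> i x + b * \<psi> i x) = cut_triple N (\<lambda>i. a * \<beta> i + b * \<gamma> i)"
      by (simp add: * cut_triple_def algebra_simps)
    moreover have "(a * \<beta> 1 + b * \<gamma> 1) + (a * \<beta> 2 + b * \<gamma> 2) + (a * \<beta> 3 + b * \<gamma> 3) = a * (\<beta> 1 + \<beta> 2 + \<beta> 3) + b * (\<gamma> 1 + \<gamma> 2 + \<gamma> 3)"
      by (simp add: algebra_simps)
    ultimately show "(\<lambda>i x. a * \<phi> i x + b * \<psi> i x) \<in> V" unfolding V_def using * by auto
  qed
  have neg: "negative_definite_on \<alpha> c V"
    unfolding negative_definite_on_def
  proof (intro ballI impI)
    fix \<phi> assume "\<phi> \<in> V" and nn: "\<not> null_triple \<phi>"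
    then obtain \<beta> where \<beta>: "\<beta> 1 + \<beta> 2 + \<beta> 3 = 0" "\<phi> = cut_triple N \<beta>" unfolding V_def by blast
    have e: "(LBINT t:ray. (cutoff' N t)\<^sup>2) - (LBINT t:ray. 2 * sech2 (t + TT i) * (cutoff N t)\<^sup>2) - tanh (TT i) < 0" for i
    proof -
      have "8 / N < 1 / 2" using N(1) by (simp add: field_simps)
      moreover have "tanh (TT i) < 1" by (rule tanh_real_lt_1)
      ultimately show ?thesis using cutoff_energy(3)[OF N0, of "TT i"] N(2)[of i] by linarith
    qed
    obtain j where j: "\<beta> j \<noteq> 0"
      using nn unfolding \<beta>(2) cut_triple_def null_triple_def by force
    have "index_form \<alpha> c \<phi> \<phi> < (\<Sum>i\<in>(UNIV::3 set). 0)"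
      unfolding \<beta>(2) index_form_cut_triple(2)[OF N0 \<beta>(1)]
    proof (rule sum_strict_mono_ex1)
      show "\<forall>i\<in>UNIV. 2 * pi * (\<beta> i)\<^sup>2 * ((LBINT t:ray. (cutoff' N t)\<^sup>2) - (LBINT t:ray. 2 * sech2 (t + TT i) * (cutoff N t)\<^sup>2) - tanh (TT i)) \<le> 0"
        by (intro ballI mult_nonneg_nonpos less_imp_le[OF e]) simp
      show "\<exists>i\<in>UNIV. 2 * pi * (\<beta> i)\<^sup>2 * ((LBINT t:ray. (cutoff' N t)\<^sup>2) - (LBINT t:ray. 2 * sech2 (t + TT i) * (cutoff N t)\<^sup>2) - tanh (TT i)) < 0"
        using mult_pos_neg[OF _ e[of j], of "2 * pi * (\<beta> j)\<^sup>2"] j by (intro bexI[of _ j]) simp_all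
    qed simp
    then show "index_form \<alpha> c \<phi> \<phi> < 0" by simp
  qed
  \<comment> \<open>The vectors (1, -1, 0) and (0, 1, -1): face 1 sees only the first and face 3
    only the second, so these faces isolate the coefficients.\<close>
  define \<beta> where "\<beta> k = (if k = 0 then (\<lambda>i::3. if i = 1 then 1 :: real else if i = 2 then -1 else 0)
      else (\<lambda>i. if i = 2 then 1 else if i = 3 then -1 else 0))" for k :: nat
  have \<beta>s: "\<beta> k 1 + \<beta> k 2 + \<beta> k 3 = (0::real)" for k by (simp add: \<beta>_def)
  have "enat 2 \<le> dimension V"
  proof (rule dimension_ge)
    show "cut_triple N (\<beta> k) \<in> V" for k unfolding V_def using \<beta>s by blast
    show "independent_family 2 (\<lambda>k. cut_triple N (\<beta> k))"
      unfolding independent_family_def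
    proof (intro allI impI)
      fix a k assume n: "null_triple (\<lambda>i x. \<Sum>k<2. a k * cut_triple N (\<beta> k) i x)" and k: "k < (2::nat)"
      have v: "a 0 * (\<beta> 0 i * cutoff N 1) + a 1 * (\<beta> 1 i * cutoff N 1) = 0" for i
      proof -
        have "(\<lambda>z. \<Sum>k<2. a k * cut_triple N (\<beta> k) i z) (1, 1) = 0"
        proof (rule continuous_AE_strip_zero)
          show "continuous_on UNIV (\<lambda>z. \<Sum>k<2. a k * cut_triple N (\<beta> k) i z)"
            unfolding cut_triple_def
            by (intro continuous_intros continuous_on_compose2[OF c1_continuous[OF c1_cutoff]]) auto
          show "AE z in lborel. z \<in> strip \<longrightarrow> (\<Sum>k<2. a k * cut_triple N (\<beta> k) i z) = 0"
            using n unfolding null_triple_def by blast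
        qed (use pi_gt3 in auto)
        then show ?thesis by (simp add: eval_nat_numeral cut_triple_def)
      qed
      have "cutoff N 1 = 1" using cutoff_values(2)[OF N0, of 1] N by simp
      then have "a 0 = 0" "a 1 = 0" using v[of 1] v[of 3] by (auto simp: \<beta>_def)
      then show "a k = 0" using k by (auto simp: less_2_cases_iff)
    qed
  qed
  also have "\<dots> \<le> morse_index \<alpha> c"
    unfolding morse_index_def
    by (rule SUP_upper) (use sub neg index_form_cut_triple(1)[OF N0] in \<open>auto simp: V_def\<close>)
  finally show ?thesis by (simp add: numeral_eq_enat)
qed

end

section \<open>Jacobi fields\<close>

lemma sq_integrable_exp:
  assumes h: "h \<in> Bor" and C: "\<And>t. 0 \<le> t \<Longrightarrow> \<bar>h t\<bar> \<le> C * exp (- t)"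
  shows "L1_on ray (\<lambda>t. (h t)\<^sup>2)"
proof (rule L1_bound[OF set_integrable_mult_right[of "C\<^sup>2", OF integrable_exp_ray]])
  show "set_borel_measurable lborel ray (\<lambda>t. (h t)\<^sup>2)"
    using h by (intro Bor_set ray_circ) auto
  have "(h t)\<^sup>2 \<le> C\<^sup>2 * exp (- t)" if "0 \<le> t" for t
  proof -
    have "(h t)\<^sup>2 \<le> (C * exp (- t))\<^sup>2" using power_mono[OF C[OF that], of 2] by simp
    also have "\<dots> = C\<^sup>2 * (exp (- t) * exp (- t))" by (simp add: power2_eq_square)
    also have "\<dots> \<le> C\<^sup>2 * (exp (- t) * 1)" using that by (intro mult_left_mono) auto
    finally show ?thesis by simp
  qed
  then show "AE t in lborel. t \<in> ray \<longrightarrow> \<bar>(h t)\<^sup>2\<bar> \<le> C\<^sup>2 * exp (- t)" by (simp add: ray_def)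
qed

lemma inverse_cosh_le: "1 / cosh (t + T) \<le> 2 * exp (- T) * exp (- t :: real)"
proof -
  have "exp (t + T) / 2 \<le> cosh (t + T)" by (simp add: cosh_def)
  then have "1 / cosh (t + T) \<le> 1 / (exp (t + T) / 2)" by (intro divide_left_mono) auto
  also have "\<dots> = 2 * exp (- T) * exp (- t)" by (simp add: exp_add exp_minus field_simps)
  finally show ?thesis .
qed

lemma sech2_le_inverse_cosh: "sech2 s \<le> 1 / cosh s"
proof -
  have "cosh s * 1 \<le> cosh s * cosh s" using cosh_real_ge_1[of s] by (intro mult_left_mono) auto
  then show ?thesis unfolding sech2_alt power2_eq_square by (intro divide_left_mono) auto
qed

lemma abs_tanh_real_lt_1: "\<bar>tanh (x::real)\<bar> < 1"
  using tanh_real_lt_1[of x] tanh_real_gt_neg1[of x] by linarith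

lemma c1_hyperbolic:
  shows "c1 (\<lambda>t. tanh (t + T)) (\<lambda>t. sech2 (t + T))"
    and "c1 (\<lambda>t. sech2 (t + T)) (\<lambda>t. - 2 * tanh (t + T) * sech2 (t + T))"
    and "c1 (\<lambda>t. k / cosh (t + T)) (\<lambda>t. - tanh (t + T) * (k / cosh (t + T)))"
    and "c1 (\<lambda>t. - tanh (t + T) * (k / cosh (t + T))) (\<lambda>t. (1 - 2 * sech2 (t + T)) * (k / cosh (t + T)))"
    and "c1 (\<lambda>t. cosh (t + T)) (\<lambda>t. sinh (t + T))"
proof -
  have aff: "((\<lambda>t. t + T) has_real_derivative 1) (at t)" for t by (auto intro!: derivative_eq_intros)
  have t: "((\<lambda>t. tanh (t + T)) has_real_derivative sech2 (t + T)) (at t)" for t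
    using DERIV_chain2[OF DERIV_tanh aff] by simp
  have k: "((\<lambda>t. k / cosh (t + T)) has_real_derivative - tanh (t + T) * (k / cosh (t + T))) (at t)" for t
    by (auto intro!: derivative_eq_intros simp: tanh_def)
  show "c1 (\<lambda>t. tanh (t + T)) (\<lambda>t. sech2 (t + T))"
    unfolding c1_def using t by (auto intro!: continuous_intros)
  show "c1 (\<lambda>t. sech2 (t + T)) (\<lambda>t. - 2 * tanh (t + T) * sech2 (t + T))"
    unfolding c1_def using DERIV_chain2[OF DERIV_sech2 aff] by (auto intro!: continuous_intros)
  show "c1 (\<lambda>t. k / cosh (t + T)) (\<lambda>t. - tanh (t + T) * (k / cosh (t + T)))"
    unfolding c1_def using k by (auto intro!: continuous_intros)
  show "c1 (\<lambda>t. - tanh (t + T) * (k / cosh (t + T))) (\<lambda>t. (1 - 2 * sech2 (t + T)) * (k / cosh (t + T)))"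
    unfolding c1_def
  proof (intro conjI allI)
    fix t
    show "((\<lambda>t. - tanh (t + T) * (k / cosh (t + T))) has_real_derivative (1 - 2 * sech2 (t + T)) * (k / cosh (t + T))) (at t)"
      by (rule DERIV_cong[OF DERIV_mult[OF DERIV_minus[OF t] k]]) (simp add: sech2_def power2_eq_square algebra_simps)
  qed (auto intro!: continuous_intros)
  show "c1 (\<lambda>t. cosh (t + T)) (\<lambda>t. sinh (t + T))"
    unfolding c1_def by (auto intro!: derivative_eq_intros continuous_intros)
qed

text \<open>On almost every line the equation for \<open>P\<close> makes v cosh constant, so
  \<open>v\<close> is its trace times a fixed profile. A single height t0 > 0 on whose circle
  \<open>v\<close> is a first harmonic then identifies the trace.\<close>

lemma mean_zero_kernel:
  assumes S: "strip_function v P R \<tau>" and k: "AE z in lborel. z \<in> strip \<longrightarrow> P z = - tanh (fst z + T) * v z"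
    and w: "AE t in lborel. t \<in> ray \<longrightarrow> (\<exists>A B. AE \<theta> in lborel. \<theta> \<in> circ \<longrightarrow> v (t, \<theta>) = A * cos \<theta> + B * sin \<theta>)"
  obtains A B where "AE z in lborel. z \<in> strip \<longrightarrow> v z = (A * cos (snd z) + B * sin (snd z)) * (cosh T / cosh (fst z + T))"
    "AE \<theta> in lborel. \<theta> \<in> circ \<longrightarrow> \<tau> \<theta> = A * cos \<theta> + B * sin \<theta>"
proof -
  note D = strip_functionD[OF S]
  have "AE \<theta> in lborel. \<theta> \<in> circ \<longrightarrow> (\<forall>t\<ge>0. trace_rep P \<tau> (t, \<theta>) = \<tau> \<theta> * (cosh T / cosh (t + T)))"
    using AE_strip_slices[OF D(2,5)] AE_product(2)[OF D(8)] AE_product(2)[OF k]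
  proof eventually_elim
    case (elim \<theta>)
    show ?case
    proof (intro impI allI)
      fix t :: real assume \<theta>: "\<theta> \<in> circ" and t: "0 \<le> t"
      have y: "ac 0 t (\<lambda>t. trace_rep P \<tau> (t, \<theta>)) (\<lambda>t. P (t, \<theta>))" using elim(1) \<theta> by (intro trace_rep_ac) auto
      have "AE s in lborel. 0 < s \<longrightarrow> s < t \<longrightarrow> P (s, \<theta>) * cosh (s + T) + trace_rep P \<tau> (s, \<theta>) * sinh (s + T) = 0"
        using elim(2,3)
      proof eventually_elim
        case (elim s)
        show ?case
        proof (intro impI)
          assume "0 < s"
          then have "P (s, \<theta>) = - tanh (s + T) * trace_rep P \<tau> (s, \<theta>)" using elim \<theta> by (simp add: ray_circ(1) ray_def)
          then show "P (s, \<theta>) * cosh (s + T) + trace_rep P \<tau> (s, \<theta>) * sinh (s + T) = 0" by (simp add: tanh_def)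
        qed
      qed
      from ac_zero_const[OF ac_mult[OF y c1_ac[OF c1_hyperbolic(5)]] this t]
      have "trace_rep P \<tau> (t, \<theta>) * cosh (t + T) = \<tau> \<theta> * cosh T" by simp
      then show "trace_rep P \<tau> (t, \<theta>) = \<tau> \<theta> * (cosh T / cosh (t + T))" by (simp add: field_simps)
    qed
  qed
  from AE_lborel_snd[OF this] D(8)
  have vz: "AE z in lborel. z \<in> strip \<longrightarrow> v z = \<tau> (snd z) * (cosh T / cosh (fst z + T))"
    by eventually_elim (auto simp: strip_def circ_def)
  have "AE t in lborel. (AE \<theta> in lborel. (t, \<theta>) \<in> strip \<longrightarrow> v (t, \<theta>) = \<tau> \<theta> * (cosh T / cosh (t + T))) \<and>
      (t \<in> ray \<longrightarrow> (\<exists>A B. AE \<theta> in lborel. \<theta> \<in> circ \<longrightarrow> v (t, \<theta>) = A * cos \<theta> + B * sin \<theta>))"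
    using AE_product(1)[OF vz] w by eventually_elim simp
  from AE_interval_ex[OF this zero_less_one] obtain t0 where t0: "0 < t0"
    "AE \<theta> in lborel. (t0, \<theta>) \<in> strip \<longrightarrow> v (t0, \<theta>) = \<tau> \<theta> * (cosh T / cosh (t0 + T))"
    "\<exists>A B. AE \<theta> in lborel. \<theta> \<in> circ \<longrightarrow> v (t0, \<theta>) = A * cos \<theta> + B * sin \<theta>"
    by (auto simp: ray_def)
  obtain A B where AB: "AE \<theta> in lborel. \<theta> \<in> circ \<longrightarrow> v (t0, \<theta>) = A * cos \<theta> + B * sin \<theta>" using t0(3) by blast
  \<comment> \<open>Undoes the profile factor between \<Gamma> and the height
    \<open>t0\<close>.\<close>
  define k where "k = cosh (t0 + T) / cosh T"
  have \<tau>: "AE \<theta> in lborel. \<theta> \<in> circ \<longrightarrow> \<tau> \<theta> = (A * k) * cos \<theta> + (B * k) * sin \<theta>"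
    using AB t0(2)
  proof eventually_elim
    case (elim \<theta>)
    show ?case
    proof
      assume "\<theta> \<in> circ"
      then have "\<tau> \<theta> * (cosh T / cosh (t0 + T)) = A * cos \<theta> + B * sin \<theta>" using elim t0(1) by (simp add: ray_circ(1) ray_def)
      then have "\<tau> \<theta> = (A * cos \<theta> + B * sin \<theta>) * k" by (simp add: k_def field_simps)
      then show "\<tau> \<theta> = (A * k) * cos \<theta> + (B * k) * sin \<theta>" by (simp add: algebra_simps)
    qed
  qed
  show ?thesis
  proof (rule that[OF _ \<tau>])
    show "AE z in lborel. z \<in> strip \<longrightarrow> v z = ((A * k) * cos (snd z) + (B * k) * sin (snd z)) * (cosh T / cosh (fst z + T))"
      using vz AE_lborel_snd[OF \<tau>] by eventually_elim (auto simp: strip_def circ_def)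
  qed
qed

text \<open>The integrand is K^2 times the derivative of sech2 tanh, and the value at t = 0 combines
  with the curvature term through sech2 + tanh^2 = 1. The result is proportional to tanh T, hence
  sums to zero over the faces.\<close>

lemma radial_form_tanh:
  assumes d: "AE t in lborel. 0 < t \<longrightarrow> d t = K * sech2 (t + T)" and m: "\<And>t. 0 \<le> t \<Longrightarrow> m t = K * tanh (t + T)"
    and mm: "m \<in> Bor" "d \<in> Bor"
    and d2: "L1_on ray (\<lambda>t. (d t)\<^sup>2)" and m2: "L1_on ray (\<lambda>t. sech2 (t + T) * (m t)\<^sup>2)"
  shows "radial_form T m d = - K\<^sup>2 * tanh T"
proof -
  let ?g = "\<lambda>t. - 2 * tanh (t + T) * sech2 (t + T) * tanh (t + T) + sech2 (t + T) * sech2 (t + T)"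
  have m2': "L1_on ray (\<lambda>t. 2 * sech2 (t + T) * (m t)\<^sup>2)"
    using set_integrable_mult_right[of 2, OF m2] by (simp add: mult.assoc)
  have c: "c1 (\<lambda>t. sech2 (t + T) * tanh (t + T)) ?g" by (rule c1_mult[OF c1_hyperbolic(2,1)])
  have mg: "?g \<in> Bor" using c1D'[OF c] by (rule borel_measurable_continuous_onI)
  have ig: "L1_on ray ?g"
  proof (rule L1_bound[OF set_integrable_mult_right[of 3, OF sech2_integrable_ray(1)[of T]]])
    have "\<bar>?g t\<bar> \<le> 3 * sech2 (t + T)" for t
    proof -
      have s: "0 < sech2 (t + T)" "sech2 (t + T) \<le> 1" by (rule sech2_bounds)+
      have "?g t = sech2 (t + T) * (3 * sech2 (t + T) - 2)" by (simp add: sech2_def power2_eq_square algebra_simps)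
      moreover have "\<bar>3 * sech2 (t + T) - 2\<bar> \<le> 3" using s by (simp add: abs_le_iff)
      ultimately show ?thesis using s by (simp add: abs_mult mult.commute)
    qed
    then show "AE t in lborel. t \<in> ray \<longrightarrow> \<bar>?g t\<bar> \<le> 3 * sech2 (t + T)" by simp
  qed (intro Bor_set mg ray_circ)
  have "AE t in lborel. t \<noteq> (0::real)" by (simp add: AE_lborel_singleton)
  with d have "AE t in lborel. t \<in> ray \<longrightarrow> (d t)\<^sup>2 - 2 * sech2 (t + T) * (m t)\<^sup>2 = K\<^sup>2 * ?g t"
    by eventually_elim (auto simp: ray_def m power2_eq_square algebra_simps)
  then have "(LBINT t:ray. (d t)\<^sup>2 - 2 * sech2 (t + T) * (m t)\<^sup>2) = (LBINT t:ray. K\<^sup>2 * ?g t)"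
    by (rule LBINT_cong_AE(1)[OF _ _ ray_circ(2), rotated 2])
       (intro borel_measurable_diff borel_measurable_times borel_measurable_power borel_measurable_const mm mg sech2_measurable)+
  also have "\<dots> = K\<^sup>2 * (LBINT t:ray. ?g t)" by (rule set_integral_mult_right)
  also have "(LBINT t:ray. ?g t) = 0 * 1 - sech2 T * tanh T"
  proof (rule tendsto_unique[OF _ ray_limit[OF ig]])
    have aff: "filterlim (\<lambda>t::real. t + T) at_top at_top"
      by (rule filterlim_tendsto_add_at_top[OF tendsto_const filterlim_ident, of T, simplified add.commute[of T]])
    have th: "((\<lambda>t. tanh (t + T)) \<longlongrightarrow> 1) at_top" by (rule filterlim_compose[OF tanh_real_at_top aff])
    have "((\<lambda>t. 1 - (tanh (t + T))\<^sup>2) \<longlongrightarrow> 1 - 1\<^sup>2) at_top" by (intro tendsto_intros th)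
    then have "((\<lambda>t. sech2 (t + T)) \<longlongrightarrow> 0) at_top" by (simp add: sech2_def[abs_def])
    then have "((\<lambda>b. sech2 (b + T) * tanh (b + T) - sech2 T * tanh T) \<longlongrightarrow> 0 * 1 - sech2 T * tanh T) at_top"
      by (intro tendsto_intros th)
    then show "((\<lambda>b. LBINT t:{0..b}. ?g t) \<longlongrightarrow> 0 * 1 - sech2 T * tanh T) at_top"
    proof (rule Lim_transform_eventually)
      show "\<forall>\<^sub>F b in at_top. sech2 (b + T) * tanh (b + T) - sech2 T * tanh T = (LBINT t:{0..b}. ?g t)"
        using eventually_ge_at_top[of 0]
      proof eventually_elim
        case (elim b)
        from acD[OF c1_ac[OF c], of 0 0 b b] elim show ?case by simp
      qed
    qed
  qed simp
  finally have "(LBINT t:ray. (d t)\<^sup>2) - (LBINT t:ray. 2 * sech2 (t + T) * (m t)\<^sup>2) = - K\<^sup>2 * (sech2 T * tanh T)"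
    by (simp add: set_integral_diff(2)[OF d2 m2'])
  then show ?thesis unfolding radial_form_def by (simp add: m sech2_def power2_eq_square algebra_simps)
qed

lemma (in noid) index_form_commute: "index_form \<alpha> c \<phi> \<psi> = index_form \<alpha> c \<psi> \<phi>"
  unfolding index_form_eq face_form_def by (simp add: mult_ac)

lemma (in noid) energy_space_variation: "\<phi> \<in> energy_space \<alpha> c \<Longrightarrow> energy_variation \<phi>"
  by (simp add: energy_space_def energy_variation_def)

text \<open>A separated solution of the Jacobi equation lies in the null space as soon as the three faces share the value
  \<open>\<rho>\<close> in the Robin boundary condition, because admissible traces sum to zero.\<close>

lemma (in separated_triple) \<psi>_null_space:
  assumes a'': "\<And>i. c1 (a' i) (a'' i)" and b'': "c1 b' (\<lambda>\<theta>. - \<kappa> * b \<theta>)"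
    and b'per: "\<And>\<theta>. b' (\<theta> + 2 * pi) = b' \<theta>"
    and jac: "\<And>i t. 2 * sech2 (t + TT i) * a i t = \<kappa> * a i t - a'' i t"
    and dec: "\<And>i. \<exists>C. \<forall>t\<ge>0. \<bar>a' i t\<bar> \<le> C * exp (- t) \<and> \<bar>a'' i t\<bar> \<le> C * exp (- t) \<and> (\<kappa> = 0 \<or> \<bar>a i t\<bar> \<le> C * exp (- t))"
    and robin: "\<And>i. a' i 0 + tanh (TT i) * a i 0 = \<rho>"
  shows "\<psi> \<in> null_space \<alpha> c"
proof -
  have eq: "- x * m - y * z * m = - (x + y * z) * m" for x y z m :: real by (simp add: algebra_simps)
  have "index_form \<alpha> c \<psi> \<phi> = 0" if \<phi>: "\<phi> \<in> energy_space \<alpha> c" for \<phi>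
  proof -
    note E = energy_space_variation[OF \<phi>]
    have "index_form \<alpha> c \<psi> \<phi> = index_form \<alpha> c \<phi> \<psi>" by (rule index_form_commute)
    also have "\<dots> = (\<Sum>i\<in>UNIV. - \<rho> * (LBINT \<theta>:circ. bdry_trace (\<phi> i) \<theta> * b \<theta>))"
      unfolding index_form_\<psi>[OF E]
    proof (rule sum.cong[OF refl])
      fix i
      obtain C where C: "\<And>t. 0 \<le> t \<Longrightarrow> \<bar>a' i t\<bar> \<le> C * exp (- t)" "\<And>t. 0 \<le> t \<Longrightarrow> \<bar>a'' i t\<bar> \<le> C * exp (- t)"
        "\<kappa> = 0 \<or> (\<forall>t\<ge>0. \<bar>a i t\<bar> \<le> C * exp (- t))" using dec[of i] by blast
      show "(LBINT z:strip. D1 (\<phi> i) z * (a' i (fst z) * b (snd z)) + D2 (\<phi> i) z * (a i (fst z) * b' (snd z))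
        - 2 * sech2 (fst z + TT i) * \<phi> i z * separated.f (a i) b z)
         - tanh (TT i) * a i 0 * (LBINT \<theta>:circ. bdry_trace (\<phi> i) \<theta> * b \<theta>)
        = - \<rho> * (LBINT \<theta>:circ. bdry_trace (\<phi> i) \<theta> * b \<theta>)"
        unfolding robin[of i, symmetric]
        by (subst separated.green[OF sep energy_strip[OF E] a'' b'' b'per jac C]) (assumption, rule eq)
    qed
    also have "\<dots> = 0"
      using trace_sum_weighted[OF E separated.borel_ab(3)[OF sep] separated.sq_circ(1)[OF sep]]
      by (simp only: sum_distrib_left[symmetric] mult_zero_right)
    finally show ?thesis .
  qed
  then show ?thesis using \<psi>_energy_space by (simp add: null_space_def)
qed

context noid
begin

text \<open>The profile is 1 at t = 0, so \<open>A\<close> and \<open>B\<close> are boundary values,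
  and admissibility only asks each of them to sum to zero; the values tanh T_i do so
  already.\<close>

definition jac :: "real \<Rightarrow> (3 \<Rightarrow> real) \<Rightarrow> (3 \<Rightarrow> real) \<Rightarrow> triple" where
  "jac K A B = (\<lambda>i z. K * tanh (fst z + TT i)
     + (A i * cos (snd z) + B i * sin (snd z)) * (cosh (TT i) / cosh (fst z + TT i)))"

lemma tanh_T_sum: "tanh (TT 1) + tanh (TT 2) + tanh (TT 3) = 0"
  using cos_ang_sum by (simp add: tanh_T)

text \<open>The field of vertical translations. Its Robin value sech2 T_i + tanh^2 T_i is 1 on every
  face, and \<kappa> = 0 spares the decay that tanh lacks.\<close>

lemma jac_tanh_null: "jac 1 (\<lambda>_. 0) (\<lambda>_. 0) \<in> null_space \<alpha> c"
proof -
  have d: "\<bar>sech2 (t + TT i)\<bar> \<le> 4 * exp (- TT i) * exp (- t)"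
    "\<bar>- 2 * tanh (t + TT i) * sech2 (t + TT i)\<bar> \<le> 4 * exp (- TT i) * exp (- t)" for t i
  proof -
    have s: "0 < sech2 (t + TT i)" "sech2 (t + TT i) \<le> 2 * exp (- TT i) * exp (- t)"
      using sech2_bounds order_trans[OF sech2_le_inverse_cosh inverse_cosh_le] by auto
    have "0 \<le> exp (- TT i) * exp (- t)" by simp
    then show "\<bar>sech2 (t + TT i)\<bar> \<le> 4 * exp (- TT i) * exp (- t)" using s by linarith
    have "\<bar>tanh (t + TT i)\<bar> * sech2 (t + TT i) \<le> 1 * (2 * exp (- TT i) * exp (- t))"
      using s less_imp_le[OF abs_tanh_real_lt_1] by (intro mult_mono) auto
    then show "\<bar>- 2 * tanh (t + TT i) * sech2 (t + TT i)\<bar> \<le> 4 * exp (- TT i) * exp (- t)"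
      using s by (simp add: abs_mult mult_ac)
  qed
  interpret s: separated_triple \<alpha> c "\<lambda>i t. tanh (t + TT i)" "\<lambda>i t. sech2 (t + TT i)" "\<lambda>_. 1" "\<lambda>_. 0" 1
  proof
    fix i
    show "c1 (\<lambda>t. tanh (t + TT i)) (\<lambda>t. sech2 (t + TT i))" by (rule c1_hyperbolic)
    show "c1 (\<lambda>_. 1) (\<lambda>_. 0)" by (simp add: c1_def)
    show "L1_on ray (\<lambda>t. (sech2 (t + TT i))\<^sup>2)" by (rule sq_integrable_exp[OF sech2_measurable d(1)])
    show "\<exists>C. \<forall>t\<ge>0. \<bar>tanh (t + TT i)\<bar> \<le> C" using abs_tanh_real_lt_1 less_imp_le by blast
  qed (use tanh_T_sum in auto)
  have "s.\<psi> \<in> null_space \<alpha> c"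
  proof (rule s.\<psi>_null_space[where \<kappa>=0 and \<rho>=1])
    show "c1 (\<lambda>t. sech2 (t + TT i)) (\<lambda>t. - 2 * tanh (t + TT i) * sech2 (t + TT i))" for i by (rule c1_hyperbolic)
    show "c1 (\<lambda>_. 0) (\<lambda>\<theta>. - 0 * 1)" by (simp add: c1_def)
    show "\<exists>C. \<forall>t\<ge>0. \<bar>sech2 (t + TT i)\<bar> \<le> C * exp (- t) \<and> \<bar>- 2 * tanh (t + TT i) * sech2 (t + TT i)\<bar> \<le> C * exp (- t) \<and>
       ((0::real) = 0 \<or> \<bar>tanh (t + TT i)\<bar> \<le> C * exp (- t))" for i using d by blast
  qed (auto simp: sech2_def power2_eq_square)
  moreover have "s.\<psi> = jac 1 (\<lambda>_. 0) (\<lambda>_. 0)" by (intro ext) (simp add: s.\<psi>_apply jac_def)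
  ultimately show ?thesis by simp
qed

text \<open>The profile satisfies a' = - tanh a, so its Robin value is 0 on every face whatever the
  coefficients, and only the sum condition on \<beta> remains. Horizontal translations account for
  one direction of \<beta>, that of sin \<alpha>_i.\<close>

lemma separated_rotation_null:
  assumes \<beta>: "\<beta> 1 + \<beta> 2 + \<beta> 3 = (0::real)" and b: "c1 b b'" "c1 b' (\<lambda>\<theta>. - b \<theta>)"
    and per: "\<And>\<theta>. b (\<theta> + 2 * pi) = b \<theta>" "\<And>\<theta>. b' (\<theta> + 2 * pi) = b' \<theta>" and B: "\<And>\<theta>. \<bar>b \<theta>\<bar> \<le> 1" "\<And>\<theta>. \<bar>b' \<theta>\<bar> \<le> 1"
  shows "(\<lambda>i z. (\<beta> i * b (snd z)) * (cosh (TT i) / cosh (fst z + TT i))) \<in> null_space \<alpha> c"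
proof -
  define k where "k i = \<beta> i * cosh (TT i)" for i
  define C where "C i = \<bar>k i\<bar> * (2 * exp (- TT i))" for i
  have d0: "\<bar>k i / cosh (t + TT i)\<bar> \<le> C i * exp (- t)" for i t
    using mult_left_mono[OF inverse_cosh_le[of t "TT i"], of "\<bar>k i\<bar>"] by (simp add: C_def)
  have d: "\<bar>x * (k i / cosh (t + TT i))\<bar> \<le> C i * exp (- t)" if "\<bar>x\<bar> \<le> 1" for x i t
    using mult_mono[OF that d0[of i t]] by (simp add: abs_mult)
  have d1: "\<bar>- tanh (t + TT i) * (k i / cosh (t + TT i))\<bar> \<le> C i * exp (- t)" for i t
    using abs_tanh_real_lt_1[of "t + TT i"] by (intro d) simp
  have d2: "\<bar>(1 - 2 * sech2 (t + TT i)) * (k i / cosh (t + TT i))\<bar> \<le> C i * exp (- t)" for i t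
    using sech2_bounds[of "t + TT i"] by (intro d) (simp add: abs_le_iff)
  note h = c1_hyperbolic(3,4)
  have mb: "f \<in> Bor" if "c1 f f'" for f f'
    using c1_continuous[OF that] by (rule borel_measurable_continuous_onI)
  interpret s: separated_triple \<alpha> c "\<lambda>i t. k i / cosh (t + TT i)" "\<lambda>i t. - tanh (t + TT i) * (k i / cosh (t + TT i))" b b' 1
  proof
    fix i
    show "c1 (\<lambda>t. k i / cosh (t + TT i)) (\<lambda>t. - tanh (t + TT i) * (k i / cosh (t + TT i)))" by (rule h)
    show "L1_on ray (\<lambda>t. (- tanh (t + TT i) * (k i / cosh (t + TT i)))\<^sup>2)"
      by (rule sq_integrable_exp[OF mb[OF h(2)] d1])
    show "(\<forall>\<theta>. b' \<theta> = 0) \<or> L1_on ray (\<lambda>t. (k i / cosh (t + TT i))\<^sup>2)"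
      using sq_integrable_exp[OF mb[OF h(1)] d0] by blast
    have "\<bar>k i / cosh (t + TT i)\<bar> \<le> C i" if "0 \<le> t" for t
    proof -
      have "C i * exp (- t) \<le> C i * 1" using that by (intro mult_left_mono) (auto simp: C_def)
      then show ?thesis using d0[of i t] by linarith
    qed
    then show "\<exists>C. \<forall>t\<ge>0. \<bar>k i / cosh (t + TT i)\<bar> \<le> C" by blast
    show "k 1 / cosh (0 + TT 1) + k 2 / cosh (0 + TT 2) + k 3 / cosh (0 + TT 3) = 0" using \<beta> by (simp add: k_def)
  qed (use b per B in auto)
  have "s.\<psi> \<in> null_space \<alpha> c"
  proof (rule s.\<psi>_null_space[where \<kappa>=1 and \<rho>=0])
    show "c1 (\<lambda>t. - tanh (t + TT i) * (k i / cosh (t + TT i))) (\<lambda>t. (1 - 2 * sech2 (t + TT i)) * (k i / cosh (t + TT i)))" for i by (rule h)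
    show "\<exists>C. \<forall>t\<ge>0. \<bar>- tanh (t + TT i) * (k i / cosh (t + TT i))\<bar> \<le> C * exp (- t) \<and>
       \<bar>(1 - 2 * sech2 (t + TT i)) * (k i / cosh (t + TT i))\<bar> \<le> C * exp (- t) \<and>
       ((1::real) = 0 \<or> \<bar>k i / cosh (t + TT i)\<bar> \<le> C * exp (- t))" for i using d0 d1 d2 by blast
    show "2 * sech2 (t + TT i) * (k i / cosh (t + TT i)) = 1 * (k i / cosh (t + TT i)) - (1 - 2 * sech2 (t + TT i)) * (k i / cosh (t + TT i))" for i t
      by (simp only: left_diff_distrib)
  qed (use b per in auto)
  moreover have "s.\<psi> = (\<lambda>i z. (\<beta> i * b (snd z)) * (cosh (TT i) / cosh (fst z + TT i)))"
    by (intro ext) (simp only: s.\<psi>_apply, simp add: k_def)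
  ultimately show ?thesis by simp
qed

lemma jac_rotation_null:
  assumes "\<beta> 1 + \<beta> 2 + \<beta> 3 = (0::real)"
  shows "jac 0 \<beta> (\<lambda>_. 0) \<in> null_space \<alpha> c" "jac 0 (\<lambda>_. 0) \<beta> \<in> null_space \<alpha> c"
proof -
  have c: "c1 cos (\<lambda>\<theta>. - sin \<theta>)" "c1 (\<lambda>\<theta>. - sin \<theta>) (\<lambda>\<theta>. - cos \<theta>)" "c1 sin cos"
    by (auto simp: c1_def intro!: derivative_eq_intros continuous_intros)
  show "jac 0 \<beta> (\<lambda>_. 0) \<in> null_space \<alpha> c"
    using separated_rotation_null[OF assms c(1,2)] by (simp add: jac_def)
  show "jac 0 (\<lambda>_. 0) \<beta> \<in> null_space \<alpha> c"
    using separated_rotation_null[OF assms c(3,1)] by (simp add: jac_def)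
qed

section \<open>Five independent Jacobi fields\<close>

lemma jac_sum:
  fixes n :: nat
  shows "(\<Sum>k<n. a k * jac (K k) (A k) (B k) i z)
    = jac (\<Sum>k<n. a k * K k) (\<lambda>i. \<Sum>k<n. a k * A k i) (\<lambda>i. \<Sum>k<n. a k * B k i) i z"
  by (induction n) (simp_all add: jac_def algebra_simps add_divide_distrib)

text \<open>At a height with t + T_i > 0 tanh is nonzero. The angles pi/2 and 3 pi/2 separate
  \<open>K\<close> from \<open>B i\<close>, and then pi gives \<open>A i\<close>.\<close>

lemma null_jac:
  assumes "null_triple (jac K A B)"
  shows "K = 0" "A i = 0" "B i = 0"
proof -
  define t where "t = \<bar>TT i\<bar> + 1"
  have t: "0 < t" "0 < t + TT i" by (auto simp: t_def)
  have z: "jac K A B i (t, \<theta>) = 0" if \<theta>: "0 < \<theta>" "\<theta> < 2 * pi" for \<theta>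
  proof (rule continuous_AE_strip_zero[OF _ _ t(1) \<theta>])
    show "continuous_on UNIV (jac K A B i)" unfolding jac_def by (intro continuous_intros) auto
    show "AE z in lborel. z \<in> strip \<longrightarrow> jac K A B i z = 0" using assms unfolding null_triple_def by blast
  qed
  define w where "w = cosh (TT i) / cosh (t + TT i)"
  have w: "w > 0" by (simp add: w_def)
  have th: "tanh (t + TT i) > 0" using t by simp
  have 1: "K * tanh (t + TT i) + B i * w = 0" using z[of "pi/2"] by (simp add: jac_def w_def)
  have 2: "K * tanh (t + TT i) - B i * w = 0"
    using z[of "3/2*pi"] sin_3over2_pi cos_3over2_pi by (simp add: jac_def w_def)
  have "K * tanh (t + TT i) = 0" "B i * w = 0" using 1 2 by linarith+
  then show K: "K = 0" and "B i = 0" using th w by auto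
  show "A i = 0" using z[of pi] K w by (simp add: jac_def w_def)
qed

lemma nullity_ge: "5 \<le> nullity \<alpha> c"
proof -
  define e1 e2 where "e1 = (\<lambda>i::3. if i = 1 then 1 else if i = 2 then -1 else 0 :: real)"
    and "e2 = (\<lambda>i::3. if i = 2 then 1 else if i = 3 then -1 else 0 :: real)"
  define K A B where "K k = (if k = 0 then 1 else 0 :: real)"
    and "A k = (if k = 1 then e1 else if k = 2 then e2 else (\<lambda>_. 0))"
    and "B k = (if k = 3 then e1 else if k = 4 then e2 else (\<lambda>_. 0))" for k :: nat
  have e: "e1 1 + e1 2 + e1 3 = 0" "e2 1 + e2 2 + e2 3 = 0" by (simp_all add: e1_def e2_def)
  have "enat 5 \<le> dimension (null_space \<alpha> c)"
  proof (rule dimension_ge)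
    fix k assume "k < (5::nat)"
    then consider "k = 0" | "k = 1" | "k = 2" | "k = 3" | "k = 4" by linarith
    then show "jac (K k) (A k) (B k) \<in> null_space \<alpha> c"
      by cases (simp_all add: K_def A_def B_def jac_tanh_null jac_rotation_null[OF e(1)] jac_rotation_null[OF e(2)])
  next
    show "independent_family 5 (\<lambda>k. jac (K k) (A k) (B k))"
      unfolding independent_family_def
    proof (intro allI impI)
      fix a k assume n: "null_triple (\<lambda>i x. \<Sum>k<5. a k * jac (K k) (A k) (B k) i x)" and k: "k < (5::nat)"
      note z = null_jac[OF n[unfolded jac_sum]]
      have "a 0 = 0" using z(1) by (simp add: eval_nat_numeral K_def)
      moreover have "a 1 = 0" "a 2 = 0" using z(2)[of 1] z(2)[of 3] by (simp_all add: eval_nat_numeral A_def e1_def e2_def)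
      moreover have "a 3 = 0" "a 4 = 0" using z(3)[of 1] z(3)[of 3] by (simp_all add: eval_nat_numeral B_def e1_def e2_def)
      moreover consider "k = 0" | "k = 1" | "k = 2" | "k = 3" | "k = 4" using k by linarith
      ultimately show "a k = 0" by metis
    qed
  qed
  then show ?thesis by (simp add: nullity_def numeral_eq_enat)
qed

end

section \<open>The null space consists of Jacobi fields\<close>

context noid
begin

lemma radial_test_sum:
  fixes \<beta> :: "3 \<Rightarrow> real"
  assumes \<phi>: "\<phi> \<in> null_space \<alpha> c" and h: "c1 h h'" and z: "\<And>t. r < t \<Longrightarrow> h t = 0"
    and s: "h 0 = 0 \<or> \<beta> 1 + \<beta> 2 + \<beta> 3 = (0::real)"
  defines "L \<equiv> \<lambda>i. (LBINT t:ray. cmean (D1 (\<phi> i)) t * h' t - 2 * sech2 (t + TT i) * mean \<phi> i t * h t)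
      - tanh (TT i) * h 0 * mean \<phi> i 0"
  shows "\<beta> 1 * L 1 + \<beta> 2 * L 2 + \<beta> 3 * L 3 = 0"
proof -
  interpret s: separated_triple \<alpha> c "\<lambda>i t. \<beta> i * h t" "\<lambda>i t. \<beta> i * h' t" "\<lambda>_. 1" "\<lambda>_. 0" 1
    by (rule radial_triple[OF h z s])
  have E: "energy_variation \<phi>" using \<phi> by (simp add: null_space_def energy_space_variation)
  have "(LBINT t:ray. cmean (D1 (\<phi> i)) t * (\<beta> i * h' t) - 2 * sech2 (t + TT i) * mean \<phi> i t * (\<beta> i * h t))
      - tanh (TT i) * (\<beta> i * h 0) * mean \<phi> i 0 = \<beta> i * L i" for i
  proof -
    have e: "(\<lambda>t. cmean (D1 (\<phi> i)) t * (\<beta> i * h' t) - 2 * sech2 (t + TT i) * mean \<phi> i t * (\<beta> i * h t))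
      = (\<lambda>t. \<beta> i * (cmean (D1 (\<phi> i)) t * h' t - 2 * sech2 (t + TT i) * mean \<phi> i t * h t))"
      by (simp add: algebra_simps)
    have eq: "b * x - y * (b * z) * w = b * (x - y * z * w)" for b x y z w :: real by (simp add: algebra_simps)
    show ?thesis unfolding e set_integral_mult_right L_def by (rule eq)
  qed
  then have "index_form \<alpha> c \<phi> s.\<psi> = \<beta> 1 * L 1 + \<beta> 2 * L 2 + \<beta> 3 * L 3"
    unfolding s.index_form_\<psi>_radial[OF E refl refl] by (simp only: sum_3)
  moreover have "index_form \<alpha> c \<phi> s.\<psi> = 0" using \<phi> s.\<psi>_energy_space by (simp add: null_space_def)
  ultimately show ?thesis by simp
qed

text \<open>Tests vanishing on \<Gamma> act on one face at a time and give a multiple K_i of tanh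
  there. Tests equal to 1 on \<Gamma>, with weights of sum zero, express the natural junction
  condition, which says that the K_i coincide.\<close>

lemma null_space_mean:
  assumes \<phi>: "\<phi> \<in> null_space \<alpha> c"
  shows "\<exists>K. (\<forall>i. \<forall>t\<ge>0. mean \<phi> i t = K * tanh (t + TT i)) \<and>
    (\<forall>i. AE t in lborel. 0 < t \<longrightarrow> cmean (D1 (\<phi> i)) t = K * sech2 (t + TT i))"
proof -
  have E: "energy_variation \<phi>" using \<phi> by (simp add: null_space_def energy_space_variation)
  have ex: "\<exists>K. (\<forall>t\<ge>0. mean \<phi> i t = K * tanh (t + TT i)) \<and> (AE t in lborel. 0 < t \<longrightarrow> cmean (D1 (\<phi> i)) t = K * sech2 (t + TT i))" for i
  proof -
    note M = mean_ac[OF E, where i=i]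
    have weak: "(LBINT t:ray. cmean (D1 (\<phi> i)) t * h' t - 2 * sech2 (t + TT i) * mean \<phi> i t * h t) = 0"
      if h: "c1 h h'" "0 < r" "\<And>x. x \<notin> {r..s} \<Longrightarrow> h x = 0" for h h' r s
    proof -
      have h0: "h 0 = 0" using h by auto
      have "s < t \<Longrightarrow> h t = 0" for t using h(3) by auto
      from radial_test_sum[where r=s, OF \<phi> h(1) this disjI1[OF h0], where \<beta>="\<lambda>j. if j = i then 1 else 0"]
      show ?thesis using exhaust_3[of i] h0 by auto
    qed
    show ?thesis
    proof (rule jacobi_solution[OF M(1,4,5,2,3)])
      fix h h' r s assume "c1 h h'" "0 < (r::real)" "\<And>x. x \<notin> {r..s} \<Longrightarrow> h x = 0"
      then show "(LBINT t:ray. cmean (D1 (\<phi> i)) t * h' t - 2 * sech2 (t + TT i) * mean \<phi> i t * h t) = 0" by (rule weak)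
    next
      fix K assume a1: "\<And>t. 0 \<le> t \<Longrightarrow> mean \<phi> i t = K * tanh (t + TT i)"
        and a2: "AE t in lborel. 0 < t \<longrightarrow> cmean (D1 (\<phi> i)) t = K * sech2 (t + TT i)"
      show ?thesis by (rule exI[of _ K], rule conjI, intro allI impI, erule a1, rule a2)
    qed
  qed
  have "\<exists>K. \<forall>i. (\<forall>t\<ge>0. mean \<phi> i t = K i * tanh (t + TT i)) \<and> (AE t in lborel. 0 < t \<longrightarrow> cmean (D1 (\<phi> i)) t = K i * sech2 (t + TT i))"
    by (rule choice) (rule allI, rule ex)
  then obtain K where KK: "\<forall>i. (\<forall>t\<ge>0. mean \<phi> i t = K i * tanh (t + TT i)) \<and> (AE t in lborel. 0 < t \<longrightarrow> cmean (D1 (\<phi> i)) t = K i * sech2 (t + TT i))" ..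
  have K: "0 \<le> t \<Longrightarrow> mean \<phi> i t = K i * tanh (t + TT i)"
    "AE t in lborel. 0 < t \<longrightarrow> cmean (D1 (\<phi> i)) t = K i * sech2 (t + TT i)" for i t
    using spec[OF KK, of i] by simp_all
  let ?h = "cutoff 1" and ?h' = "cutoff' 1"
  have hv: "2 < t \<Longrightarrow> ?h t = 0" "?h 0 = 1" "?h 2 = 0" for t
    using cutoff_values[of 1] by (auto simp: cutoff_def)
  \<comment> \<open>The integrand is K_i times the derivative of sech2 times the cut-off, so only
    -K_i sech2 T_i and the curvature term -K_i tanh^2 T_i remain; their sum is free of T_i.\<close>
  have L: "(LBINT t:ray. cmean (D1 (\<phi> i)) t * ?h' t - 2 * sech2 (t + TT i) * mean \<phi> i t * ?h t)
      - tanh (TT i) * ?h 0 * mean \<phi> i 0 = - K i" for i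
  proof -
    let ?g = "\<lambda>t. - 2 * tanh (t + TT i) * sech2 (t + TT i) * ?h t + sech2 (t + TT i) * ?h' t"
    note c = c1_mult[OF c1_hyperbolic(2)[of "TT i"] c1_cutoff[of 1]]
    have mg: "?g \<in> Bor" using c1D'[OF c] by (rule borel_measurable_continuous_onI)
    have mh: "?h \<in> Bor" "?h' \<in> Bor"
      using c1_continuous[OF c1_cutoff] c1D'[OF c1_cutoff] by (auto intro: borel_measurable_continuous_onI)
    have "AE t in lborel. t \<noteq> (0::real)" by (simp add: AE_lborel_singleton)
    with K(2)[of i] have "AE t in lborel. t \<in> ray \<longrightarrow> cmean (D1 (\<phi> i)) t * ?h' t - 2 * sech2 (t + TT i) * mean \<phi> i t * ?h t = K i * ?g t"
      by eventually_elim (auto simp: ray_def K(1) algebra_simps)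
    then have "(LBINT t:ray. cmean (D1 (\<phi> i)) t * ?h' t - 2 * sech2 (t + TT i) * mean \<phi> i t * ?h t) = (LBINT t:ray. K i * ?g t)"
      by (rule LBINT_cong_AE(1)[OF _ _ ray_circ(2), rotated 2])
         (intro borel_measurable_diff borel_measurable_times borel_measurable_const mean_ac[OF E] mh mg sech2_measurable)+
    also have "\<dots> = K i * (LBINT t:ray. ?g t)" by (rule set_integral_mult_right)
    also have "(LBINT t:ray. ?g t) = (LINT t:{0..2}|lborel. ?g t)"
      by (rule ray_compact(1)) (use hv(1) c1_eventually_zero[OF c1_cutoff hv(1)] in simp)
    also have "\<dots> = - sech2 (TT i)" using acD[OF c1_ac[OF c], of 0 0 2 2] hv by simp
    finally show ?thesis unfolding hv(2) using K(1)[of 0 i] by (simp add: sech2_def power2_eq_square algebra_simps)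
  qed
  have eq: "\<beta> 1 * K 1 + \<beta> 2 * K 2 + \<beta> 3 * K 3 = 0" if "\<beta> 1 + \<beta> 2 + \<beta> 3 = 0" for \<beta> :: "3 \<Rightarrow> real"
    using radial_test_sum[where r=2, OF \<phi> c1_cutoff[of 1] hv(1) disjI2[OF that]] unfolding L by simp
  have "K 1 = K 2" using eq[of "\<lambda>i. if i = 1 then 1 else if i = 2 then -1 else 0"] by simp
  moreover have "K 2 = K 3" using eq[of "\<lambda>i. if i = 2 then 1 else if i = 3 then -1 else 0"] by simp
  ultimately have Ki: "K i = K 1" for i using exhaust_3[of i] by (elim disjE) simp_all
  show ?thesis
  proof (intro exI[of _ "K 1"] conjI allI impI)
    fix i
    show "mean \<phi> i t = K 1 * tanh (t + TT i)" if "0 \<le> t" for t using K(1)[OF that, of i] unfolding Ki[of i] .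
    show "AE t in lborel. 0 < t \<longrightarrow> cmean (D1 (\<phi> i)) t = K 1 * sech2 (t + TT i)" using K(2)[of i] unfolding Ki[of i] .
  qed
qed

text \<open>The null field is tested with itself. The radial parts cancel over the three faces, so
  the squares \<open>X i\<close> and the Wirtinger deficits \<open>Y i\<close>, all nonnegative, sum
  to zero. Each vanishes, and the equality cases identify the remainder.\<close>

lemma null_space_rem:
  assumes \<phi>: "\<phi> \<in> null_space \<alpha> c"
  shows "\<exists>A B. \<forall>i. (AE z in lborel. z \<in> strip \<longrightarrow> rem \<phi> i z = (A i * cos (snd z) + B i * sin (snd z)) * (cosh (TT i) / cosh (fst z + TT i)))
    \<and> (AE \<theta> in lborel. \<theta> \<in> circ \<longrightarrow> rem_trace \<phi> i \<theta> = A i * cos \<theta> + B i * sin \<theta>)"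
proof -
  have E: "energy_variation \<phi>" using \<phi> by (simp add: null_space_def energy_space_variation)
  obtain K where KK: "(\<forall>i. \<forall>t\<ge>0. mean \<phi> i t = K * tanh (t + TT i)) \<and>
    (\<forall>i. AE t in lborel. 0 < t \<longrightarrow> cmean (D1 (\<phi> i)) t = K * sech2 (t + TT i))" using null_space_mean[OF \<phi>] ..
  have K: "0 \<le> t \<Longrightarrow> mean \<phi> i t = K * tanh (t + TT i)"
    "AE t in lborel. 0 < t \<longrightarrow> cmean (D1 (\<phi> i)) t = K * sech2 (t + TT i)" for i t
    using KK by simp_all
  define X where "X i = (LBINT z:strip. (rem1 \<phi> i z + tanh (fst z + TT i) * rem \<phi> i z)\<^sup>2)" for i
  define Y where "Y i = (LBINT z:strip. (D2 (\<phi> i) z)\<^sup>2) - (LBINT z:strip. (rem \<phi> i z)\<^sup>2)" for i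
  have XY: "0 \<le> X i" "0 \<le> Y i" for i using form_split(2,3)[OF E, of i] by (auto simp: X_def Y_def)
  have rf: "radial_form (TT i) (mean \<phi> i) (cmean (D1 (\<phi> i))) = - K\<^sup>2 * tanh (TT i)" for i
    by (rule radial_form_tanh[OF K(2)[of i] K(1)[of _ i] mean_ac(4,5,2,3)[OF E]])
  have "form_on \<phi> i = X i + Y i - (K\<^sup>2 / (2 * pi)) * tanh (TT i)" for i
    unfolding form_split(1)[OF E] rf by (simp add: X_def Y_def)
  moreover have "(\<Sum>i\<in>UNIV. form_on \<phi> i) = 0"
    using \<phi> unfolding index_form_split[symmetric] null_space_def by blast
  moreover have "(K\<^sup>2 / (2 * pi)) * tanh (TT 1) + (K\<^sup>2 / (2 * pi)) * tanh (TT 2) + (K\<^sup>2 / (2 * pi)) * tanh (TT 3) = 0"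
    unfolding distrib_left[symmetric] tanh_T_sum by simp
  ultimately have "X 1 + X 2 + X 3 + (Y 1 + Y 2 + Y 3) = 0" by (simp add: sum_3)
  then have "X 1 = 0 \<and> X 2 = 0 \<and> X 3 = 0 \<and> Y 1 = 0 \<and> Y 2 = 0 \<and> Y 3 = 0"
    using XY[of 1] XY[of 2] XY[of 3] by linarith
  then have z: "X i = 0" "Y i = 0" for i using exhaust_3[of i] by auto
  let ?Q = "\<lambda>i A B. (AE z in lborel. z \<in> strip \<longrightarrow> rem \<phi> i z = (A * cos (snd z) + B * sin (snd z)) * (cosh (TT i) / cosh (fst z + TT i)))
      \<and> (AE \<theta> in lborel. \<theta> \<in> circ \<longrightarrow> rem_trace \<phi> i \<theta> = A * cos \<theta> + B * sin \<theta>)"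
  have ex: "\<exists>A B. ?Q i A B" for i
  proof -
    note S = rem_strip(1)[OF E, of i] and W = wirtinger_strip[OF rem_strip[OF E, of i]]
    have "AE z in lborel. indicator strip z *\<^sub>R (rem1 \<phi> i z + tanh (fst z + TT i) * rem \<phi> i z)\<^sup>2 = 0"
    proof (rule integral_nonneg_eq_0_iff_AE[THEN iffD1])
      show "integrable lborel (\<lambda>z. indicator strip z *\<^sub>R (rem1 \<phi> i z + tanh (fst z + TT i) * rem \<phi> i z)\<^sup>2)"
        using mean_zero_form(2)[OF S W(1)] by (simp add: set_integrable_def)
      show "(LINT z|lborel. indicator strip z *\<^sub>R (rem1 \<phi> i z + tanh (fst z + TT i) * rem \<phi> i z)\<^sup>2) = 0"
        using z(1)[of i] by (simp add: X_def set_lebesgue_integral_def)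
    qed auto
    then have "AE z in lborel. z \<in> strip \<longrightarrow> rem1 \<phi> i z = - tanh (fst z + TT i) * rem \<phi> i z"
      by eventually_elim (auto simp: eq_neg_iff_add_eq_0)
    moreover have "AE t in lborel. t \<in> ray \<longrightarrow> (\<exists>A B. AE \<theta> in lborel. \<theta> \<in> circ \<longrightarrow> rem \<phi> i (t, \<theta>) = A * cos \<theta> + B * sin \<theta>)"
      by (rule W(3)) (use z(2)[of i] in \<open>simp add: Y_def\<close>)
    ultimately show ?thesis using mean_zero_kernel[OF S] by blast
  qed
  have "\<exists>A. \<forall>i. \<exists>B. ?Q i (A i) B" by (rule choice) (rule allI, rule ex)
  then obtain A where A: "\<forall>i. \<exists>B. ?Q i (A i) B" ..
  show ?thesis by (rule exI[of _ A], rule choice[OF A])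
qed

lemma null_space_jac:
  assumes \<phi>: "\<phi> \<in> null_space \<alpha> c"
  shows "\<exists>K A B. A 1 + A 2 + A 3 = 0 \<and> B 1 + B 2 + B 3 = 0 \<and>
    (\<forall>i. AE z in lborel. z \<in> strip \<longrightarrow> \<phi> i z = jac K A B i z)"
proof -
  have E: "energy_variation \<phi>" using \<phi> by (simp add: null_space_def energy_space_variation)
  obtain K where K: "(\<forall>i. \<forall>t\<ge>0. mean \<phi> i t = K * tanh (t + TT i)) \<and>
    (\<forall>i. AE t in lborel. 0 < t \<longrightarrow> cmean (D1 (\<phi> i)) t = K * sech2 (t + TT i))" using null_space_mean[OF \<phi>] ..
  obtain A B where Q: "\<forall>i. (AE z in lborel. z \<in> strip \<longrightarrow> rem \<phi> i z = (A i * cos (snd z) + B i * sin (snd z)) * (cosh (TT i) / cosh (fst z + TT i)))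
    \<and> (AE \<theta> in lborel. \<theta> \<in> circ \<longrightarrow> rem_trace \<phi> i \<theta> = A i * cos \<theta> + B i * sin \<theta>)"
    using null_space_rem[OF \<phi>] by (elim exE)
  note AB = conjunct1[OF spec[OF Q]] conjunct2[OF spec[OF Q]]
  have tr: "AE \<theta> in lborel. \<theta> \<in> circ \<longrightarrow> (\<Sum>i\<in>UNIV. bdry_trace (\<phi> i) \<theta>) = 0"
    using E by (simp add: energy_variation_def admissible_def circ_def)
  have "AE \<theta> in lborel. 0 < \<theta> \<longrightarrow> \<theta> < 2 * pi \<longrightarrow> (A 1 + A 2 + A 3) * cos \<theta> + (B 1 + B 2 + B 3) * sin \<theta> = 0"
    using AB(2)[of 1] AB(2)[of 2] AB(2)[of 3] tr
  proof eventually_elim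
    case (elim \<theta>)
    show ?case
    proof (intro impI)
      assume "0 < \<theta>" "\<theta> < 2 * pi"
      then have \<theta>: "\<theta> \<in> circ" by (simp add: circ_def)
      have "(mean \<phi> 1 0 + mean \<phi> 2 0 + mean \<phi> 3 0) / (2 * pi) = 0" using mean_sum[OF E] by simp
      then have "rem_trace \<phi> 1 \<theta> + rem_trace \<phi> 2 \<theta> + rem_trace \<phi> 3 \<theta> = 0"
        using elim(4) \<theta> by (simp add: rem_trace_def sum_3 add_divide_distrib)
      then show "(A 1 + A 2 + A 3) * cos \<theta> + (B 1 + B 2 + B 3) * sin \<theta> = 0" using elim \<theta> by (simp add: algebra_simps)
    qed
  qed
  note ae = this
  have cont: "continuous_on {0..2*pi} (\<lambda>\<theta>. (A 1 + A 2 + A 3) * cos \<theta> + (B 1 + B 2 + B 3) * sin \<theta>)" by (intro continuous_intros)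
  \<comment> \<open>By continuity the identity holds for every angle, so it can be read off at 0 and
    at pi/2.\<close>
  have z: "(A 1 + A 2 + A 3) * cos \<theta> + (B 1 + B 2 + B 3) * sin \<theta> = 0" if "\<theta> \<in> {0..2*pi}" for \<theta>
    by (rule continuous_AE_eq[OF cont continuous_on_const _ ae that]) simp
  show ?thesis
  \<comment> \<open>\<open>mean\<close> is the integral over the circle, hence the divisor 2 pi in
    the radial coefficient.\<close>
  proof (rule exI[of _ "K / (2 * pi)"], rule exI[of _ A], rule exI[of _ B], intro conjI allI)
    show "A 1 + A 2 + A 3 = 0" using z[of 0] by simp
    show "B 1 + B 2 + B 3 = 0" using z[of "pi/2"] by simp
    show "AE z in lborel. z \<in> strip \<longrightarrow> \<phi> i z = jac (K / (2 * pi)) A B i z" for i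
      using AB(1)[of i]
    proof eventually_elim
      case (elim z)
      then show ?case using conjunct1[OF K, rule_format, of "fst z" i] by (auto simp: rem_def jac_def strip_def)
    qed
  qed
qed

lemma nullity_le: "nullity \<alpha> c \<le> 5"
proof -
  have "dimension (null_space \<alpha> c) \<le> enat 5"
  proof (rule dimension_le, rule ccontr)
    fix n b assume b: "\<And>k. k < n \<Longrightarrow> b k \<in> null_space \<alpha> c" and ind: "independent_family n b" and "\<not> n \<le> 5"
    then have n: "5 < n" by simp
    define Q where "Q k p = (case p of (K, A, B) \<Rightarrow> A 1 + A 2 + A 3 = 0 \<and> B 1 + B 2 + B 3 = 0 \<and>
      (\<forall>i. AE z in lborel. z \<in> strip \<longrightarrow> b k i z = jac K A B i z))" for k p
    have "\<forall>k\<in>{..<n}. \<exists>p. Q k p"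
    proof
      fix k assume "k \<in> {..<n}"
      then have "b k \<in> null_space \<alpha> c" using b by simp
      then show "\<exists>p. Q k p" unfolding Q_def split_paired_Ex prod.case by (rule null_space_jac)
    qed
    from bchoice[OF this] obtain p where p: "\<forall>k\<in>{..<n}. Q k (p k)" by blast
    define K A B where "K k = fst (p k)" and "A k = fst (snd (p k))" and "B k = snd (snd (p k))" for k
    have J: "A k 1 + A k 2 + A k 3 = 0" "B k 1 + B k 2 + B k 3 = 0"
      "AE z in lborel. z \<in> strip \<longrightarrow> b k i z = jac (K k) (A k) (B k) i z" if "k < n" for k i
      using bspec[OF p, of k] that by (simp_all add: Q_def K_def A_def B_def case_prod_beta')
    \<comment> \<open>Five coordinates of a null field: the coefficients on face 2 follow from those
      on faces 1 and 3, because \<open>A\<close> and \<open>B\<close> sum to zero.\<close>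
    define g where "g j k = (if j = 0 then K k else if j = 1 then A k 1 else if j = 2 then A k 3 else if j = 3 then B k 1 else B k 3)" for j k :: nat
    obtain a where a: "\<exists>k<n. a k \<noteq> 0" and z: "\<And>j. j < 5 \<Longrightarrow> (\<Sum>k<n. a k * g j k) = 0"
      using nontrivial_combination[OF n, of g] by blast
    have zero: "(\<Sum>k<n. a k * K k) = 0" "(\<Sum>k<n. a k * A k 1) = 0" "(\<Sum>k<n. a k * A k 3) = 0" "(\<Sum>k<n. a k * B k 1) = 0" "(\<Sum>k<n. a k * B k 3) = 0"
      using z[of 0] z[of 1] z[of 2] z[of 3] z[of 4] by (simp_all add: g_def)
    have s2: "(\<Sum>k<n. a k * F k 2) = - (\<Sum>k<n. a k * F k 1) - (\<Sum>k<n. a k * F k 3)"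
      if "\<And>k. k < n \<Longrightarrow> F k 1 + F k 2 + F k 3 = (0::real)" for F :: "nat \<Rightarrow> 3 \<Rightarrow> real"
    proof -
      have "(\<Sum>k<n. a k * F k 2) = (\<Sum>k<n. a k * (- F k 1 - F k 3))"
      proof (rule sum.cong[OF refl])
        fix k assume "k \<in> {..<n}"
        then have "F k 2 = - F k 1 - F k 3" using that[of k] by simp
        then show "a k * F k 2 = a k * (- F k 1 - F k 3)" by simp
      qed
      then show ?thesis by (simp add: algebra_simps sum.distrib sum_subtractf sum_negf)
    qed
    have zA: "(\<Sum>k<n. a k * A k i) = 0" and zB: "(\<Sum>k<n. a k * B k i) = 0" for i
      using exhaust_3[of i] zero s2[of A, OF J(1)] s2[of B, OF J(2)] by auto
    have "null_triple (\<lambda>i x. \<Sum>k<n. a k * b k i x)"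
      unfolding null_triple_def
    proof
      fix i
      have "AE z in lborel. \<forall>k\<in>{..<n}. z \<in> strip \<longrightarrow> b k i z = jac (K k) (A k) (B k) i z"
        using J(3) by (intro AE_finite_allI) auto
      then show "AE z in lborel. z \<in> strip \<longrightarrow> (\<Sum>k<n. a k * b k i z) = 0"
      proof eventually_elim
        case (elim z)
        show ?case
        proof
          assume "z \<in> strip"
          then have "(\<Sum>k<n. a k * b k i z) = (\<Sum>k<n. a k * jac (K k) (A k) (B k) i z)" using elim by simp
          also have "\<dots> = 0" unfolding jac_sum zero(1) zA zB by (simp add: jac_def)
          finally show "(\<Sum>k<n. a k * b k i z) = 0" .
        qed
      qed
    qed
    then show False using ind a unfolding independent_family_def by blast
  qed
  then show ?thesis by (simp add: nullity_def numeral_eq_enat)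
qed

end

theorem theorem4p8:
  fixes \<alpha> c :: real
  assumes "pi / 6 < \<alpha>" and "\<alpha> < pi / 3" and "c > 0"
  shows "morse_index \<alpha> c = 2 \<and> nullity \<alpha> c = 5"
proof -
  interpret noid \<alpha> c using assms by unfold_locales
  show ?thesis using morse_index_le morse_index_ge nullity_le nullity_ge by (intro conjI antisym)
qed

end
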